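(* Let $1<p\le 2$, $a>0$, and let $u_0\in C([0,a])$ with $u_0>0$ in $[0,a]$. Let $u(t,x)$ be the solution, with maximal existence time $T_{\max}\le +\infty$, of $$ \begin{cases} u_t=u^p(u_{xx}+u-\bar u), & 0<t<T_{\max},\ 0<x<a,\\ u_x(t,0)=u_x(t,a)=0, & 0<t<T_{\max},\\ u(0,x)=u_0(x), & 0<x<a, \end{cases} $$ where $\bar u(t)=\frac1a\int_0^a u(t,x)\,dx$. Then one of the following alternatives must happen: (i) if there exists $t_0\in[0,T_{\max})$ such that $E[u](t_0)<0$, then $T_{\max}<+\infty$; (ii) if $E[u](t)\ge 0$ for $0\le t<T_{\max}$, then $T_{\max}=+\infty$ and $u$ is bounded.
   Context: The energy functional is $E[u](t)=\int_0^a\left[u_x^2-(u-\bar u)^2\right]dx$, evaluated at time $t$; in particular $E[u](0)=E[u_0]$ (with value $+\infty$ if $u_0\notin H^1((0,a))$). A solution means the positive solution $u>0$ on $[0,T_{\max})\times[0,a]$, continuous up to $t=0$ and classical ($C^1$ in $t$, $C^2$ in $x$) for $0<t<T_{\max}$; $T_{\max}$ is its maximal time of existence. Positivity of $u_0$ guarantees positivity of the solution on $0<t<T_{\max}$. "Bounded" means $\sup_{0\le t<T_{\max}}\|u(t,\cdot)\|_{C([0,a])}<+\infty$. *)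

theory Defs
  imports "HOL-Analysis.Analysis"
begin

section \<open>The Sobolev space \<open>H\<^sup>1((0,a))\<close> and the energy\<close>

definition square_integrable_on :: "(real \<Rightarrow> real) \<Rightarrow> real set \<Rightarrow> bool" where
  "square_integrable_on f A \<longleftrightarrow>
     set_borel_measurable lebesgue A f \<and> set_integrable lebesgue A (\<lambda>x. (f x)\<^sup>2)"

text \<open>The support is closed and contained in a bounded interval, hence compact.\<close>

definition test_function :: "real \<Rightarrow> (real \<Rightarrow> real) \<Rightarrow> bool" where
  "test_function a \<phi> \<longleftrightarrow>
     (\<forall>n x. (deriv ^^ n) \<phi> differentiable (at x)) \<and>
     closure {x. \<phi> x \<noteq> 0} \<subseteq> {0<..<a}"

definition has_weak_derivative :: "real \<Rightarrow> (real \<Rightarrow> real) \<Rightarrow> (real \<Rightarrow> real) \<Rightarrow> bool" where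
  "has_weak_derivative a f g \<longleftrightarrow>
     (\<forall>\<phi>. test_function a \<phi> \<longrightarrow>
        (LINT x:{0<..<a}|lebesgue. f x * deriv \<phi> x) =
        - (LINT x:{0<..<a}|lebesgue. g x * \<phi> x))"

definition in_H1 :: "real \<Rightarrow> (real \<Rightarrow> real) \<Rightarrow> bool" where
  "in_H1 a f \<longleftrightarrow>
     square_integrable_on f {0<..<a} \<and>
     (\<exists>g. square_integrable_on g {0<..<a} \<and> has_weak_derivative a f g)"

text \<open>For \<open>f \<in> H\<^sup>1((0,a))\<close> the choice below is unique up to null sets, so the energy does not
  depend on it. For \<open>f\<close> continuously differentiable on \<open>[0,a]\<close> it agrees almost everywhere with
  the classical derivative.\<close>

definition weak_derivative :: "real \<Rightarrow> (real \<Rightarrow> real) \<Rightarrow> real \<Rightarrow> real" where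
  "weak_derivative a f =
     (SOME g. square_integrable_on g {0<..<a} \<and> has_weak_derivative a f g)"

definition mean :: "real \<Rightarrow> (real \<Rightarrow> real) \<Rightarrow> real" where
  "mean a f = (1 / a) * (LINT x:{0..a}|lebesgue. f x)"

definition energy :: "real \<Rightarrow> (real \<Rightarrow> real) \<Rightarrow> ereal" where
  "energy a f =
     (if in_H1 a f
      then ereal (LINT x:{0<..<a}|lebesgue. (weak_derivative a f x)\<^sup>2 - (f x - mean a f)\<^sup>2)
      else \<infinity>)"

section \<open>Classical solutions and the maximal existence time\<close>

text \<open>A function of time and space is curried, time first: \<open>u t x\<close>; only its values for
  \<open>0 \<le> t < T\<close> and \<open>0 \<le> x \<le> a\<close> matter. The functions \<open>ut\<close>, \<open>ux\<close>, \<open>uxx\<close> are the partial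
  derivatives; they are continuous in \<open>(t, x)\<close> up to the lateral boundary, where the
  \<open>x\<close>-derivatives are one-sided.\<close>

definition classical_solution ::
    "real \<Rightarrow> real \<Rightarrow> (real \<Rightarrow> real) \<Rightarrow> ereal \<Rightarrow> (real \<Rightarrow> real \<Rightarrow> real) \<Rightarrow> bool" where
  "classical_solution p a u0 T u \<longleftrightarrow>
     0 < T \<and>
     (\<forall>t x. 0 \<le> t \<and> ereal t < T \<and> x \<in> {0..a} \<longrightarrow> u t x > 0) \<and>
     continuous_on ({t. 0 \<le> t \<and> ereal t < T} \<times> {0..a}) (\<lambda>(t, x). u t x) \<and>
     (\<forall>x\<in>{0<..<a}. u 0 x = u0 x) \<and>
     (\<exists>ut ux uxx :: real \<Rightarrow> real \<Rightarrow> real.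
        continuous_on ({t. 0 < t \<and> ereal t < T} \<times> {0..a}) (\<lambda>(t, x). ut t x) \<and>
        continuous_on ({t. 0 < t \<and> ereal t < T} \<times> {0..a}) (\<lambda>(t, x). ux t x) \<and>
        continuous_on ({t. 0 < t \<and> ereal t < T} \<times> {0..a}) (\<lambda>(t, x). uxx t x) \<and>
        (\<forall>t. 0 < t \<and> ereal t < T \<longrightarrow>
           (\<forall>x\<in>{0..a}.
              ((\<lambda>s. u s x) has_real_derivative ut t x) (at t) \<and>
              ((\<lambda>y. u t y) has_real_derivative ux t x) (at x within {0..a}) \<and>
              ((\<lambda>y. ux t y) has_real_derivative uxx t x) (at x within {0..a})) \<and>
           (\<forall>x\<in>{0<..<a}.
              ut t x = u t x powr p * (uxx t x + u t x - mean a (u t))) \<and>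
           ux t 0 = 0 \<and> ux t a = 0))"

definition maximal_solution ::
    "real \<Rightarrow> real \<Rightarrow> (real \<Rightarrow> real) \<Rightarrow> ereal \<Rightarrow> (real \<Rightarrow> real \<Rightarrow> real) \<Rightarrow> bool" where
  "maximal_solution p a u0 T u \<longleftrightarrow>
     classical_solution p a u0 T u \<and>
     (\<nexists>T' v. T < T' \<and> classical_solution p a u0 T' v \<and>
        (\<forall>t x. 0 \<le> t \<and> ereal t < T \<and> x \<in> {0..a} \<longrightarrow> v t x = u t x))"

definition bounded_solution :: "real \<Rightarrow> ereal \<Rightarrow> (real \<Rightarrow> real \<Rightarrow> real) \<Rightarrow> bool" where
  "bounded_solution a T u \<longleftrightarrow>
     (SUP t\<in>{t. 0 \<le> t \<and> ereal t < T}. SUP x\<in>{0..a}. ereal \<bar>u t x\<bar>) < \<infinity>"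

end

theory Submission
  imports Defs "HOL-Probability.Discrete_Topology" "HOL-Complex_Analysis.Great_Picard"
    "HOL-Computational_Algebra.Polynomial"
begin

text \<open>Put \<open>R = u\<^sub>x\<^sub>x + u - mean u\<close>, so that \<open>u\<^sub>t = u\<^sup>p R\<close> and \<open>E' = - 2 D\<close> with
  \<open>D = \<integral> u\<^sub>t R \<ge> 0\<close>. Since \<open>\<integral> R = 0\<close>, the integral of \<open>u powr (1 - p)\<close> is conserved, and
  \<open>\<integral> \<Phi>(u)\<close> has derivative \<open>- E\<close> when \<open>\<Phi>' s = s powr (1 - p)\<close>.

  If \<open>E < 0\<close> at a positive time, then \<open>W = \<integral> u powr (2 - p)\<close> satisfies \<open>W' = - (2 - p) E\<close> and
  \<open>E\<^sup>2 \<le> W D\<close>, so \<open>W / (- E)\<close> is positive with derivative at most \<open>- p\<close>: the solution cannot be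
  global. A negative energy of the merely continuous initial datum \<open>u\<^sub>0 \<in> H\<^sup>1\<close> is carried to a
  positive time by testing the equation with \<open>u - u\<^sub>0\<close>.

  If \<open>E \<ge> 0\<close> throughout, then \<open>\<integral> \<Phi>(u)\<close> stays bounded while \<open>\<integral> u\<^sub>x\<^sup>2 \<le> E + \<integral> u\<^sup>2\<close> keeps \<open>u\<close>
  above half its maximum on an interval of fixed length; as \<open>\<Phi>\<close> is unbounded, \<open>u\<close> is bounded.
  For a finite maximal time \<open>r\<close> the solution would be continued as follows. From data at time \<open>t\<close>
  a spatial discretisation gives a solution whose lifespan is bounded below in terms of \<open>D t\<close> by
  a multiple of \<open>1 / (1 + D t)\<close>. As \<open>D\<close> is integrable up to \<open>r\<close>, there are times \<open>t\<close> close to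
  \<open>r\<close> with \<open>(r - t) D t\<close> arbitrarily small, and from such a time the solution reaches beyond \<open>r\<close>;
  uniqueness, by a maximum principle, glues the two.\<close>

section \<open>Finite differences and the semidiscrete equation\<close>

text \<open>A bounded positive solution on [0, r) comes with no bound on its second derivatives up
  to r, so no slice at time r is available as new data. A restart is possible only from a slice at
  some t < r, and the one norm of it that may enter the lifespan is the integral of the squared
  second derivative: two-sided bounds on u turn this into D t, the only second-order quantity within
  reach of the energy, which controls its time integral but not its values. The lifespan 1 / (1 + D
  t) is what a Riccati inequality, quadratic in the dissipation, leaves.

  The local theory is therefore run with explicit constants. On a grid in space the time derivative
  of the equation exists, summation by parts is exact and the maximum principle holds.

  At time 0 the energy is defined through an arbitrarily chosen weak derivative. Two facts about it
  carry the argument: it is determined almost everywhere, and it may be tested against functions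
  that are merely continuously differentiable and vanish at both ends, such as the spatial
  derivative of u at a positive time.\<close>

instance bcontfun :: (metric_space, banach) banach ..

text \<open>Multiplying the unknown by \<open>exp (- K * t)\<close> with K = 2 L makes the integral
  operator a contraction with factor L / K = 1 / 2 on the whole interval, however large T is, so no
  patching of short intervals is needed.\<close>

lemma picard_lipschitz:
  fixes F :: "'a::banach \<Rightarrow> 'a"
  assumes lip: "\<And>x y. dist (F x) (F y) \<le> L * dist x y" and L: "0 < L" and T: "0 \<le> T"
  obtains u where "u 0 = x0"
    "\<And>t. t \<in> {0..T} \<Longrightarrow> (u has_vector_derivative F (u t)) (at t within {0..T})"
proof -
  define K where "K = 2 * L"
  have K: "K > 0" using L by (simp add: K_def)
  \<comment> \<open>Freezing time at the end points of {0..T} extends every iterate to a bounded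
    continuous function on the line, an element of the complete space in which the fixed point is
    sought.\<close>
  define c where "c t = max 0 (min T t)" for t :: real
  have c: "c t \<in> {0..T}" for t using T by (auto simp: c_def)
  have cc: "continuous_on UNIV c" unfolding c_def by (intro continuous_intros)
  have Fc: "continuous_on UNIV F"
    by (rule lipschitz_on_continuous_on[where L=L]) (use lip L in \<open>auto intro!: lipschitz_onI\<close>)
  define I where "I v t = x0 + integral {0..t} (\<lambda>s. F (exp (K * s) *\<^sub>R v s))" for v :: "real \<Rightarrow> 'a" and t
  define G where "G v t = exp (- K * c t) *\<^sub>R I v (c t)" for v :: "real \<Rightarrow> 'a" and t
  have Fv: "continuous_on S (\<lambda>s. F (exp (K * s) *\<^sub>R v s))" if "continuous_on UNIV v" for v S
    by (rule continuous_on_compose2[OF Fc]) (auto intro!: continuous_intros continuous_on_subset[OF that])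
  have int: "(\<lambda>s. F (exp (K * s) *\<^sub>R v s)) integrable_on {x..y}" if "continuous_on UNIV v" for v x y
    by (rule integrable_continuous_interval) (rule Fv[OF that])
  have Icont: "continuous_on {0..T} (I v)" if "continuous_on UNIV v" for v
    unfolding I_def by (intro continuous_intros indefinite_integral_continuous_1 int that)
  have Gb: "G v \<in> bcontfun" if v: "continuous_on UNIV v" for v
  proof -
    have 1: "continuous_on {0..T} (\<lambda>t. exp (- K * t) *\<^sub>R I v t)"
      by (intro continuous_intros Icont v)
    have "continuous_on UNIV (\<lambda>t. (\<lambda>t. exp (- K * t) *\<^sub>R I v t) (c t))"
      by (rule continuous_on_compose2[OF 1 cc]) (use c in auto)
    moreover have "bounded (range (G v))"
    proof (rule bounded_subset)
      show "bounded ((\<lambda>t. exp (- K * t) *\<^sub>R I v t) ` {0..T})"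
        by (intro compact_imp_bounded compact_continuous_image 1 compact_Icc)
    qed (use c in \<open>auto simp: G_def\<close>)
    ultimately show ?thesis by (auto simp: bcontfun_def G_def)
  qed
  define Phi where "Phi v = Bcontfun (G (apply_bcontfun v))" for v
  have Phi: "apply_bcontfun (Phi v) = G (apply_bcontfun v)" for v
    unfolding Phi_def by (rule Bcontfun_inverse) (rule Gb, simp)
  have contr: "dist (Phi v) (Phi w) \<le> (1/2) * dist v w" for v w
  proof (rule dist_bound)
    fix t
    let ?b = "c t"
    have vw: "continuous_on UNIV (apply_bcontfun v)" "continuous_on UNIV (apply_bcontfun w)" by simp_all
    have expint: "((\<lambda>s. L * dist v w * exp (K * s)) has_integral (L * dist v w * ((exp (K * ?b) - exp (K * 0)) / K))) {0..?b}"
    proof (rule has_integral_mult_right)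
      have "((\<lambda>s. exp (K * s)) has_integral (exp (K * ?b) / K - exp (K * 0) / K)) {0..?b}"
        using c[of t] K
        by (intro fundamental_theorem_of_calculus)
          (auto intro!: derivative_eq_intros simp: has_real_derivative_iff_has_vector_derivative[symmetric])
      then show "((\<lambda>s. exp (K * s)) has_integral ((exp (K * ?b) - exp (K * 0)) / K)) {0..?b}"
        by (simp add: diff_divide_distrib)
    qed
    have "norm (I v ?b - I w ?b) = norm (integral {0..?b} (\<lambda>s. F (exp (K * s) *\<^sub>R v s) - F (exp (K * s) *\<^sub>R w s)))"
      unfolding I_def using int vw by (simp add: integral_diff)
    also have "\<dots> \<le> integral {0..?b} (\<lambda>s. L * dist v w * exp (K * s))"
    proof (rule integral_norm_bound_integral)
      show "(\<lambda>s. F (exp (K * s) *\<^sub>R v s) - F (exp (K * s) *\<^sub>R w s)) integrable_on {0..?b}"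
        by (intro integrable_diff int vw)
      show "(\<lambda>s. L * dist v w * exp (K * s)) integrable_on {0..?b}" using expint by blast
      fix s assume "s \<in> {0..?b}"
      have "norm (F (exp (K * s) *\<^sub>R v s) - F (exp (K * s) *\<^sub>R w s)) \<le> L * dist (exp (K * s) *\<^sub>R v s) (exp (K * s) *\<^sub>R w s)"
        using lip by (simp add: dist_norm)
      also have "\<dots> = L * (exp (K * s) * dist (v s) (w s))"
        by (simp add: dist_norm flip: scaleR_diff_right)
      also have "\<dots> \<le> L * (exp (K * s) * dist v w)"
        using L by (intro mult_left_mono dist_bounded) auto
      finally show "norm (F (exp (K * s) *\<^sub>R v s) - F (exp (K * s) *\<^sub>R w s)) \<le> L * dist v w * exp (K * s)"
        by (simp add: mult_ac)
    qed
    also have "\<dots> = L * dist v w * ((exp (K * ?b) - 1) / K)"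
      using integral_unique[OF expint] by simp
    also have "\<dots> \<le> L * dist v w * (exp (K * ?b) / K)"
      using L K by (intro mult_left_mono divide_right_mono) auto
    also have "\<dots> = (1/2) * dist v w * exp (K * ?b)" using L by (simp add: K_def)
    finally have *: "norm (I v ?b - I w ?b) \<le> (1/2) * dist v w * exp (K * ?b)" .
    have "dist (Phi v t) (Phi w t) = exp (- K * ?b) * norm (I v ?b - I w ?b)"
      by (simp add: Phi G_def dist_norm flip: scaleR_diff_right)
    also have "\<dots> \<le> exp (- K * ?b) * ((1/2) * dist v w * exp (K * ?b))"
      by (intro mult_left_mono *) auto
    also have "\<dots> = (1/2) * dist v w" by (simp add: exp_minus)
    finally show "dist (Phi v t) (Phi w t) \<le> (1/2) * dist v w" .
  qed
  have "\<exists>!v. v \<in> UNIV \<and> Phi v = v"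
    by (rule Banach_fix[where c="1/2"]) (use contr in auto)
  then obtain v where v: "Phi v = v" by auto
  define u where "u t = exp (K * t) *\<^sub>R v t" for t
  have uI: "u t = I v t" if "t \<in> {0..T}" for t
  proof -
    have "v t = G v t" using v Phi[of v] by simp
    moreover have "c t = t" using that by (auto simp: c_def)
    ultimately show ?thesis by (simp add: u_def G_def flip: exp_add)
  qed
  show thesis
  proof
    show "u 0 = x0" using uI[of 0] T by (simp add: I_def)
    fix t assume t: "t \<in> {0..T}"
    have "((\<lambda>t. integral {0..t} (\<lambda>s. F (exp (K * s) *\<^sub>R v s))) has_vector_derivative F (exp (K * t) *\<^sub>R v t)) (at t within {0..T})"
      by (rule integral_has_vector_derivative[OF Fv t]) simp
    then have "(I v has_vector_derivative F (u t)) (at t within {0..T})"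
      unfolding I_def u_def using has_vector_derivative_add[OF has_vector_derivative_const[of x0]] by fastforce
    then show "(u has_vector_derivative F (u t)) (at t within {0..T})"
      by (rule has_vector_derivative_transform[OF t, rotated]) (use uI in auto)
  qed
qed

text \<open>A function \<open>v\<close> on \<open>N\<close> cells of width \<open>h\<close>: \<open>gd h N v i\<close> is the difference quotient across the
  face between the cells \<open>i - 1\<close> and \<open>i\<close>. It vanishes on the two boundary faces \<open>0\<close> and \<open>N\<close>, which
  is the Neumann condition.\<close>

definition gd :: "real \<Rightarrow> nat \<Rightarrow> (nat \<Rightarrow> real) \<Rightarrow> nat \<Rightarrow> real" where
  "gd h N v i = (if 0 < i \<and> i < N then (v i - v (i - 1)) / h else 0)"

definition gl :: "real \<Rightarrow> nat \<Rightarrow> (nat \<Rightarrow> real) \<Rightarrow> nat \<Rightarrow> real" where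
  "gl h N v i = (gd h N v (Suc i) - gd h N v i) / h"

definition gm :: "nat \<Rightarrow> (nat \<Rightarrow> real) \<Rightarrow> real" where
  "gm N v = (\<Sum>i<N. v i) / real N"

lemma gd_diff: "gd h N (\<lambda>i. v i - w i) i = gd h N v i - gd h N w i"
  by (simp add: gd_def diff_divide_distrib)

lemma gl_diff: "gl h N (\<lambda>i. v i - w i) i = gl h N v i - gl h N w i"
  by (simp add: gl_def gd_diff diff_divide_distrib)

lemma gm_diff: "gm N (\<lambda>i. v i - w i) = gm N v - gm N w"
  by (simp add: gm_def sum_subtractf diff_divide_distrib)

lemma abs_gd_le:
  assumes "h > 0" "\<And>i. \<bar>v i\<bar> \<le> D"
  shows "\<bar>gd h N v i\<bar> \<le> 2 * D / h"
proof -
  have "\<bar>v i - v (i - 1)\<bar> \<le> 2 * D" using assms(2)[of i] assms(2)[of "i-1"] by linarith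
  moreover have "0 \<le> D" using assms(2)[of 0] by linarith
  ultimately show ?thesis using assms(1) by (auto simp: gd_def abs_divide intro!: divide_right_mono)
qed

lemma abs_gl_le:
  assumes "h > 0" "\<And>i. \<bar>v i\<bar> \<le> D"
  shows "\<bar>gl h N v i\<bar> \<le> 4 * D / h / h"
proof -
  have "\<bar>gd h N v (Suc i) - gd h N v i\<bar> \<le> 2 * D / h + 2 * D / h"
    using abs_gd_le[of h v D N "Suc i"] abs_gd_le[of h v D N i] assms by fastforce
  then have "\<bar>gd h N v (Suc i) - gd h N v i\<bar> / h \<le> 4 * D / h / h"
    using assms(1) by (intro divide_right_mono) auto
  then show ?thesis using assms(1) by (simp add: gl_def abs_divide)
qed

lemma abs_gm_le:
  assumes "\<And>i. i < N \<Longrightarrow> \<bar>v i\<bar> \<le> D" "D \<ge> 0"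
  shows "\<bar>gm N v\<bar> \<le> D"
proof -
  have "\<bar>\<Sum>i<N. v i\<bar> \<le> (\<Sum>i<N. D)"
    using assms(1) by (intro order_trans[OF sum_abs] sum_mono) auto
  then show ?thesis using assms(2) by (cases "N = 0") (auto simp: gm_def field_simps)
qed

lemma powr_lipschitz:
  fixes m M p x y :: real
  assumes m: "0 < m" and p: "1 \<le> p" and xy: "x \<in> {m..M}" "y \<in> {m..M}"
  shows "\<bar>x powr p - y powr p\<bar> \<le> p * M powr (p - 1) * \<bar>x - y\<bar>"
proof -
  have "norm (x powr p - y powr p) \<le> p * M powr (p - 1) * norm (x - y)"
  proof (rule field_differentiable_bound[of "{m..M}" "\<lambda>x. x powr p" "\<lambda>z. p * z powr (p - 1)"])
    fix z assume z: "z \<in> {m..M}"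
    show "((\<lambda>x. x powr p) has_field_derivative p * z powr (p - 1)) (at z within {m..M})"
      using z m by (auto intro!: derivative_eq_intros)
    have "z powr (p - 1) \<le> M powr (p - 1)" using z m p by (intro powr_mono2) auto
    then show "norm (p * z powr (p - 1)) \<le> p * M powr (p - 1)" using p by (simp add: abs_mult)
  qed (use xy in auto)
  then show ?thesis by simp
qed

text \<open>Truncating the unknowns to \<open>{m..M}\<close> makes the right-hand side globally Lipschitz; for small
  times the maximum principle shows that the truncation is never active.\<close>

lemma grid_ode:
  fixes p m M h T :: real
  assumes m: "0 < m" and mM: "m \<le> M" and p: "1 \<le> p" and h: "h > 0" and T: "0 \<le> T"
  defines "clip \<equiv> (\<lambda>x::real. max m (min M x))"
  obtains u :: "real \<Rightarrow> nat \<Rightarrow> real" where "\<And>i. i < N \<Longrightarrow> u 0 i = v0 i"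
    "\<And>t i. \<lbrakk>t \<in> {0..T}; i < N\<rbrakk> \<Longrightarrow>
      ((\<lambda>t. u t i) has_real_derivative clip (u t i) powr p *
        (gl h N (\<lambda>j. clip (u t j)) i + clip (u t i) - gm N (\<lambda>j. clip (u t j)))) (at t within {0..T})"
proof -
  have clip: "m \<le> clip x" "clip x \<le> M" "\<bar>clip x\<bar> \<le> M" for x using m mM by (auto simp: clip_def)
  have cliplip: "\<bar>clip x - clip y\<bar> \<le> \<bar>x - y\<bar>" for x y by (auto simp: clip_def)
  define lin where "lin v i = gl h N v i + v i - gm N v" for v :: "nat \<Rightarrow> real" and i
  \<comment> \<open>Sup-norm bound of the linear part: 4 / h^2 for the Laplacian, 1 each for the
    identity and the mean. It degenerates as h tends to 0, which is harmless because the grid is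
    fixed here.\<close>
  define B where "B = 4 / h / h + 2"
  have B: "B > 0" using h by (auto simp: B_def intro!: add_nonneg_pos)
  have linb: "\<bar>lin v i\<bar> \<le> B * D" if "\<And>i. \<bar>v i\<bar> \<le> D" for v i D
  proof -
    have "0 \<le> D" using that[of 0] by linarith
    then have "\<bar>gl h N v i\<bar> \<le> 4 * D / h / h" "\<bar>gm N v\<bar> \<le> D" "\<bar>v i\<bar> \<le> D"
      using abs_gl_le[of h v D N i] h abs_gm_le[of N v D] that by auto
    then show ?thesis unfolding lin_def B_def by (simp add: algebra_simps)
  qed
  have lind: "lin v i - lin w i = lin (\<lambda>i. v i - w i) i" for v w i
    by (simp add: lin_def gl_diff gm_diff)
  obtain P where P: "P > 0" "\<And>x y. x \<in> {m..M} \<Longrightarrow> y \<in> {m..M} \<Longrightarrow> \<bar>x powr p - y powr p\<bar> \<le> P * \<bar>x - y\<bar>"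
  proof
    show "p * M powr (p - 1) > 0" using p m mM by auto
  qed (rule powr_lipschitz[OF m p])
  define f where "f v i = (if i < N then clip (v i) powr p * lin (\<lambda>j. clip (v j)) i else 0)"
    for v :: "nat \<Rightarrow> real" and i
  \<comment> \<open>The index set carries the discrete topology, so continuity is free; the value 0
    beyond N leaves a finite range, hence boundedness. In this way finitely many real unknowns
    become one point of a Banach space.\<close>
  have bcf: "(\<lambda>d. if of_discrete d < N then g (of_discrete d) else 0) \<in> bcontfun" (is "?g \<in> _") for g :: "nat \<Rightarrow> real"
  proof -
    have "range ?g \<subseteq> insert 0 (g ` {..<N})" by auto
    then have "bounded (range ?g)" by (rule bounded_subset[rotated]) (intro finite_imp_bounded, auto)
    moreover have "continuous_on UNIV ?g"
      by (auto simp: continuous_on_open_vimage open_discrete)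
    ultimately show ?thesis by (simp add: bcontfun_def)
  qed
  define E where "E g = Bcontfun (\<lambda>d. if of_discrete d < N then g (of_discrete d) else 0)" for g :: "nat \<Rightarrow> real"
  have E: "apply_bcontfun (E g) d = (if of_discrete d < N then g (of_discrete d) else 0)" for g d
    unfolding E_def by (subst Bcontfun_inverse) (auto simp: bcf)
  define F where "F v = E (f (\<lambda>i. apply_bcontfun v (discrete i)))" for v :: "nat discrete \<Rightarrow>\<^sub>C real"
  have F: "apply_bcontfun (F v) d = f (\<lambda>i. v (discrete i)) (of_discrete d)" for v d
    by (simp add: F_def E f_def)
  define L where "L = P * (B * M) + M powr p * B"
  have L: "L > 0" using P B m mM by (auto simp: L_def intro!: add_pos_pos)
  have Flip: "dist (F v) (F w) \<le> L * dist v w" for v w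
  proof (rule dist_bound)
    fix k :: "nat discrete"
    define i where "i = of_discrete k"
    let ?d = "dist v w"
    have d: "\<bar>v j - w j\<bar> \<le> ?d" for j
      using dist_bounded[of v j w] by (simp add: dist_real_def)
    show "dist (F v k) (F w k) \<le> L * ?d"
    proof (cases "i < N")
      case True
      let ?v = "\<lambda>j. clip (v (discrete j))" and ?w = "\<lambda>j. clip (w (discrete j))"
      have 1: "\<bar>?v i powr p - ?w i powr p\<bar> \<le> P * ?d"
      proof -
        have "\<bar>?v i powr p - ?w i powr p\<bar> \<le> P * \<bar>?v i - ?w i\<bar>" using P(2) clip by auto
        also have "\<dots> \<le> P * ?d" using cliplip[of "v (discrete i)" "w (discrete i)"] d[of "discrete i"] P by (intro mult_left_mono) auto
        finally show ?thesis .
      qed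
      have 2: "\<bar>lin ?v i\<bar> \<le> B * M" by (rule linb) (use clip in auto)
      have 3: "\<bar>lin ?v i - lin ?w i\<bar> \<le> B * ?d" unfolding lind
        by (rule linb) (use cliplip d in \<open>meson order_trans\<close>)
      have 4: "\<bar>?w i powr p\<bar> \<le> M powr p" using clip m p by (auto intro!: powr_mono2 simp: less_imp_le order_trans[OF less_imp_le[OF m]])
      have "F v k - F w k = (?v i powr p - ?w i powr p) * lin ?v i + ?w i powr p * (lin ?v i - lin ?w i)"
        using True by (simp add: F f_def i_def algebra_simps)
      also have "\<bar>\<dots>\<bar> \<le> (P * ?d) * (B * M) + M powr p * (B * ?d)"
        unfolding abs_mult[symmetric]
        by (intro order_trans[OF abs_triangle_ineq] add_mono, unfold abs_mult)
          (intro mult_mono 1 2 3 4; use P B m mM in auto)+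
      also have "\<dots> = L * ?d" by (simp add: L_def algebra_simps)
      finally show ?thesis by (simp add: dist_real_def)
    qed (use L in \<open>simp add: F f_def i_def\<close>)
  qed
  obtain U where U0: "U 0 = E v0"
    and U: "\<And>t. t \<in> {0..T} \<Longrightarrow> (U has_vector_derivative F (U t)) (at t within {0..T})"
    using picard_lipschitz[of F L T "E v0", OF Flip L T] by blast
  have evl: "bounded_linear (\<lambda>v::nat discrete \<Rightarrow>\<^sub>C real. apply_bcontfun v i)" for i
  proof (rule bounded_linear_intro[where K=1])
    show "norm (apply_bcontfun v i) \<le> norm v * 1" for v :: "nat discrete \<Rightarrow>\<^sub>C real"
      using norm_bounded[of v i] by simp
  qed (simp_all add: plus_bcontfun.rep_eq scaleR_bcontfun.rep_eq)
  show thesis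
  proof
    show "U 0 (discrete i) = v0 i" if "i < N" for i
      using that by (simp add: U0 E discrete_inverse)
    show "((\<lambda>t. U t (discrete i)) has_real_derivative clip (U t (discrete i)) powr p *
        (gl h N (\<lambda>j. clip (U t (discrete j))) i + clip (U t (discrete i)) - gm N (\<lambda>j. clip (U t (discrete j))))) (at t within {0..T})"
      if "t \<in> {0..T}" "i < N" for t i
      using bounded_linear.has_vector_derivative[OF evl[of "discrete i"] U[OF that(1)]] that(2)
      by (simp add: F f_def lin_def discrete_inverse has_real_derivative_iff_has_vector_derivative)
  qed
qed

section \<open>Uniform estimates for the semidiscrete equation\<close>

text \<open>The form in which most differential inequalities below are integrated. Derivatives are
  taken within S, so that one-sided derivatives at the ends of a time interval are covered as well
  as two-sided ones.\<close>

lemma increment_le: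
  fixes f :: "real \<Rightarrow> real"
  assumes "s \<le> t" "{s..t} \<subseteq> S" and "\<And>x. x \<in> {s..t} \<Longrightarrow> (f has_real_derivative f' x) (at x within S)"
    and "\<And>x. x \<in> {s..t} \<Longrightarrow> f' x \<le> c"
  shows "f t - f s \<le> c * (t - s)"
proof -
  obtain x where "x \<in> {s..t}" "f t - f s = f' x * (t - s)"
    using mvt_very_simple[OF assms(1), of f "\<lambda>x y. f' x * y"] assms(3)[THEN has_field_derivative_subset, OF _ assms(2)]
    by (auto simp: has_field_derivative_def)
  then show ?thesis using assms by (auto intro!: mult_right_mono)
qed

text \<open>The Riemann sum with mesh h: for h N = a it stands for the integral over [0, a], and all
  discrete norms are written with it.\<close>

definition gs :: "real \<Rightarrow> nat \<Rightarrow> (nat \<Rightarrow> real) \<Rightarrow> real" where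
  "gs h N f = h * (\<Sum>i<N. f i)"

lemma gs_add: "gs h N (\<lambda>i. f i + g i) = gs h N f + gs h N g"
  by (simp add: gs_def sum.distrib algebra_simps)

lemma gs_diff: "gs h N (\<lambda>i. f i - g i) = gs h N f - gs h N g"
  by (simp add: gs_def sum_subtractf algebra_simps)

lemma gs_cmult: "gs h N (\<lambda>i. c * f i) = c * gs h N f"
  by (simp add: gs_def sum_distrib_left mult_ac)

lemma gs_mono: "h \<ge> 0 \<Longrightarrow> (\<And>i. i < N \<Longrightarrow> f i \<le> g i) \<Longrightarrow> gs h N f \<le> gs h N g"
  unfolding gs_def by (intro mult_left_mono sum_mono) auto

lemma gs_nonneg: "h \<ge> 0 \<Longrightarrow> (\<And>i. i < N \<Longrightarrow> 0 \<le> f i) \<Longrightarrow> 0 \<le> gs h N f"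
  unfolding gs_def by (intro mult_nonneg_nonneg sum_nonneg) auto

lemma gs_cong: "(\<And>i. i < N \<Longrightarrow> f i = g i) \<Longrightarrow> gs h N f = gs h N g"
  unfolding gs_def by (intro arg_cong2[where f="(*)"] sum.cong) auto

lemma has_real_derivative_gs:
  assumes "\<And>i. i < N \<Longrightarrow> ((\<lambda>t. f t i) has_real_derivative f' i) (at x within S)"
  shows "((\<lambda>t. gs h N (f t)) has_real_derivative gs h N f') (at x within S)"
  unfolding gs_def by (intro DERIV_cmult DERIV_sum) (use assms in auto)

lemma has_real_derivative_gd:
  assumes "\<And>i. i < N \<Longrightarrow> ((\<lambda>t. f t i) has_real_derivative f' i) (at x within S)"
  shows "((\<lambda>t. gd h N (f t) i) has_real_derivative gd h N f' i) (at x within S)"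
  unfolding gd_def using assms by (auto intro!: DERIV_cdivide DERIV_diff)

lemma has_real_derivative_gl:
  assumes "\<And>i. i < N \<Longrightarrow> ((\<lambda>t. f t i) has_real_derivative f' i) (at x within S)"
  shows "((\<lambda>t. gl h N (f t) i) has_real_derivative gl h N f' i) (at x within S)"
  unfolding gl_def by (intro DERIV_cdivide DERIV_diff has_real_derivative_gd assms)

lemma has_real_derivative_gm:
  assumes "\<And>i. i < N \<Longrightarrow> ((\<lambda>t. f t i) has_real_derivative f' i) (at x within S)"
  shows "((\<lambda>t. gm N (f t)) has_real_derivative gm N f') (at x within S)"
  unfolding gm_def by (intro DERIV_cdivide DERIV_sum) (use assms in auto)

section \<open>Summation by parts and interpolation on the grid\<close>

lemma sum_by_parts:
  fixes g w :: "nat \<Rightarrow> real"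
  shows "(\<Sum>i<Suc n. (g (Suc i) - g i) * w i) =
    g (Suc n) * w n - g 0 * w 0 - (\<Sum>i<n. g (Suc i) * (w (Suc i) - w i))"
  by (induction n) (simp_all add: algebra_simps)

text \<open>No boundary terms survive, because \<open>gd\<close> is 0 on the faces 0 and N.\<close>

lemma gs_gl_by_parts:
  assumes "h \<noteq> 0"
  shows "gs h N (\<lambda>i. gl h N v i * w i) = - gs h N (\<lambda>i. gd h N v i * gd h N w i)"
proof (cases N)
  case (Suc n)
  let ?g = "gd h N v"
  have g0: "?g 0 = 0" "?g (Suc n) = 0" by (auto simp: gd_def Suc)
  have "gs h N (\<lambda>i. gl h N v i * w i) = (\<Sum>i<Suc n. (?g (Suc i) - ?g i) * w i)"
    using assms by (simp add: gs_def gl_def Suc sum_divide_distrib[symmetric] del: sum.lessThan_Suc)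
  also have "\<dots> = - (\<Sum>i<n. ?g (Suc i) * (w (Suc i) - w i))"
    unfolding sum_by_parts by (simp add: g0)
  also have "\<dots> = - h * (\<Sum>i<n. ?g (Suc i) * gd h N w (Suc i))"
    using assms by (simp add: gd_def Suc sum_distrib_left mult_ac flip: sum_negf)
  also have "(\<Sum>i<n. ?g (Suc i) * gd h N w (Suc i)) = (\<Sum>i<Suc n. ?g i * gd h N w i)"
    by (simp add: sum.lessThan_Suc_shift g0 del: sum.lessThan_Suc)
  finally show ?thesis by (simp add: gs_def Suc)
qed (simp add: gs_def)

text \<open>Between two cells f^2 changes by at most a sum over faces of gradient times value, which
  Young's inequality with weight \<delta> splits; averaging over the cell of comparison replaces the
  remaining value by the mean of f^2.\<close>

lemma grid_interpolation:
  assumes h: "h > 0" and hN: "h * real N = a" and d: "\<delta> > 0" and i: "i < N"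
  shows "(f i)\<^sup>2 \<le> (1 / a + 1 / \<delta>) * gs h N (\<lambda>i. (f i)\<^sup>2) + \<delta> * gs h N (\<lambda>i. (gd h N f i)\<^sup>2)"
proof -
  define s z where "s = gs h N (\<lambda>i. (f i)\<^sup>2)" and "z = gs h N (\<lambda>i. (gd h N f i)\<^sup>2)"
  have N: "N > 0" using i by simp
  then have a: "a > 0" using h hN by auto
  define n where "n = N - 1"
  have Nn: "N = Suc n" using N by (simp add: n_def)
  \<comment> \<open>Young bound for the jump of f^2 across the face between the cells k and k +
    1.\<close>
  define e where "e k = h * (\<delta> * (gd h N f (Suc k))\<^sup>2 + ((f k)\<^sup>2 + (f (Suc k))\<^sup>2) / (2 * \<delta>))" for k
  have e0: "e k \<ge> 0" for k using h d by (auto simp: e_def)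
  have step: "\<bar>(f (Suc k))\<^sup>2 - (f k)\<^sup>2\<bar> \<le> e k" if "Suc k < N" for k
  proof -
    define g where "g = gd h N f (Suc k)"
    have fk: "f (Suc k) - f k = h * g" using that h by (simp add: g_def gd_def)
    have "(f (Suc k))\<^sup>2 - (f k)\<^sup>2 = h * (g * (f k + f (Suc k)))"
      unfolding mult.assoc[symmetric] fk[symmetric] by (simp add: power2_eq_square algebra_simps)
    moreover have "\<bar>g * (f k + f (Suc k))\<bar> \<le> \<delta> * g\<^sup>2 + ((f k)\<^sup>2 + (f (Suc k))\<^sup>2) / (2 * \<delta>)"
    proof -
      define b where "b = f k + f (Suc k)"
      have b2: "b\<^sup>2 \<le> 2 * ((f k)\<^sup>2 + (f (Suc k))\<^sup>2)"
        using sum_squares_bound[of "f k" "f (Suc k)"] by (simp add: b_def power2_sum)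
      have "0 \<le> (2 * \<delta> * \<bar>g\<bar> - \<bar>b\<bar>)\<^sup>2" by simp
      then have "4 * \<delta> * \<bar>g * b\<bar> \<le> 4 * \<delta>\<^sup>2 * g\<^sup>2 + b\<^sup>2"
        by (simp add: power2_diff power_mult_distrib abs_mult mult_ac)
      also have "\<dots> \<le> 4 * \<delta>\<^sup>2 * g\<^sup>2 + 2 * ((f k)\<^sup>2 + (f (Suc k))\<^sup>2)" using b2 by simp
      finally show ?thesis unfolding b_def[symmetric] using d
        by (simp add: field_simps power2_eq_square)
    qed
    ultimately show ?thesis using h by (simp add: e_def abs_mult g_def)
  qed
  have sum_e: "(\<Sum>k<n. e k) \<le> \<delta> * z + s / \<delta>"
  proof -
    have "(\<Sum>k<n. (gd h N f (Suc k))\<^sup>2) = (\<Sum>k<N. (gd h N f k)\<^sup>2)"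
      unfolding Nn sum.lessThan_Suc_shift by (simp add: gd_def)
    moreover have "(\<Sum>k<n. (f k)\<^sup>2) \<le> (\<Sum>k<N. (f k)\<^sup>2)"
      unfolding Nn by simp
    moreover have "(\<Sum>k<n. (f (Suc k))\<^sup>2) \<le> (\<Sum>k<N. (f k)\<^sup>2)"
      unfolding Nn sum.lessThan_Suc_shift by simp
    ultimately have "h * (\<delta> * (\<Sum>k<n. (gd h N f (Suc k))\<^sup>2) + ((\<Sum>k<n. (f k)\<^sup>2) + (\<Sum>k<n. (f (Suc k))\<^sup>2)) / (2 * \<delta>))
       \<le> h * (\<delta> * (\<Sum>k<N. (gd h N f k)\<^sup>2) + ((\<Sum>k<N. (f k)\<^sup>2) + (\<Sum>k<N. (f k)\<^sup>2)) / (2 * \<delta>))"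
      using h d by (intro mult_left_mono add_mono divide_right_mono) auto
    moreover have "(\<Sum>k<n. e k) = h * (\<delta> * (\<Sum>k<n. (gd h N f (Suc k))\<^sup>2) + ((\<Sum>k<n. (f k)\<^sup>2) + (\<Sum>k<n. (f (Suc k))\<^sup>2)) / (2 * \<delta>))"
      unfolding e_def by (simp add: sum_distrib_left[symmetric] sum.distrib sum_divide_distrib[symmetric])
    moreover have "h * (\<delta> * (\<Sum>k<N. (gd h N f k)\<^sup>2) + ((\<Sum>k<N. (f k)\<^sup>2) + (\<Sum>k<N. (f k)\<^sup>2)) / (2 * \<delta>)) = \<delta> * z + s / \<delta>"
      using d by (simp add: s_def z_def gs_def field_simps)
    ultimately show ?thesis by linarith
  qed
  have tele: "(f j)\<^sup>2 - (f i)\<^sup>2 \<le> (\<Sum>k<n. e k) \<and> (f i)\<^sup>2 - (f j)\<^sup>2 \<le> (\<Sum>k<n. e k)" if "i \<le> j" "j < N" for i j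
  proof -
    have "(f j)\<^sup>2 - (f i)\<^sup>2 = (\<Sum>k\<in>{i..<j}. (f (Suc k))\<^sup>2 - (f k)\<^sup>2)"
      using sum_Suc_diff'[OF that(1), of "\<lambda>k. (f k)\<^sup>2"] by simp
    then have "\<bar>(f j)\<^sup>2 - (f i)\<^sup>2\<bar> \<le> (\<Sum>k\<in>{i..<j}. e k)"
      using that step by (auto intro!: order_trans[OF sum_abs] sum_mono)
    also have "\<dots> \<le> (\<Sum>k<n. e k)"
      using that Nn e0 by (intro sum_mono2) auto
    finally show ?thesis by linarith
  qed
  have ij: "(f i)\<^sup>2 \<le> (f j)\<^sup>2 + (\<delta> * z + s / \<delta>)" if "j < N" for j
    using tele[of i j] tele[of j i] that i sum_e by (cases "i \<le> j") auto
  have "h * (\<Sum>j<N. (f i)\<^sup>2) \<le> h * (\<Sum>j<N. (f j)\<^sup>2 + (\<delta> * z + s / \<delta>))"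
    using h ij by (intro mult_left_mono sum_mono) auto
  then have "a * (f i)\<^sup>2 \<le> s + a * (\<delta> * z + s / \<delta>)"
    by (simp add: s_def gs_def sum.distrib distrib_left flip: hN)
  then have "(f i)\<^sup>2 \<le> s / a + (\<delta> * z + s / \<delta>)"
    using a by (simp add: field_simps)
  then show ?thesis unfolding s_def[symmetric] z_def[symmetric] by (simp add: algebra_simps)
qed

text \<open>The choice \<delta> = sqrt d balances a squared L2 increment of order d against a merely
  bounded gradient: the squared pointwise increment is then of order sqrt d, a Hoelder exponent 1 /
  4 in time. For d = 0 that \<delta> is not admissible, but then f i vanishes.\<close>

lemma grid_interpolation_time:
  assumes h: "h > 0" and hN: "h * real N = a" and i: "i < N" and d: "0 \<le> d"
    and C: "gs h N (\<lambda>i. (f i)\<^sup>2) \<le> C * d" and D: "gs h N (\<lambda>i. (gd h N f i)\<^sup>2) \<le> D"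
  shows "(f i)\<^sup>2 \<le> C / a * d + (C + D) * sqrt d"
proof (cases "d = 0")
  case True
  have "h * (f i)\<^sup>2 \<le> h * (\<Sum>i<N. (f i)\<^sup>2)"
    using h i by (intro mult_left_mono member_le_sum) auto
  then have "h * (f i)\<^sup>2 \<le> 0" using C True by (simp add: gs_def)
  then show ?thesis using h True by (simp add: mult_le_0_iff)
next
  case False
  then have d: "0 < d" "0 < sqrt d" using d by auto
  have a: "a > 0" using h hN i by auto
  have "(f i)\<^sup>2 \<le> (1 / a + 1 / sqrt d) * gs h N (\<lambda>i. (f i)\<^sup>2) + sqrt d * gs h N (\<lambda>i. (gd h N f i)\<^sup>2)"
    by (rule grid_interpolation[OF h hN d(2) i])
  also have "\<dots> \<le> (1 / a + 1 / sqrt d) * (C * d) + sqrt d * D"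
    using a d C D by (intro add_mono mult_left_mono) auto
  also have "\<dots> = C / a * d + (C + D) * sqrt d"
  proof -
    have "C * d / sqrt d = C * sqrt d" unfolding times_divide_eq_right[symmetric] using real_div_sqrt[of d] d by simp
    then show ?thesis by (simp add: algebra_simps)
  qed
  finally show ?thesis .
qed

text \<open>Cauchy-Schwarz along the chain of faces between the two cells: exponent 1 / 2 in the
  distance h |i - j|, with a constant that does not see the mesh.\<close>

lemma grid_holder:
  assumes h: "h > 0" and "i < N" "j < N"
  shows "(f i - f j)\<^sup>2 \<le> h * \<bar>real i - real j\<bar> * gs h N (\<lambda>i. (gd h N f i)\<^sup>2)"
proof -
  have *: "(f j - f i)\<^sup>2 \<le> h * (real j - real i) * gs h N (\<lambda>i. (gd h N f i)\<^sup>2)" if "i \<le> j" "j < N" for i j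
  proof -
    have "f j - f i = (\<Sum>k\<in>{i..<j}. f (Suc k) - f k)"
      using sum_Suc_diff'[OF that(1), of f] by simp
    also have "\<dots> = (\<Sum>k\<in>{i..<j}. h * gd h N f (Suc k))"
      using that h by (intro sum.cong) (auto simp: gd_def)
    also have "\<dots> = h * (\<Sum>k\<in>{i..<j}. gd h N f (Suc k))" by (simp add: sum_distrib_left)
    finally have "(f j - f i)\<^sup>2 = h\<^sup>2 * (\<Sum>k\<in>{i..<j}. gd h N f (Suc k) * 1)\<^sup>2" by (simp add: power_mult_distrib)
    also have "\<dots> \<le> h\<^sup>2 * ((\<Sum>k\<in>{i..<j}. (gd h N f (Suc k))\<^sup>2) * (\<Sum>k\<in>{i..<j}. 1\<^sup>2))"
      by (intro mult_left_mono Cauchy_Schwarz_ineq_sum) auto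
    also have "(\<Sum>k\<in>{i..<j}. (gd h N f (Suc k))\<^sup>2) = (\<Sum>k\<in>{Suc i..<Suc j}. (gd h N f k)\<^sup>2)"
      by (rule sum.shift_bounds_Suc_ivl[symmetric])
    also have "h\<^sup>2 * ((\<Sum>k\<in>{Suc i..<Suc j}. (gd h N f k)\<^sup>2) * (\<Sum>k\<in>{i..<j}. 1\<^sup>2))
       \<le> h\<^sup>2 * ((\<Sum>k<N. (gd h N f k)\<^sup>2) * (\<Sum>k\<in>{i..<j}. 1\<^sup>2))"
      using that by (intro mult_left_mono mult_right_mono sum_mono2) auto
    also have "\<dots> = h * (real j - real i) * gs h N (\<lambda>i. (gd h N f i)\<^sup>2)"
      using that by (simp add: gs_def power2_eq_square of_nat_diff)
    finally show ?thesis .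
  qed
  show ?thesis
    using *[of i j] *[of j i] assms by (cases "i \<le> j") (auto simp: power2_commute)
qed

lemma gd_eq_sum_gl: "h \<noteq> 0 \<Longrightarrow> gd h N v i = h * (\<Sum>j<i. gl h N v j)"
proof (induction i)
  case (Suc i)
  then show ?case by (simp add: distrib_left) (simp add: gl_def)
qed (simp add: gd_def)

lemma two_mult_le: "2 * x * y \<le> x\<^sup>2 + y\<^sup>2" for x y :: real
  using sum_squares_bound[of x y] .

lemma power2_diff_le: "(x - y)\<^sup>2 \<le> 2 * x\<^sup>2 + 2 * y\<^sup>2" for x y :: real
  using sum_squares_bound[of x "- y"] by (simp add: power2_diff)

lemma power2_sum_le: "(x + y)\<^sup>2 \<le> 2 * x\<^sup>2 + 2 * y\<^sup>2" for x y :: real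
  using sum_squares_bound[of x y] by (simp add: power2_sum)

lemma gs_const: "h * real N = a \<Longrightarrow> gs h N (\<lambda>i. c) = a * c"
  by (auto simp: gs_def)

lemma gs_gm: "h * real N = a \<Longrightarrow> 0 < N \<Longrightarrow> gs h N v = a * gm N v"
  by (auto simp: gs_def gm_def)

lemma gs_variance:
  assumes "h * real N = a" "0 < N"
  shows "gs h N (\<lambda>i. (v i - gm N v)\<^sup>2) = gs h N (\<lambda>i. (v i)\<^sup>2) - a * (gm N v)\<^sup>2"
proof -
  have "gs h N (\<lambda>i. (v i - gm N v)\<^sup>2) = gs h N (\<lambda>i. (v i)\<^sup>2 + ((gm N v)\<^sup>2 - (2 * gm N v) * v i))"
    by (intro gs_cong) (simp add: power2_diff)
  also have "\<dots> = gs h N (\<lambda>i. (v i)\<^sup>2) + (a * (gm N v)\<^sup>2 - 2 * gm N v * (a * gm N v))"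
    by (simp add: gs_add gs_diff gs_cmult gs_const[OF assms(1)] gs_gm[OF assms])
  finally show ?thesis by (simp add: power2_eq_square)
qed

text \<open>The estimates come from testing the time derivative of the equation with \<open>q u powr (- p)\<close>,
  which controls \<open>y\<close>, and with \<open>gl q\<close>, which controls \<open>t z\<close>. All constants are independent of
  \<open>N\<close>.\<close>

locale grid_flow =
  fixes p a m M T h :: real and N :: nat and u q :: "real \<Rightarrow> nat \<Rightarrow> real"
  assumes p: "1 < p" and a: "0 < a" and m: "0 < m" and N: "0 < N" and hdef: "h = a / real N" and T: "0 < T"
    and u_deriv: "\<And>t i. \<lbrakk>t \<in> {0..T}; i < N\<rbrakk> \<Longrightarrow> ((\<lambda>t. u t i) has_real_derivative q t i) (at t within {0..T})"
    and u_bounds: "\<And>t i. \<lbrakk>t \<in> {0..T}; i < N\<rbrakk> \<Longrightarrow> m \<le> u t i \<and> u t i \<le> M"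
    and q_eq: "\<And>t i. \<lbrakk>t \<in> {0..T}; i < N\<rbrakk> \<Longrightarrow> q t i = u t i powr p * (gl h N (u t) i + u t i - gm N (u t))"
begin

text \<open>Coefficient of the Riccati inequality in \<open>y_deriv_le\<close>: the first summand
  collects all multiples of s through s \<le> M powr p * y, the second is what Young's inequality
  leaves of the cubic term.\<close>

definition "K = (1 / a + 3) * M powr p + p\<^sup>2 / (4 * m\<^sup>2)"

text \<open>With q in the role of the time derivative of u, and q / u powr p in that of R, this is
  the density of the dissipation; \<open>y\<close> is therefore the discrete D.\<close>

definition "w t i = (q t i)\<^sup>2 * u t i powr (- p)"

definition "y t = gs h N (w t)"
definition "s t = gs h N (\<lambda>i. (q t i)\<^sup>2)"
definition "z t = gs h N (\<lambda>i. (gd h N (q t) i)\<^sup>2)"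
text \<open>Lower-order part of the time derivative \<open>r\<close> of q: the first term comes from
  differentiating u powr p, with the bracket rewritten as q / u powr p, the second from
  differentiating u - gm. The principal part u powr p * gl q is added in \<open>r\<close>.\<close>

definition "b t i = p * (q t i)\<^sup>2 / u t i + u t i powr p * (q t i - gm N (q t))"
definition "r t i = b t i + u t i powr p * gl h N (q t) i"

lemma h: "0 < h" and hN: "h * real N = a" and mM: "m \<le> M" and M: "0 < M"
proof -
  show "0 < h" "h * real N = a" using a N by (auto simp: hdef)
  show "m \<le> M" using u_bounds[of 0 0] T N by auto
  then show "0 < M" using m by simp
qed

lemma u_pos: "t \<in> {0..T} \<Longrightarrow> i < N \<Longrightarrow> 0 < u t i"
  using u_bounds m by force

lemma powr_bounds: "t \<in> {0..T} \<Longrightarrow> i < N \<Longrightarrow> m powr p \<le> u t i powr p \<and> u t i powr p \<le> M powr p"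
  using u_bounds m p by (auto intro!: powr_mono2 simp: less_imp_le order_trans[OF less_imp_le[OF m]])

lemma q_deriv:
  assumes t: "t \<in> {0..T}" and i: "i < N"
  shows "((\<lambda>t. q t i) has_real_derivative r t i) (at t within {0..T})"
proof -
  have u: "0 < u t i" using u_pos[OF assms] .
  let ?l = "\<lambda>t. gl h N (u t) i + u t i - gm N (u t)"
  have "((\<lambda>t. u t i powr p * ?l t) has_real_derivative
      (p * u t i powr (p - 1) * q t i) * ?l t + (gl h N (q t) i + q t i - gm N (q t)) * u t i powr p) (at t within {0..T})"
    by (intro DERIV_mult DERIV_diff DERIV_add has_real_derivative_gl has_real_derivative_gm u_deriv t i)
      (auto intro!: derivative_eq_intros u_deriv t i simp: u)
  moreover have "(p * u t i powr (p - 1) * q t i) * ?l t = p * (q t i)\<^sup>2 / u t i"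
  proof -
    have "?l t = q t i / u t i powr p" using q_eq[OF t i] u by simp
    then show ?thesis using u by (simp add: powr_diff power2_eq_square)
  qed
  ultimately have "((\<lambda>t. u t i powr p * ?l t) has_real_derivative r t i) (at t within {0..T})"
    by (simp add: r_def b_def algebra_simps)
  then show ?thesis
    by (rule has_field_derivative_transform_within[OF _ zero_less_one t]) (use q_eq i in auto)
qed

lemma w_nonneg: "0 \<le> w t i" by (simp add: w_def)

lemma q2_w: "t \<in> {0..T} \<Longrightarrow> i < N \<Longrightarrow> (q t i)\<^sup>2 = u t i powr p * w t i"
  using u_pos[of t i] by (simp add: w_def powr_minus)

lemma y_nonneg: "0 \<le> y t" and s_nonneg: "0 \<le> s t" and z_nonneg: "0 \<le> z t"
  unfolding y_def s_def z_def using h w_nonneg by (auto intro!: gs_nonneg)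

lemma s_le_y: "t \<in> {0..T} \<Longrightarrow> s t \<le> M powr p * y t"
  unfolding s_def y_def gs_cmult[symmetric] using h powr_bounds w_nonneg
  by (intro gs_mono) (auto simp: q2_w intro!: mult_right_mono)

text \<open>Interpolation with \<delta> = 1 puts every single q^2 below this number; that z enters
  with coefficient 1 matters for the absorption in \<open>y_deriv_le\<close>.\<close>

definition "X t = (1 / a + 1) * s t + z t"

lemma X_nonneg: "0 \<le> X t" using s_nonneg z_nonneg a by (simp add: X_def)

lemma q2_le_X: "t \<in> {0..T} \<Longrightarrow> i < N \<Longrightarrow> (q t i)\<^sup>2 \<le> X t"
  using grid_interpolation[OF h hN zero_less_one, of i "q t"] by (simp add: X_def s_def z_def)

text \<open>The weight u powr (- p) cancels the coefficient of the principal part, so that summation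
  by parts gives exactly - 2 z; differentiating the weight takes away one half of the cubic
  term.\<close>

lemma y_deriv:
  assumes t: "t \<in> {0..T}"
  shows "(y has_real_derivative gs h N (\<lambda>i. p * (q t i / u t i) * w t i) - 2 * z t + 2 * (s t - a * (gm N (q t))\<^sup>2)) (at t within {0..T})"
proof -
  let ?w' = "\<lambda>i. (2 * q t i * r t i) * u t i powr (- p) + (- p * u t i powr (- p - 1) * q t i) * (q t i)\<^sup>2"
  have "(y has_real_derivative gs h N ?w') (at t within {0..T})"
    unfolding y_def w_def
  proof (rule has_real_derivative_gs)
    fix i assume i: "i < N"
    have u: "0 < u t i" using u_pos[OF t i] .
    show "((\<lambda>t. (q t i)\<^sup>2 * u t i powr - p) has_real_derivative ?w' i) (at t within {0..T})"
      by (rule DERIV_mult)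
        (auto intro!: derivative_eq_intros q_deriv u_deriv t i simp: u)
  qed
  moreover have "gs h N ?w' = gs h N (\<lambda>i. p * (q t i / u t i) * w t i + (2 * (gl h N (q t) i * q t i) + 2 * ((q t i)\<^sup>2 - gm N (q t) * q t i)))"
  proof (rule gs_cong)
    fix i assume i: "i < N"
    have u: "0 < u t i" using u_pos[OF t i] .
    have e1: "u t i powr (- p - 1) = u t i powr (- p) / u t i" using u by (simp add: powr_diff)
    have "u t i powr p * u t i powr (- p) = 1" using u by (simp add: powr_minus)
    then have e2: "r t i * u t i powr (- p) = p * (q t i)\<^sup>2 / u t i * u t i powr (- p) + (q t i - gm N (q t)) + gl h N (q t) i"
      by (simp add: r_def b_def algebra_simps)
    have "?w' i = 2 * q t i * (r t i * u t i powr (- p)) - p * (q t i / u t i) * w t i"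
      unfolding e1 by (simp add: w_def power2_eq_square)
    also have "\<dots> = p * (q t i / u t i) * w t i + (2 * (gl h N (q t) i * q t i) + 2 * ((q t i)\<^sup>2 - gm N (q t) * q t i))"
      unfolding e2 using u by (simp add: w_def power2_eq_square field_simps)
    finally show "?w' i = \<dots>" .
  qed
  moreover have "\<dots> = gs h N (\<lambda>i. p * (q t i / u t i) * w t i) - 2 * z t + 2 * (s t - a * (gm N (q t))\<^sup>2)"
    using h by (simp add: gs_add gs_diff gs_cmult gs_gl_by_parts gs_gm[OF hN N, of "q t"] s_def z_def power2_eq_square)
  ultimately show ?thesis by simp
qed

text \<open>The cubic term is at most p / m times the largest |q| times y, and the largest q^2 is
  bounded by X, which contains z once. Young's inequality thus costs one z, and one of the two
  negative copies remains.\<close>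

lemma y_deriv_le:
  assumes t: "t \<in> {0..T}"
  shows "gs h N (\<lambda>i. p * (q t i / u t i) * w t i) - 2 * z t + 2 * (s t - a * (gm N (q t))\<^sup>2) \<le> K * (1 + y t)\<^sup>2 - z t"
proof -
  define x where "x = sqrt (X t)"
  have x: "x \<ge> 0" "x\<^sup>2 = X t" using X_nonneg by (auto simp: x_def)
  have "gs h N (\<lambda>i. p * (q t i / u t i) * w t i) \<le> gs h N (\<lambda>i. p / m * x * w t i)"
  proof (rule gs_mono)
    fix i assume i: "i < N"
    have u: "0 < u t i" "m \<le> u t i" using u_pos[OF t i] u_bounds[OF t i] by auto
    have "q t i \<le> x" using q2_le_X[OF t i] by (simp add: real_le_rsqrt x_def)
    then have "q t i / u t i \<le> x / m" using u m x by (intro frac_le) auto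
    then have "p * (q t i / u t i) \<le> p * (x / m)" using p by (intro mult_left_mono) auto
    then show "p * (q t i / u t i) * w t i \<le> p / m * x * w t i"
      by (intro mult_right_mono w_nonneg) simp
  qed (use h in simp)
  also have "\<dots> = p / m * x * y t" unfolding y_def by (rule gs_cmult)
  also have "\<dots> \<le> x\<^sup>2 + (p * y t / (2 * m))\<^sup>2"
    using sum_squares_bound[of x "p * y t / (2 * m)"] by (simp add: mult_ac)
  finally have 1: "gs h N (\<lambda>i. p * (q t i / u t i) * w t i) \<le> X t + (p * y t / (2 * m))\<^sup>2" using x by simp
  have 2: "(p * y t / (2 * m))\<^sup>2 = p\<^sup>2 / (4 * m\<^sup>2) * (y t)\<^sup>2" by (simp add: power_divide power_mult_distrib)
  have 3: "(1 / a + 3) * s t \<le> (1 / a + 3) * (M powr p * y t)"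
    using s_le_y[OF t] a by (intro mult_left_mono) auto
  have y2: "(y t)\<^sup>2 \<le> (1 + y t)\<^sup>2" "y t \<le> (1 + y t)\<^sup>2" using y_nonneg[of t] by (auto simp: power2_eq_square algebra_simps)
  have 4: "p\<^sup>2 / (4 * m\<^sup>2) * (y t)\<^sup>2 \<le> p\<^sup>2 / (4 * m\<^sup>2) * (1 + y t)\<^sup>2" by (intro mult_left_mono y2) auto
  have 5: "(1 / a + 3) * M powr p * y t \<le> (1 / a + 3) * M powr p * (1 + y t)\<^sup>2" using a by (intro mult_left_mono y2) auto
  have 6: "0 \<le> a * (gm N (q t))\<^sup>2" using a by simp
  have "gs h N (\<lambda>i. p * (q t i / u t i) * w t i) - 2 * z t + 2 * (s t - a * (gm N (q t))\<^sup>2)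
      \<le> (1 / a + 3) * s t + p\<^sup>2 / (4 * m\<^sup>2) * (y t)\<^sup>2 - z t"
    using 1 6 unfolding 2 X_def by (simp add: algebra_simps)
  also have "\<dots> \<le> K * (1 + y t)\<^sup>2 - z t" using 3 4 5 unfolding K_def by (simp add: algebra_simps)
  finally show ?thesis .
qed

lemma K_pos: "0 < K" using p m a M by (auto simp: K_def intro!: add_pos_pos add_nonneg_pos mult_pos_pos)

end

text \<open>On the time interval in question the Riccati inequality \<open>y' \<le> K (1 + y)\<^sup>2\<close> keeps \<open>1 + y\<close>
  below twice its initial value.\<close>

locale grid_flow_bounded = grid_flow +
  fixes Y :: real
  assumes Y: "2 * (1 + y 0) \<le> Y" "K * T * Y \<le> 1"
begin

lemma Y_pos: "0 < Y"
proof -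
  have "0 \<le> y 0" by (rule y_nonneg)
  then have "0 < 2 * (1 + y 0)" by simp
  then show ?thesis using Y(1) by (rule less_le_trans)
qed

text \<open>The function - 1 / (1 + y) has derivative at most K. Since Y \<ge> 2 (1 + y 0) and K T
  \<le> 1 / Y, the quantity 1 / (1 + y) starts at 2 / Y or more and cannot fall below 1 / Y.\<close>

lemma y_le_Y:
  assumes t: "t \<in> {0..T}"
  shows "y t \<le> Y"
proof -
  have pos: "0 < 1 + y t" for t using y_nonneg[of t] by linarith
  define y' where "y' t = gs h N (\<lambda>i. p * (q t i / u t i) * w t i) - 2 * z t + 2 * (s t - a * (gm N (q t))\<^sup>2)" for t
  have "- (1 / (1 + y t)) - - (1 / (1 + y 0)) \<le> K * (t - 0)"
  proof (rule increment_le[where S="{0..T}"])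
    fix x assume "x \<in> {0..t}"
    then have x: "x \<in> {0..T}" using t by auto
    show "((\<lambda>t. - (1 / (1 + y t))) has_real_derivative y' x / (1 + y x)\<^sup>2) (at x within {0..T})"
      using pos[of x] by (auto intro!: derivative_eq_intros y_deriv[OF x, folded y'_def] simp: power2_eq_square)
    have "y' x \<le> K * (1 + y x)\<^sup>2"
      using y_deriv_le[OF x] z_nonneg[of x] unfolding y'_def by linarith
    then show "y' x / (1 + y x)\<^sup>2 \<le> K" using pos[of x] by (simp add: divide_le_eq)
  qed (use t in auto)
  moreover have "K * t \<le> 1 / Y"
  proof -
    have "K * t \<le> K * T" using t K_pos by auto
    also have "\<dots> \<le> 1 / Y" using Y(2) Y_pos by (simp add: pos_le_divide_eq)
    finally show ?thesis .
  qed
  moreover have "2 / Y \<le> 1 / (1 + y 0)" using Y(1) Y_pos pos[of 0] by (simp add: field_simps)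
  moreover have "2 / Y = 1 / Y + 1 / Y" "t - 0 = t" by simp_all
  ultimately have "1 / Y \<le> 1 / (1 + y t)" by (smt (verit))
  then have "1 + y t \<le> Y" using Y_pos pos[of t] by (simp add: field_simps)
  then show ?thesis by simp
qed

definition "S0 = M powr p * Y"

lemma S0_nonneg: "0 \<le> S0" using Y_pos by (simp add: S0_def)

lemma s_le: "t \<in> {0..T} \<Longrightarrow> s t \<le> S0"
  using s_le_y[of t] y_le_Y[of t] mult_left_mono[of "y t" Y "M powr p"] by (simp add: S0_def)

definition "C1 = p\<^sup>2 / m\<^sup>2 * ((1 / a + 1) * S0 + 1) * Y + M powr p * S0"

lemma C1_nonneg: "0 \<le> C1"
  using S0_nonneg Y_pos a m by (simp add: C1_def)

text \<open>The term with q^4 is split unevenly: one q^2 goes into the sup bound X, the other into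
  the density w, whose sum y is bounded. In this way the estimate stays linear in z, which is what
  \<open>z_le\<close> needs.\<close>

lemma b_bound:
  assumes t: "t \<in> {0..T}"
  shows "gs h N (\<lambda>i. (b t i)\<^sup>2 / (2 * u t i powr p)) \<le> C1 * (1 + z t)"
proof -
  have "gs h N (\<lambda>i. (b t i)\<^sup>2 / (2 * u t i powr p))
      \<le> gs h N (\<lambda>i. (p\<^sup>2 / m\<^sup>2 * X t) * w t i + M powr p * (q t i - gm N (q t))\<^sup>2)"
  proof (rule gs_mono)
    fix i assume i: "i < N"
    define v P c d where "v = u t i" and "P = v powr p" and "c = p * (q t i)\<^sup>2 / v" and "d = q t i - gm N (q t)"
    have v: "0 < v" "m \<le> v" and P: "0 < P" "P \<le> M powr p"
      using u_pos[OF t i] u_bounds[OF t i] powr_bounds[OF t i] by (auto simp: v_def P_def)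
    have "(c + P * d)\<^sup>2 \<le> 2 * c\<^sup>2 + 2 * (P * d)\<^sup>2"
      using sum_squares_bound[of c "P * d"] by (simp add: power2_sum)
    then have "(c + P * d)\<^sup>2 / (2 * P) \<le> (2 * c\<^sup>2 + 2 * (P * d)\<^sup>2) / (2 * P)"
      using P by (intro divide_right_mono) auto
    also have "\<dots> = c\<^sup>2 / P + P * d\<^sup>2" using P by (simp add: field_simps power2_eq_square)
    also have "c\<^sup>2 / P = p\<^sup>2 / v\<^sup>2 * (q t i)\<^sup>2 * w t i"
      using q2_w[OF t i] P v by (simp add: c_def P_def v_def w_def powr_minus power2_eq_square field_simps)
    also have "\<dots> \<le> p\<^sup>2 / m\<^sup>2 * X t * w t i"
      using q2_le_X[OF t i] v m p X_nonneg by (intro mult_right_mono mult_mono w_nonneg frac_le power_mono) auto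
    finally have "(c + P * d)\<^sup>2 / (2 * P) \<le> p\<^sup>2 / m\<^sup>2 * X t * w t i + M powr p * d\<^sup>2"
      using P mult_right_mono[of P "M powr p" "d\<^sup>2"] by simp
    then show "(b t i)\<^sup>2 / (2 * u t i powr p) \<le> p\<^sup>2 / m\<^sup>2 * X t * w t i + M powr p * (q t i - gm N (q t))\<^sup>2"
      by (simp add: b_def c_def d_def P_def v_def)
  qed (use h in simp)
  also have "\<dots> = (p\<^sup>2 / m\<^sup>2 * X t) * y t + M powr p * (s t - a * (gm N (q t))\<^sup>2)"
    unfolding gs_add gs_cmult gs_variance[OF hN N] y_def s_def ..
  also have "\<dots> \<le> (p\<^sup>2 / m\<^sup>2 * (((1 / a + 1) * S0 + 1) * (1 + z t))) * Y + M powr p * (S0 * (1 + z t))"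
  proof (intro add_mono mult_mono)
    have "(1 / a + 1) * s t \<le> (1 / a + 1) * S0" using s_le[OF t] a by (intro mult_left_mono) auto
    moreover have "0 \<le> (1 / a + 1) * S0 * z t" using a S0_nonneg z_nonneg by simp
    ultimately show "X t \<le> ((1 / a + 1) * S0 + 1) * (1 + z t)" by (simp add: X_def algebra_simps)
    show "y t \<le> Y" using y_le_Y[OF t] .
    have "0 \<le> a * (gm N (q t))\<^sup>2" "0 \<le> S0 * z t" using a S0_nonneg z_nonneg by auto
    then show "s t - a * (gm N (q t))\<^sup>2 \<le> S0 * (1 + z t)" using s_le[OF t] by (simp add: algebra_simps)
    show "0 \<le> s t - a * (gm N (q t))\<^sup>2"
      unfolding s_def gs_variance[OF hN N, symmetric] using h by (intro gs_nonneg) auto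
  qed (use X_nonneg y_nonneg z_nonneg S0_nonneg a in auto)
  also have "\<dots> = C1 * (1 + z t)"
  proof -
    have "(A * (B * c)) * Y + D * (S0 * c) = (A * B * Y + D * S0) * c" for A B c D :: real
      by (simp add: algebra_simps)
    then show ?thesis unfolding C1_def .
  qed
  finally show ?thesis .
qed

text \<open>After summation by parts z' is - 2 times the sum of gl q * r. Its principal part gives
  the good term - 2 u powr p (gl q)^2, and completing the square leaves b^2 / (2 u powr p), so no
  second difference of q has to be estimated.\<close>

lemma z_deriv:
  assumes t: "t \<in> {0..T}"
  obtains z' where "(z has_real_derivative z') (at t within {0..T})" "z' \<le> C1 * (1 + z t)"
proof
  let ?z' = "gs h N (\<lambda>i. 2 * (gd h N (q t) i * gd h N (r t) i))"
  show "(z has_real_derivative ?z') (at t within {0..T})"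
    unfolding z_def
  proof (rule has_real_derivative_gs)
    fix i assume "i < N"
    have "((\<lambda>t. gd h N (q t) i) has_real_derivative gd h N (r t) i) (at t within {0..T})"
      by (intro has_real_derivative_gd q_deriv t)
    then show "((\<lambda>t. (gd h N (q t) i)\<^sup>2) has_real_derivative 2 * (gd h N (q t) i * gd h N (r t) i)) (at t within {0..T})"
      by (auto intro!: derivative_eq_intros)
  qed
  have "?z' = 2 * gs h N (\<lambda>i. gd h N (q t) i * gd h N (r t) i)" by (rule gs_cmult)
  also have "\<dots> = - 2 * gs h N (\<lambda>i. gl h N (q t) i * r t i)" using h by (simp add: gs_gl_by_parts)
  also have "\<dots> = gs h N (\<lambda>i. - 2 * (gl h N (q t) i * r t i))" by (rule gs_cmult[symmetric])
  also have "\<dots> \<le> gs h N (\<lambda>i. (b t i)\<^sup>2 / (2 * u t i powr p))"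
  proof (rule gs_mono)
    fix i assume i: "i < N"
    define P l c where "P = u t i powr p" and "l = gl h N (q t) i" and "c = b t i"
    have P: "0 < P" using u_pos[OF t i] by (simp add: P_def)
    have "0 \<le> (c + 2 * P * l)\<^sup>2 / (2 * P)" using P by simp
    also have "\<dots> = c\<^sup>2 / (2 * P) + 2 * l * c + 2 * P * l\<^sup>2" using P by (simp add: power2_sum field_simps power2_eq_square)
    finally have "- 2 * (l * (c + P * l)) \<le> c\<^sup>2 / (2 * P)" by (simp add: algebra_simps power2_eq_square)
    then show "- 2 * (gl h N (q t) i * r t i) \<le> (b t i)\<^sup>2 / (2 * u t i powr p)"
      by (simp add: P_def l_def c_def r_def)
  qed (use h in simp)
  also have "\<dots> \<le> C1 * (1 + z t)" by (rule b_bound[OF t])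
  finally show "?z' \<le> C1 * (1 + z t)" .
qed

definition "C2 = (1 + C1 * T) * K * (1 + Y)\<^sup>2 + C1 * T"
definition "Z = (1 + C1 * T) * Y + C2 * T"

lemma C2_nonneg: "0 \<le> C2" using C1_nonneg K_pos T by (simp add: C2_def)

text \<open>No bound for z at time 0 is at hand, so it is weighted with t. The derivative of t z is
  at most (1 + C1 T) z + C1 T, and this multiple of z is exactly what the term - z in the inequality
  for y pays for when y is added with the factor 1 + C1 T.\<close>

lemma z_le:
  assumes t: "t \<in> {0..T}"
  shows "t * z t \<le> Z"
proof -
  define y' where "y' t = gs h N (\<lambda>i. p * (q t i / u t i) * w t i) - 2 * z t + 2 * (s t - a * (gm N (q t))\<^sup>2)" for t
  obtain z' where z': "\<And>t. t \<in> {0..T} \<Longrightarrow> (z has_real_derivative z' t) (at t within {0..T})"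
    "\<And>t. t \<in> {0..T} \<Longrightarrow> z' t \<le> C1 * (1 + z t)"
  proof -
    have "\<exists>z'. \<forall>t\<in>{0..T}. (z has_real_derivative z' t) (at t within {0..T}) \<and> z' t \<le> C1 * (1 + z t)"
      by (rule bchoice) (meson z_deriv)
    then show thesis using that by blast
  qed
  have "(t * z t + (1 + C1 * T) * y t) - (0 * z 0 + (1 + C1 * T) * y 0) \<le> C2 * (t - 0)"
  proof (rule increment_le[where S="{0..T}"])
    fix x assume "x \<in> {0..t}"
    then have x: "x \<in> {0..T}" using t by auto
    have yd: "(y has_real_derivative y' x) (at x within {0..T})" unfolding y'_def by (rule y_deriv[OF x])
    show "((\<lambda>t. t * z t + (1 + C1 * T) * y t) has_real_derivative z x + x * z' x + (1 + C1 * T) * y' x) (at x within {0..T})"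
      by (auto intro!: derivative_eq_intros z' x yd)
    have "x * z' x \<le> x * (C1 * (1 + z x))" using x by (intro mult_left_mono z') auto
    also have "\<dots> \<le> T * (C1 * (1 + z x))" using x C1_nonneg z_nonneg[of x] by (intro mult_right_mono) auto
    finally have 1: "x * z' x \<le> T * (C1 * (1 + z x))" .
    have "y' x \<le> K * (1 + y x)\<^sup>2 - z x" unfolding y'_def by (rule y_deriv_le[OF x])
    also have "\<dots> \<le> K * (1 + Y)\<^sup>2 - z x"
      using y_le_Y[OF x] y_nonneg[of x] K_pos by (intro diff_right_mono mult_left_mono power_mono) auto
    finally have "(1 + C1 * T) * y' x \<le> (1 + C1 * T) * (K * (1 + Y)\<^sup>2 - z x)"
      using C1_nonneg T by (intro mult_left_mono) auto
    with 1 show "z x + x * z' x + (1 + C1 * T) * y' x \<le> C2" by (simp add: C2_def algebra_simps)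
  qed (use t in auto)
  moreover have "0 \<le> (1 + C1 * T) * y t" using C1_nonneg T y_nonneg by simp
  moreover have "(1 + C1 * T) * y 0 \<le> (1 + C1 * T) * Y" using C1_nonneg T y_le_Y[of 0] by (intro mult_left_mono) auto
  moreover have "C2 * t \<le> C2 * T" using C2_nonneg t by (intro mult_left_mono) auto
  ultimately show ?thesis unfolding Z_def by simp
qed

section \<open>Gradient of u, and Hoelder moduli of u and q in space and time\<close>

definition "L = a / 2 + Y / m powr p + a * M\<^sup>2"

lemma gm_bounds:
  assumes t: "t \<in> {0..T}"
  shows "0 \<le> gm N (u t)" "gm N (u t) \<le> M"
proof -
  have "0 \<le> (\<Sum>i<N. u t i)" using u_pos[OF t] by (intro sum_nonneg) (simp add: less_imp_le)
  then show "0 \<le> gm N (u t)" by (simp add: gm_def)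
  have "(\<Sum>i<N. u t i) \<le> (\<Sum>i<N. M)" using u_bounds[OF t] by (intro sum_mono) auto
  then show "gm N (u t) \<le> M" using N by (simp add: gm_def divide_le_eq mult.commute)
qed

text \<open>The gradient is a sum of Laplacians starting from the face 0, where it vanishes. By the
  equation the Laplacian is q / u powr p - (u - gm), and its L1 norm is controlled by y because (q /
  u powr p)^2 = w / u powr p.\<close>

lemma gd_u_bound:
  assumes t: "t \<in> {0..T}" and i: "i < N"
  shows "\<bar>gd h N (u t) i\<bar> \<le> L"
proof -
  have "\<bar>gd h N (u t) i\<bar> \<le> h * (\<Sum>j<i. \<bar>gl h N (u t) j\<bar>)"
    using h by (simp add: gd_eq_sum_gl abs_mult)
  also have "\<dots> \<le> h * (\<Sum>j<N. \<bar>gl h N (u t) j\<bar>)"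
    using h i by (intro mult_left_mono sum_mono2) auto
  also have "\<dots> \<le> gs h N (\<lambda>j. 1 / 2 + (1 / m powr p * w t j + M\<^sup>2))"
    unfolding gs_def
  proof (intro mult_left_mono sum_mono)
    fix j assume "j \<in> {..<N}"
    then have j: "j < N" by simp
    define l P d where "l = gl h N (u t) j" and "P = u t j powr p" and "d = u t j - gm N (u t)"
    have P: "0 < P" "m powr p \<le> P" using u_pos[OF t j] powr_bounds[OF t j] by (auto simp: P_def)
    have m0: "0 < m powr p" using m by simp
    have d: "\<bar>d\<bar> \<le> M" using gm_bounds[OF t] u_bounds[OF t j] u_pos[OF t j] by (auto simp: d_def)
    have qe: "q t j = P * (l + d)" unfolding q_eq[OF t j] by (simp add: P_def l_def d_def)
    have "(q t j / P)\<^sup>2 = w t j / P" using P q2_w[OF t j] by (simp add: power_divide P_def power2_eq_square)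
    also have "\<dots> \<le> w t j / m powr p" using P m0 w_nonneg[of t j] by (intro divide_left_mono mult_pos_pos P(1) m0) auto
    finally have wP: "(q t j / P)\<^sup>2 \<le> 1 / m powr p * w t j" by simp
    have "l\<^sup>2 = (q t j / P - d)\<^sup>2" using P by (simp add: qe)
    also have "\<dots> \<le> 2 * (q t j / P)\<^sup>2 + 2 * d\<^sup>2" by (rule power2_diff_le)
    also have "\<dots> \<le> 2 * (1 / m powr p * w t j) + 2 * M\<^sup>2"
      using wP abs_le_square_iff[of d M] d M by auto
    finally have "l\<^sup>2 \<le> 2 * (1 / m powr p * w t j) + 2 * M\<^sup>2" .
    moreover have "2 * \<bar>l\<bar> \<le> 1 + l\<^sup>2" using two_mult_le[of "\<bar>l\<bar>" 1] by simp
    ultimately show "\<bar>gl h N (u t) j\<bar> \<le> 1 / 2 + (1 / m powr p * w t j + M\<^sup>2)" by (simp add: l_def)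
  qed (use h in simp)
  also have "\<dots> = a / 2 + (1 / m powr p * y t + a * M\<^sup>2)"
    unfolding gs_add gs_cmult y_def gs_const[OF hN] by simp
  also have "\<dots> \<le> L" unfolding L_def using y_le_Y[OF t] m by (auto intro!: divide_right_mono)
  finally show ?thesis .
qed

lemma L_nonneg: "0 \<le> L" using gd_u_bound[of 0 0] T N by auto

lemma gs_gd_u_le: "t \<in> {0..T} \<Longrightarrow> gs h N (\<lambda>i. (gd h N (u t) i)\<^sup>2) \<le> a * L\<^sup>2"
  unfolding gs_const[OF hN, symmetric]
  using h gd_u_bound L_nonneg by (intro gs_mono) (auto simp: abs_le_square_iff[symmetric])

lemma u_holder_space:
  "t \<in> {0..T} \<Longrightarrow> i < N \<Longrightarrow> j < N \<Longrightarrow> (u t i - u t j)\<^sup>2 \<le> h * \<bar>real i - real j\<bar> * (a * L\<^sup>2)"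
  by (rule order_trans[OF grid_holder[OF h]]) (use h in \<open>auto intro!: mult_left_mono gs_gd_u_le\<close>)

definition "C3 = a * M\<^sup>2 + S0"

text \<open>The squared L2 distance to a fixed earlier slice grows at a bounded rate because s is
  bounded; with the gradient bound, \<open>grid_interpolation_time\<close> turns this into a
  pointwise modulus.\<close>

lemma u_holder_time_aux:
  assumes t: "0 \<le> t'" "t' \<le> t" "t \<le> T" and i: "i < N"
  shows "(u t i - u t' i)\<^sup>2 \<le> C3 / a * (t - t') + (C3 + 4 * (a * L\<^sup>2)) * sqrt (t - t')"
proof (rule grid_interpolation_time[OF h hN i])
  have "gs h N (\<lambda>i. (u t i - u t' i)\<^sup>2) - gs h N (\<lambda>i. (u t' i - u t' i)\<^sup>2) \<le> C3 * (t - t')"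
  proof (rule increment_le[where S="{0..T}"])
    fix x assume "x \<in> {t'..t}"
    then have x: "x \<in> {0..T}" using t by auto
    show "((\<lambda>x. gs h N (\<lambda>i. (u x i - u t' i)\<^sup>2)) has_real_derivative gs h N (\<lambda>i. 2 * (u x i - u t' i) * q x i)) (at x within {0..T})"
      by (rule has_real_derivative_gs) (auto intro!: derivative_eq_intros u_deriv x)
    have "gs h N (\<lambda>i. 2 * (u x i - u t' i) * q x i) \<le> gs h N (\<lambda>i. M\<^sup>2 + (q x i)\<^sup>2)"
    proof (rule gs_mono)
      fix i assume i: "i < N"
      have "\<bar>u x i - u t' i\<bar> \<le> M" using u_bounds[OF x i] u_bounds[OF _ i, of t'] u_pos[OF x i] u_pos[OF _ i, of t'] t by auto
      then have "(u x i - u t' i)\<^sup>2 \<le> M\<^sup>2" using abs_le_square_iff[of "u x i - u t' i" M] M by simp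
      then show "2 * (u x i - u t' i) * q x i \<le> M\<^sup>2 + (q x i)\<^sup>2"
        using two_mult_le[of "u x i - u t' i" "q x i"] by linarith
    qed (use h in simp)
    also have "\<dots> \<le> C3" unfolding gs_add gs_const[OF hN] C3_def using s_le[OF x] by (simp add: s_def)
    finally show "gs h N (\<lambda>i. 2 * (u x i - u t' i) * q x i) \<le> C3" .
  qed (use t in auto)
  then show "gs h N (\<lambda>i. (u t i - u t' i)\<^sup>2) \<le> C3 * (t - t')" by (simp add: gs_const[OF hN])
  have "gs h N (\<lambda>i. (gd h N (\<lambda>i. u t i - u t' i) i)\<^sup>2) \<le> gs h N (\<lambda>i. 2 * (gd h N (u t) i)\<^sup>2 + 2 * (gd h N (u t') i)\<^sup>2)"
    unfolding gd_diff using h by (intro gs_mono power2_diff_le) auto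
  also have "\<dots> \<le> 2 * (a * L\<^sup>2) + 2 * (a * L\<^sup>2)"
    unfolding gs_add gs_cmult using gs_gd_u_le[of t] gs_gd_u_le[of t'] t by (intro add_mono mult_left_mono) auto
  finally show "gs h N (\<lambda>i. (gd h N (\<lambda>i. u t i - u t' i) i)\<^sup>2) \<le> 4 * (a * L\<^sup>2)" by simp
qed (use t in auto)

lemma z_le_div:
  assumes "0 < \<epsilon>" "\<epsilon> \<le> t" "t \<le> T" shows "z t \<le> Z / \<epsilon>"
proof -
  have "\<epsilon> * z t \<le> t * z t" using assms z_nonneg[of t] by (intro mult_right_mono) auto
  also have "\<dots> \<le> Z" using z_le[of t] assms by auto
  finally show ?thesis using assms by (simp add: pos_le_divide_eq mult.commute)
qed

definition "B0 \<epsilon> = (1 / a + 1) * S0 + Z / \<epsilon>"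

lemma q2_le:
  assumes "0 < \<epsilon>" "\<epsilon> \<le> t" "t \<le> T" "i < N" shows "(q t i)\<^sup>2 \<le> B0 \<epsilon>"
proof -
  have "(1 / a + 1) * s t \<le> (1 / a + 1) * S0" using s_le[of t] a assms by (intro mult_left_mono) auto
  then show ?thesis using q2_le_X[of t i] z_le_div[of \<epsilon> t] assms by (simp add: X_def B0_def)
qed

lemma q_holder_space:
  assumes "0 < \<epsilon>" "\<epsilon> \<le> t" "t \<le> T" "i < N" "j < N"
  shows "(q t i - q t j)\<^sup>2 \<le> h * \<bar>real i - real j\<bar> * (Z / \<epsilon>)"
proof (rule order_trans[OF grid_holder[OF h]])
  show "h * \<bar>real i - real j\<bar> * gs h N (\<lambda>i. (gd h N (q t) i)\<^sup>2) \<le> h * \<bar>real i - real j\<bar> * (Z / \<epsilon>)"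
    unfolding z_def[symmetric] using h z_le_div assms by (intro mult_left_mono) auto
qed (use assms in auto)

definition "C4 \<epsilon> = 4 * S0 + 2 * M powr p * (C1 * (1 + Z / \<epsilon>)) + Z / \<epsilon> + 8 * (M powr p)\<^sup>2 * (Z / \<epsilon>)
   + 8 * a * (p * M powr (p - 1) * L)\<^sup>2 * B0 \<epsilon>"

text \<open>As for u, but the time derivative \<open>r\<close> contains the Laplacian of q, for
  which no L2 bound is available. It is moved by parts onto the increment of q times u powr p, whose
  gradient is controlled by z and the gradient bound on u; hence the restriction to times beyond
  \<epsilon>.\<close>

lemma q_holder_time_aux:
  assumes e: "0 < \<epsilon>" and t: "\<epsilon> \<le> t'" "t' \<le> t" "t \<le> T" and i: "i < N"
  shows "(q t i - q t' i)\<^sup>2 \<le> C4 \<epsilon> / a * (t - t') + (C4 \<epsilon> + 4 * (Z / \<epsilon>)) * sqrt (t - t')"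
proof (rule grid_interpolation_time[OF h hN i])
  have gdW: "gs h N (\<lambda>i. (gd h N (\<lambda>i. q x i - q t' i) i)\<^sup>2) \<le> 4 * (Z / \<epsilon>)" if "x \<in> {t'..t}" for x
  proof -
    have "gs h N (\<lambda>i. (gd h N (\<lambda>i. q x i - q t' i) i)\<^sup>2) \<le> gs h N (\<lambda>i. 2 * (gd h N (q x) i)\<^sup>2 + 2 * (gd h N (q t') i)\<^sup>2)"
      unfolding gd_diff using h by (intro gs_mono power2_diff_le) auto
    also have "\<dots> \<le> 2 * (Z / \<epsilon>) + 2 * (Z / \<epsilon>)"
      unfolding gs_add gs_cmult z_def[symmetric]
      using z_le_div[OF e, of x] z_le_div[OF e, of t'] that t by (intro add_mono mult_left_mono) auto
    finally show ?thesis by simp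
  qed
  then show "gs h N (\<lambda>i. (gd h N (\<lambda>i. q t i - q t' i) i)\<^sup>2) \<le> 4 * (Z / \<epsilon>)" using t by auto
  have "gs h N (\<lambda>i. (q t i - q t' i)\<^sup>2) - gs h N (\<lambda>i. (q t' i - q t' i)\<^sup>2) \<le> C4 \<epsilon> * (t - t')"
  proof (rule increment_le[where S="{0..T}"])
    fix x assume xt: "x \<in> {t'..t}"
    then have x: "x \<in> {0..T}" and t'0: "t' \<in> {0..T}" using t e by auto
    define W where "W i = q x i - q t' i" for i
    define P where "P i = u x i powr p" for i
    show "((\<lambda>x. gs h N (\<lambda>i. (q x i - q t' i)\<^sup>2)) has_real_derivative gs h N (\<lambda>i. 2 * W i * r x i)) (at x within {0..T})"
      by (rule has_real_derivative_gs) (auto intro!: derivative_eq_intros q_deriv x simp: W_def)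
    have W2: "(W i)\<^sup>2 \<le> 2 * (q x i)\<^sup>2 + 2 * (q t' i)\<^sup>2" for i unfolding W_def by (rule power2_diff_le)
    have W2B: "(W i)\<^sup>2 \<le> 4 * B0 \<epsilon>" if "i < N" for i
      using W2[of i] q2_le[OF e, of x i] q2_le[OF e, of t' i] xt t that by auto
    have P: "0 < P i" "P i \<le> M powr p" if "i < N" for i
      using u_pos[OF x that] powr_bounds[OF x that] by (auto simp: P_def)
    define A where "A = M powr p"
    define LP where "LP = p * M powr (p - 1) * L"
    have gdP: "(gd h N (\<lambda>i. W i * P i) i)\<^sup>2 \<le> 2 * A\<^sup>2 * (gd h N W i)\<^sup>2 + 8 * LP\<^sup>2 * B0 \<epsilon>" if i: "i < N" for i
    proof (cases "0 < i")
      case True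
      then have i': "i - 1 < N" using i by simp
      \<comment> \<open>Discrete product rule, with W evaluated in the left cell i - 1 in the second
        term.\<close>
      have eq: "gd h N (\<lambda>i. W i * P i) i = gd h N W i * P i + W (i - 1) * ((P i - P (i - 1)) / h)"
        using True i h by (simp add: gd_def field_simps)
      have "\<bar>P i - P (i - 1)\<bar> \<le> p * M powr (p - 1) * \<bar>u x i - u x (i - 1)\<bar>"
        unfolding P_def using u_bounds[OF x i] u_bounds[OF x i'] p by (intro powr_lipschitz[OF m]) auto
      also have "\<bar>u x i - u x (i - 1)\<bar> = h * \<bar>gd h N (u x) i\<bar>" using True i h by (simp add: gd_def abs_divide)
      also have "p * M powr (p - 1) * (h * \<bar>gd h N (u x) i\<bar>) \<le> p * M powr (p - 1) * (h * L)"
        using h p gd_u_bound[OF x i] by (intro mult_left_mono) auto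
      finally have "\<bar>(P i - P (i - 1)) / h\<bar> \<le> LP" using h by (simp add: LP_def abs_divide divide_le_eq mult_ac)
      then have 1: "((P i - P (i - 1)) / h)\<^sup>2 \<le> LP\<^sup>2" by (metis abs_le_square_iff abs_ge_self order_trans)
      have 2: "(P i)\<^sup>2 \<le> A\<^sup>2" using P[OF i] unfolding A_def by (intro power_mono) auto
      have "(gd h N (\<lambda>i. W i * P i) i)\<^sup>2 \<le> 2 * ((gd h N W i)\<^sup>2 * (P i)\<^sup>2) + 2 * ((W (i - 1))\<^sup>2 * ((P i - P (i - 1)) / h)\<^sup>2)"
        unfolding eq power_mult_distrib[symmetric] by (rule power2_sum_le)
      also have "\<dots> \<le> 2 * ((gd h N W i)\<^sup>2 * A\<^sup>2) + 2 * ((4 * B0 \<epsilon>) * LP\<^sup>2)"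
        by (intro add_mono mult_left_mono mult_mono 1 2 W2B i') (use order_trans[OF zero_le_power2 W2B[OF i']] in auto)
      finally show ?thesis by (simp add: algebra_simps)
    next
      case False
      have "0 \<le> B0 \<epsilon>" using W2B[OF i] zero_le_power2[of "W i"] by linarith
      then show ?thesis using False by (simp add: gd_def)
    qed
    have "gs h N (\<lambda>i. 2 * W i * r x i) = gs h N (\<lambda>i. 2 * W i * b x i + 2 * (gl h N (q x) i * (W i * P i)))"
      by (rule gs_cong) (simp add: r_def P_def algebra_simps)
    also have "\<dots> = gs h N (\<lambda>i. 2 * W i * b x i) + gs h N (\<lambda>i. - 2 * (gd h N (q x) i * gd h N (\<lambda>i. W i * P i) i))"
      unfolding gs_add gs_cmult using h by (simp add: gs_gl_by_parts)
    also have "\<dots> \<le> gs h N (\<lambda>i. (2 * (q x i)\<^sup>2 + 2 * (q t' i)\<^sup>2) + 2 * A * ((b x i)\<^sup>2 / (2 * P i)))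
       + gs h N (\<lambda>i. (gd h N (q x) i)\<^sup>2 + (2 * A\<^sup>2 * (gd h N W i)\<^sup>2 + 8 * LP\<^sup>2 * B0 \<epsilon>))"
    proof (intro add_mono gs_mono)
      fix i assume i: "i < N"
      have "(b x i)\<^sup>2 * P i \<le> (b x i)\<^sup>2 * A" using P[OF i] by (intro mult_left_mono) (auto simp: A_def)
      then have "(b x i)\<^sup>2 \<le> 2 * A * ((b x i)\<^sup>2 / (2 * P i))" using P[OF i] by (simp add: field_simps)
      then show "2 * W i * b x i \<le> (2 * (q x i)\<^sup>2 + 2 * (q t' i)\<^sup>2) + 2 * A * ((b x i)\<^sup>2 / (2 * P i))"
        using two_mult_le[of "W i" "b x i"] W2[of i] by linarith
      show "- 2 * (gd h N (q x) i * gd h N (\<lambda>i. W i * P i) i) \<le> (gd h N (q x) i)\<^sup>2 + (2 * A\<^sup>2 * (gd h N W i)\<^sup>2 + 8 * LP\<^sup>2 * B0 \<epsilon>)"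
        using two_mult_le[of "- gd h N (q x) i" "gd h N (\<lambda>i. W i * P i) i"] gdP[OF i] by simp
    qed (use h in simp_all)
    also have "\<dots> = 2 * s x + 2 * s t' + 2 * A * gs h N (\<lambda>i. (b x i)\<^sup>2 / (2 * P i)) + z x
        + 2 * A\<^sup>2 * gs h N (\<lambda>i. (gd h N W i)\<^sup>2) + a * (8 * LP\<^sup>2 * B0 \<epsilon>)"
      unfolding gs_add gs_cmult gs_const[OF hN] s_def z_def by simp
    also have "\<dots> \<le> 2 * S0 + 2 * S0 + 2 * A * (C1 * (1 + Z / \<epsilon>)) + Z / \<epsilon> + 2 * A\<^sup>2 * (4 * (Z / \<epsilon>)) + a * (8 * LP\<^sup>2 * B0 \<epsilon>)"
    proof (intro add_mono mult_left_mono order_refl)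
      have zx: "z x \<le> Z / \<epsilon>" using z_le_div[OF e, of x] xt t by auto
      then show "z x \<le> Z / \<epsilon>" .
      have "gs h N (\<lambda>i. (b x i)\<^sup>2 / (2 * P i)) \<le> C1 * (1 + z x)" unfolding P_def by (rule b_bound[OF x])
      also have "\<dots> \<le> C1 * (1 + Z / \<epsilon>)" using zx C1_nonneg by (intro mult_left_mono) auto
      finally show "gs h N (\<lambda>i. (b x i)\<^sup>2 / (2 * P i)) \<le> C1 * (1 + Z / \<epsilon>)" .
      show "gs h N (\<lambda>i. (gd h N W i)\<^sup>2) \<le> 4 * (Z / \<epsilon>)" unfolding W_def by (rule gdW[OF xt])
    qed (use s_le[OF x] s_le[OF t'0] a in \<open>auto simp: A_def\<close>)
    also have "\<dots> = C4 \<epsilon>" by (simp add: C4_def A_def LP_def)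
    finally show "gs h N (\<lambda>i. 2 * W i * r x i) \<le> C4 \<epsilon>" .
  qed (use t e in auto)
  then show "gs h N (\<lambda>i. (q t i - q t' i)\<^sup>2) \<le> C4 \<epsilon> * (t - t')" by (simp add: gs_const[OF hN])
qed (use t in auto)

end

section \<open>Passage to the limit\<close>

text \<open>Arzela-Ascoli for functions that may be discontinuous: piecewise constant interpolants
  obey a modulus only for large n, hence the quantifier in \<open>equi\<close>. Convergence on a
  countable dense subset is spread by equicontinuity, and uniformity is obtained on each compact
  subset from a finite cover.\<close>

lemma subsequence_locally_uniform:
  fixes F :: "nat \<Rightarrow> 'a::euclidean_space \<Rightarrow> real"
  assumes bdd: "\<And>x. x \<in> S \<Longrightarrow> \<exists>B. \<forall>n. \<bar>F n x\<bar> \<le> B"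
    and equi: "\<And>x e. \<lbrakk>x \<in> S; 0 < e\<rbrakk> \<Longrightarrow> \<exists>d>0. \<forall>\<^sub>F n in sequentially. \<forall>y\<in>S. dist x y < d \<longrightarrow> \<bar>F n x - F n y\<bar> \<le> e"
  obtains g k where "strict_mono (k :: nat \<Rightarrow> nat)" "continuous_on S g"
    "\<And>C. \<lbrakk>compact C; C \<subseteq> S\<rbrakk> \<Longrightarrow> uniform_limit C (\<lambda>n. F (k n)) g sequentially"
proof -
  obtain R where R: "countable R" "R \<subseteq> S" "S \<subseteq> closure R" by (metis separable)
  obtain B where B: "\<And>x n. x \<in> S \<Longrightarrow> \<bar>F n x\<bar> \<le> B x" using bdd by metis
  \<comment> \<open>The bound on F varies with the point; dividing by it gives functions bounded by
    1, to which the diagonal argument applies.\<close>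
  define B' where "B' x = max 1 (B x)" for x
  have B': "B' x > 0" "x \<in> S \<Longrightarrow> \<bar>F n x\<bar> \<le> B' x" for x n using B[of x n] by (auto simp: B'_def)
  obtain k where k: "strict_mono (k::nat \<Rightarrow> nat)" and lim: "\<And>x. x \<in> R \<Longrightarrow> \<exists>l. (\<lambda>n. F (k n) x / B' x) \<longlonglongrightarrow> l"
  proof (rule function_convergent_subsequence[of R "\<lambda>n x. F n x / B' x" 1])
    show "countable R" by fact
    show "norm (F n x / B' x) \<le> 1" if "x \<in> R" for n x
      using B'(1)[of x] B'(2)[of x n] R(2) that by (auto simp: abs_divide divide_le_eq)
  qed (use that in blast)
  have limR: "Cauchy (\<lambda>n. F (k n) x)" if x: "x \<in> R" for x
  proof -
    obtain l where "(\<lambda>n. F (k n) x / B' x) \<longlonglongrightarrow> l" using lim[OF x] by blast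
    then have "(\<lambda>n. F (k n) x / B' x * B' x) \<longlonglongrightarrow> l * B' x" by (intro tendsto_intros)
    then have "(\<lambda>n. F (k n) x) \<longlonglongrightarrow> l * B' x" using B'(1)[of x] by simp
    then show ?thesis using LIMSEQ_imp_Cauchy by blast
  qed
  have equik: "\<exists>d>0. \<forall>\<^sub>F n in sequentially. \<forall>y\<in>S. dist x y < d \<longrightarrow> \<bar>F (k n) x - F (k n) y\<bar> \<le> e"
    if xe: "x \<in> S" "0 < e" for x e
  proof -
    obtain d where d: "d > 0" "\<forall>\<^sub>F n in sequentially. \<forall>y\<in>S. dist x y < d \<longrightarrow> \<bar>F n x - F n y\<bar> \<le> e"
      using equi[OF xe] by blast
    have "filterlim k sequentially sequentially" using k by (rule filterlim_subseq)
    from eventually_compose_filterlim[OF d(2) this] d(1) show ?thesis by blast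
  qed
  have "convergent (\<lambda>n. F (k n) x)" if x: "x \<in> S" for x
  proof (rule Cauchy_convergent, rule metric_CauchyI)
    fix e :: real assume e: "0 < e"
    obtain d where d: "d > 0" "\<forall>\<^sub>F n in sequentially. \<forall>y\<in>S. dist x y < d \<longrightarrow> \<bar>F (k n) x - F (k n) y\<bar> \<le> e / 4"
      using equik[OF x, of "e / 4"] e by auto
    obtain y where y: "y \<in> R" "dist y x < d" using R(3) x d(1) closure_approachable by blast
    obtain N1 where N1: "\<And>n. n \<ge> N1 \<Longrightarrow> \<bar>F (k n) x - F (k n) y\<bar> \<le> e / 4"
      using d(2) y R(2) unfolding eventually_sequentially by (metis dist_commute subsetD)
    obtain N2 where N2: "\<And>m n. m \<ge> N2 \<Longrightarrow> n \<ge> N2 \<Longrightarrow> dist (F (k m) y) (F (k n) y) < e / 4"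
      using metric_CauchyD[OF limR[OF y(1)], of "e / 4"] e by auto
    show "\<exists>M. \<forall>m\<ge>M. \<forall>n\<ge>M. dist (F (k m) x) (F (k n) x) < e"
    proof (intro exI[of _ "max N1 N2"] allI impI)
      fix m n assume "m \<ge> max N1 N2" "n \<ge> max N1 N2"
      then have "\<bar>F (k m) x - F (k m) y\<bar> \<le> e / 4" "\<bar>F (k n) x - F (k n) y\<bar> \<le> e / 4" "\<bar>F (k m) y - F (k n) y\<bar> < e / 4"
        using N1 N2 by (auto simp: dist_real_def)
      then show "dist (F (k m) x) (F (k n) x) < e" using e unfolding dist_real_def by linarith
    qed
  qed
  then obtain g where g: "\<And>x. x \<in> S \<Longrightarrow> (\<lambda>n. F (k n) x) \<longlonglongrightarrow> g x" unfolding convergent_def by metis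
  have geq: "\<exists>d>0. (\<forall>\<^sub>F n in sequentially. \<forall>y\<in>S. dist x y < d \<longrightarrow> \<bar>F (k n) x - F (k n) y\<bar> \<le> e)
      \<and> (\<forall>y\<in>S. dist x y < d \<longrightarrow> \<bar>g x - g y\<bar> \<le> e)" if x: "x \<in> S" and e: "0 < e" for x e
  proof -
    obtain d where d: "d > 0" "\<forall>\<^sub>F n in sequentially. \<forall>y\<in>S. dist x y < d \<longrightarrow> \<bar>F (k n) x - F (k n) y\<bar> \<le> e"
      using equik[OF x e] by blast
    have "\<bar>g x - g y\<bar> \<le> e" if "y \<in> S" "dist x y < d" for y
    proof (rule tendsto_upperbound)
      show "(\<lambda>n. \<bar>F (k n) x - F (k n) y\<bar>) \<longlonglongrightarrow> \<bar>g x - g y\<bar>" by (intro tendsto_intros g x that)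
      show "\<forall>\<^sub>F n in sequentially. \<bar>F (k n) x - F (k n) y\<bar> \<le> e" using d(2) by eventually_elim (use that in auto)
    qed simp
    with d show ?thesis by blast
  qed
  show thesis
  proof
    show "strict_mono k" by fact
    show "continuous_on S g" unfolding continuous_on_iff
    proof (intro ballI allI impI)
      fix x e assume "x \<in> S" "0 < (e::real)"
      then obtain d where "d > 0" and gd: "\<forall>y\<in>S. dist x y < d \<longrightarrow> \<bar>g x - g y\<bar> \<le> e / 2" using geq[of x "e/2"] by auto
      then show "\<exists>d>0. \<forall>x'\<in>S. dist x' x < d \<longrightarrow> dist (g x') (g x) < e"
      proof (intro exI[of _ d] conjI ballI impI)
        show "0 < d" by fact
        fix y assume "y \<in> S" "dist y x < d"
        then have "\<bar>g x - g y\<bar> \<le> e / 2"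
          using gd by (metis dist_commute)
        then show "dist (g y) (g x) < e" unfolding dist_real_def using \<open>0 < e\<close> by linarith
      qed
    qed
    fix C assume C: "compact C" "C \<subseteq> S"
    show "uniform_limit C (\<lambda>n. F (k n)) g sequentially"
    proof (rule uniform_limitI)
      fix e :: real assume e: "0 < e"
      obtain d where d: "\<And>x. x \<in> S \<Longrightarrow> d x > 0"
        "\<And>x. x \<in> S \<Longrightarrow> \<forall>\<^sub>F n in sequentially. \<forall>y\<in>S. dist x y < d x \<longrightarrow> \<bar>F (k n) x - F (k n) y\<bar> \<le> e / 4"
        "\<And>x y. x \<in> S \<Longrightarrow> y \<in> S \<Longrightarrow> dist x y < d x \<Longrightarrow> \<bar>g x - g y\<bar> \<le> e / 4"
      proof -
        have "\<forall>x\<in>S. \<exists>d>0. (\<forall>\<^sub>F n in sequentially. \<forall>y\<in>S. dist x y < d \<longrightarrow> \<bar>F (k n) x - F (k n) y\<bar> \<le> e / 4)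
          \<and> (\<forall>y\<in>S. dist x y < d \<longrightarrow> \<bar>g x - g y\<bar> \<le> e / 4)"
          using geq[of _ "e / 4"] e by simp
        from bchoice[OF this] show thesis using that by blast
      qed
      obtain D where D: "D \<subseteq> C" "finite D" "C \<subseteq> (\<Union>x\<in>D. ball x (d x))"
      proof (rule compactE_image[OF C(1), of C "\<lambda>x. ball x (d x)"])
        show "C \<subseteq> (\<Union>x\<in>C. ball x (d x))" using d(1) C(2) by force
      qed (use that in auto)
      have "\<forall>\<^sub>F n in sequentially. \<forall>x\<in>D. (\<forall>y\<in>S. dist x y < d x \<longrightarrow> \<bar>F (k n) x - F (k n) y\<bar> \<le> e / 4) \<and> \<bar>F (k n) x - g x\<bar> < e / 4"
      proof (intro eventually_ball_finite[OF D(2)] ballI eventually_conj)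
        fix x assume "x \<in> D"
        then have x: "x \<in> S" using D C by auto
        then show "\<forall>\<^sub>F n in sequentially. \<forall>y\<in>S. dist x y < d x \<longrightarrow> \<bar>F (k n) x - F (k n) y\<bar> \<le> e / 4" by (rule d)
        show "\<forall>\<^sub>F n in sequentially. \<bar>F (k n) x - g x\<bar> < e / 4"
          using tendstoD[OF g[OF x], of "e / 4"] e by (simp add: dist_real_def)
      qed
      then show "\<forall>\<^sub>F n in sequentially. \<forall>x\<in>C. dist (F (k n) x) (g x) < e"
      proof eventually_elim
        case (elim n)
        show ?case
        proof
          fix y assume y: "y \<in> C"
          then obtain x where x: "x \<in> D" "dist x y < d x" using D(3) by auto
          have "\<bar>F (k n) x - F (k n) y\<bar> \<le> e / 4" "\<bar>F (k n) x - g x\<bar> < e / 4" "\<bar>g x - g y\<bar> \<le> e / 4"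
            using elim x y C D d(3)[of x y] by auto
          then show "dist (F (k n) y) (g y) < e" unfolding dist_real_def using e by linarith
        qed
      qed
    qed
  qed
qed

text \<open>The index of the cell that contains \<open>x\<close>; the minimum assigns \<open>x = a\<close> to the last cell.\<close>

definition idx :: "real \<Rightarrow> nat \<Rightarrow> real \<Rightarrow> nat" where
  "idx a N x = min (N - 1) (nat \<lfloor>x * real N / a\<rfloor>)"

section \<open>Piecewise constant interpolation of grid functions\<close>

lemma idx_less: "0 < N \<Longrightarrow> idx a N x < N" by (auto simp: idx_def)

lemma idx_bounds:
  assumes a: "a > 0" and N: "0 < N" and x: "x \<in> {0..a}"
  shows "a / real N * real (idx a N x) \<le> x" "x \<le> a / real N * (real (idx a N x) + 1)"
proof -
  define y where "y = x * real N / a"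
  have y: "0 \<le> y" "y \<le> real N" using x a N by (auto simp: y_def divide_le_eq)
  have xy: "x = a / real N * y" using a N by (simp add: y_def)
  have 1: "real (nat \<lfloor>y\<rfloor>) \<le> y" "y < real (nat \<lfloor>y\<rfloor>) + 1" using y by linarith+
  have i: "idx a N x = min (N - 1) (nat \<lfloor>y\<rfloor>)" by (simp add: idx_def y_def)
  have "real (idx a N x) \<le> real (nat \<lfloor>y\<rfloor>)" by (simp add: i)
  then have "real (idx a N x) \<le> y" using 1 by linarith
  moreover have "y \<le> real (idx a N x) + 1"
    using 1 y N unfolding i by (cases "N - 1 \<le> nat \<lfloor>y\<rfloor>") (auto simp: min_def of_nat_diff)
  ultimately have "real (idx a N x) \<le> y" "y \<le> real (idx a N x) + 1" .
  then show "a / real N * real (idx a N x) \<le> x" "x \<le> a / real N * (real (idx a N x) + 1)"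
    using a N mult_left_mono[of "real (idx a N x)" y "a / real N"] mult_left_mono[of y "real (idx a N x) + 1" "a / real N"]
    unfolding xy[symmetric] by simp_all
qed

lemma idx_dist:
  assumes "a > 0" "0 < N" "x \<in> {0..a}" "y \<in> {0..a}"
  shows "a / real N * \<bar>real (idx a N x) - real (idx a N y)\<bar> \<le> \<bar>x - y\<bar> + a / real N"
proof -
  define h where "h = a / real N"
  define i j where "i = h * real (idx a N x)" and "j = h * real (idx a N y)"
  have h: "h > 0" using assms by (simp add: h_def)
  have "i \<le> x" "x \<le> i + h" "j \<le> y" "y \<le> j + h"
    using idx_bounds[OF assms(1,2,3)] idx_bounds[OF assms(1,2,4)] by (auto simp: i_def j_def h_def[symmetric] algebra_simps)
  then have "\<bar>i - j\<bar> \<le> \<bar>x - y\<bar> + h" using h by linarith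
  moreover have "h * \<bar>real (idx a N x) - real (idx a N y)\<bar> = \<bar>i - j\<bar>"
    using h by (simp add: i_def j_def abs_mult flip: right_diff_distrib)
  ultimately show ?thesis by (simp add: h_def)
qed

lemma idx_eq:
  assumes a: "a > 0" and N: "0 < N" and j: "j < N" and x: "a / real N * real j \<le> x" "x < a / real N * (real j + 1)"
  shows "idx a N x = j"
proof -
  have "real j \<le> x * real N / a" "x * real N / a < real j + 1" using x a N by (auto simp: field_simps)
  then have "\<lfloor>x * real N / a\<rfloor> = int j" by (simp add: floor_eq_iff)
  then show ?thesis using j by (simp add: idx_def)
qed

lemma has_integral_idx:
  assumes a: "a > 0" and N: "0 < N" and n: "n \<le> N"
  shows "((\<lambda>x. f (idx a N x)) has_integral (a / real N * (\<Sum>j<n. f j))) {0..a / real N * real n}"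
  using n
proof (induction n)
  case (Suc n)
  define h where "h = a / real N"
  have h: "h > 0" using a N by (simp add: h_def)
  have "((\<lambda>x. f (idx a N x)) has_integral h * f n) {h * real n..h * real (Suc n)}"
  \<comment> \<open>At the right end point of the cell the index may already have jumped, so this
    single point is discarded.\<close>
  proof (rule has_integral_spike_finite[of "{h * real (Suc n)}"])
    show "((\<lambda>x. f n) has_integral h * f n) {h * real n..h * real (Suc n)}"
      using has_integral_const_real[of "f n" "h * real n" "h * real (Suc n)"] h by (simp add: algebra_simps)
    fix x assume "x \<in> {h * real n..h * real (Suc n)} - {h * real (Suc n)}"
    then have "idx a N x = n" using Suc.prems by (intro idx_eq[OF a N]) (auto simp: h_def algebra_simps)
    then show "f (idx a N x) = f n" by simp
  qed simp
  with Suc have "((\<lambda>x. f (idx a N x)) has_integral (h * (\<Sum>j<n. f j) + h * f n)) {0..h * real (Suc n)}"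
    using h by (intro has_integral_combine[of 0 "h * real n" "h * real (Suc n)"]) (auto simp: h_def[symmetric])
  then show ?case by (simp add: h_def algebra_simps)
next
  case 0
  have "((\<lambda>x. f (idx a N x)) has_integral 0) {0..0}" by (rule has_integral_null_real) simp
  then show ?case by simp
qed

lemma integral_idx:
  assumes "a > 0" "0 < N"
  shows "((\<lambda>x. f (idx a N x)) has_integral gs (a / real N) N f) {0..a}"
    and "((\<lambda>x. f (idx a N x)) has_integral (a * gm N f)) {0..a}"
  using has_integral_idx[OF assms order_refl, of f] assms by (simp_all add: gs_def gm_def)

text \<open>A discrete Laplacian is summed once to the flux and again to the function; both sums are
  integrals of step functions, so pointwise limits and a common bound suffice. The vanishing flux on
  the last face becomes the first conclusion, the Neumann condition at a.\<close>

lemma grid_double_integral_limit: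
  fixes f :: "nat \<Rightarrow> nat \<Rightarrow> real" and N :: "nat \<Rightarrow> nat"
  assumes a: "a > 0" and N: "filterlim N at_top sequentially" "\<And>n. 0 < N n"
    and fu: "\<And>x. x \<in> {0..a} \<Longrightarrow> (\<lambda>n. f n (idx a (N n) x)) \<longlonglongrightarrow> u x"
    and fg: "\<And>x. x \<in> {0..a} \<Longrightarrow> (\<lambda>n. gl (a / N n) (N n) (f n) (idx a (N n) x)) \<longlonglongrightarrow> g x"
    and B: "\<And>n i. i < N n \<Longrightarrow> \<bar>gl (a / N n) (N n) (f n) i\<bar> \<le> B" and g: "continuous_on {0..a} g"
  shows "integral {0..a} g = 0"
    and "x \<in> {0..a} \<Longrightarrow> u x = u 0 + integral {0..x} (\<lambda>s. integral {0..s} g)"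
proof -
  define h where "h n = a / real (N n)" for n
  have h: "h n > 0" for n using a N(2) by (simp add: h_def)
  have hlim: "h \<longlonglongrightarrow> 0" unfolding h_def
    by (rule tendsto_divide_0[OF tendsto_const]) (use N(1) filterlim_real_sequentially in \<open>auto intro: filterlim_at_top_imp_at_infinity filterlim_compose\<close>)
  define F where "F n x = gl (h n) (N n) (f n) (idx a (N n) x)" for n x
  have F_int: "F n integrable_on {0..h n * real m}" "integral {0..h n * real m} (F n) = gd (h n) (N n) (f n) m" if "m \<le> N n" for n m
    using has_integral_idx[OF a N(2) that, of "gl (h n) (N n) (f n)"] h[of n]
    by (auto simp: F_def[abs_def] h_def[symmetric] gd_eq_sum_gl has_integral_iff)
  have hN: "h n * real (N n) = a" for n using N(2)[of n] by (simp add: h_def)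
  have Fa: "F n integrable_on {0..a}" for n using F_int(1)[of "N n" n] hN by simp
  have FB: "\<bar>F n x\<bar> \<le> B" for n x unfolding F_def h_def by (rule B) (rule idx_less[OF N(2)])
  have B0: "0 \<le> B" using FB[of 0 0] by linarith
  have Flim: "(\<lambda>n. integral {0..x} (F n)) \<longlonglongrightarrow> integral {0..x} g" if "x \<in> {0..a}" for x
  proof (rule dominated_convergence(2)[where h="\<lambda>_. B"])
    show "F n integrable_on {0..x}" for n by (rule integrable_on_subinterval[OF Fa]) (use that in auto)
    show "(\<lambda>n. F n y) \<longlonglongrightarrow> g y" if "y \<in> {0..x}" for y
      using fg[of y] that \<open>x \<in> {0..a}\<close> by (auto simp: F_def h_def)
  qed (use FB in auto)
  have "integral {0..a} (F n) = 0" for n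
    using F_int(2)[of "N n" n] by (simp add: hN gd_def)
  then show "integral {0..a} g = 0" using Flim[of a] a by (simp add: LIMSEQ_const_iff)
  \<comment> \<open>Flux on the right face of the cell: it is the integral of F over all cells up to
    and including the one of x, and so differs from the integral up to x by at most one
    cell.\<close>
  define V where "V n x = gd (h n) (N n) (f n) (Suc (idx a (N n) x))" for n x
  have V_int: "((V n) has_integral (h n * (\<Sum>j<m. gd (h n) (N n) (f n) (Suc j)))) {0..h n * real m}" if "m \<le> N n" for n m
    using has_integral_idx[OF a N(2) that, of "\<lambda>i. gd (h n) (N n) (f n) (Suc i)"] unfolding V_def h_def .
  have Va: "V n integrable_on {0..a}" for n using V_int[of "N n" n] hN by auto
  have V_eq: "V n x = integral {0..h n * real (Suc (idx a (N n) x))} (F n)" for n x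
    using F_int(2)[of "Suc (idx a (N n) x)" n] idx_less[OF N(2)[of n], of a x] by (simp add: V_def Suc_leI)
  have hidx: "h n * real (idx a (N n) x) \<le> x" "x \<le> h n * real (Suc (idx a (N n) x))" "h n * real (Suc (idx a (N n) x)) \<le> a" if "x \<in> {0..a}" for n x
  proof -
    show "h n * real (idx a (N n) x) \<le> x" "x \<le> h n * real (Suc (idx a (N n) x))"
      using idx_bounds[OF a N(2) that] by (auto simp: h_def add.commute)
    have "h n * real (Suc (idx a (N n) x)) \<le> h n * real (N n)"
      using idx_less[OF N(2)[of n], of a x] h[of n] by (intro mult_left_mono) (auto simp del: of_nat_Suc)
    then show "h n * real (Suc (idx a (N n) x)) \<le> a" by (simp add: hN)
  qed
  have int_diff: "\<bar>integral {0..y} G - integral {0..x} G\<bar> \<le> D * (y - x)"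
    if "0 \<le> x" "x \<le> y" "y \<le> a" "G integrable_on {0..a}" "\<And>s. \<bar>G s\<bar> \<le> D" for x y D and G :: "real \<Rightarrow> real"
  proof -
    have i: "G integrable_on {0..y}" by (rule integrable_on_subinterval[OF that(4)]) (use that in auto)
    have i2: "G integrable_on {x..y}" by (rule integrable_on_subinterval[OF that(4)]) (use that in auto)
    have "integral {0..x} G + integral {x..y} G = integral {0..y} G"
      by (rule Henstock_Kurzweil_Integration.integral_combine) (use that i in auto)
    moreover have "norm (integral {x..y} G) \<le> integral {x..y} (\<lambda>_. D)"
      by (rule integral_norm_bound_integral[OF i2]) (use that in auto)
    ultimately show ?thesis using that by (simp add: algebra_simps)
  qed
  have VB: "\<bar>V n x\<bar> \<le> B * a" for n x
  proof -
    have "h n * real (Suc (idx a (N n) x)) \<le> h n * real (N n)"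
      using idx_less[OF N(2)[of n], of a x] h[of n] by (intro mult_left_mono) (auto simp del: of_nat_Suc)
    then have "h n * real (Suc (idx a (N n) x)) \<le> a" by (simp add: hN)
    moreover have "0 \<le> h n * real (Suc (idx a (N n) x))" using h[of n] by (intro mult_nonneg_nonneg) auto
    ultimately have "\<bar>V n x\<bar> \<le> B * (h n * real (Suc (idx a (N n) x)))"
      using int_diff[of 0 "h n * real (Suc (idx a (N n) x))" "F n" B] FB Fa by (simp add: V_eq del: of_nat_Suc)
    also have "\<dots> \<le> B * a" using B0 \<open>_ \<le> a\<close> by (intro mult_left_mono)
    finally show ?thesis .
  qed
  have Vlim: "(\<lambda>n. V n x) \<longlonglongrightarrow> integral {0..x} g" if x: "x \<in> {0..a}" for x
  proof -
    have "(\<lambda>n. V n x - integral {0..x} (F n)) \<longlonglongrightarrow> 0"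
    proof (rule Lim_null_comparison[of _ "\<lambda>n. B * h n"])
      show "\<forall>\<^sub>F n in sequentially. norm (V n x - integral {0..x} (F n)) \<le> B * h n"
      proof (rule always_eventually, rule allI)
        fix n
        have "\<bar>V n x - integral {0..x} (F n)\<bar> \<le> B * (h n * real (Suc (idx a (N n) x)) - x)"
          unfolding V_eq by (rule int_diff) (use hidx[OF x, of n] x Fa FB in auto)
        also have "\<dots> \<le> B * h n" using hidx(1)[OF x, of n] B0 by (intro mult_left_mono) (auto simp: algebra_simps)
        finally show "norm (V n x - integral {0..x} (F n)) \<le> B * h n" by simp
      qed
      show "(\<lambda>n. B * h n) \<longlonglongrightarrow> 0" using tendsto_mult_right_zero[OF hlim] by simp
    qed
    from tendsto_add[OF this Flim[OF x]] show ?thesis by simp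
  qed
  assume x: "x \<in> {0..a}"
  have Vl: "(\<lambda>n. integral {0..x} (V n)) \<longlonglongrightarrow> integral {0..x} (\<lambda>s. integral {0..s} g)"
  proof (rule dominated_convergence(2)[where h="\<lambda>_. B * a"])
    show "V n integrable_on {0..x}" for n by (rule integrable_on_subinterval[OF Va]) (use x in auto)
    show "(\<lambda>n. V n y) \<longlonglongrightarrow> integral {0..y} g" if "y \<in> {0..x}" for y
      using Vlim[of y] that x by auto
  qed (use VB in auto)
  have "(\<lambda>n. (f n (idx a (N n) x) - f n (idx a (N n) 0)) - integral {0..x} (V n)) \<longlonglongrightarrow> 0"
  proof (rule Lim_null_comparison[of _ "\<lambda>n. B * a * h n"])
    show "\<forall>\<^sub>F n in sequentially. norm ((f n (idx a (N n) x) - f n (idx a (N n) 0)) - integral {0..x} (V n)) \<le> B * a * h n"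
    proof (rule always_eventually, rule allI)
      fix n
      define i where "i = idx a (N n) x"
      have i: "i < N n" unfolding i_def by (rule idx_less[OF N(2)])
      have i0: "idx a (N n) 0 = 0" by (simp add: idx_def)
      have "f n i - f n 0 = (\<Sum>j<i. f n (Suc j) - f n j)" by (rule sum_lessThan_telescope[symmetric])
      also have "\<dots> = (\<Sum>j<i. h n * gd (h n) (N n) (f n) (Suc j))"
        using i h[of n] by (intro sum.cong) (auto simp: gd_def)
      also have "\<dots> = integral {0..h n * real i} (V n)"
        using V_int[of i n] i by (simp add: has_integral_iff sum_distrib_left)
      finally have "\<bar>(f n i - f n 0) - integral {0..x} (V n)\<bar> = \<bar>integral {0..x} (V n) - integral {0..h n * real i} (V n)\<bar>" by simp
      also have "\<dots> \<le> B * a * (x - h n * real i)"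
        by (rule int_diff) (use hidx[OF x, of n] x Va VB h[of n] in \<open>auto simp: i_def\<close>)
      also have "\<dots> \<le> B * a * h n" using hidx(2)[OF x, of n] B0 a by (intro mult_left_mono) (auto simp: algebra_simps i_def)
      finally show "norm ((f n (idx a (N n) x) - f n (idx a (N n) 0)) - integral {0..x} (V n)) \<le> B * a * h n" by (simp add: i_def i0)
    qed
    show "(\<lambda>n. B * a * h n) \<longlonglongrightarrow> 0" using tendsto_mult_right_zero[OF hlim] by simp
  qed
  from tendsto_add[OF this Vl] have "(\<lambda>n. f n (idx a (N n) x) - f n (idx a (N n) 0)) \<longlonglongrightarrow> integral {0..x} (\<lambda>s. integral {0..s} g)"
    by simp
  moreover have "(\<lambda>n. f n (idx a (N n) x) - f n (idx a (N n) 0)) \<longlonglongrightarrow> u x - u 0"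
    by (intro tendsto_intros fu) (use x a in auto)
  ultimately have "u x - u 0 = integral {0..x} (\<lambda>s. integral {0..s} g)" by (rule LIMSEQ_unique[rotated])
  then show "u x = u 0 + integral {0..x} (\<lambda>s. integral {0..s} g)" by simp
qed

text \<open>For a slack \<eta> > 0 the function u - (k + \<eta>) t cannot attain its maximum over
  times and cells at a positive time, since its derivative there would be at most - \<eta>. The rate
  k is required only at cells where u is maximal, where the Laplacian has a sign.\<close>

lemma grid_max_principle:
  fixes u q :: "real \<Rightarrow> nat \<Rightarrow> real"
  assumes deriv: "\<And>t i. \<lbrakk>t \<in> {0..T}; i < N\<rbrakk> \<Longrightarrow> ((\<lambda>t. u t i) has_real_derivative q t i) (at t within {0..T})"
    and max: "\<And>t i. \<lbrakk>t \<in> {0..T}; i < N; \<And>j. j < N \<Longrightarrow> u t j \<le> u t i\<rbrakk> \<Longrightarrow> q t i \<le> k"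
    and init: "\<And>i. i < N \<Longrightarrow> u 0 i \<le> c"
    and t: "t \<in> {0..T}" and i: "i < N"
  shows "u t i \<le> c + k * t"
proof (rule field_le_epsilon)
  fix e :: real assume e: "0 < e"
  \<comment> \<open>The slack costs at most e on {0..T}; the 1 avoids a zero denominator.\<close>
  define \<eta> where "\<eta> = e / (T + 1)"
  have T: "0 \<le> T" using t by simp
  have \<eta>: "\<eta> > 0" "\<eta> * t \<le> e"
  proof -
    show "\<eta> > 0" using e T by (simp add: \<eta>_def)
    then have "\<eta> * t \<le> \<eta> * (T + 1)" using t by (intro mult_left_mono) auto
    then show "\<eta> * t \<le> e" using T by (simp add: \<eta>_def)
  qed
  define v where "v t i = u t i - (k + \<eta>) * t" for t i
  have vd: "((\<lambda>t. v t i) has_real_derivative q t i - (k + \<eta>)) (at t within {0..T})" if "t \<in> {0..T}" "i < N" for t i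
    unfolding v_def by (auto intro!: derivative_eq_intros deriv that)
  have "\<exists>s\<in>{0..T}. \<forall>t\<in>{0..T}. v t i \<le> v s i" if "i < N" for i
  proof (rule continuous_attains_sup)
    show "continuous_on {0..T} (\<lambda>t. v t i)"
      by (rule DERIV_continuous_on[OF vd]) (use that in auto)
  qed (use T in auto)
  then obtain s where s: "\<And>i. i < N \<Longrightarrow> s i \<in> {0..T}" "\<And>i t. i < N \<Longrightarrow> t \<in> {0..T} \<Longrightarrow> v t i \<le> v (s i) i" by metis
  obtain l where l: "l < N" "\<And>j. j < N \<Longrightarrow> v (s j) j \<le> v (s l) l"
  proof -
    define A where "A = (\<lambda>j. v (s j) j) ` {..<N}"
    have A: "finite A" "A \<noteq> {}" using i by (auto simp: A_def)
    obtain l where "l < N" "v (s l) l = Max A" using Max_in[OF A] by (auto simp: A_def)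
    moreover have "v (s j) j \<le> Max A" if "j < N" for j using A(1) that by (intro Max_ge) (auto simp: A_def)
    ultimately show ?thesis using that by auto
  qed
  have top: "v t j \<le> v (s l) l" if "t \<in> {0..T}" "j < N" for t j
    using s(2)[of j t] l(2)[of j] that by auto
  have "s l = 0"
  proof (rule ccontr)
    assume "s l \<noteq> 0"
    then have sl: "0 < s l" "s l \<in> {0..T}" using s(1)[OF l(1)] by auto
    have "q (s l) l \<le> k"
      by (rule max[OF sl(2) l(1)]) (use top[OF sl(2)] in \<open>simp add: v_def\<close>)
    then have "q (s l) l - (k + \<eta>) < 0" using \<eta> by simp
    from has_real_derivative_neg_dec_left[OF vd[OF sl(2) l(1)] this]
    obtain d where d: "d > 0" "\<And>h. h > 0 \<Longrightarrow> s l - h \<in> {0..T} \<Longrightarrow> h < d \<Longrightarrow> v (s l) l < v (s l - h) l" by blast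
    define h where "h = min (d / 2) (s l)"
    have "h > 0" "h < d" "s l - h \<in> {0..T}" using d(1) sl by (auto simp: h_def min_def)
    then show False using d(2)[of h] top[of "s l - h" l] l(1) by auto
  qed
  then have "v t i \<le> u 0 l" using top[OF t i] by (simp add: v_def)
  also have "\<dots> \<le> c" by (rule init[OF l(1)])
  finally show "u t i \<le> c + k * t + e" using \<eta> by (simp add: v_def algebra_simps)
qed

lemma gl_at_max:
  assumes "h > 0" "i < N" "\<And>j. j < N \<Longrightarrow> v j \<le> v i"
  shows "gl h N v i \<le> 0"
proof -
  have "gd h N v (Suc i) \<le> 0" "0 \<le> gd h N v i"
    using assms by (auto simp: gd_def divide_le_0_iff zero_le_divide_iff)
  then show ?thesis using assms(1) by (simp add: gl_def divide_le_0_iff)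
qed

lemma gl_uminus: "gl h N (\<lambda>j. - v j) i = - gl h N v i"
  using gl_diff[of h N "\<lambda>_. 0" v i] by (simp add: gl_def gd_def)

lemma gl_at_min:
  assumes "h > 0" "i < N" "\<And>j. j < N \<Longrightarrow> v i \<le> v j"
  shows "0 \<le> gl h N v i"
  using gl_at_max[of h i N "\<lambda>j. - v j"] assms by (simp add: gl_uminus)

lemma gl_cong: "(\<And>j. j < N \<Longrightarrow> v j = w j) \<Longrightarrow> gl h N v i = gl h N w i"
  by (simp add: gl_def gd_def)

lemma gm_cong: "(\<And>j. j < N \<Longrightarrow> v j = w j) \<Longrightarrow> gm N v = gm N w"
  by (simp add: gm_def)

lemma gm_between:
  assumes "0 < N" "\<And>j. j < N \<Longrightarrow> A \<le> v j \<and> v j \<le> B"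
  shows "A \<le> gm N v" "gm N v \<le> B"
proof -
  have "(\<Sum>i<N. A) \<le> (\<Sum>i<N. v i)" by (rule sum_mono) (use assms in auto)
  moreover have "(\<Sum>i<N. v i) \<le> (\<Sum>i<N. B)" by (rule sum_mono) (use assms in auto)
  ultimately show "A \<le> gm N v" "gm N v \<le> B" using assms(1) by (auto simp: gm_def field_simps)
qed

text \<open>At a maximal cell the Laplacian is nonpositive and u minus its mean is at most M, so the
  maximum rises, and likewise the minimum falls, at a rate of at most M powr p * M. The bound on T
  then keeps the values between c - c / 2 and C + c / 2 \<le> 2 C, where the truncation is the
  identity.\<close>

lemma grid_flow_exists:
  fixes p a c C G T Y :: real
  defines "m \<equiv> c / 2" and "M \<equiv> 2 * C"
  assumes p: "1 < p" and a: "0 < a" and c: "0 < c" and cC: "c \<le> C" and G: "0 \<le> G" and N: "0 < N"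
    and T: "0 < T" "2 * (M powr p * M) * T \<le> c"
    and Ydef: "Y = 2 * (1 + M powr p * (2 * G + 2 * (a * M\<^sup>2)))"
    and Y: "grid_flow.K p a m M * T * Y \<le> 1"
    and v0: "\<And>i. i < N \<Longrightarrow> c \<le> v0 i \<and> v0 i \<le> C"
    and G: "gs (a / real N) N (\<lambda>i. (gl (a / real N) N v0 i)\<^sup>2) \<le> G"
  obtains u q where "grid_flow_bounded p a m M T (a / real N) N u q Y" "\<And>i. i < N \<Longrightarrow> u 0 i = v0 i"
proof -
  define h where "h = a / real N"
  have h: "h > 0" "h * real N = a" using a N by (auto simp: h_def)
  have m: "0 < m" and mM: "m \<le> M" and M: "0 < M" using c cC by (auto simp: m_def M_def)
  define clip where "clip = (\<lambda>x::real. max m (min M x))"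
  have clip: "m \<le> clip x" "clip x \<le> M" "0 < clip x" for x using m mM by (auto simp: clip_def)
  have clip_mono: "x \<le> y \<Longrightarrow> clip x \<le> clip y" for x y by (auto simp: clip_def)
  obtain u where u0: "\<And>i. i < N \<Longrightarrow> u 0 i = v0 i"
    and ud: "\<And>t i. \<lbrakk>t \<in> {0..T}; i < N\<rbrakk> \<Longrightarrow>
      ((\<lambda>t. u t i) has_real_derivative clip (u t i) powr p *
        (gl h N (\<lambda>j. clip (u t j)) i + clip (u t i) - gm N (\<lambda>j. clip (u t j)))) (at t within {0..T})"
  proof -
    obtain v :: "real \<Rightarrow> nat \<Rightarrow> real" where v: "\<And>i. i < N \<Longrightarrow> v 0 i = v0 i"
      "\<And>t i. \<lbrakk>t \<in> {0..T}; i < N\<rbrakk> \<Longrightarrow>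
      ((\<lambda>t. v t i) has_real_derivative max m (min M (v t i)) powr p *
        (gl h N (\<lambda>j. max m (min M (v t j))) i + max m (min M (v t i)) - gm N (\<lambda>j. max m (min M (v t j))))) (at t within {0..T})"
      by (rule grid_ode[of m M p h T N v0, OF m mM less_imp_le[OF p] h(1) less_imp_le[OF T(1)]]) (rule that)
    show thesis
    proof (rule that)
      show "v 0 i = v0 i" if "i < N" for i by (rule v(1)[OF that])
    qed (unfold clip_def, rule v(2))
  qed
  define q where "q t i = clip (u t i) powr p *
        (gl h N (\<lambda>j. clip (u t j)) i + clip (u t i) - gm N (\<lambda>j. clip (u t j)))" for t i
  have ud: "((\<lambda>t. u t i) has_real_derivative q t i) (at t within {0..T})" if "t \<in> {0..T}" "i < N" for t i
    unfolding q_def by (rule ud[OF that])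
  define k where "k = M powr p * M"
  have k: "0 < k" using M by (simp add: k_def)
  have bnd: "r powr p * x \<le> k" if "x \<le> M" "0 < r" "r \<le> M" for x r
  proof -
    have "r powr p * x \<le> r powr p * M" using that by (intro mult_left_mono) auto
    also have "\<dots> \<le> k" unfolding k_def using that p M by (intro mult_right_mono powr_mono2) auto
    finally show ?thesis .
  qed
  have gmc: "0 \<le> gm N (\<lambda>j. clip (u t j))" "gm N (\<lambda>j. clip (u t j)) \<le> M" for t
    using gm_between[OF N, of m "\<lambda>j. clip (u t j)" M] clip m by auto
  have up: "u t i \<le> C + k * t" if "t \<in> {0..T}" "i < N" for t i
  proof (rule grid_max_principle[OF ud _ _ that])
    fix t i assume i: "i < N" and mx: "\<And>j. j < N \<Longrightarrow> u t j \<le> u t i"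
    have "gl h N (\<lambda>j. clip (u t j)) i \<le> 0" by (rule gl_at_max[OF h(1) i]) (use mx clip_mono in auto)
    then show "q t i \<le> k" unfolding q_def using gmc[of t] clip[of "u t i"] by (intro bnd) auto
  qed (use u0 v0 in auto)
  have lo: "- u t i \<le> - c + k * t" if "t \<in> {0..T}" "i < N" for t i
  proof (rule grid_max_principle[where u="\<lambda>t i. - u t i" and q="\<lambda>t i. - q t i" and T=T and N=N])
    show "((\<lambda>t. - u t i) has_real_derivative - q t i) (at t within {0..T})" if "t \<in> {0..T}" "i < N" for t i
      by (auto intro!: derivative_eq_intros ud that)
    fix t i assume i: "i < N" and mx: "\<And>j. j < N \<Longrightarrow> - u t j \<le> - u t i"
    have "0 \<le> gl h N (\<lambda>j. clip (u t j)) i" by (rule gl_at_min[OF h(1) i]) (use mx clip_mono in auto)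
    then have "clip (u t i) powr p * - (gl h N (\<lambda>j. clip (u t j)) i + clip (u t i) - gm N (\<lambda>j. clip (u t j))) \<le> k"
      using gmc[of t] clip[of "u t i"] by (intro bnd) auto
    then show "- q t i \<le> k" unfolding q_def mult_minus_right .
  qed (use u0 v0 that in auto)
  have kT: "k * t \<le> c / 2" if "t \<in> {0..T}" for t
  proof -
    have "k * t \<le> k * T" using k that by (intro mult_left_mono) auto
    then show ?thesis using T(2) by (simp add: k_def)
  qed
  have ub: "m \<le> u t i \<and> u t i \<le> M" if "t \<in> {0..T}" "i < N" for t i
    using up[OF that] lo[OF that] kT[OF that(1)] c cC by (simp add: m_def M_def)
  have clip_id: "clip (u t i) = u t i" if "t \<in> {0..T}" "i < N" for t i using ub[OF that] by (simp add: clip_def)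
  have qe: "q t i = u t i powr p * (gl h N (u t) i + u t i - gm N (u t))" if "t \<in> {0..T}" "i < N" for t i
    unfolding q_def using clip_id that by (simp cong: gl_cong gm_cong)
  interpret grid_flow p a m M T h N u q
    by unfold_locales (use p a m N T ud ub qe in \<open>auto simp: h_def\<close>)
  \<comment> \<open>Origin of Y: at time 0 the density w equals u powr p times the square of
    Laplacian plus u minus mean, so the initial dissipation is bounded by the data through
    G.\<close>
  have "y 0 \<le> gs h N (\<lambda>i. M powr p * (2 * (gl h N v0 i)\<^sup>2 + 2 * M\<^sup>2))"
    unfolding y_def
  proof (rule gs_mono)
    fix i assume i: "i < N"
    have 0: "0 \<in> {0..T}" using T by simp
    define l d P where "l = gl h N v0 i" and "d = u 0 i - gm N (u 0)" and "P = u 0 i powr p"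
    have P: "0 < P" "P \<le> M powr p" using u_pos[OF 0 i] powr_bounds[OF 0 i] by (auto simp: P_def)
    have l: "gl h N (u 0) i = l" unfolding l_def by (rule gl_cong) (rule u0)
    have qi: "q 0 i = P * (l + d)" unfolding qe[OF 0 i] l by (simp add: P_def d_def)
    have "P * w 0 i = (q 0 i)\<^sup>2" using q2_w[OF 0 i] by (simp add: P_def)
    also have "\<dots> = P * (P * (l + d)\<^sup>2)" unfolding qi by (simp add: power2_eq_square)
    finally have "P * w 0 i = P * (P * (l + d)\<^sup>2)" .
    then have "w 0 i = P * (l + d)\<^sup>2" using P(1) by (metis mult_left_cancel order_less_irrefl)
    also have "\<dots> \<le> M powr p * (2 * l\<^sup>2 + 2 * d\<^sup>2)"
      using P by (intro mult_mono power2_sum_le) auto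
    also have "\<dots> \<le> M powr p * (2 * l\<^sup>2 + 2 * M\<^sup>2)"
    proof -
      have "\<bar>d\<bar> \<le> M" unfolding d_def
        using gm_between[OF N, of m "u 0" M] ub[OF 0] ub[OF 0 i] m by (simp add: abs_le_iff)
      then have "d\<^sup>2 \<le> M\<^sup>2" using abs_le_square_iff[of d M] M by simp
      then show ?thesis by (intro mult_left_mono) auto
    qed
    finally show "w 0 i \<le> M powr p * (2 * (gl h N v0 i)\<^sup>2 + 2 * M\<^sup>2)" by (simp add: l_def)
  qed (use h in auto)
  also have "\<dots> = M powr p * (2 * gs h N (\<lambda>i. (gl h N v0 i)\<^sup>2) + a * (2 * M\<^sup>2))"
    unfolding gs_cmult gs_add gs_const[OF hN] by simp
  also have "\<dots> \<le> M powr p * (2 * G + 2 * (a * M\<^sup>2))"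
    using G by (intro mult_left_mono) (auto simp: h_def)
  finally have "2 * (1 + y 0) \<le> Y" unfolding Ydef by simp
  then have "grid_flow_bounded p a m M T h N u q Y"
    by unfold_locales (use Y in auto)
  then show thesis unfolding h_def by (rule that) (rule u0)
qed

lemma real_le_rsqrt_abs: "x\<^sup>2 \<le> y \<Longrightarrow> \<bar>x\<bar> \<le> sqrt y"
  by (rule real_le_rsqrt) simp

text \<open>The cells of x and y are at most |x - y| plus one mesh width apart, so moduli for grid
  functions carry over once the mesh is finer than d. This is why the modulus holds only eventually
  in n.\<close>

lemma piecewise_constant_equicontinuous:
  fixes f :: "nat \<Rightarrow> real \<Rightarrow> nat \<Rightarrow> real" and N :: "nat \<Rightarrow> nat"
  assumes a: "0 < a" and N: "filterlim N at_top sequentially" "\<And>n. 0 < N n" and A: "0 \<le> A1" "0 \<le> A2" "0 \<le> A3"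
    and sp: "\<And>n t i j. \<lbrakk>t \<in> I; i < N n; j < N n\<rbrakk> \<Longrightarrow> (f n t i - f n t j)\<^sup>2 \<le> a / N n * \<bar>real i - real j\<bar> * A1"
    and tm: "\<And>n t s i. \<lbrakk>s \<in> I; t \<in> I; s \<le> t; i < N n\<rbrakk> \<Longrightarrow> (f n t i - f n s i)\<^sup>2 \<le> A2 * (t - s) + A3 * sqrt (t - s)"
    and e: "0 < e"
  shows "\<exists>d>0. \<forall>\<^sub>F n in sequentially. \<forall>t\<in>I. \<forall>s\<in>I. \<forall>x\<in>{0..a}. \<forall>y\<in>{0..a}. \<bar>t - s\<bar> < d \<longrightarrow> \<bar>x - y\<bar> < d \<longrightarrow>
     \<bar>f n t (idx a (N n) x) - f n s (idx a (N n) y)\<bar> \<le> e"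
proof -
  \<comment> \<open>Total modulus at distance d; in d + d the second d pays for the mesh
    width.\<close>
  define \<psi> where "\<psi> d = sqrt ((d + d) * A1) + sqrt (A2 * d + A3 * sqrt d)" for d
  have "isCont \<psi> 0" unfolding \<psi>_def by (intro continuous_intros)
  then have "\<psi> \<midarrow>0\<rightarrow> \<psi> 0" by (simp add: isCont_def)
  then have "\<forall>\<^sub>F d in at 0. dist (\<psi> d) (\<psi> 0) < e" using e tendstoD by blast
  then obtain b where b: "b > 0" "\<And>d. d \<noteq> 0 \<Longrightarrow> \<bar>d\<bar> < b \<Longrightarrow> \<bar>\<psi> d\<bar> < e"
    by (auto simp: eventually_at dist_real_def \<psi>_def)
  define d where "d = b / 2"
  have d: "d > 0" "\<psi> d \<le> e" using b(1) b(2)[of d] by (auto simp: d_def)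
  have "(\<lambda>n. a / real (N n)) \<longlonglongrightarrow> 0"
    by (rule tendsto_divide_0[OF tendsto_const]) (use N(1) filterlim_real_sequentially in \<open>auto intro: filterlim_at_top_imp_at_infinity filterlim_compose\<close>)
  then have "\<forall>\<^sub>F n in sequentially. a / real (N n) < d" using d(1) by (rule order_tendstoD)
  then have "\<forall>\<^sub>F n in sequentially. \<forall>t\<in>I. \<forall>s\<in>I. \<forall>x\<in>{0..a}. \<forall>y\<in>{0..a}. \<bar>t - s\<bar> < d \<longrightarrow> \<bar>x - y\<bar> < d \<longrightarrow>
     \<bar>f n t (idx a (N n) x) - f n s (idx a (N n) y)\<bar> \<le> e"
  proof eventually_elim
    case (elim n)
    show ?case
    proof (intro ballI impI)
      fix t s x y assume ts: "t \<in> I" "s \<in> I" and xy: "x \<in> {0..a}" "y \<in> {0..a}" and dd: "\<bar>t - s\<bar> < d" "\<bar>x - y\<bar> < d"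
      let ?i = "idx a (N n) x" and ?j = "idx a (N n) y"
      have ij: "?i < N n" "?j < N n" using idx_less[OF N(2)] by auto
      have "(f n t ?i - f n t ?j)\<^sup>2 \<le> a / N n * \<bar>real ?i - real ?j\<bar> * A1" by (rule sp[OF ts(1) ij])
      also have "\<dots> \<le> (d + d) * A1"
        using idx_dist[OF a N(2)[of n] xy] dd elim A by (intro mult_right_mono) auto
      finally have 1: "\<bar>f n t ?i - f n t ?j\<bar> \<le> sqrt ((d + d) * A1)" by (rule real_le_rsqrt_abs)
      have *: "(f n t ?j - f n s ?j)\<^sup>2 \<le> A2 * \<bar>t - s\<bar> + A3 * sqrt \<bar>t - s\<bar>"
        using tm[of s t ?j n] tm[of t s ?j n] ts ij(2) by (cases "s \<le> t") (auto simp: power2_commute)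
      also have "\<dots> \<le> A2 * d + A3 * sqrt d" using dd A by (intro add_mono mult_left_mono) auto
      finally have 2: "\<bar>f n t ?j - f n s ?j\<bar> \<le> sqrt (A2 * d + A3 * sqrt d)" by (rule real_le_rsqrt_abs)
      show "\<bar>f n t ?i - f n s ?j\<bar> \<le> e" using 1 2 d(2) unfolding \<psi>_def by linarith
    qed
  qed
  then show ?thesis using d(1) by blast
qed

section \<open>Parameter integrals and sampled initial data\<close>

lemma mean_eq_integral:
  assumes "continuous_on {0..a} f"
  shows "mean a f = integral {0..a} f / a"
proof -
  have "set_integrable lebesgue {0..a} f"
    using borel_integrable_atLeastAtMost'[OF assms]
    unfolding set_integrable_def by (simp add: integrable_completion)
  from set_lebesgue_integral_eq_integral(2)[OF this] show ?thesis by (simp add: mean_def)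
qed

text \<open>Rescaling the variable of integration by x moves the upper limit into the integrand, so
  that continuity of parameter integrals over the fixed interval [0, 1] applies.\<close>

lemma continuous_on_integral_upper:
  fixes g :: "real \<Rightarrow> real \<Rightarrow> real"
  assumes g: "continuous_on (S \<times> {0..a}) (\<lambda>(t, x). g t x)"
  shows "continuous_on (S \<times> {0..a}) (\<lambda>(t, x). integral {0..x} (g t))"
proof -
  have eq: "integral {0..x} (g t) = integral (cbox 0 1) (\<lambda>s. x * g t (x * s))" if "t \<in> S" "x \<in> {0..a}" for t x
  proof (cases "x = 0")
    case False
    then have x: "0 < x" using that by auto
    have gt: "continuous_on {0..a} (g t)"
      using continuous_on_compose2[OF g, of "{0..a}" "\<lambda>x. (t, x)"] that
      by (simp add: image_subset_iff continuous_on_Pair continuous_on_const continuous_on_id)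
    have "(g t has_integral integral {0..x} (g t)) {0..x}"
      by (intro integrable_integral integrable_continuous_interval continuous_on_subset[OF gt]) (use that in auto)
    from has_integral_stretch_real[OF this, of x]
    have "((\<lambda>s. g t (x * s)) has_integral (1 / x * integral {0..x} (g t))) ((\<lambda>s. s / x) ` {0..x})" using x by simp
    also have "(\<lambda>s. s / x) ` {0..x} = {0..1}" using x by (auto simp: image_iff divide_le_eq intro!: bexI[of _ "x * _"] mult_left_le)
    finally have "((\<lambda>s. x * g t (x * s)) has_integral x * (1 / x * integral {0..x} (g t))) {0..1}"
      by (rule has_integral_mult_right)
    then have "((\<lambda>s. x * g t (x * s)) has_integral integral {0..x} (g t)) (cbox 0 1)" using x by simp
    then show ?thesis by (rule integral_unique[symmetric])
  qed simp
  have "continuous_on (S \<times> {0..a}) (\<lambda>z. integral (cbox 0 1) ((\<lambda>(t, x) s. x * g t (x * s)) z))"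
  proof (rule integral_continuous_on_param)
    have "continuous_on ((S \<times> {0..a}) \<times> cbox 0 1) (\<lambda>z. (\<lambda>(t, x). g t x) (fst (fst z), snd (fst z) * snd z))"
    proof (rule continuous_on_compose2[OF g])
      show "(\<lambda>z. (fst (fst z), snd (fst z) * snd z)) ` ((S \<times> {0..a}) \<times> cbox 0 1) \<subseteq> S \<times> {0..a}"
        by (auto intro: order_trans[OF mult_left_le])
    qed (intro continuous_intros)
    then show "continuous_on ((S \<times> {0..a}) \<times> cbox 0 1) (\<lambda>(z, s). (\<lambda>(t, x) s. x * g t (x * s)) z s)"
      by (auto simp: case_prod_unfold intro!: continuous_intros)
  qed
  then show ?thesis
    by (rule continuous_on_eq) (auto simp: eq)
qed

text \<open>By the mean value theorem the difference quotient on a face is v1 at a point within half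
  a cell of it, so gl is v2 at an intermediate point times the distance of two such points over h, a
  ratio of at most 2. This explains the factor 4; the summand a absorbs the oscillation of v2^2 on a
  fine grid.\<close>

lemma sampled_laplacian_bound:
  fixes v v1 v2 :: "real \<Rightarrow> real"
  assumes a: "0 < a"
    and v1: "\<And>x. x \<in> {0..a} \<Longrightarrow> (v has_real_derivative v1 x) (at x within {0..a})"
    and v2: "\<And>x. x \<in> {0..a} \<Longrightarrow> (v1 has_real_derivative v2 x) (at x within {0..a})"
    and cont: "continuous_on {0..a} v2" and bc: "v1 0 = 0" "v1 a = 0"
  shows "\<exists>N0. \<forall>N>N0. gs (a / real N) N (\<lambda>i. (gl (a / real N) N (\<lambda>i. v (a / real N * (real i + 1 / 2))) i)\<^sup>2)
    \<le> 4 * (integral {0..a} (\<lambda>x. (v2 x)\<^sup>2) + a)"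
proof -
  have "uniformly_continuous_on {0..a} (\<lambda>x. (v2 x)\<^sup>2)"
    by (intro compact_uniformly_continuous continuous_intros cont compact_Icc)
  then obtain d where d: "d > 0" "\<And>x y. x \<in> {0..a} \<Longrightarrow> y \<in> {0..a} \<Longrightarrow> \<bar>x - y\<bar> < d \<Longrightarrow> \<bar>(v2 x)\<^sup>2 - (v2 y)\<^sup>2\<bar> < 1"
    unfolding uniformly_continuous_on_def dist_real_def by (metis zero_less_one)
  obtain N0 where N0: "2 * a / d < real N0" using reals_Archimedean2 by blast
  have "gs (a / real N) N (\<lambda>i. (gl (a / real N) N (\<lambda>i. v (a / real N * (real i + 1 / 2))) i)\<^sup>2)
    \<le> 4 * (integral {0..a} (\<lambda>x. (v2 x)\<^sup>2) + a)" if N: "N > N0" for N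
  proof -
    define h where "h = a / real N"
    have Npos: "0 < N" using N by simp
    have h: "h > 0" "h * real N = a" using a Npos by (auto simp: h_def)
    have "2 * a / d < real N" using N0 N by linarith
    then have hd: "2 * h < d" using d(1) Npos by (simp add: h_def field_simps)
    define w where "w = (\<lambda>i::nat. v (h * (real i + 1 / 2)))"
    have mvt: "\<exists>z\<in>{x..y}. f y - f x = f' z * (y - x)"
      if "0 \<le> x" "x \<le> y" "y \<le> a" "\<And>x. x \<in> {0..a} \<Longrightarrow> (f has_real_derivative f' x) (at x within {0..a})" for f f' :: "real \<Rightarrow> real" and x y
      using mvt_very_simple[OF that(2), of f "\<lambda>x y. f' x * y"] that(1,3)
        has_field_derivative_subset[OF that(4), of _ "{x..y}"]
      by (fastforce simp: has_field_derivative_def)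
    \<comment> \<open>On the boundary faces \<open>gd\<close> is 0 by definition, which matches v1
      at the end points because of the Neumann condition; no boundary layer arises.\<close>
    have "\<exists>\<xi>\<in>{0..a}. h * (real i - 1 / 2) \<le> \<xi> \<and> \<xi> \<le> h * (real i + 1 / 2) \<and> gd h N w i = v1 \<xi>" if i: "i \<le> N" for i
    proof (cases "0 < i \<and> i < N")
      case True
      have ri: "real (i - 1) = real i - 1" using True by (simp add: of_nat_diff)
      have i1: "0 \<le> h * (real i - 1 / 2)" using True h by auto
      have "h * (real i + 1 / 2) \<le> h * real N" using True h by (intro mult_left_mono) auto
      then have i2: "h * (real i + 1 / 2) \<le> a" using h by simp
      have i3: "h * (real i - 1 / 2) \<le> h * (real i + 1 / 2)" using h by (intro mult_left_mono) auto
      obtain \<xi> where \<xi>: "\<xi> \<in> {h * (real i - 1 / 2)..h * (real i + 1 / 2)}"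
        "v (h * (real i + 1 / 2)) - v (h * (real i - 1 / 2)) = v1 \<xi> * (h * (real i + 1 / 2) - h * (real i - 1 / 2))"
        using mvt[OF i1 i3 i2 v1] by blast
      have "gd h N w i = v1 \<xi>" using True \<xi>(2) h by (simp add: gd_def w_def ri algebra_simps)
      then show ?thesis using \<xi>(1) i1 i2 by (intro bexI[of _ \<xi>]) auto
    next
      case False
      then consider "i = 0" | "i = N" using i by linarith
      then show ?thesis
      proof cases
        case 1 then show ?thesis using h bc a by (intro bexI[of _ 0]) (auto simp: gd_def)
      next
        case 2 then show ?thesis using h bc a by (intro bexI[of _ a]) (auto simp: gd_def algebra_simps)
      qed
    qed
    then obtain \<xi> where \<xi>: "\<And>i. i \<le> N \<Longrightarrow> \<xi> i \<in> {0..a} \<and> h * (real i - 1 / 2) \<le> \<xi> i \<and> \<xi> i \<le> h * (real i + 1 / 2) \<and> gd h N w i = v1 (\<xi> i)"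
      by metis
    have key: "(gl h N w i)\<^sup>2 \<le> 4 * ((v2 x)\<^sup>2 + 1)" if i: "i < N" and x: "x \<in> {0..a}" "h * real i \<le> x" "x \<le> h * (real i + 1)" for i x
    proof -
      have a1: "\<xi> i \<in> {0..a}" "h * (real i - 1 / 2) \<le> \<xi> i" "\<xi> i \<le> h * (real i + 1 / 2)" "gd h N w i = v1 (\<xi> i)"
        and a2: "\<xi> (Suc i) \<in> {0..a}" "h * (real i + 1 / 2) \<le> \<xi> (Suc i)" "\<xi> (Suc i) \<le> h * (real i + 3 / 2)" "gd h N w (Suc i) = v1 (\<xi> (Suc i))"
        using \<xi>[of i] \<xi>[of "Suc i"] i by (auto simp: algebra_simps)
      obtain \<eta> where \<eta>: "\<eta> \<in> {\<xi> i..\<xi> (Suc i)}" "v1 (\<xi> (Suc i)) - v1 (\<xi> i) = v2 \<eta> * (\<xi> (Suc i) - \<xi> i)"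
        using mvt[of "\<xi> i" "\<xi> (Suc i)" v1 v2] a1 a2 v2 by auto
      have "\<xi> (Suc i) - \<xi> i \<le> 2 * h" "0 \<le> \<xi> (Suc i) - \<xi> i" using a1 a2 by (auto simp: algebra_simps)
      then have "((\<xi> (Suc i) - \<xi> i) / h)\<^sup>2 \<le> 2\<^sup>2" using h by (intro power_mono) (auto simp: divide_le_eq)
      then have 4: "((\<xi> (Suc i) - \<xi> i) / h)\<^sup>2 \<le> 4" by simp
      have "gl h N w i = v2 \<eta> * ((\<xi> (Suc i) - \<xi> i) / h)" unfolding gl_def a1 a2 \<eta>(2) by simp
      then have "(gl h N w i)\<^sup>2 = (v2 \<eta>)\<^sup>2 * ((\<xi> (Suc i) - \<xi> i) / h)\<^sup>2" by (simp add: power_mult_distrib power_divide)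
      also have "\<dots> \<le> (v2 \<eta>)\<^sup>2 * 4" by (intro mult_left_mono 4) auto
      finally have "(gl h N w i)\<^sup>2 \<le> 4 * (v2 \<eta>)\<^sup>2" by simp
      moreover have "\<bar>\<eta> - x\<bar> < d"
      proof -
        have "\<eta> \<le> h * (real i + 3 / 2)" "h * (real i - 1 / 2) \<le> \<eta>" using \<eta>(1) a1 a2 by auto
        then have "\<bar>\<eta> - x\<bar> \<le> 2 * h" using x h by (auto simp: algebra_simps)
        then show ?thesis using hd by linarith
      qed
      then have "\<bar>(v2 \<eta>)\<^sup>2 - (v2 x)\<^sup>2\<bar> < 1" using \<eta>(1) a1 a2 x by (intro d(2)) auto
      then have "(v2 \<eta>)\<^sup>2 \<le> (v2 x)\<^sup>2 + 1" by (simp add: abs_less_iff)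
      ultimately show ?thesis by (smt (verit))
    qed
    have "gs h N (\<lambda>i. (gl h N w i)\<^sup>2) \<le> integral {0..a} (\<lambda>x. 4 * ((v2 x)\<^sup>2 + 1))"
    proof (rule has_integral_le[OF integral_idx(1)[OF a Npos, of "\<lambda>i. (gl h N w i)\<^sup>2", folded h_def]])
      show "((\<lambda>x. 4 * ((v2 x)\<^sup>2 + 1)) has_integral integral {0..a} (\<lambda>x. 4 * ((v2 x)\<^sup>2 + 1))) {0..a}"
        by (intro integrable_integral integrable_continuous_interval continuous_intros cont)
      fix x assume x: "x \<in> {0..a}"
      show "(gl h N w (idx a N x))\<^sup>2 \<le> 4 * ((v2 x)\<^sup>2 + 1)"
        using idx_bounds[OF a Npos x] x by (intro key idx_less Npos) (auto simp: h_def)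
    qed
    also have "\<dots> = 4 * (integral {0..a} (\<lambda>x. (v2 x)\<^sup>2) + a)"
    proof -
      have "(\<lambda>x. (v2 x)\<^sup>2) integrable_on {0..a}" by (intro integrable_continuous_interval continuous_intros cont)
      then have "integral {0..a} (\<lambda>x. (v2 x)\<^sup>2 + 1) = integral {0..a} (\<lambda>x. (v2 x)\<^sup>2) + a"
        using a by (subst integral_add) auto
      then show ?thesis by (simp only: integral_mult_right)
    qed
    finally show ?thesis unfolding w_def h_def .
  qed
  then show ?thesis by blast
qed

text \<open>The quantifier order matters: the moduli are fixed before h, N, u and q, as
  equicontinuity of a whole sequence of grids demands. The absolute values in the witnesses make
  nonnegativity evident without a flow at hand.\<close>

lemma grid_flow_moduli:
  fixes p a m M T Y :: real
  obtains A1 A2 A3 B1 B2 B3 B4 where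
    "0 \<le> A1" "0 \<le> A2" "0 \<le> A3" "\<And>e. 0 \<le> B1 e" "\<And>e. 0 \<le> B2 e" "\<And>e. 0 \<le> B3 e"
    "\<And>h N u q t i j. \<lbrakk>grid_flow_bounded p a m M T h N u q Y; t \<in> {0..T}; i < N; j < N\<rbrakk> \<Longrightarrow>
       (u t i - u t j)\<^sup>2 \<le> h * \<bar>real i - real j\<bar> * A1"
    "\<And>h N u q t s i. \<lbrakk>grid_flow_bounded p a m M T h N u q Y; s \<in> {0..T}; t \<in> {0..T}; s \<le> t; i < N\<rbrakk> \<Longrightarrow>
       (u t i - u s i)\<^sup>2 \<le> A2 * (t - s) + A3 * sqrt (t - s)"
    "\<And>h N u q e t i j. \<lbrakk>grid_flow_bounded p a m M T h N u q Y; 0 < e; t \<in> {e..T}; i < N; j < N\<rbrakk> \<Longrightarrow>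
       (q t i - q t j)\<^sup>2 \<le> h * \<bar>real i - real j\<bar> * B1 e"
    "\<And>h N u q e t s i. \<lbrakk>grid_flow_bounded p a m M T h N u q Y; 0 < e; s \<in> {e..T}; t \<in> {e..T}; s \<le> t; i < N\<rbrakk> \<Longrightarrow>
       (q t i - q s i)\<^sup>2 \<le> B2 e * (t - s) + B3 e * sqrt (t - s)"
    "\<And>h N u q e t i. \<lbrakk>grid_flow_bounded p a m M T h N u q Y; 0 < e; t \<in> {e..T}; i < N\<rbrakk> \<Longrightarrow> (q t i)\<^sup>2 \<le> B4 e"
proof -
  let ?L = "a * (grid_flow_bounded.L p a m M Y)\<^sup>2" and ?C = "grid_flow_bounded.C3 p a M Y"
  let ?Z = "\<lambda>e. grid_flow_bounded.Z p a m M T Y / e" and ?D = "\<lambda>e. grid_flow_bounded.C4 p a m M T Y e"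
  show thesis
  proof (rule that[of "\<bar>?L\<bar>" "\<bar>?C / a\<bar>" "\<bar>?C + 4 * ?L\<bar>" "\<lambda>e. \<bar>?Z e\<bar>" "\<lambda>e. \<bar>?D e / a\<bar>" "\<lambda>e. \<bar>?D e + 4 * ?Z e\<bar>"
      "\<lambda>e. grid_flow_bounded.B0 p a m M T Y e"])
    fix h N u q assume fl: "grid_flow_bounded p a m M T h N u q Y"
    then have h: "0 < h" by (intro grid_flow.h grid_flow_bounded.axioms(1))
    have up: "c * x \<le> \<bar>c\<bar> * x" if "0 \<le> x" for c x :: real using that by (intro mult_right_mono) auto
    show "(u t i - u t j)\<^sup>2 \<le> h * \<bar>real i - real j\<bar> * \<bar>?L\<bar>" if "t \<in> {0..T}" "i < N" "j < N" for t i j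
      by (rule order_trans[OF grid_flow_bounded.u_holder_space[OF fl that]]) (use h in \<open>auto intro!: mult_left_mono\<close>)
    show "(u t i - u s i)\<^sup>2 \<le> \<bar>?C / a\<bar> * (t - s) + \<bar>?C + 4 * ?L\<bar> * sqrt (t - s)"
      if "s \<in> {0..T}" "t \<in> {0..T}" "s \<le> t" "i < N" for t s i
      by (rule order_trans[OF grid_flow_bounded.u_holder_time_aux[OF fl, of s t i]])
        (use that in \<open>auto intro!: add_mono up simp del: abs_divide times_divide_eq_left\<close>)
    fix e :: real assume e: "0 < e"
    show "(q t i - q t j)\<^sup>2 \<le> h * \<bar>real i - real j\<bar> * \<bar>?Z e\<bar>" if "t \<in> {e..T}" "i < N" "j < N" for t i j
      by (rule order_trans[OF grid_flow_bounded.q_holder_space[OF fl e, of t i j]])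
        (use h that in \<open>auto intro!: mult_left_mono simp del: abs_divide times_divide_eq_right times_divide_eq_left\<close>)
    show "(q t i - q s i)\<^sup>2 \<le> \<bar>?D e / a\<bar> * (t - s) + \<bar>?D e + 4 * ?Z e\<bar> * sqrt (t - s)"
      if "s \<in> {e..T}" "t \<in> {e..T}" "s \<le> t" "i < N" for t s i
      by (rule order_trans[OF grid_flow_bounded.q_holder_time_aux[OF fl e, of s t i]])
        (use that in \<open>auto intro!: add_mono up simp del: abs_divide times_divide_eq_right times_divide_eq_left\<close>)
    show "(q t i)\<^sup>2 \<le> grid_flow_bounded.B0 p a m M T Y e" if "t \<in> {e..T}" "i < N" for t i
      by (rule grid_flow_bounded.q2_le[OF fl e]) (use that in auto)
  qed auto
qed

text \<open>u converges up to time 0, but q only away from it, since the squared gradient of q is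
  bounded by a multiple of 1 / t. Difference quotients are not differentiated in the limit: the
  Laplacian is read off from the equation and integrated twice in space, q is integrated in time,
  and the derivatives of the limit come back from the fundamental theorem of calculus.\<close>

lemma local_existence:
  fixes p a c C T :: real and v v1 v2 :: "real \<Rightarrow> real"
  defines "m \<equiv> c / 2" and "M \<equiv> 2 * C" and "J \<equiv> 4 * (integral {0..a} (\<lambda>x. (v2 x)\<^sup>2) + a)"
  defines "Y \<equiv> 2 * (1 + M powr p * (2 * J + 2 * (a * M\<^sup>2)))"
  assumes p: "1 < p" and a: "0 < a" and c: "0 < c" and cC: "c \<le> C"
    and T: "0 < T" "2 * (M powr p * M) * T \<le> c" and KT: "grid_flow.K p a m M * T * Y \<le> 1"
    and v: "\<And>x. x \<in> {0..a} \<Longrightarrow> c \<le> v x \<and> v x \<le> C"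
    and v1: "\<And>x. x \<in> {0..a} \<Longrightarrow> (v has_real_derivative v1 x) (at x within {0..a})"
    and v2: "\<And>x. x \<in> {0..a} \<Longrightarrow> (v1 has_real_derivative v2 x) (at x within {0..a})"
    and v2_cont: "continuous_on {0..a} v2" and bc: "v1 0 = 0" "v1 a = 0"
  obtains u ut ux uxx :: "real \<Rightarrow> real \<Rightarrow> real" where
    "continuous_on ({0..T} \<times> {0..a}) (\<lambda>(t, x). u t x)"
    "\<And>t x. \<lbrakk>t \<in> {0..T}; x \<in> {0..a}\<rbrakk> \<Longrightarrow> 0 < u t x"
    "\<And>x. x \<in> {0..a} \<Longrightarrow> u 0 x = v x"
    "continuous_on ({0<..T} \<times> {0..a}) (\<lambda>(t, x). ut t x)"
    "continuous_on ({0<..T} \<times> {0..a}) (\<lambda>(t, x). ux t x)"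
    "continuous_on ({0<..T} \<times> {0..a}) (\<lambda>(t, x). uxx t x)"
    "\<And>t x. \<lbrakk>t \<in> {0<..<T}; x \<in> {0..a}\<rbrakk> \<Longrightarrow> ((\<lambda>s. u s x) has_real_derivative ut t x) (at t)"
    "\<And>t x. \<lbrakk>t \<in> {0<..T}; x \<in> {0..a}\<rbrakk> \<Longrightarrow> ((\<lambda>y. u t y) has_real_derivative ux t x) (at x within {0..a})"
    "\<And>t x. \<lbrakk>t \<in> {0<..T}; x \<in> {0..a}\<rbrakk> \<Longrightarrow> ((\<lambda>y. ux t y) has_real_derivative uxx t x) (at x within {0..a})"
    "\<And>t x. \<lbrakk>t \<in> {0<..T}; x \<in> {0..a}\<rbrakk> \<Longrightarrow> ut t x = u t x powr p * (uxx t x + u t x - mean a (u t))"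
    "\<And>t. t \<in> {0<..T} \<Longrightarrow> ux t 0 = 0" "\<And>t. t \<in> {0<..T} \<Longrightarrow> ux t a = 0"
proof -
  have vc: "continuous_on {0..a} v" by (rule DERIV_continuous_on[OF v1])
  have m: "0 < m" and M: "0 < M" using c cC by (auto simp: m_def M_def)
  obtain N0 where N0: "\<And>N. N > N0 \<Longrightarrow> gs (a / real N) N (\<lambda>i. (gl (a / real N) N (\<lambda>i. v (a / real N * (real i + 1 / 2))) i)\<^sup>2) \<le> J"
    using sampled_laplacian_bound[OF a v1 v2 v2_cont bc] unfolding J_def by blast
  have J: "0 \<le> J"
  proof -
    have "0 \<le> integral {0..a} (\<lambda>x. (v2 x)\<^sup>2)"
      by (rule integral_nonneg) (auto intro!: integrable_continuous_interval continuous_intros v2_cont)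
    then show ?thesis using a by (simp add: J_def)
  qed
  define N where "N n = n + N0 + 1" for n :: nat
  have Npos: "0 < N n" for n by (simp add: N_def)
  have Ntop: "filterlim N at_top sequentially"
    unfolding N_def by (intro filterlim_subseq) (auto simp: strict_mono_def)
  define h where "h n = a / real (N n)" for n
  have h: "h n > 0" "h n * real (N n) = a" for n using a Npos[of n] by (auto simp: h_def)
  define v0 where "v0 n i = v (h n * (real i + 1 / 2))" for n and i :: nat
  have mid: "h n * (real i + 1 / 2) \<in> {0..a}" if "i < N n" for n i
  proof -
    have "h n * (real i + 1 / 2) \<le> h n * real (N n)" using that h(1)[of n] by (intro mult_left_mono) auto
    then show ?thesis using h[of n] by simp
  qed
  have "\<exists>u q. grid_flow_bounded p a m M T (h n) (N n) u q Y \<and> (\<forall>i<N n. u 0 i = v0 n i)" for n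
  proof -
    have Ydef: "Y = 2 * (1 + M powr p * (2 * J + 2 * (a * M\<^sup>2)))" by (simp add: Y_def)
    have v0: "c \<le> v0 n i \<and> v0 n i \<le> C" if "i < N n" for i unfolding v0_def by (rule v[OF mid[OF that]])
    have gsJ: "gs (a / real (N n)) (N n) (\<lambda>i. (gl (a / real (N n)) (N n) (v0 n) i)\<^sup>2) \<le> J"
      using N0[of "N n"] unfolding v0_def h_def by (simp add: N_def)
    have "\<exists>u q. grid_flow_bounded p a (c / 2) (2 * C) T (a / real (N n)) (N n) u q Y \<and> (\<forall>i<N n. u 0 i = v0 n i)"
      by (rule grid_flow_exists[where N="N n", OF p a c cC J Npos T[unfolded M_def] Ydef[unfolded M_def] KT[unfolded m_def M_def] v0 gsJ])
        blast+
    then show ?thesis by (simp add: m_def M_def h_def)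
  qed
  then have "\<forall>n. \<exists>uq. grid_flow_bounded p a m M T (h n) (N n) (fst uq) (snd uq) Y \<and> (\<forall>i<N n. fst uq 0 i = v0 n i)"
    by simp
  from choice[OF this] obtain uq where uq: "\<And>n. grid_flow_bounded p a m M T (h n) (N n) (fst (uq n)) (snd (uq n)) Y"
    "\<And>n i. i < N n \<Longrightarrow> fst (uq n) 0 i = v0 n i" by blast
  define U where "U n = fst (uq n)" for n
  define Q where "Q n = snd (uq n)" for n
  have flow: "grid_flow_bounded p a m M T (h n) (N n) (U n) (Q n) Y" and U0: "i < N n \<Longrightarrow> U n 0 i = v0 n i" for n i
    using uq by (auto simp: U_def Q_def)
  have gflow: "grid_flow p a m M T (h n) (N n) (U n) (Q n)" for n
    using flow[of n] by (simp add: grid_flow_bounded_def)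
  have U_deriv: "((\<lambda>t. U n t i) has_real_derivative Q n t i) (at t within {0..T})" if "t \<in> {0..T}" "i < N n" for n t i
    by (rule grid_flow.u_deriv[OF gflow that])
  have U_bounds: "m \<le> U n t i \<and> U n t i \<le> M" if "t \<in> {0..T}" "i < N n" for n t i
    by (rule grid_flow.u_bounds[OF gflow that])
  have Q_eq: "Q n t i = U n t i powr p * (gl (h n) (N n) (U n t) i + U n t i - gm (N n) (U n t))" if "t \<in> {0..T}" "i < N n" for n t i
    by (rule grid_flow.q_eq[OF gflow that])
  obtain A1 A2 A3 B1 B2 B3 B4 where A: "0 \<le> A1" "0 \<le> A2" "0 \<le> A3" and B: "\<And>e. 0 \<le> B1 e" "\<And>e. 0 \<le> B2 e" "\<And>e. 0 \<le> B3 e"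
    and Usp: "\<And>h N u q t i j. \<lbrakk>grid_flow_bounded p a m M T h N u q Y; t \<in> {0..T}; i < N; j < N\<rbrakk> \<Longrightarrow>
       (u t i - u t j)\<^sup>2 \<le> h * \<bar>real i - real j\<bar> * A1"
    and Utm: "\<And>h N u q t s i. \<lbrakk>grid_flow_bounded p a m M T h N u q Y; s \<in> {0..T}; t \<in> {0..T}; s \<le> t; i < N\<rbrakk> \<Longrightarrow>
       (u t i - u s i)\<^sup>2 \<le> A2 * (t - s) + A3 * sqrt (t - s)"
    and Qsp: "\<And>h N u q e t i j. \<lbrakk>grid_flow_bounded p a m M T h N u q Y; 0 < e; t \<in> {e..T}; i < N; j < N\<rbrakk> \<Longrightarrow>
       (q t i - q t j)\<^sup>2 \<le> h * \<bar>real i - real j\<bar> * B1 e"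
    and Qtm: "\<And>h N u q e t s i. \<lbrakk>grid_flow_bounded p a m M T h N u q Y; 0 < e; s \<in> {e..T}; t \<in> {e..T}; s \<le> t; i < N\<rbrakk> \<Longrightarrow>
       (q t i - q s i)\<^sup>2 \<le> B2 e * (t - s) + B3 e * sqrt (t - s)"
    and Qb: "\<And>h N u q e t i. \<lbrakk>grid_flow_bounded p a m M T h N u q Y; 0 < e; t \<in> {e..T}; i < N\<rbrakk> \<Longrightarrow> (q t i)\<^sup>2 \<le> B4 e"
  proof (rule grid_flow_moduli[of p a m M T Y], goal_cases)
    case (1 A1 A2 A3 B1 B2 B3 B4)
    show ?case by (rule 1(1)[of A1 A2 A3 B1 B2 B3 B4]; fact 1)
  qed
  have idx: "idx a (N n) x < N n" for n x by (rule idx_less[OF Npos])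
  have dist_prod: "\<bar>t - s\<bar> < d \<and> \<bar>x - y\<bar> < d" if "dist (t, x) (s, y) < d" for t x s y d :: real
    using that dist_fst_le[of "(t, x)" "(s, y)"] dist_snd_le[of "(t, x)" "(s, y)"] by (simp add: dist_real_def)
  define FU where "FU n z = U n (fst z) (idx a (N n) (snd z))" for n and z :: "real \<times> real"
  define FQ where "FQ n z = Q n (fst z) (idx a (N n) (snd z))" for n and z :: "real \<times> real"
  obtain k1 g1 where k1: "strict_mono (k1 :: nat \<Rightarrow> nat)" and g1: "continuous_on ({0..T} \<times> {0..a}) g1"
    and lim1: "\<And>D. \<lbrakk>compact D; D \<subseteq> {0..T} \<times> {0..a}\<rbrakk> \<Longrightarrow> uniform_limit D (\<lambda>n. FU (k1 n)) g1 sequentially"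
  proof (rule subsequence_locally_uniform[of "{0..T} \<times> {0..a}" FU])
    show "\<exists>B. \<forall>n. \<bar>FU n z\<bar> \<le> B" if "z \<in> {0..T} \<times> {0..a}" for z
    proof (intro exI allI)
      fix n
      have "m \<le> FU n z" "FU n z \<le> M" using U_bounds[of "fst z" _ n, OF _ idx] that by (auto simp: FU_def)
      then show "\<bar>FU n z\<bar> \<le> M" using m by simp
    qed
    fix z and e :: real assume z: "z \<in> {0..T} \<times> {0..a}" and e: "0 < e"
    have "\<exists>d>0. \<forall>\<^sub>F n in sequentially. \<forall>t\<in>{0..T}. \<forall>s\<in>{0..T}. \<forall>x\<in>{0..a}. \<forall>y\<in>{0..a}. \<bar>t - s\<bar> < d \<longrightarrow> \<bar>x - y\<bar> < d \<longrightarrow>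
       \<bar>U n t (idx a (N n) x) - U n s (idx a (N n) y)\<bar> \<le> e"
      by (rule piecewise_constant_equicontinuous[OF a Ntop Npos A _ _ e]) (rule Usp[OF flow, unfolded h_def] Utm[OF flow]; assumption)+
    then obtain d where "d > 0" and d: "\<forall>\<^sub>F n in sequentially. \<forall>t\<in>{0..T}. \<forall>s\<in>{0..T}. \<forall>x\<in>{0..a}. \<forall>y\<in>{0..a}. \<bar>t - s\<bar> < d \<longrightarrow> \<bar>x - y\<bar> < d \<longrightarrow>
       \<bar>U n t (idx a (N n) x) - U n s (idx a (N n) y)\<bar> \<le> e" by (elim exE conjE)
    from d have "\<forall>\<^sub>F n in sequentially. \<forall>y\<in>{0..T} \<times> {0..a}. dist z y < d \<longrightarrow> \<bar>FU n z - FU n y\<bar> \<le> e"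
      by eventually_elim (use z in \<open>auto simp: FU_def dest!: dist_prod\<close>)
    with \<open>d > 0\<close> show "\<exists>d>0. \<forall>\<^sub>F n in sequentially. \<forall>y\<in>{0..T} \<times> {0..a}. dist z y < d \<longrightarrow> \<bar>FU n z - FU n y\<bar> \<le> e" by blast
  qed (rule that)
  \<comment> \<open>Extracted from the first subsequence, so that u and q converge along the same
    indices.\<close>
  obtain k2 g2 where k2: "strict_mono (k2 :: nat \<Rightarrow> nat)" and g2: "continuous_on ({0<..T} \<times> {0..a}) g2"
    and lim2: "\<And>D. \<lbrakk>compact D; D \<subseteq> {0<..T} \<times> {0..a}\<rbrakk> \<Longrightarrow> uniform_limit D (\<lambda>n. FQ (k1 (k2 n))) g2 sequentially"
  proof (rule subsequence_locally_uniform[of "{0<..T} \<times> {0..a}" "\<lambda>n. FQ (k1 n)"])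
    show "\<exists>B. \<forall>n. \<bar>FQ (k1 n) z\<bar> \<le> B" if "z \<in> {0<..T} \<times> {0..a}" for z
    proof (intro exI allI)
      fix n show "\<bar>FQ (k1 n) z\<bar> \<le> sqrt (B4 (fst z))"
        unfolding FQ_def by (rule real_le_rsqrt_abs, rule Qb[OF flow]) (use that idx in auto)
    qed
    fix z and e :: real assume z: "z \<in> {0<..T} \<times> {0..a}" and e: "0 < e"
    \<comment> \<open>Half of the time coordinate: a small ball around z stays at times beyond t0,
      where the estimates on q hold with constants fixed by t0.\<close>
    define t0 where "t0 = fst z / 2"
    have t0: "0 < t0" using z by (auto simp: t0_def)
    have "\<exists>d>0. \<forall>\<^sub>F n in sequentially. \<forall>t\<in>{t0..T}. \<forall>s\<in>{t0..T}. \<forall>x\<in>{0..a}. \<forall>y\<in>{0..a}. \<bar>t - s\<bar> < d \<longrightarrow> \<bar>x - y\<bar> < d \<longrightarrow>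
       \<bar>Q n t (idx a (N n) x) - Q n s (idx a (N n) y)\<bar> \<le> e"
      by (rule piecewise_constant_equicontinuous[OF a Ntop Npos B(1)[of t0] B(2)[of t0] B(3)[of t0] _ _ e]) (rule Qsp[OF flow t0, unfolded h_def] Qtm[OF flow t0]; assumption)+
    then obtain d where "d > 0" and d: "\<forall>\<^sub>F n in sequentially. \<forall>t\<in>{t0..T}. \<forall>s\<in>{t0..T}. \<forall>x\<in>{0..a}. \<forall>y\<in>{0..a}. \<bar>t - s\<bar> < d \<longrightarrow> \<bar>x - y\<bar> < d \<longrightarrow>
       \<bar>Q n t (idx a (N n) x) - Q n s (idx a (N n) y)\<bar> \<le> e" by (elim exE conjE)
    have "filterlim k1 sequentially sequentially" by (rule filterlim_subseq[OF k1])
    from eventually_compose_filterlim[OF d this]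
    have "\<forall>\<^sub>F n in sequentially. \<forall>y\<in>{0<..T} \<times> {0..a}. dist z y < min d t0 \<longrightarrow> \<bar>FQ (k1 n) z - FQ (k1 n) y\<bar> \<le> e"
    proof eventually_elim
      case (elim n)
      show ?case
      proof (intro ballI impI)
        fix y assume y: "y \<in> {0<..T} \<times> {0..a}" "dist z y < min d t0"
        have "\<bar>fst z - fst y\<bar> < min d t0" "\<bar>snd z - snd y\<bar> < min d t0"
          using dist_prod[of "fst z" "snd z" "fst y" "snd y"] y(2) by auto
        moreover have "fst z = 2 * t0" by (simp add: t0_def)
        ultimately have "t0 \<le> fst y" "t0 \<le> fst z" "\<bar>fst z - fst y\<bar> < d" "\<bar>snd z - snd y\<bar> < d" using t0 by auto
        then show "\<bar>FQ (k1 n) z - FQ (k1 n) y\<bar> \<le> e"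
          unfolding FQ_def using elim y(1) z by (auto simp: mem_Times_iff)
      qed
    qed
    then show "\<exists>d>0. \<forall>\<^sub>F n in sequentially. \<forall>y\<in>{0<..T} \<times> {0..a}. dist z y < d \<longrightarrow> \<bar>FQ (k1 n) z - FQ (k1 n) y\<bar> \<le> e"
      using \<open>d > 0\<close> t0 by (intro exI[of _ "min d t0"]) auto
  qed (rule that)
  define k where "k n = k1 (k2 n)" for n
  have k: "filterlim k sequentially sequentially"
    unfolding k_def by (rule filterlim_compose[OF filterlim_subseq[OF k1] filterlim_subseq[OF k2]])
  have Nk: "filterlim (\<lambda>n. N (k n)) at_top sequentially" by (rule filterlim_compose[OF Ntop k])
  define u where "u t x = g1 (t, x)" for t x
  define ut where "ut t x = g2 (t, x)" for t x
  have Ulim: "(\<lambda>n. U (k n) t (idx a (N (k n)) x)) \<longlonglongrightarrow> u t x" if "t \<in> {0..T}" "x \<in> {0..a}" for t x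
  proof -
    have "uniform_limit {(t, x)} (\<lambda>n. FU (k1 n)) g1 sequentially" by (rule lim1) (use that in auto)
    then have "(\<lambda>n. FU (k1 n) (t, x)) \<longlonglongrightarrow> u t x" by (auto simp: u_def dest!: tendsto_uniform_limitI)
    then have "(\<lambda>n. FU (k1 (k2 n)) (t, x)) \<longlonglongrightarrow> u t x" by (rule filterlim_compose[OF _ filterlim_subseq[OF k2]])
    then show ?thesis by (simp add: FU_def k_def)
  qed
  have Qlim: "(\<lambda>n. Q (k n) t (idx a (N (k n)) x)) \<longlonglongrightarrow> ut t x" if "t \<in> {0<..T}" "x \<in> {0..a}" for t x
  proof -
    have "uniform_limit {(t, x)} (\<lambda>n. FQ (k1 (k2 n))) g2 sequentially" by (rule lim2) (use that in auto)
    then have "(\<lambda>n. FQ (k1 (k2 n)) (t, x)) \<longlonglongrightarrow> ut t x" by (auto simp: ut_def dest!: tendsto_uniform_limitI)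
    then show ?thesis by (simp add: FQ_def k_def)
  qed
  have u_cont: "continuous_on ({0..T} \<times> {0..a}) (\<lambda>(t, x). u t x)" using g1 by (simp add: u_def)
  have ut_cont: "continuous_on ({0<..T} \<times> {0..a}) (\<lambda>(t, x). ut t x)" using g2 by (simp add: ut_def)
  have u_bounds: "m \<le> u t x" "u t x \<le> M" if "t \<in> {0..T}" "x \<in> {0..a}" for t x
    using U_bounds[OF that(1) idx] by (auto intro: LIMSEQ_le_const[OF Ulim[OF that]] LIMSEQ_le_const2[OF Ulim[OF that]])
  have u_pos: "0 < u t x" if "t \<in> {0..T}" "x \<in> {0..a}" for t x using u_bounds[OF that] m by linarith
  have ux_cont: "continuous_on {0..a} (u t)" if "t \<in> {0..T}" for t
    using continuous_on_compose2[OF u_cont, of "{0..a}" "\<lambda>x. (t, x)"] that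
    by (simp add: image_subset_iff continuous_on_Pair continuous_on_const continuous_on_id)
  have u_init: "u 0 x = v x" if x: "x \<in> {0..a}" for x
  proof -
    define xi where "xi n = h (k n) * (real (idx a (N (k n)) x) + 1 / 2)" for n
    have xi: "xi n \<in> {0..a}" for n unfolding xi_def by (rule mid[OF idx])
    have hk: "(\<lambda>n. h (k n)) \<longlonglongrightarrow> 0"
      unfolding h_def by (rule tendsto_divide_0[OF tendsto_const])
        (use Nk filterlim_real_sequentially in \<open>auto intro: filterlim_at_top_imp_at_infinity filterlim_compose\<close>)
    have "(\<lambda>n. xi n - x) \<longlonglongrightarrow> 0"
    proof (rule Lim_null_comparison[OF always_eventually hk], rule allI)
      fix n show "norm (xi n - x) \<le> h (k n)"
        using idx_bounds[OF a Npos[of "k n"] x, folded h_def] h(1)[of "k n"] by (auto simp: xi_def algebra_simps abs_le_iff)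
    qed
    then have "xi \<longlonglongrightarrow> x" by (simp add: LIM_zero_iff)
    then have "(\<lambda>n. v (xi n)) \<longlonglongrightarrow> v x"
      by (rule continuous_on_tendsto_compose[OF vc]) (use x xi in auto)
    moreover have "(\<lambda>n. v (xi n)) \<longlonglongrightarrow> u 0 x"
      using Ulim[of 0 x] x T U0[OF idx] by (simp add: v0_def xi_def)
    ultimately show ?thesis by (rule LIMSEQ_unique[symmetric])
  qed
  have mean_lim: "(\<lambda>n. gm (N (k n)) (U (k n) t)) \<longlonglongrightarrow> mean a (u t)" if t: "t \<in> {0..T}" for t
  proof -
    have "(\<lambda>n. integral {0..a} (\<lambda>x. U (k n) t (idx a (N (k n)) x))) \<longlonglongrightarrow> integral {0..a} (u t)"
    proof (rule dominated_convergence(2)[where h="\<lambda>_. M"])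
      show "(\<lambda>x. U (k n) t (idx a (N (k n)) x)) integrable_on {0..a}" for n
        using integral_idx(2)[OF a Npos] by blast
      show "norm (U (k n) t (idx a (N (k n)) x)) \<le> M" for n x
        using U_bounds[OF t idx, of "k n" x] m by auto
    qed (use Ulim t in auto)
    then have "(\<lambda>n. a * gm (N (k n)) (U (k n) t) / a) \<longlonglongrightarrow> integral {0..a} (u t) / a"
      unfolding integral_unique[OF integral_idx(2)[OF a Npos]] by (intro tendsto_divide tendsto_const) (use a in auto)
    then show ?thesis using a by (simp add: mean_eq_integral[OF ux_cont[OF t]])
  qed
  \<comment> \<open>The equation solved for its second derivative. This becomes the function
    \<open>uxx\<close>, so that the equation holds by construction.\<close>
  define g where "g t x = ut t x / u t x powr p - u t x + mean a (u t)" for t x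
  have glim: "(\<lambda>n. gl (h (k n)) (N (k n)) (U (k n) t) (idx a (N (k n)) x)) \<longlonglongrightarrow> g t x"
    if t: "t \<in> {0<..T}" and x: "x \<in> {0..a}" for t x
  proof -
    have t': "t \<in> {0..T}" using t by auto
    let ?U = "\<lambda>n. U (k n) t (idx a (N (k n)) x)"
    have "gl (h (k n)) (N (k n)) (U (k n) t) (idx a (N (k n)) x) = Q (k n) t (idx a (N (k n)) x) / ?U n powr p - ?U n + gm (N (k n)) (U (k n) t)" for n
      using Q_eq[OF t' idx, of "k n" x] U_bounds[OF t' idx, of "k n" x] m by (simp add: field_simps)
    moreover have "(\<lambda>n. Q (k n) t (idx a (N (k n)) x) / ?U n powr p - ?U n + gm (N (k n)) (U (k n) t)) \<longlonglongrightarrow> g t x"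
      unfolding g_def using u_pos[OF t' x] by (intro tendsto_intros Qlim[OF t x] Ulim[OF t' x] mean_lim[OF t']) auto
    ultimately show ?thesis by simp
  qed
  have mean_cont: "continuous_on {0..T} (\<lambda>t. mean a (u t))"
  proof -
    have "continuous_on {0..T} (\<lambda>t. integral (cbox 0 a) (u t) / a)"
      using a by (intro continuous_intros integral_continuous_on_param) (use u_cont in auto)
    then show ?thesis by (rule continuous_on_eq) (simp add: mean_eq_integral ux_cont)
  qed
  have g_cont: "continuous_on ({0<..T} \<times> {0..a}) (\<lambda>(t, x). g t x)"
  proof -
    have uc: "continuous_on ({0<..T} \<times> {0..a}) (\<lambda>z. u (fst z) (snd z))"
      by (rule continuous_on_subset[OF u_cont[unfolded case_prod_unfold]]) auto
    have utc: "continuous_on ({0<..T} \<times> {0..a}) (\<lambda>z. ut (fst z) (snd z))" using ut_cont by (simp add: case_prod_unfold)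
    have mc: "continuous_on ({0<..T} \<times> {0..a}) (\<lambda>z. mean a (u (fst z)))"
      by (rule continuous_on_compose2[OF mean_cont]) (auto intro!: continuous_intros)
    have "u (fst z) (snd z) \<noteq> 0" if "z \<in> {0<..T} \<times> {0..a}" for z
      using u_pos[of "fst z" "snd z"] that by auto
    then show ?thesis unfolding g_def case_prod_unfold
      by (intro continuous_intros uc utc mc) auto
  qed
  have gt_cont: "continuous_on {0..a} (g t)" if "t \<in> {0<..T}" for t
    using continuous_on_compose2[OF g_cont, of "{0..a}" "\<lambda>x. (t, x)"] that
    by (simp add: image_subset_iff continuous_on_Pair continuous_on_const continuous_on_id)
  have dbl: "integral {0..a} (g t) = 0" "x \<in> {0..a} \<Longrightarrow> u t x = u t 0 + integral {0..x} (\<lambda>s. integral {0..s} (g t))"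
    if t: "t \<in> {0<..T}" for t x
  proof -
    have t': "t \<in> {0..T}" using t by auto
    have glB: "\<bar>gl (a / real (N (k n))) (N (k n)) (U (k n) t) i\<bar> \<le> sqrt (B4 t) / m powr p + 2 * M" if i: "i < N (k n)" for n i
    proof -
      define U' where "U' = U (k n) t i"
      have U': "m \<le> U'" "U' \<le> M" using U_bounds[OF t' i] by (auto simp: U'_def)
      have mp: "0 < m powr p" "m powr p \<le> U' powr p" using m U' p by (auto intro!: powr_mono2)
      have "\<bar>Q (k n) t i\<bar> \<le> sqrt (B4 t)" by (rule real_le_rsqrt_abs, rule Qb[OF flow]) (use t i in auto)
      then have "\<bar>Q (k n) t i / U' powr p\<bar> \<le> sqrt (B4 t) / m powr p"
        unfolding abs_divide using mp by (intro frac_le order_trans[OF abs_ge_zero]) auto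
      moreover have "gl (h (k n)) (N (k n)) (U (k n) t) i = Q (k n) t i / U' powr p - U' + gm (N (k n)) (U (k n) t)"
        using Q_eq[OF t' i] U' m by (simp add: field_simps U'_def)
      moreover have "m \<le> gm (N (k n)) (U (k n) t)" "gm (N (k n)) (U (k n) t) \<le> M"
        using gm_between[OF Npos, of "k n" m "U (k n) t" M] U_bounds[OF t'] by auto
      ultimately have "\<bar>gl (h (k n)) (N (k n)) (U (k n) t) i\<bar> \<le> sqrt (B4 t) / m powr p + 2 * M" using U' m M by linarith
      then show ?thesis by (simp add: h_def)
    qed
    note lims = grid_double_integral_limit[where f="\<lambda>n. U (k n) t" and N="\<lambda>n. N (k n)" and u="u t" and g="g t"
        and B="sqrt (B4 t) / m powr p + 2 * M"]
    have gl': "(\<lambda>n. gl (a / real (N (k n))) (N (k n)) (U (k n) t) (idx a (N (k n)) x)) \<longlonglongrightarrow> g t x" if "x \<in> {0..a}" for x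
      using glim[OF t that] by (simp only: h_def)
    show "integral {0..a} (g t) = 0"
      by (rule lims(1)[OF a Nk Npos Ulim[OF t'] gl' glB gt_cont[OF t]])
    show "u t x = u t 0 + integral {0..x} (\<lambda>s. integral {0..s} (g t))" if "x \<in> {0..a}"
      by (rule lims(2)[OF a Nk Npos Ulim[OF t'] gl' glB gt_cont[OF t] that])
  qed
  define ux where "ux t x = integral {0..x} (g t)" for t x
  have uxx_d: "((\<lambda>y. ux t y) has_real_derivative g t x) (at x within {0..a})" if "t \<in> {0<..T}" "x \<in> {0..a}" for t x
    unfolding ux_def by (rule integral_has_real_derivative[OF gt_cont[OF that(1)] that(2)])
  have ux_c: "continuous_on {0..a} (ux t)" if "t \<in> {0<..T}" for t
    by (rule DERIV_continuous_on[OF uxx_d[OF that]])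
  have ux_d: "((\<lambda>y. u t y) has_real_derivative ux t x) (at x within {0..a})" if "t \<in> {0<..T}" "x \<in> {0..a}" for t x
  proof -
    have "((\<lambda>y. integral {0..y} (ux t)) has_real_derivative ux t x) (at x within {0..a})"
      by (rule integral_has_real_derivative[OF ux_c[OF that(1)] that(2)])
    from DERIV_add[OF DERIV_const[of "u t 0"] this]
    have *: "((\<lambda>y. u t 0 + integral {0..y} (ux t)) has_real_derivative ux t x) (at x within {0..a})" by simp
    show ?thesis
    proof (rule has_field_derivative_transform_within[OF * zero_less_one that(2)])
      fix y assume "y \<in> {0..a}"
      from dbl(2)[OF that(1) this] show "u t 0 + integral {0..y} (ux t) = u t y"
        unfolding ux_def[abs_def] by (rule sym)
    qed
  qed
  \<comment> \<open>The grid identity between the times s and t passes to the limit by dominated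
    convergence, with the bound on q valid from time s on; differentiability of the limit in time is
    a consequence.\<close>
  have ut_int: "u t x - u s x = integral {s..t} (\<lambda>r. ut r x)" if st: "0 < s" "s \<le> t" "t \<le> T" and x: "x \<in> {0..a}" for s t x
  proof -
    have FTC: "((\<lambda>r. Q (k n) r (idx a (N (k n)) x)) has_integral (U (k n) t (idx a (N (k n)) x) - U (k n) s (idx a (N (k n)) x))) {s..t}" for n
      by (rule fundamental_theorem_of_calculus[OF st(2)])
        (use st in \<open>auto simp flip: has_real_derivative_iff_has_vector_derivative intro!: has_field_derivative_subset[OF U_deriv[OF _ idx]]\<close>)
    have "(\<lambda>n. integral {s..t} (\<lambda>r. Q (k n) r (idx a (N (k n)) x))) \<longlonglongrightarrow> integral {s..t} (\<lambda>r. ut r x)"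
    proof (rule dominated_convergence(2)[where h="\<lambda>_. sqrt (B4 s)"])
      show "norm (Q (k n) r (idx a (N (k n)) x)) \<le> sqrt (B4 s)" if "r \<in> {s..t}" for n r
        unfolding real_norm_def by (rule real_le_rsqrt_abs, rule Qb[OF flow]) (use st that idx in auto)
    qed (use FTC Qlim x st in auto)
    moreover have "(\<lambda>n. U (k n) t (idx a (N (k n)) x) - U (k n) s (idx a (N (k n)) x)) \<longlonglongrightarrow> u t x - u s x"
      by (intro tendsto_diff Ulim) (use x st in auto)
    ultimately show ?thesis unfolding integral_unique[OF FTC] by (rule LIMSEQ_unique[symmetric])
  qed
  have ut_d: "((\<lambda>s. u s x) has_real_derivative ut t x) (at t)" if t: "t \<in> {0<..<T}" and x: "x \<in> {0..a}" for t x
  proof -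
    define s where "s = t / 2"
    have s: "0 < s" "s < t" using t by (auto simp: s_def)
    have "continuous_on {s..T} (\<lambda>r. ut r x)"
      using continuous_on_compose2[OF ut_cont, of "{s..T}" "\<lambda>r. (r, x)"] s x
      by (simp add: image_subset_iff continuous_on_Pair continuous_on_const continuous_on_id)
    then have "((\<lambda>r. integral {s..r} (\<lambda>r. ut r x)) has_real_derivative ut t x) (at t within {s..T})"
      by (rule integral_has_real_derivative) (use s t in auto)
    then have "((\<lambda>r. integral {s..r} (\<lambda>r. ut r x)) has_real_derivative ut t x) (at t)"
      using s t by (simp add: at_within_Icc_at)
    from DERIV_add[OF DERIV_const[of "u s x"] this]
    have *: "((\<lambda>r. u s x + integral {s..r} (\<lambda>r. ut r x)) has_real_derivative ut t x) (at t)" by simp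
    show ?thesis
    proof (rule DERIV_cong_ev[THEN iffD1, OF refl _ refl *])
      have "\<forall>\<^sub>F r in nhds t. r \<in> {s<..<T}" using s t by (intro eventually_nhds_in_open) auto
      then show "\<forall>\<^sub>F r in nhds t. u s x + integral {s..r} (\<lambda>r. ut r x) = u r x"
      proof eventually_elim
        case (elim r)
        then show ?case using ut_int[of s r x] s(1) x by simp
      qed
    qed
  qed
  show thesis
  proof (rule that[of u ut ux g])
    show "continuous_on ({0<..T} \<times> {0..a}) (\<lambda>(t, x). ux t x)"
      unfolding ux_def by (rule continuous_on_integral_upper[OF g_cont])
    show "ut t x = u t x powr p * (g t x + u t x - mean a (u t))" if "t \<in> {0<..T}" "x \<in> {0..a}" for t x
      using u_pos[of t x] that by (simp add: g_def)
    show "ux t 0 = 0" "ux t a = 0" if "t \<in> {0<..T}" for t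
      using dbl(1)[OF that] by (auto simp: ux_def)
  qed (fact u_cont u_pos u_init ut_cont g_cont ut_d ux_d uxx_d)+
qed

section \<open>Weak derivatives and the energy of smooth functions\<close>

lemma power_le_fact_exp:
  fixes t :: real
  assumes "0 \<le> t"
  shows "t ^ n \<le> fact n * exp t"
proof -
  have "(\<Sum>i\<in>{n}. t ^ i /\<^sub>R fact i) \<le> exp t"
    unfolding exp_def by (rule sum_le_suminf[OF summable_exp_generic]) (use assms in auto)
  then show ?thesis by (simp add: field_simps)
qed

text \<open>These functions are closed under differentiation, which makes them smooth.\<close>

definition expfun :: "real poly \<Rightarrow> real poly \<Rightarrow> nat \<Rightarrow> real \<Rightarrow> real" where
  "expfun w P k x = (if 0 < poly w x then poly P x * (1 / poly w x) ^ k * exp (- 1 / poly w x) else 0)"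

text \<open>With t = 1 / w this is t^(k + 2) exp (- t) \<le> (k + 2)!. Two spare powers of w are
  kept: at a zero of w one is used up by the difference quotient, and the other tends to 0.\<close>

lemma expfun_bound: "\<bar>expfun w P k x\<bar> \<le> \<bar>poly P x\<bar> * fact (k + 2) * (poly w x)\<^sup>2"
proof (cases "0 < poly w x")
  case True
  define t where "t = 1 / poly w x"
  have t: "0 < t" "poly w x = 1 / t" using True by (auto simp: t_def)
  have "t ^ (k + 2) * exp (- t) \<le> fact (k + 2)"
    using power_le_fact_exp[of t "k + 2"] t by (simp add: exp_minus field_simps del: fact_Suc)
  then have "t ^ k * exp (- t) \<le> fact (k + 2) * (1 / t)\<^sup>2"
    using t by (simp add: field_simps power_add power2_eq_square del: fact_Suc)
  then have "\<bar>poly P x\<bar> * (t ^ k * exp (- t)) \<le> \<bar>poly P x\<bar> * (fact (k + 2) * (1 / t)\<^sup>2)"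
    by (intro mult_left_mono) auto
  moreover have "expfun w P k x = poly P x * (t ^ k * exp (- t))" using True by (simp add: expfun_def t_def)
  ultimately show ?thesis using t by (simp add: abs_mult mult_ac del: fact_Suc)
qed (simp add: expfun_def)

text \<open>Where w > 0 the three terms of the product rule are brought to the common power 1 / w^(k
  + 2). At a zero of w the difference quotient is dominated by that of w times a factor |w|, thanks
  to \<open>expfun_bound\<close>.\<close>

lemma expfun_deriv:
  "(expfun w P k has_real_derivative
     expfun w (pderiv P * w\<^sup>2 - of_nat k * P * pderiv w * w + P * pderiv w) (k + 2) x) (at x)"
proof -
  have cw: "isCont (poly w) x" by simp
  consider "0 < poly w x" | "poly w x < 0" | "poly w x = 0" by linarith
  then show ?thesis
  proof cases
    case 1
    define W where "W = poly w x"
    have W: "W > 0" using 1 by (simp add: W_def)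
    let ?f = "\<lambda>x. poly P x * (1 / poly w x) ^ k * exp (- 1 / poly w x)"
    have ev: "\<forall>\<^sub>F y in nhds x. 0 < poly w y"
      using cw 1 by (auto simp: isCont_def tendsto_at_iff_tendsto_nhds dest: order_tendstoD(1))
    have pw: "((\<lambda>x. (1 / poly w x) ^ k) has_real_derivative - (of_nat k * poly (pderiv w) x * (1 / W) ^ (k + 1))) (at x)"
    proof (cases k)
      case (Suc j)
      have "((\<lambda>x. (1 / poly w x) ^ k) has_real_derivative of_nat k * (1 / W) ^ (k - 1) * (- (poly (pderiv w) x / W\<^sup>2))) (at x)"
        using W by (auto intro!: derivative_eq_intros simp: W_def power2_eq_square)
      moreover have "of_nat k * (1 / W) ^ (k - 1) * (- (poly (pderiv w) x / W\<^sup>2)) = - (of_nat k * poly (pderiv w) x * (1 / W) ^ (k + 1))"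
        using W by (simp add: Suc field_simps power2_eq_square)
      ultimately show ?thesis by simp
    qed simp
    have ex: "((\<lambda>x. exp (- 1 / poly w x)) has_real_derivative exp (- 1 / W) * (poly (pderiv w) x * (1 / W)\<^sup>2)) (at x)"
      using W by (auto intro!: derivative_eq_intros simp: W_def power2_eq_square)
    have "(?f has_real_derivative
      (poly (pderiv P) x * (1 / W) ^ k + - (of_nat k * poly (pderiv w) x * (1 / W) ^ (k + 1)) * poly P x) * exp (- 1 / W)
       + exp (- 1 / W) * (poly (pderiv w) x * (1 / W)\<^sup>2) * (poly P x * (1 / W) ^ k)) (at x)"
      using DERIV_mult[OF DERIV_mult[OF poly_DERIV[of P x] pw] ex] by (simp add: W_def)
    moreover have "(poly (pderiv P) x * (1 / W) ^ k + - (of_nat k * poly (pderiv w) x * (1 / W) ^ (k + 1)) * poly P x) * exp (- 1 / W)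
       + exp (- 1 / W) * (poly (pderiv w) x * (1 / W)\<^sup>2) * (poly P x * (1 / W) ^ k)
       = expfun w (pderiv P * w\<^sup>2 - of_nat k * P * pderiv w * w + P * pderiv w) (k + 2) x"
    proof -
      have "(1 / W) ^ k = W\<^sup>2 * (1 / W) ^ (k + 2)" "(1 / W) ^ (k + 1) = W * (1 / W) ^ (k + 2)" "(1 / W)\<^sup>2 * (1 / W) ^ k = (1 / W) ^ (k + 2)"
        using W by (auto simp: power_add power2_eq_square)
      then show ?thesis using 1 unfolding expfun_def by (simp add: W_def[symmetric] algebra_simps)
    qed
    ultimately have "(?f has_real_derivative expfun w (pderiv P * w\<^sup>2 - of_nat k * P * pderiv w * w + P * pderiv w) (k + 2) x) (at x)"
      by simp
    moreover have "\<forall>\<^sub>F y in nhds x. ?f y = expfun w P k y" using ev by eventually_elim (simp add: expfun_def)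
    ultimately show ?thesis by (rule DERIV_cong_ev[THEN iffD1, OF refl _ refl, rotated])
  next
    case 2
    have "\<forall>\<^sub>F y in nhds x. poly w y < 0"
      using cw 2 by (auto simp: isCont_def tendsto_at_iff_tendsto_nhds dest: order_tendstoD(2))
    then have "\<forall>\<^sub>F y in nhds x. 0 = expfun w P k y" by eventually_elim (simp add: expfun_def)
    moreover have "((\<lambda>_. 0) has_real_derivative expfun w (pderiv P * w\<^sup>2 - of_nat k * P * pderiv w * w + P * pderiv w) (k + 2) x) (at x)"
      using 2 by (simp add: expfun_def)
    ultimately show ?thesis by (rule DERIV_cong_ev[THEN iffD1, OF refl _ refl])
  next
    case 3
    have d: "((\<lambda>y. (poly w y - poly w x) / (y - x)) \<longlongrightarrow> poly (pderiv w) x) (at x)"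
      using poly_DERIV[of w x] by (simp add: has_field_derivative_iff)
    have "((\<lambda>y. \<bar>(poly w y - poly w x) / (y - x)\<bar> * \<bar>poly w y\<bar> * (\<bar>poly P y\<bar> * fact (k + 2))) \<longlongrightarrow>
       \<bar>poly (pderiv w) x\<bar> * \<bar>poly w x\<bar> * (\<bar>poly P x\<bar> * fact (k + 2))) (at x)"
      by (intro tendsto_intros d isContD) auto
    then have lim: "((\<lambda>y. \<bar>(poly w y - poly w x) / (y - x)\<bar> * \<bar>poly w y\<bar> * (\<bar>poly P y\<bar> * fact (k + 2))) \<longlongrightarrow> 0) (at x)"
      by (simp add: 3)
    have "((\<lambda>y. (expfun w P k y - expfun w P k x) / (y - x)) \<longlongrightarrow> 0) (at x)"
    proof (rule Lim_null_comparison[OF always_eventually lim], rule allI)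
      fix y
      have "norm ((expfun w P k y - expfun w P k x) / (y - x)) = \<bar>expfun w P k y\<bar> / \<bar>y - x\<bar>"
        using 3 by (simp add: expfun_def abs_divide)
      also have "\<dots> \<le> (\<bar>poly P y\<bar> * fact (k + 2) * (poly w y)\<^sup>2) / \<bar>y - x\<bar>"
        by (intro divide_right_mono expfun_bound) auto
      also have "\<dots> = \<bar>(poly w y - poly w x) / (y - x)\<bar> * \<bar>poly w y\<bar> * (\<bar>poly P y\<bar> * fact (k + 2))"
        using 3 by (simp add: abs_divide power2_eq_square abs_mult mult_ac del: fact_Suc)
      finally show "norm ((expfun w P k y - expfun w P k x) / (y - x)) \<le> \<dots>" .
    qed
    then show ?thesis using 3 by (simp add: has_field_derivative_iff expfun_def)
  qed
qed

lemma deriv_expfun: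
  "deriv (expfun w P k) = expfun w (pderiv P * w\<^sup>2 - of_nat k * P * pderiv w * w + P * pderiv w) (k + 2)"
  by (rule ext, rule DERIV_imp_deriv, rule expfun_deriv)

lemma funpow_deriv_expfun: "\<exists>Q j. (deriv ^^ n) (expfun w P k) = expfun w Q j"
  by (induction n) (auto simp: deriv_expfun, blast+)

lemma expfun_differentiable: "(deriv ^^ n) (expfun w P k) differentiable (at x)"
  using funpow_deriv_expfun[of n w P k] expfun_deriv unfolding real_differentiable_def by metis

lemma expfun_measurable [measurable]: "expfun w P k \<in> borel_measurable borel"
  by (intro borel_measurable_continuous_onI continuous_at_imp_continuous_on ballI DERIV_isCont[OF expfun_deriv])

text \<open>The set where this polynomial is nonnegative is a compact part of \<open>(0, a)\<close>, and the polynomial tends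
  to infinity there as \<open>n \<rightarrow> \<infinity>\<close>, so that \<open>expfun (bump_poly a n) P 0\<close> approximates \<open>P\<close>.\<close>

definition bump_poly :: "real \<Rightarrow> nat \<Rightarrow> real poly" where
  "bump_poly a n = [:- 1, real n * a, - real n:]"

lemma poly_bump: "poly (bump_poly a n) x = real n * (x * (a - x)) - 1"
  by (simp add: bump_poly_def algebra_simps)

lemma poly_pderiv_bump: "poly (pderiv (bump_poly a n)) x = real n * (a - 2 * x)"
  by (simp add: bump_poly_def pderiv_pCons algebra_simps)

lemma test_function_bump:
  assumes "0 < a"
  shows "test_function a (expfun (bump_poly a n) P 0)"
proof -
  have "closed {x. 0 \<le> poly (bump_poly a n) x}"
    by (intro closed_Collect_le continuous_intros)
  moreover have "{x. expfun (bump_poly a n) P 0 x \<noteq> 0} \<subseteq> {x. 0 \<le> poly (bump_poly a n) x}"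
    by (auto simp: expfun_def split: if_splits)
  ultimately have "closure {x. expfun (bump_poly a n) P 0 x \<noteq> 0} \<subseteq> {x. 0 \<le> poly (bump_poly a n) x}"
    by (rule closure_minimal[rotated])
  also have "\<dots> \<subseteq> {0<..<a}"
  proof
    fix x assume "x \<in> {x. 0 \<le> poly (bump_poly a n) x}"
    then have "1 \<le> real n * (x * (a - x))" by (simp add: poly_bump)
    then have "0 < x * (a - x)" by (metis less_le_not_le mult_nonneg_nonpos not_less of_nat_0_le_iff order_trans zero_less_one)
    then show "x \<in> {0<..<a}" using assms by (auto simp: zero_less_mult_iff)
  qed
  finally show ?thesis by (simp add: test_function_def expfun_differentiable)
qed

lemma bump_poly_tends:
  assumes "x \<in> {0<..<a}"
  shows "filterlim (\<lambda>n. poly (bump_poly a n) x) at_top sequentially"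
proof -
  have "0 < x * (a - x)" using assms by simp
  then have "filterlim (\<lambda>n. real n * (x * (a - x))) at_top sequentially"
    by (intro filterlim_at_top_mult_tendsto_pos[OF tendsto_const _ filterlim_real_sequentially] filterlim_tendsto_pos_mult_at_top) auto
  then show ?thesis unfolding poly_bump
    using filterlim_tendsto_add_at_top[OF tendsto_const[of "-1"]] by force
qed

section \<open>Polynomials and continuously differentiable functions as test functions\<close>

lemma set_integral_limit:
  fixes f :: "real \<Rightarrow> real" and \<phi> :: "nat \<Rightarrow> real \<Rightarrow> real"
  assumes f: "set_integrable lebesgue {0<..<a} f"
    and meas: "\<And>n. \<phi> n \<in> borel_measurable borel" "\<psi> \<in> borel_measurable lebesgue"
    and lim: "AE x in lebesgue. x \<in> {0<..<a} \<longrightarrow> (\<lambda>n. \<phi> n x) \<longlonglongrightarrow> \<psi> x"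
    and bound: "\<And>n x. x \<in> {0<..<a} \<Longrightarrow> \<bar>\<phi> n x\<bar> \<le> B"
  shows "(\<lambda>n. LINT x:{0<..<a}|lebesgue. f x * \<phi> n x) \<longlonglongrightarrow> (LINT x:{0<..<a}|lebesgue. f x * \<psi> x)"
  unfolding set_lebesgue_integral_def
proof (rule integral_dominated_convergence[where w="\<lambda>x. B * \<bar>indicator {0<..<a} x *\<^sub>R f x\<bar>"])
  have fm: "(\<lambda>x. indicator {0<..<a} x *\<^sub>R f x) \<in> borel_measurable lebesgue"
    using f unfolding set_integrable_def by auto
  have m: "g \<in> borel_measurable lebesgue" if "g \<in> borel_measurable borel" for g :: "real \<Rightarrow> real"
    using measurable_completion[of g lborel borel] that by simp
  have "(\<lambda>x. (indicator {0<..<a} x *\<^sub>R f x) * g x) \<in> borel_measurable lebesgue" if "g \<in> borel_measurable lebesgue" for g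
    by (intro borel_measurable_times fm that)
  then show "(\<lambda>x. indicat_real {0<..<a} x *\<^sub>R (f x * \<psi> x)) \<in> borel_measurable lebesgue"
    "(\<lambda>x. indicat_real {0<..<a} x *\<^sub>R (f x * \<phi> n x)) \<in> borel_measurable lebesgue" for n
    using meas(2) m[OF meas(1)] by (auto simp: mult.assoc)
  show "integrable lebesgue (\<lambda>x. B * \<bar>indicator {0<..<a} x *\<^sub>R f x\<bar>)"
    using f unfolding set_integrable_def by (intro integrable_mult_right integrable_abs)
  show "AE x in lebesgue. (\<lambda>n. indicat_real {0<..<a} x *\<^sub>R (f x * \<phi> n x)) \<longlonglongrightarrow> indicat_real {0<..<a} x *\<^sub>R (f x * \<psi> x)"
    using lim by eventually_elim (auto simp: indicator_def intro!: tendsto_intros)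
  show "AE x in lebesgue. norm (indicat_real {0<..<a} x *\<^sub>R (f x * \<phi> n x)) \<le> B * \<bar>indicat_real {0<..<a} x *\<^sub>R f x\<bar>" for n
    using bound[of _ n] by (intro AE_I2) (auto simp: indicator_def abs_mult mult.commute[of "\<bar>f _\<bar>"] intro!: mult_right_mono)
qed

lemma expfun_bump_0:
  fixes P :: "real poly"
  assumes a: "0 < a"
  shows "\<exists>B. (\<forall>n. \<forall>x\<in>{0<..<a}. \<bar>expfun (bump_poly a n) P 0 x\<bar> \<le> B)
    \<and> (\<forall>x\<in>{0<..<a}. (\<lambda>n. expfun (bump_poly a n) P 0 x) \<longlonglongrightarrow> poly P x)"
proof -
  have "bounded (poly P ` {0..a})"
    by (intro compact_imp_bounded compact_continuous_image continuous_intros compact_Icc)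
  then obtain B where "\<forall>x\<in>{0..a}. \<bar>poly P x\<bar> \<le> B" by (auto simp: bounded_iff)
  then have B: "\<bar>poly P x\<bar> \<le> B" if "x \<in> {0..a}" for x using that by blast
  have B0: "0 \<le> B" using B[of 0] a by auto
  show ?thesis
  proof (intro exI conjI allI ballI)
    fix n x assume x: "x \<in> {0<..<a}"
    show "\<bar>expfun (bump_poly a n) P 0 x\<bar> \<le> B"
    proof (cases "0 < poly (bump_poly a n) x")
      case True
      then have "exp (- 1 / poly (bump_poly a n) x) \<le> 1" by simp
      then have "\<bar>poly P x\<bar> * exp (- 1 / poly (bump_poly a n) x) \<le> B * 1"
        using B[of x] x B0 by (intro mult_mono) auto
      then show ?thesis using True by (simp add: expfun_def abs_mult)
    qed (use B0 in \<open>simp add: expfun_def\<close>)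
  next
    fix x assume x: "x \<in> {0<..<a}"
    let ?w = "\<lambda>n. poly (bump_poly a n) x"
    have top: "filterlim ?w at_top sequentially" by (rule bump_poly_tends[OF x])
    have "(\<lambda>n. - 1 / ?w n) \<longlonglongrightarrow> 0"
      by (rule tendsto_divide_0[OF tendsto_const]) (rule filterlim_at_top_imp_at_infinity[OF top])
    then have "(\<lambda>n. poly P x * exp (- 1 / ?w n)) \<longlonglongrightarrow> poly P x * exp 0" by (intro tendsto_intros)
    moreover have "\<forall>\<^sub>F n in sequentially. poly P x * exp (- 1 / ?w n) = expfun (bump_poly a n) P 0 x"
      using filterlim_at_top_dense[THEN iffD1, OF top, rule_format, of 0] by eventually_elim (simp add: expfun_def)
    ultimately show "(\<lambda>n. expfun (bump_poly a n) P 0 x) \<longlonglongrightarrow> poly P x" by (auto dest: Lim_transform_eventually)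
  qed
qed

text \<open>Differentiating the cutoff produces a factor n / w^2, which is not bounded in n. Since P
  vanishes at both ends, |P| \<le> C x (a - x), and n x (a - x) = w + 1 turns the product into a
  multiple of 1 / w + 1 / w^2. The factor exp (- 1 / w) keeps this bounded, and it tends to 0
  pointwise.\<close>

lemma expfun_bump_deriv:
  fixes P :: "real poly"
  assumes a: "0 < a" and P: "poly P 0 = 0" "poly P a = 0"
  shows "\<exists>B. (\<forall>n. \<forall>x\<in>{0<..<a}. \<bar>deriv (expfun (bump_poly a n) P 0) x\<bar> \<le> B)
    \<and> (\<forall>x\<in>{0<..<a}. (\<lambda>n. deriv (expfun (bump_poly a n) P 0) x) \<longlonglongrightarrow> poly (pderiv P) x)"
proof -
  have "bounded (poly (pderiv P) ` {0..a})"
    by (intro compact_imp_bounded compact_continuous_image continuous_intros compact_Icc)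
  then obtain B1 where "\<forall>x\<in>{0..a}. \<bar>poly (pderiv P) x\<bar> \<le> B1" by (auto simp: bounded_iff)
  then have B1: "\<bar>poly (pderiv P) x\<bar> \<le> B1" if "x \<in> {0..a}" for x using that by blast
  obtain Q where Q: "P = [:0, 1:] * Q" using P(1) by (auto simp: poly_eq_0_iff_dvd elim: dvdE)
  then have "poly Q a = 0" using P(2) a by simp
  then obtain R where R: "Q = [:- a, 1:] * R" by (auto simp: poly_eq_0_iff_dvd elim: dvdE)
  have "bounded (poly R ` {0..a})"
    by (intro compact_imp_bounded compact_continuous_image continuous_intros compact_Icc)
  then obtain C where "\<forall>x\<in>{0..a}. \<bar>poly R x\<bar> \<le> C" by (auto simp: bounded_iff)
  then have C: "\<bar>poly R x\<bar> \<le> C" if "x \<in> {0..a}" for x using that by blast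
  have C0: "0 \<le> C" "0 \<le> B1" using C[of 0] B1[of 0] a by auto
  have Px: "\<bar>poly P x\<bar> \<le> C * (x * (a - x))" if "x \<in> {0<..<a}" for x
  proof -
    have "poly P x = - (x * (a - x)) * poly R x" by (simp add: Q R algebra_simps)
    then have "\<bar>poly P x\<bar> = x * (a - x) * \<bar>poly R x\<bar>" using that by (simp add: abs_mult)
    also have "\<dots> \<le> x * (a - x) * C" using that C[of x] by (intro mult_left_mono) auto
    finally show ?thesis by (simp add: mult.commute)
  qed
  define w where "w n x = poly (bump_poly a n) x" for n x
  have key: "deriv (expfun (bump_poly a n) P 0) x = poly (pderiv P) x * exp (- 1 / w n x) + poly P x * (real n * (a - 2 * x)) * (1 / w n x)\<^sup>2 * exp (- 1 / w n x)"
    if "0 < w n x" for n x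
    using that unfolding deriv_expfun by (simp add: expfun_def poly_pderiv_bump w_def field_simps power2_eq_square)
  have neg: "deriv (expfun (bump_poly a n) P 0) x = 0" if "\<not> 0 < w n x" for n x
    using that unfolding deriv_expfun by (simp add: expfun_def w_def)
  have est: "\<bar>poly P x * (real n * (a - 2 * x)) * (1 / w n x)\<^sup>2\<bar> \<le> C * a * (1 / w n x + (1 / w n x)\<^sup>2)"
    if x: "x \<in> {0<..<a}" and w: "0 < w n x" for n x
  proof -
    have "\<bar>poly P x * (real n * (a - 2 * x))\<bar> \<le> (C * (x * (a - x))) * (real n * a)"
      unfolding abs_mult using x Px[OF x] C0 by (intro mult_mono) auto
    also have "\<dots> = C * a * (w n x + 1)" by (simp add: w_def poly_bump)
    finally have "\<bar>poly P x * (real n * (a - 2 * x))\<bar> * (1 / w n x)\<^sup>2 \<le> C * a * (w n x + 1) * (1 / w n x)\<^sup>2"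
      by (intro mult_right_mono) auto
    also have "\<dots> = C * a * (1 / w n x + (1 / w n x)\<^sup>2)" using w by (simp add: field_simps power2_eq_square)
    finally show ?thesis by (simp add: abs_mult)
  qed
  show ?thesis
  proof (intro exI conjI allI ballI)
    fix n x assume x: "x \<in> {0<..<a}"
    show "\<bar>deriv (expfun (bump_poly a n) P 0) x\<bar> \<le> B1 + C * a * 3"
    proof (cases "0 < w n x")
      case True
      define t where "t = 1 / w n x"
      have t: "0 < t" using True by (simp add: t_def)
      have e: "exp (- t) \<le> 1" "t * exp (- t) \<le> 1" "t\<^sup>2 * exp (- t) \<le> 2"
        using t power_le_fact_exp[of t 1] power_le_fact_exp[of t 2] by (auto simp: exp_minus field_simps fact_numeral)
      have 1: "\<bar>poly (pderiv P) x\<bar> * exp (- t) \<le> B1 * 1" using B1[of x] x e C0 by (intro mult_mono) auto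
      have "\<bar>poly P x * (real n * (a - 2 * x)) * t\<^sup>2\<bar> * exp (- t) \<le> C * a * (t + t\<^sup>2) * exp (- t)"
        using est[OF x True] by (intro mult_right_mono) (auto simp: t_def)
      also have "\<dots> = C * a * (t * exp (- t) + t\<^sup>2 * exp (- t))" by (simp add: algebra_simps)
      also have "\<dots> \<le> C * a * 3" using e C0 a by (intro mult_left_mono) auto
      finally have 2: "\<bar>poly P x * (real n * (a - 2 * x)) * t\<^sup>2\<bar> * exp (- t) \<le> C * a * 3" .
      have "\<bar>deriv (expfun (bump_poly a n) P 0) x\<bar> \<le> \<bar>poly (pderiv P) x * exp (- t)\<bar> + \<bar>poly P x * (real n * (a - 2 * x)) * t\<^sup>2 * exp (- t)\<bar>"
        unfolding key[OF True] by (rule order_trans[OF abs_triangle_ineq]) (simp add: t_def)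
      then show ?thesis using 1 2 unfolding abs_mult by simp
    qed (use neg C0 a in simp)
  next
    fix x assume x: "x \<in> {0<..<a}"
    have top: "filterlim (\<lambda>n. w n x) at_top sequentially" unfolding w_def by (rule bump_poly_tends[OF x])
    have t0: "(\<lambda>n. 1 / w n x) \<longlonglongrightarrow> 0"
      by (rule tendsto_divide_0[OF tendsto_const]) (rule filterlim_at_top_imp_at_infinity[OF top])
    have ev: "\<forall>\<^sub>F n in sequentially. 0 < w n x"
      using filterlim_at_top_dense[THEN iffD1, OF top] by blast
    have "(\<lambda>n. C * a * (1 / w n x + (1 / w n x)\<^sup>2)) \<longlonglongrightarrow> C * a * (0 + 0\<^sup>2)" by (intro tendsto_intros t0)
    then have z: "(\<lambda>n. C * a * (1 / w n x + (1 / w n x)\<^sup>2)) \<longlonglongrightarrow> 0" by simp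
    have A: "(\<lambda>n. poly P x * (real n * (a - 2 * x)) * (1 / w n x)\<^sup>2) \<longlonglongrightarrow> 0"
      by (rule Lim_null_comparison[OF _ z]) (use ev in eventually_elim, use est[OF x] in auto)
    have B: "(\<lambda>n. exp (- (1 / w n x))) \<longlonglongrightarrow> exp (- 0)" by (intro tendsto_intros t0)
    have "(\<lambda>n. poly (pderiv P) x * exp (- (1 / w n x)) + poly P x * (real n * (a - 2 * x)) * (1 / w n x)\<^sup>2 * exp (- (1 / w n x)))
       \<longlonglongrightarrow> poly (pderiv P) x * exp (- 0) + 0 * exp (- 0)"
      by (rule tendsto_add[OF tendsto_mult[OF tendsto_const B] tendsto_mult[OF A B]])
    then have "(\<lambda>n. poly (pderiv P) x * exp (- (1 / w n x)) + poly P x * (real n * (a - 2 * x)) * (1 / w n x)\<^sup>2 * exp (- (1 / w n x))) \<longlonglongrightarrow> poly (pderiv P) x" by simp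
    moreover have "\<forall>\<^sub>F n in sequentially. poly (pderiv P) x * exp (- (1 / w n x)) + poly P x * (real n * (a - 2 * x)) * (1 / w n x)\<^sup>2 * exp (- (1 / w n x)) = deriv (expfun (bump_poly a n) P 0) x"
      using ev by eventually_elim (simp add: key)
    ultimately show "(\<lambda>n. deriv (expfun (bump_poly a n) P 0) x) \<longlonglongrightarrow> poly (pderiv P) x"
      by (rule Lim_transform_eventually)
  qed
qed

lemma LINT_Ioo:
  fixes h :: "real \<Rightarrow> real"
  assumes "continuous_on {0..a} h"
  shows "set_integrable lebesgue {0<..<a} h" "(LINT x:{0<..<a}|lebesgue. h x) = integral {0..a} h"
proof -
  have "set_integrable lebesgue {0..a} h"
    using borel_integrable_atLeastAtMost'[OF assms] unfolding set_integrable_def by (simp add: integrable_completion)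
  then show *: "set_integrable lebesgue {0<..<a} h" by (rule set_integrable_subset) auto
  show "(LINT x:{0<..<a}|lebesgue. h x) = integral {0..a} h"
    using set_lebesgue_integral_eq_integral(2)[OF *] by (simp add: integral_open_interval_real)
qed

lemma square_integrable_continuous:
  assumes "continuous_on {0..a} f"
  shows "square_integrable_on f {0<..<a}"
  using LINT_Ioo(1)[OF assms] LINT_Ioo(1)[of a "\<lambda>x. (f x)\<^sup>2"] assms
  by (auto simp: square_integrable_on_def set_borel_measurable_def set_integrable_def intro!: continuous_intros)

lemma set_integrable_square:
  assumes "square_integrable_on f {0<..<a}"
  shows "set_integrable lebesgue {0<..<a} f"
proof -
  have "set_integrable lebesgue {0<..<a} (\<lambda>x. 1 + (f x)\<^sup>2)"
    using assms LINT_Ioo(1)[of a "\<lambda>_. 1"] by (auto simp: square_integrable_on_def intro: set_integral_add)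
  then show ?thesis unfolding set_integrable_def
  proof (rule Bochner_Integration.integrable_bound)
    show "(\<lambda>x. indicat_real {0<..<a} x *\<^sub>R f x) \<in> borel_measurable lebesgue"
      using assms by (simp add: square_integrable_on_def set_borel_measurable_def)
    have "\<bar>y\<bar> \<le> 1 + y\<^sup>2" for y :: real using two_mult_le[of 1 "\<bar>y\<bar>"] by simp
    then show "AE x in lebesgue. norm (indicat_real {0<..<a} x *\<^sub>R f x) \<le> norm (indicat_real {0<..<a} x *\<^sub>R (1 + (f x)\<^sup>2))"
      by (intro AE_I2) (auto simp: indicator_def)
  qed
qed

lemma set_integrable_mult_square:
  assumes "square_integrable_on f {0<..<a}" "square_integrable_on g {0<..<a}"
  shows "set_integrable lebesgue {0<..<a} (\<lambda>x. f x * g x)"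
proof -
  have "set_integrable lebesgue {0<..<a} (\<lambda>x. (f x)\<^sup>2 + (g x)\<^sup>2)"
    using assms by (auto simp: square_integrable_on_def intro: set_integral_add)
  then show ?thesis unfolding set_integrable_def
  proof (rule Bochner_Integration.integrable_bound)
    have "(\<lambda>x. (indicat_real {0<..<a} x *\<^sub>R f x) * (indicat_real {0<..<a} x *\<^sub>R g x)) \<in> borel_measurable lebesgue"
      using assms by (intro borel_measurable_times) (auto simp: square_integrable_on_def set_borel_measurable_def)
    then show "(\<lambda>x. indicat_real {0<..<a} x *\<^sub>R (f x * g x)) \<in> borel_measurable lebesgue"
      by (rule measurable_cong[THEN iffD1, rotated]) (auto simp: indicator_def)
    have "\<bar>y * z\<bar> \<le> y\<^sup>2 + z\<^sup>2" for y z :: real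
    proof -
      have "0 \<le> \<bar>y\<bar> * \<bar>z\<bar>" by simp
      then show ?thesis using two_mult_le[of "\<bar>y\<bar>" "\<bar>z\<bar>"] unfolding abs_mult power2_abs by linarith
    qed
    then show "AE x in lebesgue. norm (indicat_real {0<..<a} x *\<^sub>R (f x * g x)) \<le> norm (indicat_real {0<..<a} x *\<^sub>R ((f x)\<^sup>2 + (g x)\<^sup>2))"
      by (intro AE_I2) (auto simp: indicator_def)
  qed
qed

lemma poly_integral:
  fixes q :: "real \<Rightarrow> real"
  assumes "real_polynomial_function q"
  obtains P where "poly P 0 = 0" "poly (pderiv P) = q"
proof -
  obtain c n where q: "q = (\<lambda>x. \<Sum>i\<le>n. c i * x ^ i)"
    using assms real_polynomial_function_iff_sum by blast
  define P where "P = (\<Sum>i\<le>n. monom (c i / real (Suc i)) (Suc i))"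
  show thesis
  proof
    show "poly P 0 = 0" by (simp add: P_def poly_sum poly_monom)
    have "pderiv (\<Sum>i\<le>n. monom (c i / real (Suc i)) (Suc i)) = (\<Sum>i\<le>n. monom (c i) i)" for n
      by (induction n) (simp_all add: pderiv_add pderiv_monom del: of_nat_Suc)
    then have "pderiv P = (\<Sum>i\<le>n. monom (c i) i)" by (simp add: P_def)
    then show "poly (pderiv P) = q" by (auto simp: q poly_sum poly_monom)
  qed
qed

text \<open>Weierstrass is applied to the derivative and the result integrated, which makes both
  close; subtracting the linear function c x restores the zero at a and costs no more than the error
  there.\<close>

lemma C1_poly_approx:
  fixes \<psi> \<psi>' :: "real \<Rightarrow> real"
  assumes a: "0 < a" and d: "\<And>x. x \<in> {0..a} \<Longrightarrow> (\<psi> has_real_derivative \<psi>' x) (at x within {0..a})"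
    and c: "continuous_on {0..a} \<psi>'" and bc: "\<psi> 0 = 0" "\<psi> a = 0" and e: "0 < e"
  shows "\<exists>P. poly P 0 = 0 \<and> poly P a = 0 \<and> (\<forall>x\<in>{0..a}. \<bar>poly P x - \<psi> x\<bar> \<le> e \<and> \<bar>poly (pderiv P) x - \<psi>' x\<bar> \<le> e)"
proof -
  \<comment> \<open>Half of the tolerance is for the approximation and half for the linear
    correction, in the values as well as in the derivatives.\<close>
  define e' where "e' = min (e / 2) (e / (2 * a))"
  have e': "0 < e'" "2 * e' \<le> e" "2 * (e' * a) \<le> e"
  proof -
    show "0 < e'" "2 * e' \<le> e" using e a by (auto simp: e'_def)
    have "e' * a \<le> e / (2 * a) * a" using a by (intro mult_right_mono) (auto simp: e'_def)
    then show "2 * (e' * a) \<le> e" using a by simp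
  qed
  obtain q where q: "real_polynomial_function q" "\<And>x. x \<in> {0..a} \<Longrightarrow> \<bar>\<psi>' x - q x\<bar> < e'"
    using Stone_Weierstrass_real_polynomial_function[OF compact_Icc c e'(1)] by blast
  obtain I where I: "poly I 0 = 0" "poly (pderiv I) = q" using poly_integral[OF q(1)] by blast
  have est: "\<bar>poly I x - \<psi> x\<bar> \<le> e' * a" if x: "x \<in> {0..a}" for x
  proof -
    have "norm ((poly I x - \<psi> x) - (poly I 0 - \<psi> 0)) \<le> e' * norm (x - 0)"
    proof (rule field_differentiable_bound[of "{0..a}"])
      fix z assume z: "z \<in> {0..a}"
      show "((\<lambda>x. poly I x - \<psi> x) has_field_derivative q z - \<psi>' z) (at z within {0..a})"
        by (rule DERIV_diff[OF has_field_derivative_at_within[OF poly_DERIV, of I z, unfolded I] d[OF z]])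
      show "norm (q z - \<psi>' z) \<le> e'" using q(2)[OF z] by (simp add: abs_minus_commute)
    qed (use x a in auto)
    also have "\<dots> \<le> e' * a" using x e' by (intro mult_left_mono) auto
    finally show ?thesis using I bc by simp
  qed
  define c where "c = poly I a / a"
  have c: "\<bar>c\<bar> \<le> e'" using est[of a] a bc by (simp add: c_def abs_divide divide_le_eq)
  define P where "P = I - monom c 1"
  have P: "poly P x = poly I x - c * x" "poly (pderiv P) x = q x - c" for x
    by (auto simp: P_def poly_monom pderiv_diff pderiv_monom I)
  show ?thesis
  proof (intro exI[of _ P] conjI ballI)
    show "poly P 0 = 0" "poly P a = 0" using a I by (auto simp: P c_def)
    fix x assume x: "x \<in> {0..a}"
    have "\<bar>c * x\<bar> \<le> e' * a" unfolding abs_mult using c x by (intro mult_mono) auto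
    then show "\<bar>poly P x - \<psi> x\<bar> \<le> e" using est[OF x] e' unfolding P by linarith
    show "\<bar>poly (pderiv P) x - \<psi>' x\<bar> \<le> e" using c q(2)[OF x] e' unfolding P by linarith
  qed
qed

lemma weak_derivative_poly:
  assumes a: "0 < a" and f: "set_integrable lebesgue {0<..<a} f" and g: "set_integrable lebesgue {0<..<a} g"
    and w: "has_weak_derivative a f g" and P: "poly P 0 = 0" "poly P a = 0"
  shows "(LINT x:{0<..<a}|lebesgue. f x * poly (pderiv P) x) = - (LINT x:{0<..<a}|lebesgue. g x * poly P x)"
proof -
  define \<phi> where "\<phi> n = expfun (bump_poly a n) P 0" for n
  have pm: "poly Q \<in> borel_measurable lebesgue" for Q :: "real poly"
    using measurable_completion[of "poly Q" lborel borel] by (simp add: borel_measurable_continuous_onI continuous_intros)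
  obtain B where "\<forall>n. \<forall>x\<in>{0<..<a}. \<bar>\<phi> n x\<bar> \<le> B" "\<forall>x\<in>{0<..<a}. (\<lambda>n. \<phi> n x) \<longlonglongrightarrow> poly P x"
    using expfun_bump_0[OF a, of P] unfolding \<phi>_def by (elim exE conjE)
  then have B: "\<bar>\<phi> n x\<bar> \<le> B" "(\<lambda>n. \<phi> n x) \<longlonglongrightarrow> poly P x" if "x \<in> {0<..<a}" for n x using that by auto
  obtain B' where "\<forall>n. \<forall>x\<in>{0<..<a}. \<bar>deriv (\<phi> n) x\<bar> \<le> B'" "\<forall>x\<in>{0<..<a}. (\<lambda>n. deriv (\<phi> n) x) \<longlonglongrightarrow> poly (pderiv P) x"
    using expfun_bump_deriv[OF a P] unfolding \<phi>_def by (elim exE conjE)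
  then have B': "\<bar>deriv (\<phi> n) x\<bar> \<le> B'" "(\<lambda>n. deriv (\<phi> n) x) \<longlonglongrightarrow> poly (pderiv P) x" if "x \<in> {0<..<a}" for n x using that by auto
  have "(\<lambda>n. LINT x:{0<..<a}|lebesgue. f x * deriv (\<phi> n) x) \<longlonglongrightarrow> (LINT x:{0<..<a}|lebesgue. f x * poly (pderiv P) x)"
    by (rule set_integral_limit[OF f _ pm _ B'(1)]) (use B'(2) in \<open>auto simp: \<phi>_def deriv_expfun\<close>)
  moreover have "(\<lambda>n. LINT x:{0<..<a}|lebesgue. g x * \<phi> n x) \<longlonglongrightarrow> (LINT x:{0<..<a}|lebesgue. g x * poly P x)"
    by (rule set_integral_limit[OF g _ pm _ B(1)]) (use B(2) in \<open>auto simp: \<phi>_def\<close>)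
  then have "(\<lambda>n. - (LINT x:{0<..<a}|lebesgue. g x * \<phi> n x)) \<longlonglongrightarrow> - (LINT x:{0<..<a}|lebesgue. g x * poly P x)" by (rule tendsto_minus)
  moreover have "(LINT x:{0<..<a}|lebesgue. f x * deriv (\<phi> n) x) = - (LINT x:{0<..<a}|lebesgue. g x * \<phi> n x)" for n
    using w test_function_bump[OF a] unfolding has_weak_derivative_def \<phi>_def by blast
  ultimately show ?thesis using LIMSEQ_unique by (simp only:) blast
qed

text \<open>Polynomials vanishing at both ends approximate \<psi> together with its derivative, and
  the identity is known for them. The extension is needed because the function tested later is the
  spatial derivative of u, which vanishes at the ends but need not have compact support in the
  interior.\<close>

lemma weak_derivative_by_parts:
  fixes \<psi> \<psi>' :: "real \<Rightarrow> real"
  assumes a: "0 < a" and f: "set_integrable lebesgue {0<..<a} f" and g: "set_integrable lebesgue {0<..<a} g"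
    and w: "has_weak_derivative a f g"
    and d: "\<And>x. x \<in> {0..a} \<Longrightarrow> (\<psi> has_real_derivative \<psi>' x) (at x within {0..a})"
    and c: "continuous_on {0..a} \<psi>'" and bc: "\<psi> 0 = 0" "\<psi> a = 0"
  shows "(LINT x:{0<..<a}|lebesgue. f x * \<psi>' x) = - (LINT x:{0<..<a}|lebesgue. g x * \<psi> x)"
proof -
  have "\<exists>P. poly P 0 = 0 \<and> poly P a = 0 \<and> (\<forall>x\<in>{0..a}. \<bar>poly P x - \<psi> x\<bar> \<le> 1 / real (Suc n) \<and> \<bar>poly (pderiv P) x - \<psi>' x\<bar> \<le> 1 / real (Suc n))" for n
    by (rule C1_poly_approx[OF a d c bc]) auto
  then have "\<forall>n. \<exists>P. poly P 0 = 0 \<and> poly P a = 0 \<and> (\<forall>x\<in>{0..a}. \<bar>poly P x - \<psi> x\<bar> \<le> 1 / real (Suc n) \<and> \<bar>poly (pderiv P) x - \<psi>' x\<bar> \<le> 1 / real (Suc n))" ..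
  from choice[OF this] obtain P where PP: "\<forall>n. poly (P n) 0 = 0 \<and> poly (P n) a = 0 \<and> (\<forall>x\<in>{0..a}. \<bar>poly (P n) x - \<psi> x\<bar> \<le> 1 / real (Suc n) \<and> \<bar>poly (pderiv (P n)) x - \<psi>' x\<bar> \<le> 1 / real (Suc n))"
    by (elim exE)
  have P: "poly (P n) 0 = 0" "poly (P n) a = 0"
    "x \<in> {0..a} \<Longrightarrow> \<bar>poly (P n) x - \<psi> x\<bar> \<le> 1 / real (Suc n)"
    "x \<in> {0..a} \<Longrightarrow> \<bar>poly (pderiv (P n)) x - \<psi>' x\<bar> \<le> 1 / real (Suc n)" for n x
    using PP[rule_format, of n] by (blast, blast, blast, blast)
  have main: "(\<lambda>n. LINT x:{0<..<a}|lebesgue. h x * poly (Q n) x) \<longlonglongrightarrow> (LINT x:{0<..<a}|lebesgue. h x * \<rho> x)"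
    if h: "set_integrable lebesgue {0<..<a} h" and chi: "continuous_on {0..a} \<rho>"
      and Q: "\<And>n x. x \<in> {0..a} \<Longrightarrow> \<bar>poly (Q n) x - \<rho> x\<bar> \<le> 1 / real (Suc n)"
    for h \<rho> :: "real \<Rightarrow> real" and Q :: "nat \<Rightarrow> real poly"
  proof -
    have "bounded (\<rho> ` {0..a})" by (intro compact_imp_bounded compact_continuous_image chi compact_Icc)
    then obtain B where "\<forall>x\<in>{0..a}. \<bar>\<rho> x\<bar> \<le> B" by (auto simp: bounded_iff)
    then have B: "\<bar>\<rho> x\<bar> \<le> B" if "x \<in> {0..a}" for x using that by blast
    \<comment> \<open>Cut off outside [0, a], where nothing is known of \<rho>, to obtain
      measurability on the whole line.\<close>
    define \<rho>2 where "\<rho>2 x = indicat_real {0..a} x *\<^sub>R \<rho> x" for x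
    have "(\<lambda>x. indicat_real {0..a} x *\<^sub>R \<rho> x) \<in> borel_measurable borel"
      by (rule borel_measurable_continuous_on_indicator[OF _ chi]) simp
    then have "\<rho>2 \<in> borel_measurable lborel" unfolding \<rho>2_def[abs_def] by simp
    then have m: "\<rho>2 \<in> borel_measurable lebesgue" by (rule measurable_completion)
    have "(\<lambda>n. LINT x:{0<..<a}|lebesgue. h x * poly (Q n) x) \<longlonglongrightarrow> (LINT x:{0<..<a}|lebesgue. h x * \<rho>2 x)"
    proof (rule set_integral_limit[OF h _ m, where B="B + 1"])
      show "poly (Q n) \<in> borel_measurable borel" for n by (intro borel_measurable_continuous_onI continuous_intros)
      show "AE x in lebesgue. x \<in> {0<..<a} \<longrightarrow> (\<lambda>n. poly (Q n) x) \<longlonglongrightarrow> \<rho>2 x"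
      proof (intro AE_I2 impI)
        fix x assume x: "x \<in> {0<..<a}"
        have "(\<lambda>n. poly (Q n) x - \<rho> x) \<longlonglongrightarrow> 0"
        proof (rule Lim_null_comparison[OF always_eventually LIMSEQ_inverse_real_of_nat], rule allI)
          fix n show "norm (poly (Q n) x - \<rho> x) \<le> inverse (real (Suc n))"
            using Q[of x n] x by (simp add: inverse_eq_divide)
        qed
        then show "(\<lambda>n. poly (Q n) x) \<longlonglongrightarrow> \<rho>2 x" using x by (simp add: LIM_zero_iff \<rho>2_def)
      qed
      fix n x assume "x \<in> {0<..<a}"
      then have x: "x \<in> {0..a}" by simp
      have "\<bar>\<rho> x\<bar> \<le> B" "\<bar>poly (Q n) x - \<rho> x\<bar> \<le> 1 / real (Suc n)" by (rule B[OF x], rule Q[OF x])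
      moreover have "1 / real (Suc n) \<le> 1" by simp
      ultimately show "\<bar>poly (Q n) x\<bar> \<le> B + 1" by linarith
    qed
    moreover have "(LINT x:{0<..<a}|lebesgue. h x * \<rho>2 x) = (LINT x:{0<..<a}|lebesgue. h x * \<rho> x)"
    proof (rule set_lebesgue_integral_cong)
      show "\<forall>x. x \<in> {0<..<a} \<longrightarrow> h x * \<rho>2 x = h x * \<rho> x" by (simp add: \<rho>2_def)
    qed simp
    ultimately show ?thesis by (simp only:)
  qed
  have psic: "continuous_on {0..a} \<psi>" by (rule DERIV_continuous_on[OF d])
  have "(\<lambda>n. LINT x:{0<..<a}|lebesgue. f x * poly (pderiv (P n)) x) \<longlonglongrightarrow> (LINT x:{0<..<a}|lebesgue. f x * \<psi>' x)"
    by (rule main[of f "\<psi>'" "\<lambda>n. pderiv (P n)", OF f c P(4)])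
  moreover have "(\<lambda>n. - (LINT x:{0<..<a}|lebesgue. g x * poly (P n) x)) \<longlonglongrightarrow> - (LINT x:{0<..<a}|lebesgue. g x * \<psi> x)"
    by (rule tendsto_minus[OF main[of g \<psi> P, OF g psic P(3)]])
  moreover have "(LINT x:{0<..<a}|lebesgue. f x * poly (pderiv (P n)) x) = - (LINT x:{0<..<a}|lebesgue. g x * poly (P n) x)" for n
    by (rule weak_derivative_poly[OF a f g w P(1,2)])
  ultimately show ?thesis using LIMSEQ_unique by (simp only:) blast
qed

text \<open>The function to test with is d / (1 + |d|), bounded and of the sign of d. It is reached
  in stages: bumps approximate polynomials, polynomials approximate continuous functions, and these
  converge almost everywhere. What remains is that d^2 / (1 + |d|) has integral 0.\<close>

lemma zero_of_orthogonal_test_functions: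
  fixes d :: "real \<Rightarrow> real"
  assumes a: "0 < a" and d: "set_integrable lebesgue {0<..<a} d"
    and orth: "\<And>\<phi>. test_function a \<phi> \<Longrightarrow> (LINT x:{0<..<a}|lebesgue. d x * \<phi> x) = 0"
  shows "AE x in lebesgue. x \<in> {0<..<a} \<longrightarrow> d x = 0"
proof -
  have polym: "poly Q \<in> borel_measurable borel" for Q :: "real poly" by (intro borel_measurable_continuous_onI continuous_intros)
  have poly0: "(LINT x:{0<..<a}|lebesgue. d x * poly P x) = 0" for P
  proof -
    obtain B where "\<forall>n. \<forall>x\<in>{0<..<a}. \<bar>expfun (bump_poly a n) P 0 x\<bar> \<le> B"
      "\<forall>x\<in>{0<..<a}. (\<lambda>n. expfun (bump_poly a n) P 0 x) \<longlonglongrightarrow> poly P x"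
      using expfun_bump_0[OF a, of P] by (elim exE conjE)
    then have B: "\<bar>expfun (bump_poly a n) P 0 x\<bar> \<le> B" "(\<lambda>n. expfun (bump_poly a n) P 0 x) \<longlonglongrightarrow> poly P x"
      if "x \<in> {0<..<a}" for n x using that by auto
    have "(\<lambda>n. LINT x:{0<..<a}|lebesgue. d x * expfun (bump_poly a n) P 0 x) \<longlonglongrightarrow> (LINT x:{0<..<a}|lebesgue. d x * poly P x)"
      using measurable_completion[of "poly P" lborel borel] polym
      by (intro set_integral_limit[OF d _ _ _ B(1)]) (use B(2) in auto)
    then show ?thesis using orth[OF test_function_bump[OF a]] by (simp add: LIMSEQ_const_iff)
  qed
  define D where "D x = indicat_real {0<..<a} x *\<^sub>R d x" for x
  have Dm: "D \<in> borel_measurable lebesgue" using d unfolding set_integrable_def D_def by auto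
  have "D measurable_on UNIV" by (rule lebesgue_measurable_imp_measurable_on_real[OF Dm]) simp
  then obtain N g where N: "negligible N" and g: "\<And>n. continuous_on UNIV (g n :: real \<Rightarrow> real)"
    "\<And>x. x \<notin> N \<Longrightarrow> (\<lambda>n. g n x) \<longlonglongrightarrow> D x"
    unfolding measurable_on_def by auto
  \<comment> \<open>The map y / (1 + |y|) bounds the continuous approximants uniformly, as dominated
    convergence requires.\<close>
  define \<psi> where "\<psi> n x = g n x / (1 + \<bar>g n x\<bar>)" for n x
  have pc: "continuous_on {0..a} (\<psi> n)" for n
    unfolding \<psi>_def by (intro continuous_intros continuous_on_subset[OF g(1)]) (auto simp: add_nonneg_eq_0_iff)
  have pb: "\<bar>\<psi> n x\<bar> \<le> 1" for n x by (simp add: \<psi>_def abs_divide divide_le_eq)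
  have "\<exists>P. \<forall>x\<in>{0..a}. \<bar>\<psi> n x - poly P x\<bar> < 1 / real (Suc n)" for n
  proof -
    obtain q where q: "real_polynomial_function q" "\<And>x. x \<in> {0..a} \<Longrightarrow> \<bar>\<psi> n x - q x\<bar> < 1 / real (Suc n)"
      using Stone_Weierstrass_real_polynomial_function[OF compact_Icc pc[of n], of "1 / real (Suc n)"] by auto
    obtain I where "poly (pderiv I) = q" using poly_integral[OF q(1)] by blast
    then show ?thesis using q(2) by metis
  qed
  then obtain P where P: "\<And>n x. x \<in> {0..a} \<Longrightarrow> \<bar>\<psi> n x - poly (P n) x\<bar> < 1 / real (Suc n)" by metis
  have m: "(\<lambda>x. D x / (1 + \<bar>D x\<bar>)) \<in> borel_measurable lebesgue" using Dm by measurable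
  have Pb: "\<bar>poly (P n) x\<bar> \<le> 2" if "x \<in> {0<..<a}" for n x
  proof -
    have "1 / real (Suc n) \<le> 1" by simp
    moreover have "\<bar>\<psi> n x - poly (P n) x\<bar> < 1 / real (Suc n)" by (rule P) (use that in auto)
    ultimately show ?thesis using pb[of n x] by linarith
  qed
  have AEN: "AE x in lebesgue. x \<notin> N" using N by (simp add: negligible_iff_null_sets AE_not_in)
  have "(\<lambda>n. LINT x:{0<..<a}|lebesgue. d x * poly (P n) x) \<longlonglongrightarrow> (LINT x:{0<..<a}|lebesgue. d x * (D x / (1 + \<bar>D x\<bar>)))"
  proof (rule set_integral_limit[OF d polym m _ Pb])
    from AEN show "AE x in lebesgue. x \<in> {0<..<a} \<longrightarrow> (\<lambda>n. poly (P n) x) \<longlonglongrightarrow> D x / (1 + \<bar>D x\<bar>)"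
    proof eventually_elim
      case (elim x)
      show ?case
      proof
        assume x: "x \<in> {0<..<a}"
        have "(\<lambda>n. \<psi> n x) \<longlonglongrightarrow> D x / (1 + \<bar>D x\<bar>)" unfolding \<psi>_def
          by (intro tendsto_intros g(2)[OF elim]) (auto simp: add_nonneg_eq_0_iff)
        moreover have "(\<lambda>n. \<psi> n x - poly (P n) x) \<longlonglongrightarrow> 0"
        proof (rule Lim_null_comparison[OF always_eventually LIMSEQ_inverse_real_of_nat], rule allI)
          fix n show "norm (\<psi> n x - poly (P n) x) \<le> inverse (real (Suc n))"
            using P[of x n] x by (simp add: inverse_eq_divide)
        qed
        ultimately have "(\<lambda>n. \<psi> n x - (\<psi> n x - poly (P n) x)) \<longlonglongrightarrow> D x / (1 + \<bar>D x\<bar>) - 0" by (rule tendsto_diff)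
        then show "(\<lambda>n. poly (P n) x) \<longlonglongrightarrow> D x / (1 + \<bar>D x\<bar>)" by simp
      qed
    qed
  qed
  then have "(LINT x:{0<..<a}|lebesgue. d x * (D x / (1 + \<bar>D x\<bar>))) = 0" by (simp add: poly0 LIMSEQ_const_iff)
  then have z: "(LINT x|lebesgue. D x * (D x / (1 + \<bar>D x\<bar>))) = 0"
    unfolding set_lebesgue_integral_def by (simp add: D_def mult.assoc)
  have int: "integrable lebesgue (\<lambda>x. D x * (D x / (1 + \<bar>D x\<bar>)))"
  proof (rule Bochner_Integration.integrable_bound[of _ D])
    show "integrable lebesgue D" using d unfolding set_integrable_def D_def .
    show "(\<lambda>x. D x * (D x / (1 + \<bar>D x\<bar>))) \<in> borel_measurable lebesgue" using m Dm by measurable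
    have "\<bar>y * (y / (1 + \<bar>y\<bar>))\<bar> \<le> \<bar>y\<bar>" for y :: real
      unfolding abs_mult by (rule mult_left_le) (auto simp: abs_divide divide_le_eq)
    then show "AE x in lebesgue. norm (D x * (D x / (1 + \<bar>D x\<bar>))) \<le> norm (D x)" by simp
  qed
  have "AE x in lebesgue. D x * (D x / (1 + \<bar>D x\<bar>)) = 0"
    using integral_nonneg_eq_0_iff_AE[OF int] z by (auto simp: zero_le_mult_iff zero_le_divide_iff)
  then show ?thesis
    by eventually_elim (auto simp: D_def indicator_def add_nonneg_eq_0_iff split: if_splits)
qed

lemma classical_has_weak_derivative:
  assumes a: "0 < a" and d: "\<And>x. x \<in> {0..a} \<Longrightarrow> (f has_real_derivative f' x) (at x within {0..a})"
    and c: "continuous_on {0..a} f'"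
  shows "has_weak_derivative a f f'"
  unfolding has_weak_derivative_def
proof (intro allI impI)
  fix \<phi> assume t: "test_function a \<phi>"
  have fc: "continuous_on {0..a} f" by (rule DERIV_continuous_on[OF d])
  have smooth: "(deriv ^^ n) \<phi> differentiable (at x)" for n x
    using t unfolding test_function_def by blast
  have pd: "(\<phi> has_real_derivative deriv \<phi> x) (at x)" for x
    using smooth[of 0 x] by (simp add: DERIV_deriv_iff_real_differentiable)
  have pc: "continuous_on {0..a} (deriv \<phi>)"
  proof (rule continuous_at_imp_continuous_on, rule ballI)
    fix x show "isCont (deriv \<phi>) x"
      using smooth[of 1 x] by (simp add: differentiable_imp_continuous_within)
  qed
  have phc: "continuous_on {0..a} \<phi>" by (rule DERIV_continuous_on[OF has_field_derivative_at_within[OF pd]])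
  have "{x. \<phi> x \<noteq> 0} \<subseteq> {0<..<a}"
    using t unfolding test_function_def by (elim conjE) (rule order_trans[OF closure_subset])
  then have z: "\<phi> 0 = 0" "\<phi> a = 0" using a by auto
  have "((\<lambda>x. f x * deriv \<phi> x + f' x * \<phi> x) has_integral (f a * \<phi> a - f 0 * \<phi> 0)) {0..a}"
  proof (rule fundamental_theorem_of_calculus)
    fix x assume x: "x \<in> {0..a}"
    show "((\<lambda>x. f x * \<phi> x) has_vector_derivative f x * deriv \<phi> x + f' x * \<phi> x) (at x within {0..a})"
      unfolding has_real_derivative_iff_has_vector_derivative[symmetric]
      by (rule DERIV_mult'[OF d[OF x] has_field_derivative_at_within[OF pd]])
  qed (use a in simp)
  then have "integral {0..a} (\<lambda>x. f x * deriv \<phi> x + f' x * \<phi> x) = 0" by (simp add: z integral_unique)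
  moreover have "integral {0..a} (\<lambda>x. f x * deriv \<phi> x + f' x * \<phi> x) = integral {0..a} (\<lambda>x. f x * deriv \<phi> x) + integral {0..a} (\<lambda>x. f' x * \<phi> x)"
    by (intro integral_add integrable_continuous_interval continuous_intros fc pc phc c)
  moreover have "(LINT x:{0<..<a}|lebesgue. f x * deriv \<phi> x) = integral {0..a} (\<lambda>x. f x * deriv \<phi> x)"
    by (intro LINT_Ioo continuous_intros fc pc)
  moreover have "(LINT x:{0<..<a}|lebesgue. f' x * \<phi> x) = integral {0..a} (\<lambda>x. f' x * \<phi> x)"
    by (intro LINT_Ioo continuous_intros c phc)
  ultimately show "(LINT x:{0<..<a}|lebesgue. f x * deriv \<phi> x) = - (LINT x:{0<..<a}|lebesgue. f' x * \<phi> x)" by linarith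
qed

section \<open>Evaluation of the energy\<close>

lemma weak_derivative_spec:
  assumes "in_H1 a f"
  shows "square_integrable_on (weak_derivative a f) {0<..<a}" "has_weak_derivative a f (weak_derivative a f)"
  using someI_ex[of "\<lambda>g. square_integrable_on g {0<..<a} \<and> has_weak_derivative a f g"] assms
  by (auto simp: in_H1_def weak_derivative_def)

lemma energy_eq:
  assumes f: "continuous_on {0..a} f" and H: "in_H1 a f"
  shows "energy a f = ereal ((LINT x:{0<..<a}|lebesgue. (weak_derivative a f x)\<^sup>2) - integral {0..a} (\<lambda>x. (f x - mean a f)\<^sup>2))"
proof -
  have 1: "set_integrable lebesgue {0<..<a} (\<lambda>x. (weak_derivative a f x)\<^sup>2)"
    using weak_derivative_spec(1)[OF H] by (simp add: square_integrable_on_def)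
  have 2: "set_integrable lebesgue {0<..<a} (\<lambda>x. (f x - mean a f)\<^sup>2)"
    "(LINT x:{0<..<a}|lebesgue. (f x - mean a f)\<^sup>2) = integral {0..a} (\<lambda>x. (f x - mean a f)\<^sup>2)"
    by (intro LINT_Ioo continuous_intros f)+
  show ?thesis using H by (simp add: energy_def set_integral_diff(2)[OF 1 2(1)] 2(2))
qed

text \<open>\<open>weak_derivative\<close> is an arbitrary choice, so the claim is one of
  uniqueness: the chosen function minus f' is orthogonal to all test functions and hence vanishes
  almost everywhere.\<close>

lemma energy_classical:
  assumes a: "0 < a" and d: "\<And>x. x \<in> {0..a} \<Longrightarrow> (f has_real_derivative f' x) (at x within {0..a})"
    and c: "continuous_on {0..a} f'"
  shows "energy a f = ereal (integral {0..a} (\<lambda>x. (f' x)\<^sup>2) - integral {0..a} (\<lambda>x. (f x - mean a f)\<^sup>2))"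
proof -
  have fc: "continuous_on {0..a} f" by (rule DERIV_continuous_on[OF d])
  have H: "in_H1 a f" unfolding in_H1_def
    using square_integrable_continuous[OF fc] square_integrable_continuous[OF c] classical_has_weak_derivative[OF a d c] by blast
  define g where "g = weak_derivative a f"
  have g: "square_integrable_on g {0<..<a}" "has_weak_derivative a f g"
    unfolding g_def by (rule weak_derivative_spec[OF H])+
  have gi: "set_integrable lebesgue {0<..<a} g" and fi: "set_integrable lebesgue {0<..<a} f'"
    by (intro set_integrable_square g square_integrable_continuous c)+
  have "AE x in lebesgue. x \<in> {0<..<a} \<longrightarrow> g x - f' x = 0"
  proof (rule zero_of_orthogonal_test_functions[OF a set_integral_diff(1)[OF gi fi]])
    fix \<phi> assume t: "test_function a \<phi>"
    have "continuous_on {0..a} \<phi>"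
      using t[unfolded test_function_def, THEN conjunct1, rule_format, of 0]
      by (auto intro!: continuous_at_imp_continuous_on differentiable_imp_continuous_within)
    then have p: "square_integrable_on \<phi> {0<..<a}" by (rule square_integrable_continuous)
    have "(LINT x:{0<..<a}|lebesgue. g x * \<phi> x - f' x * \<phi> x) = (LINT x:{0<..<a}|lebesgue. g x * \<phi> x) - (LINT x:{0<..<a}|lebesgue. f' x * \<phi> x)"
      by (intro set_integral_diff set_integrable_mult_square g p square_integrable_continuous c)
    also have "\<dots> = 0" using g(2) classical_has_weak_derivative[OF a d c] t by (simp add: has_weak_derivative_def)
    finally show "(LINT x:{0<..<a}|lebesgue. (g x - f' x) * \<phi> x) = 0" by (simp add: left_diff_distrib)
  qed
  then have "AE x in lebesgue. indicat_real {0<..<a} x *\<^sub>R (g x)\<^sup>2 = indicat_real {0<..<a} x *\<^sub>R (f' x)\<^sup>2"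
    by eventually_elim (auto simp: indicator_def)
  moreover have "(\<lambda>x. indicat_real {0<..<a} x *\<^sub>R (g x)\<^sup>2) \<in> borel_measurable lebesgue"
    using g(1) by (auto simp: square_integrable_on_def set_integrable_def)
  moreover have "(\<lambda>x. indicat_real {0<..<a} x *\<^sub>R (f' x)\<^sup>2) \<in> borel_measurable lebesgue"
    using square_integrable_continuous[OF c] by (auto simp: square_integrable_on_def set_integrable_def)
  ultimately have "(LINT x:{0<..<a}|lebesgue. (g x)\<^sup>2) = (LINT x:{0<..<a}|lebesgue. (f' x)\<^sup>2)"
    unfolding set_lebesgue_integral_def by (intro integral_cong_AE)
  also have "\<dots> = integral {0..a} (\<lambda>x. (f' x)\<^sup>2)" by (intro LINT_Ioo continuous_intros c)
  finally show ?thesis unfolding energy_eq[OF fc H] g_def by simp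
qed

text \<open>All that is kept of the weak derivative g is its squared norm G. The inequality is 2 g
  \<psi> \<le> g^2 + \<psi>^2 after integration by parts, so later arguments never mention
  g.\<close>

lemma energy_finite:
  assumes a: "0 < a" and f: "continuous_on {0..a} f" and E: "energy a f < \<infinity>"
  obtains G where "energy a f = ereal (G - integral {0..a} (\<lambda>x. (f x - mean a f)\<^sup>2))"
    "\<And>\<psi> \<psi>'. \<lbrakk>\<And>x. x \<in> {0..a} \<Longrightarrow> (\<psi> has_real_derivative \<psi>' x) (at x within {0..a}); continuous_on {0..a} \<psi>'; \<psi> 0 = 0; \<psi> a = 0\<rbrakk>
      \<Longrightarrow> - 2 * integral {0..a} (\<lambda>x. f x * \<psi>' x) \<le> G + integral {0..a} (\<lambda>x. (\<psi> x)\<^sup>2)"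
proof -
  have H: "in_H1 a f" using E by (auto simp: energy_def split: if_splits)
  define g where "g = weak_derivative a f"
  have g: "square_integrable_on g {0<..<a}" "has_weak_derivative a f g"
    unfolding g_def by (rule weak_derivative_spec[OF H])+
  show thesis
  proof (rule that[of "LINT x:{0<..<a}|lebesgue. (g x)\<^sup>2"])
    show "energy a f = ereal ((LINT x:{0<..<a}|lebesgue. (g x)\<^sup>2) - integral {0..a} (\<lambda>x. (f x - mean a f)\<^sup>2))"
      unfolding g_def by (rule energy_eq[OF f H])
    fix \<psi> \<psi>' assume d: "\<And>x. x \<in> {0..a} \<Longrightarrow> (\<psi> has_real_derivative \<psi>' x) (at x within {0..a})"
      and c: "continuous_on {0..a} \<psi>'" and bc: "\<psi> 0 = 0" "\<psi> a = 0"
    have pc: "continuous_on {0..a} \<psi>" by (rule DERIV_continuous_on[OF d])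
    have psq: "set_integrable lebesgue {0<..<a} (\<lambda>x. (\<psi> x)\<^sup>2)" "(LINT x:{0<..<a}|lebesgue. (\<psi> x)\<^sup>2) = integral {0..a} (\<lambda>x. (\<psi> x)\<^sup>2)"
      by (intro LINT_Ioo continuous_intros pc)+
    have gsq: "set_integrable lebesgue {0<..<a} (\<lambda>x. (g x)\<^sup>2)" using g(1) by (simp add: square_integrable_on_def)
    have gp: "set_integrable lebesgue {0<..<a} (\<lambda>x. g x * \<psi> x)"
      by (intro set_integrable_mult_square g square_integrable_continuous pc)
    have "integral {0..a} (\<lambda>x. f x * \<psi>' x) = (LINT x:{0<..<a}|lebesgue. f x * \<psi>' x)"
      by (intro LINT_Ioo(2)[symmetric] continuous_intros f c)
    also have "\<dots> = - (LINT x:{0<..<a}|lebesgue. g x * \<psi> x)"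
      by (rule weak_derivative_by_parts[OF a LINT_Ioo(1)[OF f] set_integrable_square[OF g(1)] g(2) d c bc])
    finally have "- 2 * integral {0..a} (\<lambda>x. f x * \<psi>' x) = (LINT x:{0<..<a}|lebesgue. 2 * (g x * \<psi> x))" by simp
    also have "\<dots> \<le> (LINT x:{0<..<a}|lebesgue. (g x)\<^sup>2 + (\<psi> x)\<^sup>2)"
    proof (rule set_integral_mono)
      show "set_integrable lebesgue {0<..<a} (\<lambda>x. 2 * (g x * \<psi> x))" using gp by simp
      show "set_integrable lebesgue {0<..<a} (\<lambda>x. (g x)\<^sup>2 + (\<psi> x)\<^sup>2)" by (intro set_integral_add gsq psq)
      show "2 * (g x * \<psi> x) \<le> (g x)\<^sup>2 + (\<psi> x)\<^sup>2" for x using two_mult_le[of "g x" "\<psi> x"] by simp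
    qed
    also have "\<dots> = (LINT x:{0<..<a}|lebesgue. (g x)\<^sup>2) + integral {0..a} (\<lambda>x. (\<psi> x)\<^sup>2)"
      unfolding set_integral_add(2)[OF gsq psq(1)] psq(2) ..
    finally show "- 2 * integral {0..a} (\<lambda>x. f x * \<psi>' x) \<le> (LINT x:{0<..<a}|lebesgue. (g x)\<^sup>2) + integral {0..a} (\<lambda>x. (\<psi> x)\<^sup>2)" .
  qed
qed

section \<open>Energy identities for classical solutions\<close>

lemma continuous_on_slice:
  assumes "continuous_on (S \<times> X) (\<lambda>(t, x). f t x)" "t \<in> S"
  shows "continuous_on X (f t)"
  using continuous_on_compose2[OF assms(1), of X "\<lambda>x. (t, x)"] assms(2)
  by (simp add: image_subset_iff continuous_on_Pair continuous_on_const continuous_on_id)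

lemma integral_deriv_mult:
  fixes f g :: "real \<Rightarrow> real"
  assumes a: "0 \<le> a"
    and f: "\<And>x. x \<in> {0..a} \<Longrightarrow> (f has_real_derivative f' x) (at x within {0..a})"
    and g: "\<And>x. x \<in> {0..a} \<Longrightarrow> (g has_real_derivative g' x) (at x within {0..a})"
    and c: "continuous_on {0..a} f'" "continuous_on {0..a} g'" and bc: "g 0 = 0" "g a = 0"
  shows "integral {0..a} (\<lambda>x. f x * g' x) = - integral {0..a} (\<lambda>x. f' x * g x)"
proof -
  have fc: "continuous_on {0..a} f" and gc: "continuous_on {0..a} g"
    by (rule DERIV_continuous_on[OF f], assumption) (rule DERIV_continuous_on[OF g], assumption)
  have "((\<lambda>x. f x * g' x + f' x * g x) has_integral (f a * g a - f 0 * g 0)) {0..a}"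
    by (rule fundamental_theorem_of_calculus[OF a])
      (auto simp flip: has_real_derivative_iff_has_vector_derivative intro!: DERIV_mult' f g)
  then have "integral {0..a} (\<lambda>x. f x * g' x + f' x * g x) = 0" by (simp add: bc integral_unique)
  moreover have "integral {0..a} (\<lambda>x. f x * g' x + f' x * g x) = integral {0..a} (\<lambda>x. f x * g' x) + integral {0..a} (\<lambda>x. f' x * g x)"
    by (intro integral_add integrable_continuous_interval continuous_intros fc gc c)
  ultimately show ?thesis by linarith
qed

lemma integral_cauchy_schwarz:
  fixes f g :: "real \<Rightarrow> real"
  assumes f: "continuous_on {x..y} f" and g: "continuous_on {x..y} g"
  shows "(integral {x..y} (\<lambda>s. f s * g s))\<^sup>2 \<le> integral {x..y} (\<lambda>s. (f s)\<^sup>2) * integral {x..y} (\<lambda>s. (g s)\<^sup>2)"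
proof -
  define A B C where "A = integral {x..y} (\<lambda>s. (f s)\<^sup>2)" and "B = integral {x..y} (\<lambda>s. f s * g s)" and "C = integral {x..y} (\<lambda>s. (g s)\<^sup>2)"
  have *: "0 \<le> A * \<mu>\<^sup>2 + 2 * B * \<mu> + C" for \<mu>
  proof -
    have "integral {x..y} (\<lambda>s. (\<mu> * f s + g s)\<^sup>2) = integral {x..y} (\<lambda>s. \<mu>\<^sup>2 * (f s)\<^sup>2 + (2 * \<mu> * (f s * g s) + (g s)\<^sup>2))"
      by (rule integral_cong) (simp add: power2_sum power_mult_distrib mult_ac)
    also have "\<dots> = \<mu>\<^sup>2 * A + (2 * \<mu> * B + C)"
      unfolding A_def B_def C_def
      by (subst integral_add, intro integrable_continuous_interval continuous_intros f g, intro integrable_continuous_interval continuous_intros f g,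
          subst integral_add, intro integrable_continuous_interval continuous_intros f g, intro integrable_continuous_interval continuous_intros f g)
        (simp only: integral_mult_right)
    finally have "\<mu>\<^sup>2 * A + (2 * \<mu> * B + C) = integral {x..y} (\<lambda>s. (\<mu> * f s + g s)\<^sup>2)" ..
    also have "\<dots> \<ge> 0" by (rule integral_nonneg) (auto intro!: integrable_continuous_interval continuous_intros f g)
    finally show ?thesis by (simp add: algebra_simps)
  qed
  have A0: "0 \<le> A" unfolding A_def by (rule integral_nonneg) (auto intro!: integrable_continuous_interval continuous_intros f)
  have "B\<^sup>2 \<le> A * C"
  proof (cases "A = 0")
    case True
    have "B = 0"
    proof (rule ccontr)
      assume "B \<noteq> 0"
      \<comment> \<open>For A = 0 the quadratic is linear in \<mu>, and this \<mu> gives it the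
        value - 1.\<close>
      then show False using *[of "- (C + 1) / (2 * B)"] True by simp
    qed
    then show ?thesis using True by simp
  next
    case False
    then have "0 < A" using A0 by simp
    moreover have "0 \<le> C - B\<^sup>2 / A" using *[of "- B / A"] False by (simp add: power2_eq_square field_simps)
    ultimately show ?thesis by (simp add: field_simps)
  qed
  then show ?thesis by (simp add: A_def B_def C_def)
qed

text \<open>A classical solution with its derivatives named and its initial datum left open: u 0 is
  whatever it is. Time shifts and gluing thus become operations on flows. The equation is demanded
  in the interior only, as in \<open>classical_solution\<close>.\<close>

locale neumann_flow =
  fixes p a :: real and T :: ereal and u ut ux uxx :: "real \<Rightarrow> real \<Rightarrow> real"
  assumes p: "1 < p" "p \<le> 2" and a: "0 < a" and T: "0 < T"
    and pos: "\<And>t x. \<lbrakk>0 \<le> t; ereal t < T; x \<in> {0..a}\<rbrakk> \<Longrightarrow> 0 < u t x"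
    and u_cont: "continuous_on ({t. 0 \<le> t \<and> ereal t < T} \<times> {0..a}) (\<lambda>(t, x). u t x)"
    and ut_cont: "continuous_on ({t. 0 < t \<and> ereal t < T} \<times> {0..a}) (\<lambda>(t, x). ut t x)"
    and ux_cont: "continuous_on ({t. 0 < t \<and> ereal t < T} \<times> {0..a}) (\<lambda>(t, x). ux t x)"
    and uxx_cont: "continuous_on ({t. 0 < t \<and> ereal t < T} \<times> {0..a}) (\<lambda>(t, x). uxx t x)"
    and ut: "\<And>t x. \<lbrakk>0 < t; ereal t < T; x \<in> {0..a}\<rbrakk> \<Longrightarrow> ((\<lambda>s. u s x) has_real_derivative ut t x) (at t)"
    and ux: "\<And>t x. \<lbrakk>0 < t; ereal t < T; x \<in> {0..a}\<rbrakk> \<Longrightarrow> ((\<lambda>y. u t y) has_real_derivative ux t x) (at x within {0..a})"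
    and uxx: "\<And>t x. \<lbrakk>0 < t; ereal t < T; x \<in> {0..a}\<rbrakk> \<Longrightarrow> ((\<lambda>y. ux t y) has_real_derivative uxx t x) (at x within {0..a})"
    and pde_interior: "\<And>t x. \<lbrakk>0 < t; ereal t < T; x \<in> {0<..<a}\<rbrakk> \<Longrightarrow> ut t x = u t x powr p * (uxx t x + u t x - mean a (u t))"
    and bc: "\<And>t. \<lbrakk>0 < t; ereal t < T\<rbrakk> \<Longrightarrow> ux t 0 = 0" "\<And>t. \<lbrakk>0 < t; ereal t < T\<rbrakk> \<Longrightarrow> ux t a = 0"
begin

abbreviation "I0 \<equiv> {t. 0 \<le> t \<and> ereal t < T}"
abbreviation "I1 \<equiv> {t. 0 < t \<and> ereal t < T}"

definition "R t x = uxx t x + u t x - mean a (u t)"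
definition "E t = integral {0..a} (\<lambda>x. (ux t x)\<^sup>2) - integral {0..a} (\<lambda>x. (u t x - mean a (u t))\<^sup>2)"
definition "D t = integral {0..a} (\<lambda>x. ut t x * R t x)"
definition "W t = integral {0..a} (\<lambda>x. u t x powr (2 - p))"

section \<open>Regularity of slices and the equation up to the lateral boundary\<close>

lemma u_slice: "t \<in> I0 \<Longrightarrow> continuous_on {0..a} (u t)" by (rule continuous_on_slice[OF u_cont])
lemma ut_slice: "t \<in> I1 \<Longrightarrow> continuous_on {0..a} (ut t)" by (rule continuous_on_slice[OF ut_cont])
lemma ux_slice: "t \<in> I1 \<Longrightarrow> continuous_on {0..a} (ux t)" by (rule continuous_on_slice[OF ux_cont])
lemma uxx_slice: "t \<in> I1 \<Longrightarrow> continuous_on {0..a} (uxx t)" by (rule continuous_on_slice[OF uxx_cont])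
lemma R_slice: "t \<in> I1 \<Longrightarrow> continuous_on {0..a} (R t)"
  unfolding R_def[abs_def] by (intro continuous_intros uxx_slice u_slice) auto

lemma mean_integral: "t \<in> I0 \<Longrightarrow> integral {0..a} (u t) = a * mean a (u t)"
  using a by (simp add: mean_eq_integral u_slice)

lemma open_I1: "open I1"
  by (cases T) (auto simp: open_Collect_conj open_Collect_less)

lemma convex_I1: "convex I1"
proof -
  have "is_interval I1"
    unfolding is_interval_1 by (auto intro: le_less_trans[of "ereal _" "ereal _"])
  then show ?thesis by (simp add: is_interval_convex)
qed

lemma I1_sub: "s \<in> I0 \<Longrightarrow> s \<le> t \<Longrightarrow> t \<in> I0 \<Longrightarrow> {s..t} \<subseteq> I0"
  by (auto intro: le_less_trans[of "ereal _" "ereal _"])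

lemma I1_sub': "s \<in> I1 \<Longrightarrow> t \<in> I1 \<Longrightarrow> {s..t} \<subseteq> I1"
  by (auto intro: le_less_trans[of "ereal _" "ereal _"])

lemma mean_cont: "continuous_on I0 (\<lambda>t. mean a (u t))"
proof -
  have "continuous_on I0 (\<lambda>t. integral (cbox 0 a) (u t) / a)"
    using a by (intro continuous_intros integral_continuous_on_param) (use u_cont in auto)
  then show ?thesis by (rule continuous_on_eq) (simp add: mean_eq_integral u_slice)
qed

lemma u_cont1: "continuous_on (I1 \<times> {0..a}) (\<lambda>z. u (fst z) (snd z))"
  by (rule continuous_on_subset[OF u_cont[unfolded case_prod_unfold]]) auto

lemma R_cont: "continuous_on (I1 \<times> {0..a}) (\<lambda>(t, x). R t x)"
proof -
  have mc: "continuous_on (I1 \<times> {0..a}) (\<lambda>z. mean a (u (fst z)))"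
    by (rule continuous_on_compose2[OF mean_cont]) (auto intro!: continuous_intros)
  show ?thesis unfolding R_def case_prod_unfold
    by (intro continuous_intros u_cont1 mc uxx_cont[unfolded case_prod_unfold])
qed

text \<open>Both sides are continuous up to the lateral boundary, so the equation extends there; the
  extremum arguments below use it at end points too.\<close>

lemma pde:
  assumes t: "t \<in> I1" and x: "x \<in> {0..a}"
  shows "ut t x = u t x powr p * R t x"
proof -
  have t0: "t \<in> I0" using t by auto
  define g where "g x = ut t x - u t x powr p * R t x" for x
  have up: "u t x \<noteq> 0" if "x \<in> {0..a}" for x using pos[of t x] t that by auto
  have gc: "continuous_on {0..a} g" unfolding g_def
    by (intro continuous_intros ut_slice R_slice u_slice t t0) (use up in auto)
  have "closure {0<..<a} = {0..a}" using a by simp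
  moreover have "g ` closure {0<..<a} \<subseteq> {0}"
  proof (rule image_closure_subset)
    show "continuous_on (closure {0<..<a}) g" using gc a by simp
    show "g ` {0<..<a} \<subseteq> {0}" using pde_interior t by (auto simp: g_def R_def)
  qed simp
  ultimately have "g x = 0" using x by (auto simp: image_subset_iff)
  then show ?thesis by (simp add: g_def)
qed

lemma R_eq: "t \<in> I1 \<Longrightarrow> x \<in> {0..a} \<Longrightarrow> R t x = u t x powr (- p) * ut t x"
  using pos[of t x] by (simp add: pde powr_minus)

lemma integral_R:
  assumes t: "t \<in> I1" shows "integral {0..a} (R t) = 0"
proof -
  have t0: "t \<in> I0" using t by auto
  have "(uxx t has_integral (ux t a - ux t 0)) {0..a}"
    by (rule fundamental_theorem_of_calculus)
      (use a uxx t in \<open>auto simp flip: has_real_derivative_iff_has_vector_derivative\<close>)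
  then have "integral {0..a} (uxx t) = 0" using bc t by (simp add: integral_unique)
  moreover have "integral {0..a} (R t) = integral {0..a} (\<lambda>x. uxx t x + u t x) - integral {0..a} (\<lambda>_. mean a (u t))"
    unfolding R_def[abs_def]
    by (rule integral_diff) (intro integrable_continuous_interval continuous_intros uxx_slice u_slice t t0)+
  moreover have "integral {0..a} (\<lambda>x. uxx t x + u t x) = integral {0..a} (uxx t) + integral {0..a} (u t)"
    by (rule integral_add) (intro integrable_continuous_interval continuous_intros uxx_slice u_slice t t0)+
  ultimately show ?thesis using a mean_integral[OF t0] by simp
qed

lemma E_nonneg_part: "t \<in> I0 \<Longrightarrow> integral {0..a} (\<lambda>x. (u t x - mean a (u t))\<^sup>2) = integral {0..a} (\<lambda>x. (u t x)\<^sup>2) - a * (mean a (u t))\<^sup>2"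
proof -
  assume t: "t \<in> I0"
  have "integral {0..a} (\<lambda>x. (u t x - mean a (u t))\<^sup>2) = integral {0..a} (\<lambda>x. (u t x)\<^sup>2 - ((2 * mean a (u t)) * u t x - (mean a (u t))\<^sup>2))"
    by (rule integral_cong) (simp add: power2_diff)
  also have "\<dots> = integral {0..a} (\<lambda>x. (u t x)\<^sup>2) - ((2 * mean a (u t)) * integral {0..a} (u t) - integral {0..a} (\<lambda>_. (mean a (u t))\<^sup>2))"
    by (subst integral_diff, (intro integrable_continuous_interval continuous_intros u_slice t)+,
        subst integral_diff, (intro integrable_continuous_interval continuous_intros u_slice t)+) simp
  finally show ?thesis using a mean_integral[OF t] by (simp add: power2_eq_square algebra_simps)
qed

text \<open>Symmetrising in \<open>s\<close> and \<open>t\<close> avoids the mixed derivative \<open>u\<^sub>x\<^sub>t\<close>, which need not exist.\<close>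

lemma E_diff:
  assumes t: "t \<in> I1" and s: "s \<in> I1"
  shows "E s - E t = - integral {0..a} (\<lambda>x. (u s x - u t x) * (R s x + R t x))"
proof -
  have t0: "t \<in> I0" and s0: "s \<in> I0" using s t by auto
  note c = u_slice[OF t0] u_slice[OF s0] ux_slice[OF t] ux_slice[OF s] uxx_slice[OF t] uxx_slice[OF s]
  define \<mu> where "\<mu> t = mean a (u t)" for t
  have 1: "integral {0..a} (\<lambda>x. (ux s x)\<^sup>2) - integral {0..a} (\<lambda>x. (ux t x)\<^sup>2) = integral {0..a} (\<lambda>x. (ux s x - ux t x) * (ux s x + ux t x))"
    by (subst integral_diff[symmetric], (intro integrable_continuous_interval continuous_intros c)+,
        rule integral_cong) (simp add: power2_eq_square algebra_simps)
  have 2: "integral {0..a} (\<lambda>x. (u s x - u t x) * (uxx s x + uxx t x)) = - integral {0..a} (\<lambda>x. (ux s x - ux t x) * (ux s x + ux t x))"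
    by (rule integral_deriv_mult)
      (use a s t bc in \<open>auto intro!: DERIV_diff DERIV_add ux uxx continuous_intros c\<close>)
  have 3: "integral {0..a} (\<lambda>x. (u s x)\<^sup>2) - integral {0..a} (\<lambda>x. (u t x)\<^sup>2) = integral {0..a} (\<lambda>x. (u s x - u t x) * (u s x + u t x))"
    by (subst integral_diff[symmetric], (intro integrable_continuous_interval continuous_intros c)+,
        rule integral_cong) (simp add: power2_eq_square algebra_simps)
  have 4: "integral {0..a} (\<lambda>x. (\<mu> s + \<mu> t) * (u s x - u t x)) = a * (\<mu> s)\<^sup>2 - a * (\<mu> t)\<^sup>2"
    unfolding integral_mult_right
    by (subst integral_diff, (intro integrable_continuous_interval c)+)
      (simp only: mean_integral[OF s0] mean_integral[OF t0] \<mu>_def power2_eq_square, simp add: algebra_simps)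
  have "integral {0..a} (\<lambda>x. (u s x - u t x) * (R s x + R t x))
      = integral {0..a} (\<lambda>x. (u s x - u t x) * (uxx s x + uxx t x) + ((u s x - u t x) * (u s x + u t x) - (\<mu> s + \<mu> t) * (u s x - u t x)))"
    by (rule integral_cong) (simp add: R_def \<mu>_def algebra_simps)
  also have "\<dots> = integral {0..a} (\<lambda>x. (u s x - u t x) * (uxx s x + uxx t x)) + (integral {0..a} (\<lambda>x. (u s x - u t x) * (u s x + u t x)) - integral {0..a} (\<lambda>x. (\<mu> s + \<mu> t) * (u s x - u t x)))"
    by (subst integral_add, (intro integrable_continuous_interval continuous_intros c)+,
        subst integral_diff, (intro integrable_continuous_interval continuous_intros c)+) simp
  finally show ?thesis
    using 1 2 3 4 unfolding E_def E_nonneg_part[OF s0] E_nonneg_part[OF t0] \<mu>_def by linarith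
qed

text \<open>By \<open>E_diff\<close> the increment of E splits into A1, in which R is frozen at time
  t and the parameter integral can be differentiated, and A2, which is o(s - t): near t the function
  u is Lipschitz in time uniformly in x, and R s tends to R t in the mean.\<close>

lemma E_deriv:
  assumes t: "t \<in> I1"
  shows "(E has_real_derivative - 2 * D t) (at t)"
proof -
  obtain d where d: "d > 0" "cball t d \<subseteq> I1"
    using bspec[OF open_contains_cball[THEN iffD1, OF open_I1] t] by (elim exE conjE)
  define S where "S = cball t d"
  have S: "compact S" "convex S" "t \<in> S" using d(1) by (auto simp: S_def)
  have SI: "s \<in> I1" if "s \<in> S" for s using subsetD[OF d(2)] that unfolding S_def .
  have SS: "S \<times> {0..a} \<subseteq> I1 \<times> {0..a}"
    by (rule Sigma_mono[OF subsetI subset_refl]) (rule SI)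
  have Rc: "continuous_on (S \<times> {0..a}) (\<lambda>(t, x). R t x)"
    by (rule continuous_on_subset[OF R_cont SS])
  have utc: "continuous_on (S \<times> {0..a}) (\<lambda>(t, x). ut t x)"
    by (rule continuous_on_subset[OF ut_cont SS])
  have "bounded ((\<lambda>(t, x). ut t x) ` (S \<times> {0..a}))"
    by (intro compact_imp_bounded compact_continuous_image utc compact_Times S compact_Icc)
  then obtain B where B0: "\<forall>y\<in>(\<lambda>(t, x). ut t x) ` (S \<times> {0..a}). norm y \<le> B" unfolding bounded_iff by (elim exE)
  have B: "\<bar>ut s x\<bar> \<le> B" if "s \<in> S" "x \<in> {0..a}" for s x
    using bspec[OF B0 imageI[of "(s, x)"]] that by simp
  have lip: "\<bar>u s x - u t x\<bar> \<le> B * \<bar>s - t\<bar>" if "s \<in> S" "x \<in> {0..a}" for s x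
  proof -
    have "norm (u s x - u t x) \<le> B * norm (s - t)"
    proof (rule field_differentiable_bound[of S "\<lambda>s. u s x" "\<lambda>s. ut s x"])
      fix z assume z: "z \<in> S"
      show "((\<lambda>s. u s x) has_field_derivative ut z x) (at z within S)"
        using SI[OF z] that(2) by (simp add: has_field_derivative_at_within ut)
      show "norm (ut z x) \<le> B" using B z that by simp
    qed (use that S in simp_all)
    then show ?thesis by simp
  qed
  define A1 where "A1 s = integral {0..a} (\<lambda>x. u s x * (2 * R t x))" for s
  define A2 where "A2 s = integral {0..a} (\<lambda>x. (u s x - u t x) * (R s x - R t x))" for s
  have sl: "continuous_on {0..a} (u s)" "continuous_on {0..a} (R s)" if "s \<in> I1" for s
    using that by (auto intro: u_slice R_slice)
  have dec: "E s = E t - (A1 s - A1 t) - A2 s" if s: "s \<in> I1" for s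
  proof -
    have "integral {0..a} (\<lambda>x. (u s x - u t x) * (R s x + R t x)) = integral {0..a} (\<lambda>x. (u s x * (2 * R t x) - u t x * (2 * R t x)) + (u s x - u t x) * (R s x - R t x))"
      by (rule integral_cong) (simp add: algebra_simps)
    also have "\<dots> = (A1 s - A1 t) + A2 s"
      unfolding A1_def A2_def
      by (subst integral_add, (intro integrable_continuous_interval continuous_intros sl s t)+,
          subst integral_diff, (intro integrable_continuous_interval continuous_intros sl s t)+) simp
    finally show ?thesis using E_diff[OF t s] by linarith
  qed
  have A1w: "(A1 has_real_derivative integral (cbox 0 a) (\<lambda>x. ut t x * (2 * R t x))) (at t within I1)"
    unfolding A1_def cbox_interval[symmetric]
  proof (rule leibniz_rule_field_derivative[where fx="\<lambda>s x. ut s x * (2 * R t x)"])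
    show "((\<lambda>s. u s x * (2 * R t x)) has_real_derivative ut s x * (2 * R t x)) (at s within I1)"
      if "s \<in> I1" "x \<in> cbox 0 a" for s x
      using that by (intro DERIV_cmult_right) (simp add: has_field_derivative_at_within ut)
    show "(\<lambda>x. u s x * (2 * R t x)) integrable_on cbox 0 a" if "s \<in> I1" for s
      unfolding cbox_interval by (intro integrable_continuous_interval continuous_intros sl that t)
    have "continuous_on (I1 \<times> {0..a}) (\<lambda>z. R t (snd z))"
      by (rule continuous_on_compose2[OF sl(2)[OF t]]) (auto intro!: continuous_intros)
    then show "continuous_on (I1 \<times> cbox 0 a) (\<lambda>(s, x). ut s x * (2 * R t x))"
      using ut_cont unfolding cbox_interval case_prod_unfold by (intro continuous_intros)
  qed (use t convex_I1 in auto)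
  have A1d: "(A1 has_real_derivative 2 * D t) (at t)"
  proof -
    have "integral (cbox 0 a) (\<lambda>x. ut t x * (2 * R t x)) = integral {0..a} (\<lambda>x. 2 * (ut t x * R t x))"
      unfolding cbox_interval by (rule integral_cong) simp
    then have "integral (cbox 0 a) (\<lambda>x. ut t x * (2 * R t x)) = 2 * D t" unfolding D_def by simp
    then show ?thesis using A1w at_within_open[OF t open_I1] by simp
  qed
  have "(A2 has_real_derivative 0) (at t)"
  proof -
    have A2t: "A2 t = 0" by (simp add: A2_def)
    have "continuous_on S (\<lambda>s. integral (cbox 0 a) (\<lambda>x. \<bar>R s x - R t x\<bar>))"
    proof (rule integral_continuous_on_param)
      have "continuous_on (S \<times> {0..a}) (\<lambda>z. R t (snd z))"
        by (rule continuous_on_compose2[OF sl(2)[OF t]]) (auto intro!: continuous_intros)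
      then show "continuous_on (S \<times> cbox 0 a) (\<lambda>(s, x). \<bar>R s x - R t x\<bar>)"
        using Rc unfolding cbox_interval case_prod_unfold by (intro continuous_intros)
    qed
    then have "continuous_on S (\<lambda>s. B * integral {0..a} (\<lambda>x. \<bar>R s x - R t x\<bar>))"
      unfolding cbox_interval by (intro continuous_intros)
    then have "isCont (\<lambda>s. B * integral {0..a} (\<lambda>x. \<bar>R s x - R t x\<bar>)) t"
      by (rule continuous_on_interior) (use d in \<open>simp add: S_def interior_cball\<close>)
    then have lim: "((\<lambda>s. B * integral {0..a} (\<lambda>x. \<bar>R s x - R t x\<bar>)) \<longlongrightarrow> 0) (at t)"
      by (simp add: isCont_def)
    have "((\<lambda>s. (A2 s - A2 t) / (s - t)) \<longlongrightarrow> 0) (at t)"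
    proof (rule Lim_null_comparison[OF _ lim])
      have "\<forall>\<^sub>F s in at t. s \<in> ball t d - {t}" using d(1) unfolding eventually_at by (intro exI[of _ d]) (auto simp: dist_commute)
      then show "\<forall>\<^sub>F s in at t. norm ((A2 s - A2 t) / (s - t)) \<le> B * integral {0..a} (\<lambda>x. \<bar>R s x - R t x\<bar>)"
      proof eventually_elim
        case (elim s)
        then have s: "s \<in> S" "s \<noteq> t" by (auto simp: S_def)
        then have sI: "s \<in> I1" by (intro SI)
        have "norm (A2 s) \<le> integral {0..a} (\<lambda>x. (B * \<bar>s - t\<bar>) * \<bar>R s x - R t x\<bar>)"
          unfolding A2_def
        proof (rule integral_norm_bound_integral)
          show "(\<lambda>x. (u s x - u t x) * (R s x - R t x)) integrable_on {0..a}" "(\<lambda>x. (B * \<bar>s - t\<bar>) * \<bar>R s x - R t x\<bar>) integrable_on {0..a}"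
            by (intro integrable_continuous_interval continuous_intros sl sI t)+
          show "norm ((u s x - u t x) * (R s x - R t x)) \<le> (B * \<bar>s - t\<bar>) * \<bar>R s x - R t x\<bar>" if "x \<in> {0..a}" for x
            unfolding real_norm_def abs_mult using lip[OF s(1) that] by (intro mult_right_mono) auto
        qed
        also have "\<dots> = \<bar>s - t\<bar> * (B * integral {0..a} (\<lambda>x. \<bar>R s x - R t x\<bar>))"
          unfolding integral_mult_right by simp
        finally show ?case using s(2) A2t by (simp add: abs_divide divide_le_eq mult.commute)
      qed
    qed
    then show ?thesis by (simp add: has_field_derivative_iff)
  qed
  then have "((\<lambda>s. E t - (A1 s - A1 t) - A2 s) has_real_derivative 0 - (2 * D t - 0) - 0) (at t)"
    by (intro DERIV_diff DERIV_const A1d)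
  then have *: "((\<lambda>s. E t - (A1 s - A1 t) - A2 s) has_real_derivative - 2 * D t) (at t)" by simp
  show ?thesis
  proof (rule DERIV_cong_ev[THEN iffD1, OF refl _ refl *])
    show "\<forall>\<^sub>F s in nhds t. E t - (A1 s - A1 t) - A2 s = E s"
      using eventually_nhds_in_open[OF open_I1 t] by eventually_elim (simp only: dec)
  qed
qed

lemma integral_compose_deriv:
  fixes \<Phi> \<Phi>' :: "real \<Rightarrow> real"
  assumes d: "\<And>s. 0 < s \<Longrightarrow> (\<Phi> has_real_derivative \<Phi>' s) (at s)" and c: "continuous_on {0<..} \<Phi>'" and t: "t \<in> I1"
  shows "((\<lambda>t. integral {0..a} (\<lambda>x. \<Phi> (u t x))) has_real_derivative integral {0..a} (\<lambda>x. \<Phi>' (u t x) * ut t x)) (at t)"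
proof -
  have Pc: "continuous_on {0<..} \<Phi>" by (rule DERIV_continuous_on[OF has_field_derivative_at_within[OF d]]) auto
  have "((\<lambda>t. integral (cbox 0 a) (\<lambda>x. \<Phi> (u t x))) has_real_derivative integral (cbox 0 a) (\<lambda>x. \<Phi>' (u t x) * ut t x)) (at t within I1)"
  proof (rule leibniz_rule_field_derivative)
    show "((\<lambda>s. \<Phi> (u s x)) has_real_derivative \<Phi>' (u s x) * ut s x) (at s within I1)" if "s \<in> I1" "x \<in> cbox 0 a" for s x
      by (rule has_field_derivative_at_within, rule DERIV_chain2[OF d ut]) (use that pos in auto)
    show "(\<lambda>x. \<Phi> (u s x)) integrable_on cbox 0 a" if "s \<in> I1" for s
      unfolding cbox_interval
      by (intro integrable_continuous_interval continuous_on_compose2[OF Pc u_slice]) (use that pos in auto)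
    have "continuous_on (I1 \<times> {0..a}) (\<lambda>z. \<Phi>' (u (fst z) (snd z)))"
      by (rule continuous_on_compose2[OF c u_cont1]) (use pos in auto)
    then show "continuous_on (I1 \<times> cbox 0 a) (\<lambda>(s, x). \<Phi>' (u s x) * ut s x)"
      using ut_cont unfolding cbox_interval case_prod_unfold by (intro continuous_intros)
  qed (use t convex_I1 in auto)
  then show ?thesis using at_within_open[OF t open_I1] by simp
qed

text \<open>E is a quadratic form whose gradient is - 2 R, by parts and the Neumann condition, so
  pairing R with u itself returns - E.\<close>

lemma integral_uR:
  assumes t: "t \<in> I1"
  shows "integral {0..a} (\<lambda>x. u t x * R t x) = - E t"
proof -
  have t0: "t \<in> I0" using t by auto
  note c = u_slice[OF t0] ux_slice[OF t] uxx_slice[OF t]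
  define \<mu> where "\<mu> = mean a (u t)"
  have "integral {0..a} (\<lambda>x. u t x * R t x) = integral {0..a} (\<lambda>x. u t x * uxx t x + ((u t x)\<^sup>2 - \<mu> * u t x))"
    by (rule integral_cong) (simp add: R_def \<mu>_def power2_eq_square algebra_simps)
  also have "\<dots> = integral {0..a} (\<lambda>x. u t x * uxx t x) + (integral {0..a} (\<lambda>x. (u t x)\<^sup>2) - integral {0..a} (\<lambda>x. \<mu> * u t x))"
    by (subst integral_add, (intro integrable_continuous_interval continuous_intros c)+,
        subst integral_diff, (intro integrable_continuous_interval continuous_intros c)+) simp
  also have "integral {0..a} (\<lambda>x. u t x * uxx t x) = - integral {0..a} (\<lambda>x. ux t x * ux t x)"
    by (rule integral_deriv_mult) (use a t bc in \<open>auto intro!: ux uxx c\<close>)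
  also have "integral {0..a} (\<lambda>x. \<mu> * u t x) = a * \<mu>\<^sup>2"
    unfolding integral_mult_right mean_integral[OF t0] by (simp add: \<mu>_def power2_eq_square)
  finally show ?thesis unfolding E_def E_nonneg_part[OF t0] \<mu>_def by (simp add: power2_eq_square)
qed

lemma W_deriv:
  assumes t: "t \<in> I1"
  shows "(W has_real_derivative (2 - p) * - E t) (at t)"
proof -
  have "(W has_real_derivative integral {0..a} (\<lambda>x. ((2 - p) * u t x powr (1 - p)) * ut t x)) (at t)"
    unfolding W_def
  proof (rule integral_compose_deriv[OF _ _ t])
    show "((\<lambda>s. s powr (2 - p)) has_real_derivative (2 - p) * s powr (1 - p)) (at s)" if "0 < s" for s
      using that by (auto intro!: derivative_eq_intros)
  qed (auto intro!: continuous_intros)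
  also have "integral {0..a} (\<lambda>x. ((2 - p) * u t x powr (1 - p)) * ut t x) = integral {0..a} (\<lambda>x. (2 - p) * (u t x * R t x))"
  proof (rule integral_cong)
    fix x assume x: "x \<in> {0..a}"
    have "0 < u t x" using pos t x by auto
    then have "u t x powr (1 - p) * u t x powr p = u t x" by (simp flip: powr_add)
    then show "((2 - p) * u t x powr (1 - p)) * ut t x = (2 - p) * (u t x * R t x)"
      unfolding pde[OF t x] by (simp add: mult.assoc[symmetric])
  qed
  also have "\<dots> = (2 - p) * - E t" unfolding integral_mult_right integral_uR[OF t] ..
  finally show ?thesis .
qed

lemma W_pos: "t \<in> I0 \<Longrightarrow> 0 < W t"
proof -
  assume t: "t \<in> I0"
  have c: "continuous_on {0..a} (\<lambda>x. u t x powr (2 - p))"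
    by (intro continuous_intros u_slice t) (use pos[of t] t in \<open>auto simp: less_imp_neq[symmetric]\<close>)
  have "0 < integral {0..a} (\<lambda>x. u t x powr (2 - p))"
  proof -
    obtain m where m: "m \<in> {0..a}" "\<And>x. x \<in> {0..a} \<Longrightarrow> u t m powr (2 - p) \<le> u t x powr (2 - p)"
      using continuous_attains_inf[OF compact_Icc _ c] a by auto
    have "integral {0..a} (\<lambda>_. u t m powr (2 - p)) \<le> integral {0..a} (\<lambda>x. u t x powr (2 - p))"
      by (rule integral_le) (auto intro!: integrable_continuous_interval c m(2))
    moreover have "0 < u t m powr (2 - p)" using pos[of t m] t m by auto
    moreover have "0 < integral {0..a} (\<lambda>_. u t m powr (2 - p))" using calculation(2) a by simp
    ultimately show ?thesis by linarith
  qed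
  then show ?thesis by (simp add: W_def)
qed

lemma D_nonneg: "t \<in> I1 \<Longrightarrow> 0 \<le> D t"
proof -
  assume t: "t \<in> I1"
  show ?thesis unfolding D_def
  proof (rule integral_nonneg)
    show "(\<lambda>x. ut t x * R t x) integrable_on {0..a}" by (intro integrable_continuous_interval continuous_intros ut_slice R_slice t)
    fix x assume "x \<in> {0..a}"
    then have "ut t x * R t x = u t x powr p * (R t x)\<^sup>2" using pde t by (simp add: power2_eq_square)
    then show "0 \<le> ut t x * R t x" by simp
  qed
qed

text \<open>Cauchy-Schwarz for u R = u powr (1 - p / 2) * (u powr (p / 2) * R): the squares of the
  two factors integrate to W and D.\<close>

lemma E_sq_le:
  assumes t: "t \<in> I1"
  shows "(E t)\<^sup>2 \<le> W t * D t"
proof -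
  have t0: "t \<in> I0" using t by auto
  have up: "0 < u t x" if "x \<in> {0..a}" for x using pos t that by auto
  have c1: "continuous_on {0..a} (\<lambda>x. u t x powr (1 - p / 2))" by (intro continuous_intros u_slice t0) (use up in \<open>auto simp: less_imp_neq[symmetric]\<close>)
  have c2: "continuous_on {0..a} (\<lambda>x. u t x powr (p / 2) * R t x)" by (intro continuous_intros u_slice R_slice t0 t) (use up in \<open>auto simp: less_imp_neq[symmetric]\<close>)
  have "(integral {0..a} (\<lambda>x. u t x powr (1 - p / 2) * (u t x powr (p / 2) * R t x)))\<^sup>2
    \<le> integral {0..a} (\<lambda>x. (u t x powr (1 - p / 2))\<^sup>2) * integral {0..a} (\<lambda>x. (u t x powr (p / 2) * R t x)\<^sup>2)"
    by (rule integral_cauchy_schwarz[OF c1 c2])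
  also have "integral {0..a} (\<lambda>x. u t x powr (1 - p / 2) * (u t x powr (p / 2) * R t x)) = integral {0..a} (\<lambda>x. u t x * R t x)"
  proof (rule integral_cong)
    fix x assume x: "x \<in> {0..a}"
    have "u t x powr (1 - p / 2) * u t x powr (p / 2) = u t x" using up[OF x] by (simp flip: powr_add)
    then show "u t x powr (1 - p / 2) * (u t x powr (p / 2) * R t x) = u t x * R t x" by (simp flip: mult.assoc)
  qed
  also have "integral {0..a} (\<lambda>x. (u t x powr (1 - p / 2))\<^sup>2) = W t"
    unfolding W_def by (rule integral_cong) (use up in \<open>auto simp: power2_eq_square simp flip: powr_add\<close>)
  also have "integral {0..a} (\<lambda>x. (u t x powr (p / 2) * R t x)\<^sup>2) = D t"
    unfolding D_def
  proof (rule integral_cong)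
    fix x assume x: "x \<in> {0..a}"
    have "(u t x powr (p / 2))\<^sup>2 = u t x powr p" using up[OF x] by (simp add: power2_eq_square flip: powr_add)
    then show "(u t x powr (p / 2) * R t x)\<^sup>2 = ut t x * R t x" by (simp add: pde[OF t x] power_mult_distrib power2_eq_square)
  qed
  finally show ?thesis by (simp add: integral_uR[OF t])
qed

end

section \<open>Blow-up and a priori bounds\<close>

text \<open>The first derivative vanishes at x, at an end point by the Neumann condition. If g2 x
  were negative, g would decrease on moving from x to a side inside [0, a], against minimality. End
  points thus need no separate boundary argument.\<close>

lemma neumann_min_second_deriv:
  fixes g g1 g2 :: "real \<Rightarrow> real"
  assumes a: "0 < a"
    and d1: "\<And>x. x \<in> {0..a} \<Longrightarrow> (g has_real_derivative g1 x) (at x within {0..a})"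
    and d2: "\<And>x. x \<in> {0..a} \<Longrightarrow> (g1 has_real_derivative g2 x) (at x within {0..a})"
    and bc: "g1 0 = 0" "g1 a = 0"
    and x: "x \<in> {0..a}" and min: "\<And>y. y \<in> {0..a} \<Longrightarrow> g x \<le> g y"
  shows "0 \<le> g2 x"
proof (rule ccontr)
  assume "\<not> 0 \<le> g2 x"
  then have neg: "g2 x < 0" by simp
  have g1x: "g1 x = 0"
  proof (cases "x \<in> {0<..<a}")
    case True
    have "(g has_real_derivative g1 x) (at x)" using d1[OF x] True by (simp add: at_within_Icc_at)
    then show ?thesis
    proof (rule DERIV_local_min)
      show "0 < Orderings.min x (a - x)" using True by simp
      show "\<forall>y. \<bar>x - y\<bar> < Orderings.min x (a - x) \<longrightarrow> g x \<le> g y" by (intro allI impI min) (auto simp: abs_if split: if_splits)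
    qed
  next
    case False
    then have "x = 0 \<or> x = a" using x by auto
    then show ?thesis using bc by auto
  qed
  have mvt: "\<exists>z\<in>{s<..<t}. g t - g s = g1 z * (t - s)" if st: "0 \<le> s" "s < t" "t \<le> a" for s t
  proof (rule mvt_simple[OF st(2)])
    fix z assume "s \<le> z" "z \<le> t"
    then show "(g has_derivative (\<lambda>y. g1 z * y)) (at z within {s..t})"
      using has_field_derivative_subset[OF d1[of z], of "{s..t}"] st by (auto simp: has_field_derivative_def)
  qed
  show False
  proof (cases "x < a")
    case True
    obtain d where d: "0 < d" "\<And>h. 0 < h \<Longrightarrow> x + h \<in> {0..a} \<Longrightarrow> h < d \<Longrightarrow> g1 (x + h) < g1 x"
      using has_real_derivative_neg_dec_right[OF d2[OF x] neg] by blast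
    define y where "y = x + Orderings.min (d / 2) (a - x)"
    have y: "x < y" "y \<le> a" "y - x < d" using d(1) True by (auto simp: y_def)
    obtain z where z: "z \<in> {x<..<y}" "g y - g x = g1 z * (y - x)" using mvt[of x y] x y by auto
    have "g1 z < 0" using d(2)[of "z - x"] z(1) y x g1x by auto
    then have "g1 z * (y - x) < 0" using y by (simp add: mult_neg_pos)
    then show False using z(2) min[of y] x y by auto
  next
    case False
    then have xa: "x = a" using x by auto
    obtain d where d: "0 < d" "\<And>h. 0 < h \<Longrightarrow> x - h \<in> {0..a} \<Longrightarrow> h < d \<Longrightarrow> g1 x < g1 (x - h)"
      using has_real_derivative_neg_dec_left[OF d2[OF x] neg] by blast
    define y where "y = a - Orderings.min (d / 2) a"
    have y: "0 \<le> y" "y < a" "a - y < d" using d(1) a by (auto simp: y_def)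
    obtain z where z: "z \<in> {y<..<a}" "g a - g y = g1 z * (a - y)" using mvt[of y a] y by auto
    have "0 < g1 z" using d(2)[of "a - z"] z(1) y g1x xa by auto
    then have "0 < g1 z * (a - y)" using y by simp
    then show False using z(2) min[of y] y xa by auto
  qed
qed

text \<open>A minimum over time and space at a positive time would have a positive time derivative,
  hence smaller values just before. Positivity is asked only where the slice is minimal in space,
  the place where the second derivative has a known sign.\<close>

lemma weak_minimum_principle:
  fixes w :: "real \<Rightarrow> real \<Rightarrow> real"
  assumes a: "0 \<le> a" and c: "continuous_on ({0..\<tau>} \<times> {0..a}) (\<lambda>(t, x). w t x)"
    and d: "\<And>t x. \<lbrakk>t \<in> {0<..\<tau>}; x \<in> {0..a}; \<And>y. y \<in> {0..a} \<Longrightarrow> w t x \<le> w t y\<rbrakk>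
      \<Longrightarrow> \<exists>d>0. ((\<lambda>s. w s x) has_real_derivative d) (at t within {0..\<tau>})"
    and t: "t \<in> {0..\<tau>}" and x: "x \<in> {0..a}"
  shows "\<exists>y\<in>{0..a}. w 0 y \<le> w t x"
proof -
  have "{0..\<tau>} \<times> {0..a} \<noteq> {}" using t x by auto
  then obtain z where z: "z \<in> {0..\<tau>} \<times> {0..a}" "\<And>y. y \<in> {0..\<tau>} \<times> {0..a} \<Longrightarrow> (\<lambda>(t, x). w t x) z \<le> (\<lambda>(t, x). w t x) y"
    using continuous_attains_inf[OF compact_Times[OF compact_Icc compact_Icc] _ c] by blast
  define s y where "s = fst z" and "y = snd z"
  have sy: "s \<in> {0..\<tau>}" "y \<in> {0..a}" using z(1) by (auto simp: s_def y_def)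
  have min: "w s y \<le> w s' y'" if "s' \<in> {0..\<tau>}" "y' \<in> {0..a}" for s' y'
    using z(2)[of "(s', y')"] that by (simp add: s_def y_def case_prod_unfold)
  have "s = 0"
  proof (rule ccontr)
    assume "s \<noteq> 0"
    then have s: "s \<in> {0<..\<tau>}" using sy by auto
    obtain e where e: "e > 0" "((\<lambda>s. w s y) has_real_derivative e) (at s within {0..\<tau>})"
      using d[OF s sy(2)] min[OF sy(1)] by blast
    obtain h0 where h0: "h0 > 0" "\<And>h. 0 < h \<Longrightarrow> s - h \<in> {0..\<tau>} \<Longrightarrow> h < h0 \<Longrightarrow> w (s - h) y < w s y"
      using has_real_derivative_pos_inc_left[OF e(2,1)] by blast
    define h where "h = Orderings.min (h0 / 2) s"
    have h: "0 < h" "h < h0" "s - h \<in> {0..\<tau>}" using h0(1) s by (auto simp: h_def min_def)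
    have "w (s - h) y < w s y" by (rule h0(2)[OF h(1,3,2)])
    moreover have "w s y \<le> w (s - h) y" by (rule min[OF h(3) sy(2)])
    ultimately show False by simp
  qed
  then show ?thesis using min[OF t x] sy(2) by auto
qed

context neumann_flow
begin

section \<open>Blow-up for negative energy\<close>

lemma energy_E: "t \<in> I1 \<Longrightarrow> energy a (u t) = ereal (E t)"
  unfolding E_def by (rule energy_classical[OF a ux ux_slice]) auto

lemma E_antimono:
  assumes "s \<in> I1" "t \<in> I1" "s \<le> t"
  shows "E t \<le> E s"
proof -
  have "E t - E s \<le> 0 * (t - s)"
  proof (rule increment_le[OF assms(3) subset_UNIV])
    fix x assume "x \<in> {s..t}"
    then have x: "x \<in> I1" using I1_sub'[OF assms(1,2)] by blast
    show "(E has_real_derivative - 2 * D x) (at x)" by (rule E_deriv[OF x])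
    show "- 2 * D x \<le> 0" using D_nonneg[OF x] by simp
  qed
  then show ?thesis by simp
qed

lemma blow_up:
  assumes t0: "t0 \<in> I1" and neg: "E t0 < 0"
  shows "T < \<infinity>"
proof (rule ccontr)
  assume "\<not> T < \<infinity>"
  then have Tinf: "T = \<infinity>" by simp
  have I1: "t \<in> I1" if "t0 \<le> t" for t using that t0 Tinf by auto
  have En: "E t < 0" if "t0 \<le> t" for t using E_antimono[OF t0 I1[OF that] that] neg by linarith
  have Wp: "0 < W t" if "t0 \<le> t" for t using W_pos[of t] I1[OF that] by auto
  define X where "X t = W t / - E t" for t
  have X: "0 < X t" if "t0 \<le> t" for t using Wp[OF that] En[OF that] by (simp add: X_def divide_pos_neg)
  \<comment> \<open>The time at which the linear bound X t0 - p (t - t0) reaches 0.\<close>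
  define t where "t = t0 + X t0 / p"
  have t: "t0 \<le> t" using X[of t0] p by (simp add: t_def)
  have "X t - X t0 \<le> - p * (t - t0)"
  proof (rule increment_le[OF t subset_UNIV])
    fix s assume "s \<in> {t0..t}"
    then have s: "t0 \<le> s" by simp
    have e: "0 < - E s" using En[OF s] by simp
    show "(X has_real_derivative (((2 - p) * - E s) * - E s - W s * (- (- 2 * D s))) / (- E s * - E s)) (at s)"
      unfolding X_def[abs_def] by (rule DERIV_divide[OF W_deriv[OF I1[OF s]] DERIV_minus[OF E_deriv[OF I1[OF s]]]]) (use e in simp)
    have "((2 - p) * - E s) * - E s - W s * (- (- 2 * D s)) \<le> - p * (- E s * - E s)"
      using E_sq_le[OF I1[OF s]] by (simp add: power2_eq_square algebra_simps)
    then show "(((2 - p) * - E s) * - E s - W s * (- (- 2 * D s))) / (- E s * - E s) \<le> - p"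
      by (simp only: pos_divide_le_eq[OF mult_pos_pos[OF e e]])
  qed
  then have "X t \<le> 0" using p by (simp add: t_def)
  then show False using X[OF t] by simp
qed

section \<open>A priori bound for nonnegative energy\<close>

definition "\<Phi> s = (if p = 2 then ln s else s powr (2 - p) / (2 - p))" for s :: real

lemma Phi_deriv: "0 < s \<Longrightarrow> (\<Phi> has_real_derivative s powr (1 - p)) (at s)"
proof (cases "p = 2")
  case True
  assume "0 < s"
  then have "(ln has_real_derivative s powr (1 - p)) (at s)"
    using True by (auto intro!: derivative_eq_intros simp: powr_minus_divide)
  then show ?thesis unfolding \<Phi>_def[abs_def] if_P[OF True] .
next
  case False
  assume "0 < s"
  then have "((\<lambda>s. s powr (2 - p) / (2 - p)) has_real_derivative s powr (1 - p)) (at s)"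
    using False by (auto intro!: derivative_eq_intros)
  then show ?thesis using False by (simp add: \<Phi>_def[abs_def])
qed

lemma Phi_cont: "continuous_on {0<..} \<Phi>"
  by (rule DERIV_continuous_on[OF has_field_derivative_at_within[OF Phi_deriv]]) simp

lemma Phi_mono: "0 < s \<Longrightarrow> s \<le> t \<Longrightarrow> \<Phi> s \<le> \<Phi> t"
  by (rule DERIV_nonneg_imp_nondecreasing[of s t \<Phi>]) (auto intro!: exI[of _ "_ powr (1 - p)"] Phi_deriv)

text \<open>For p = 2 the primitive is a logarithm, unbounded below near 0. Adding the integrand of
  the conserved quantity makes the sum nonnegative, so that its integral over a subinterval is
  dominated by the one over [0, a].\<close>

lemma Phi_lower: "0 < s \<Longrightarrow> 0 \<le> \<Phi> s + s powr (1 - p)"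
proof (cases "p = 2")
  case True
  assume s: "0 < s"
  have "ln (1 / s) \<le> 1 / s - 1" by (rule ln_le_minus_one) (use s in simp)
  moreover have "s powr (1 - p) = 1 / s" using True s by (simp add: powr_minus_divide)
  ultimately show ?thesis unfolding \<Phi>_def if_P[OF True] using s by (simp add: ln_div)
qed (use p in \<open>simp add: \<Phi>_def\<close>)

text \<open>Here p \<le> 2 enters: for p > 2 a primitive of s powr (1 - p) is bounded above, and a
  bound on its integral would not limit large values of u.\<close>

lemma Phi_unbounded: "\<exists>S>0. K < \<Phi> S"
proof (cases "p = 2")
  case True
  show ?thesis unfolding \<Phi>_def if_P[OF True] by (intro exI[of _ "exp (K + 1)"]) simp
next
  case False
  then have p': "0 < 2 - p" using p by simp
  define r where "r = (2 - p) * (\<bar>K\<bar> + 1)"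
  have r: "0 < r" using p' by (simp add: r_def)
  have "\<Phi> (r powr (1 / (2 - p))) = \<bar>K\<bar> + 1" using False p' r by (simp add: \<Phi>_def powr_powr r_def)
  then show ?thesis using r by (intro exI[of _ "r powr (1 / (2 - p))"]) auto
qed

definition "F t = integral {0..a} (\<lambda>x. \<Phi> (u t x))"
definition "C t = integral {0..a} (\<lambda>x. u t x powr (1 - p))"

lemma F_deriv:
  assumes t: "t \<in> I1"
  shows "(F has_real_derivative - E t) (at t)"
proof -
  have "(F has_real_derivative integral {0..a} (\<lambda>x. u t x powr (1 - p) * ut t x)) (at t)"
    unfolding F_def by (rule integral_compose_deriv[OF Phi_deriv _ t]) (auto intro!: continuous_intros)
  also have "integral {0..a} (\<lambda>x. u t x powr (1 - p) * ut t x) = integral {0..a} (\<lambda>x. u t x * R t x)"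
  proof (rule integral_cong)
    fix x assume x: "x \<in> {0..a}"
    have "0 < u t x" using pos t x by auto
    then have "u t x powr (1 - p) * u t x powr p = u t x" by (simp flip: powr_add)
    then show "u t x powr (1 - p) * ut t x = u t x * R t x" unfolding pde[OF t x] by (simp add: mult.assoc[symmetric])
  qed
  finally show ?thesis by (simp add: integral_uR[OF t])
qed

lemma C_deriv:
  assumes t: "t \<in> I1"
  shows "(C has_real_derivative 0) (at t)"
proof -
  have "(C has_real_derivative integral {0..a} (\<lambda>x. ((1 - p) * u t x powr (- p)) * ut t x)) (at t)"
    unfolding C_def
  proof (rule integral_compose_deriv[OF _ _ t])
    show "((\<lambda>s. s powr (1 - p)) has_real_derivative (1 - p) * s powr (- p)) (at s)" if "0 < s" for s
      using that by (auto intro!: derivative_eq_intros)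
  qed (auto intro!: continuous_intros)
  also have "integral {0..a} (\<lambda>x. ((1 - p) * u t x powr (- p)) * ut t x) = integral {0..a} (\<lambda>x. (1 - p) * R t x)"
    by (rule integral_cong) (use t in \<open>simp add: R_eq mult.assoc\<close>)
  finally show ?thesis by (simp add: integral_R[OF t])
qed

lemma u_holder:
  assumes t: "t \<in> I1" and xy: "0 \<le> x" "x \<le> y" "y \<le> a"
  shows "(u t y - u t x)\<^sup>2 \<le> (y - x) * integral {0..a} (\<lambda>x. (ux t x)\<^sup>2)"
proof -
  have c: "continuous_on {x..y} (ux t)" by (rule continuous_on_subset[OF ux_slice[OF t]]) (use xy in auto)
  have "(ux t has_integral (u t y - u t x)) {x..y}"
    by (rule fundamental_theorem_of_calculus[OF xy(2)])
      (use t xy in \<open>auto simp flip: has_real_derivative_iff_has_vector_derivative intro!: has_field_derivative_subset[OF ux]\<close>)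
  then have "u t y - u t x = integral {x..y} (\<lambda>s. ux t s * 1)" by (simp add: integral_unique)
  then have "(u t y - u t x)\<^sup>2 \<le> integral {x..y} (\<lambda>s. (ux t s)\<^sup>2) * integral {x..y} (\<lambda>s. 1\<^sup>2)"
    using integral_cauchy_schwarz[OF c continuous_on_const[of _ 1]] by simp
  also have "\<dots> = (y - x) * integral {x..y} (\<lambda>s. (ux t s)\<^sup>2)" using xy by simp
  also have "\<dots> \<le> (y - x) * integral {0..a} (\<lambda>s. (ux t s)\<^sup>2)"
    using xy by (intro mult_left_mono integral_subset_le integrable_continuous_interval continuous_intros c ux_slice[OF t]) auto
  finally show ?thesis .
qed

lemma bounded_after:
  assumes E0: "\<And>t. t \<in> I1 \<Longrightarrow> 0 \<le> E t" and t1: "t1 \<in> I1"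
  shows "\<exists>B. \<forall>t\<in>I1. t1 \<le> t \<longrightarrow> (\<forall>x\<in>{0..a}. u t x \<le> B)"
proof -
  define K where "K = F t1 + C t1"
  \<comment> \<open>The second entry makes the Hoelder estimate give an oscillation of at most M / 2
    within distance \<delta> of the maximum; the first lets an interval of length \<delta> fit on
    one side of it.\<close>
  define \<delta> where "\<delta> = min (a / 2) (1 / (4 * (E t1 + a)))"
  have E1: "0 \<le> E t1" by (rule E0[OF t1])
  have \<delta>: "0 < \<delta>" "\<delta> \<le> a / 2" "\<delta> * (E t1 + a) \<le> 1 / 4"
  proof -
    show "0 < \<delta>" "\<delta> \<le> a / 2" using a E1 by (auto simp: \<delta>_def)
    define X where "X = E t1 + a"
    have X: "0 < X" using a E1 by (simp add: X_def)
    have "\<delta> * X \<le> 1 / (4 * X) * X"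
      using X by (intro mult_right_mono) (auto simp: \<delta>_def X_def)
    then show "\<delta> * (E t1 + a) \<le> 1 / 4" using X by (simp add: X_def[symmetric])
  qed
  obtain S where S: "0 < S" "K / \<delta> < \<Phi> S" using Phi_unbounded by blast
  have "u t x \<le> max 1 (2 * S)" if t: "t \<in> I1" and tt: "t1 \<le> t" and x: "x \<in> {0..a}" for t x
  proof -
    have t0: "t \<in> I0" using t by auto
    obtain x0 where x0: "x0 \<in> {0..a}" "\<And>y. y \<in> {0..a} \<Longrightarrow> u t y \<le> u t x0"
      using continuous_attains_sup[OF compact_Icc _ u_slice[OF t0]] a by auto
    define M where "M = u t x0"
    have up: "0 < u t y" if "y \<in> {0..a}" for y using pos t that by auto
    have "M \<le> max 1 (2 * S)"
    \<comment> \<open>For M > 1 one has E t1 \<le> E t1 * M^2, so the gradient bound becomes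
      homogeneous in M and \<delta> does not depend on t.\<close>
    proof (cases "M \<le> 1")
      case False
      then have M1: "1 \<le> M" by simp
      have usq: "integral {0..a} (\<lambda>x. (u t x)\<^sup>2) \<le> a * M\<^sup>2"
      proof -
        have "integral {0..a} (\<lambda>x. (u t x)\<^sup>2) \<le> integral {0..a} (\<lambda>_. M\<^sup>2)"
          by (intro integral_le integrable_continuous_interval continuous_intros u_slice t0 power_mono)
            (use x0 up in \<open>auto simp: M_def less_imp_le\<close>)
        then show ?thesis using a by simp
      qed
      have "E t \<le> E t1" by (rule E_antimono[OF t1 t tt])
      moreover have "0 \<le> a * (mean a (u t))\<^sup>2" using a by simp
      ultimately have "integral {0..a} (\<lambda>x. (ux t x)\<^sup>2) \<le> E t1 + a * M\<^sup>2"
        using usq unfolding E_def[of t] E_nonneg_part[OF t0] by linarith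
      also have "\<dots> \<le> (E t1 + a) * M\<^sup>2"
        using mult_left_mono[OF one_le_power[OF M1, of 2] E1] by (simp add: algebra_simps)
      finally have grad: "integral {0..a} (\<lambda>x. (ux t x)\<^sup>2) \<le> (E t1 + a) * M\<^sup>2" .
      have near: "M / 2 \<le> u t y" if y: "y \<in> {0..a}" "\<bar>y - x0\<bar> \<le> \<delta>" for y
      proof -
        have g0: "0 \<le> integral {0..a} (\<lambda>x. (ux t x)\<^sup>2)"
          by (rule integral_nonneg) (auto intro!: integrable_continuous_interval continuous_intros ux_slice t)
        have "(u t y - u t x0)\<^sup>2 \<le> \<bar>y - x0\<bar> * integral {0..a} (\<lambda>x. (ux t x)\<^sup>2)"
          using u_holder[OF t, of x0 y] u_holder[OF t, of y x0] x0(1) y(1)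
          by (cases "x0 \<le> y") (auto simp: power2_commute)
        also have "\<dots> \<le> \<delta> * ((E t1 + a) * M\<^sup>2)" using y(2) grad g0 \<delta> by (intro mult_mono) auto
        also have "\<dots> \<le> 1 / 4 * M\<^sup>2" using mult_right_mono[OF \<delta>(3), of "M\<^sup>2"] by (simp add: mult.assoc)
        finally have "(u t y - u t x0)\<^sup>2 \<le> (M / 2)\<^sup>2" by (simp add: power_divide)
        then have "\<bar>u t y - u t x0\<bar> \<le> \<bar>M / 2\<bar>" by (simp only: abs_le_square_iff)
        then show ?thesis using M1 unfolding M_def by linarith
      qed
      obtain l where l: "0 \<le> l" "l + \<delta> \<le> a" "\<And>y. y \<in> {l..l + \<delta>} \<Longrightarrow> \<bar>y - x0\<bar> \<le> \<delta>"
      proof (cases "x0 + \<delta> \<le> a")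
        case True
        then show ?thesis using x0(1) by (intro that[of x0]) auto
      next
        case False
        then show ?thesis using x0(1) \<delta> by (intro that[of "x0 - \<delta>"]) auto
      qed
      define G where "G s = \<Phi> s + s powr (1 - p)" for s
      have Gc: "continuous_on {0..a} (\<lambda>x. G (u t x))"
        unfolding G_def
        by (intro continuous_intros u_slice t0 continuous_on_compose2[OF Phi_cont u_slice[OF t0]])
          (use up in \<open>auto simp: less_imp_neq[symmetric]\<close>)
      have "\<delta> * \<Phi> (M / 2) = integral {l..l + \<delta>} (\<lambda>_. \<Phi> (M / 2))" using \<delta> by simp
      also have "\<dots> \<le> integral {l..l + \<delta>} (\<lambda>x. G (u t x))"
      proof (rule integral_le)
        show "(\<lambda>x. G (u t x)) integrable_on {l..l + \<delta>}"
          by (intro integrable_continuous_interval continuous_on_subset[OF Gc]) (use l in auto)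
        fix y assume y: "y \<in> {l..l + \<delta>}"
        then have "\<Phi> (M / 2) \<le> \<Phi> (u t y)" using l near M1 by (intro Phi_mono) auto
        then show "\<Phi> (M / 2) \<le> G (u t y)" by (simp add: G_def add_increasing2)
      qed (intro integrable_continuous_interval continuous_intros)
      also have "\<dots> \<le> integral {0..a} (\<lambda>x. G (u t x))"
      proof (rule integral_subset_le)
        show "(\<lambda>x. G (u t x)) integrable_on {l..l + \<delta>}"
          by (intro integrable_continuous_interval continuous_on_subset[OF Gc]) (use l in auto)
        show "(\<lambda>x. G (u t x)) integrable_on {0..a}" by (rule integrable_continuous_interval[OF Gc])
        show "\<forall>x\<in>{0..a}. 0 \<le> G (u t x)" unfolding G_def by (intro ballI Phi_lower up)
      qed (use l in auto)
      also have "\<dots> = F t + C t"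
        unfolding G_def F_def C_def
        by (intro integral_add integrable_continuous_interval continuous_intros u_slice t0 continuous_on_compose2[OF Phi_cont u_slice[OF t0]])
          (use up in \<open>auto simp: less_imp_neq[symmetric]\<close>)
      \<comment> \<open>F has derivative - E \<le> 0 and C is constant, so the sum never exceeds its
        value at t1.\<close>
      also have "\<dots> \<le> K"
      proof -
        have "(F t + C t) - (F t1 + C t1) \<le> 0 * (t - t1)"
        proof (rule increment_le[OF tt subset_UNIV])
          fix s assume "s \<in> {t1..t}"
          then have s: "s \<in> I1" using I1_sub'[OF t1 t] by blast
          show "((\<lambda>t. F t + C t) has_real_derivative - E s + 0) (at s)" by (rule DERIV_add[OF F_deriv[OF s] C_deriv[OF s]])
          show "- E s + 0 \<le> 0" using E0[OF s] by simp
        qed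
        then show ?thesis by (simp add: K_def)
      qed
      finally have "\<Phi> (M / 2) \<le> K / \<delta>" using \<delta> by (simp add: pos_le_divide_eq mult.commute)
      then have "\<not> S \<le> M / 2" using S Phi_mono[of S "M / 2"] by linarith
      then show ?thesis by simp
    qed simp
    then show ?thesis using x0(2)[OF x] by (simp add: M_def)
  qed
  then show ?thesis by blast
qed

section \<open>Two-sided bounds, the energy at time 0, and the dissipation near a finite end
  time\<close>

lemma compact_bounds:
  assumes "\<tau> \<in> I0"
  shows "\<exists>m>0. \<exists>B. \<forall>t\<in>{0..\<tau>}. \<forall>x\<in>{0..a}. m \<le> u t x \<and> u t x \<le> B"
proof -
  have sub: "{0..\<tau>} \<times> {0..a} \<subseteq> I0 \<times> {0..a}"
    using I1_sub[of 0 \<tau>] assms T by (intro Sigma_mono) (auto simp: zero_ereal_def)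
  have ne: "{0..\<tau>} \<times> {0..a} \<noteq> {}" using assms a by auto
  have cp: "compact ({0..\<tau>} \<times> {0..a})" by (intro compact_Times compact_Icc)
  have c: "continuous_on ({0..\<tau>} \<times> {0..a}) (\<lambda>(t, x). u t x)" by (rule continuous_on_subset[OF u_cont sub])
  obtain z where z: "z \<in> {0..\<tau>} \<times> {0..a}" "\<And>y. y \<in> {0..\<tau>} \<times> {0..a} \<Longrightarrow> (\<lambda>(t, x). u t x) z \<le> (\<lambda>(t, x). u t x) y"
    using continuous_attains_inf[OF cp ne c] by blast
  obtain z' where z': "\<And>y. y \<in> {0..\<tau>} \<times> {0..a} \<Longrightarrow> (\<lambda>(t, x). u t x) y \<le> (\<lambda>(t, x). u t x) z'"
    using continuous_attains_sup[OF cp ne c] by blast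
  show ?thesis
  proof (rule exI[of _ "u (fst z) (snd z)"], rule conjI, rule_tac [2] exI[of _ "u (fst z') (snd z')"], rule_tac [2] ballI, rule_tac [2] ballI)
    show "0 < u (fst z) (snd z)" using pos subsetD[OF sub z(1)] by (auto simp: mem_Times_iff)
    fix t x assume "t \<in> {0..\<tau>}" "x \<in> {0..a}"
    then show "u (fst z) (snd z) \<le> u t x \<and> u t x \<le> u (fst z') (snd z')"
      using z(2)[of "(t, x)"] z'[of "(t, x)"] by (simp add: case_prod_unfold)
  qed
qed

lemma bounded_all:
  assumes E0: "\<And>t. t \<in> I1 \<Longrightarrow> 0 \<le> E t"
  shows "\<exists>B. \<forall>t\<in>I0. \<forall>x\<in>{0..a}. u t x \<le> B"
proof -
  obtain t1 where t1: "t1 \<in> I1"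
  proof -
    obtain r where "0 < ereal r" "ereal r < T" using ereal_dense2[OF T] by blast
    then show ?thesis using that[of r] by (simp add: zero_ereal_def)
  qed
  then have t10: "t1 \<in> I0" by auto
  have "\<exists>B. \<forall>t\<in>I1. t1 \<le> t \<longrightarrow> (\<forall>x\<in>{0..a}. u t x \<le> B)" by (rule bounded_after[OF E0 t1])
  then obtain B1 where B1: "\<forall>t\<in>I1. t1 \<le> t \<longrightarrow> (\<forall>x\<in>{0..a}. u t x \<le> B1)" by (elim exE)
  obtain m B2 where B2: "\<forall>t\<in>{0..t1}. \<forall>x\<in>{0..a}. m \<le> u t x \<and> u t x \<le> B2"
    using compact_bounds[OF t10] by (elim exE conjE)
  have "u t x \<le> max B1 B2" if t: "t \<in> I0" and x: "x \<in> {0..a}" for t x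
  proof (cases "t1 \<le> t")
    case True
    then have "t \<in> I1" using t t1 by auto
    then show ?thesis using B1 True x by (simp add: max.coboundedI1)
  next
    case False
    then have "u t x \<le> B2" using B2 t x by auto
    then show ?thesis by simp
  qed
  then show ?thesis by blast
qed

lemma mean_le:
  assumes t: "t \<in> I0" and B: "\<And>x. x \<in> {0..a} \<Longrightarrow> u t x \<le> B"
  shows "mean a (u t) \<le> B"
proof -
  have "integral {0..a} (u t) \<le> integral {0..a} (\<lambda>_. B)"
    by (intro integral_le integrable_continuous_interval u_slice t B) auto
  then show ?thesis using a by (simp add: mean_integral[OF t])
qed

lemma mean_nonneg:
  assumes t: "t \<in> I0" shows "0 \<le> mean a (u t)"
proof -
  have "0 \<le> integral {0..a} (u t)"
    by (intro integral_nonneg integrable_continuous_interval u_slice t) (use pos t in \<open>auto simp: less_imp_le\<close>)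
  then show ?thesis using a by (simp add: mean_integral[OF t] zero_le_mult_iff)
qed

text \<open>At a spatial minimum uxx is nonnegative, hence ut \<ge> - u powr p * B \<ge> - u * B
  powr p because u \<le> B and p > 1; the minimum decays at most exponentially.\<close>

lemma lower_bound:
  assumes B: "\<And>t x. t \<in> I0 \<Longrightarrow> x \<in> {0..a} \<Longrightarrow> u t x \<le> B" and t: "t \<in> I0" and x: "x \<in> {0..a}"
    and c: "\<And>x. x \<in> {0..a} \<Longrightarrow> c \<le> u 0 x"
  shows "c * exp (- (B powr p + 1) * t) \<le> u t x"
proof -
  \<comment> \<open>The added 1 turns the weak inequality for the decay rate into a strict
    one.\<close>
  define k where "k = B powr p + 1"
  define w where "w t x = u t x * exp (k * t)" for t x
  have "{0..t} \<subseteq> I0" by (rule I1_sub) (use t T in \<open>auto simp: zero_ereal_def\<close>)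
  then have sub: "{0..t} \<times> {0..a} \<subseteq> I0 \<times> {0..a}" by (rule Sigma_mono) simp
  have "\<exists>y\<in>{0..a}. w 0 y \<le> w t x"
  proof (rule weak_minimum_principle[where \<tau>=t])
    have "continuous_on ({0..t} \<times> {0..a}) (\<lambda>z. u (fst z) (snd z))"
      by (rule continuous_on_subset[OF u_cont[unfolded case_prod_unfold] sub])
    then show "continuous_on ({0..t} \<times> {0..a}) (\<lambda>(t, x). w t x)"
      unfolding w_def case_prod_unfold by (intro continuous_intros)
    fix s y assume s: "s \<in> {0<..t}" and y: "y \<in> {0..a}" and mn: "\<And>y'. y' \<in> {0..a} \<Longrightarrow> w s y \<le> w s y'"
    have sI: "s \<in> I1" using s t by (auto intro: le_less_trans[of "ereal _" "ereal _"])
    then have sI0: "s \<in> I0" by auto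
    have sT: "0 < s" "ereal s < T" using sI by auto
    have mn': "u s y \<le> u s y'" if "y' \<in> {0..a}" for y' using mn[OF that] by (simp add: w_def)
    have uxx0: "0 \<le> uxx s y"
      by (rule neumann_min_second_deriv[OF a ux[OF sT] uxx[OF sT] bc(1)[OF sT] bc(2)[OF sT] y mn'])
    define U where "U = u s y"
    have U: "0 < U" "U \<le> B" using pos[of s y] B[OF sI0 y] sT y by (auto simp: U_def)
    have mB: "mean a (u s) \<le> B" by (rule mean_le[OF sI0 B[OF sI0]])
    have "- B \<le> uxx s y + U - mean a (u s)" using uxx0 U mB by linarith
    then have "U powr p * - B \<le> U powr p * (uxx s y + U - mean a (u s))" by (intro mult_left_mono) auto
    moreover have "U powr p * B \<le> U * B powr p"
    proof -
      have "U powr p = U * U powr (p - 1)" using U by (simp add: powr_mult_base)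
      moreover have "U powr (p - 1) \<le> B powr (p - 1)" using U p by (intro powr_mono2) auto
      moreover have "B powr p = B * B powr (p - 1)" using U by (simp add: powr_mult_base)
      ultimately show ?thesis using U by (simp add: mult_left_mono mult_right_mono)
    qed
    ultimately have "- (U * B powr p) \<le> ut s y"
      unfolding pde[OF sI y] R_def U_def[symmetric] by simp
    then have posd: "0 < ut s y + k * U" using U by (simp add: k_def algebra_simps)
    have "((\<lambda>s. w s y) has_real_derivative ut s y * exp (k * s) + exp (k * s) * k * u s y) (at s)"
      unfolding w_def by (auto intro!: derivative_eq_intros ut sT y)
    moreover have "ut s y * exp (k * s) + exp (k * s) * k * u s y = (ut s y + k * U) * exp (k * s)" by (simp add: U_def algebra_simps)
    ultimately have "((\<lambda>s. w s y) has_real_derivative (ut s y + k * U) * exp (k * s)) (at s within {0..t})"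
      by (simp add: has_field_derivative_at_within)
    then show "\<exists>d>0. ((\<lambda>s. w s y) has_real_derivative d) (at s within {0..t})" using posd by (intro exI conjI) auto
  qed (use t x a in auto)
  then obtain y where y: "y \<in> {0..a}" "u 0 y \<le> u t x * exp (k * t)" by (auto simp: w_def)
  then have "c \<le> u t x * exp (k * t)" using c[OF y(1)] by linarith
  then have "c * exp (- (k * t)) \<le> u t x * exp (k * t) * exp (- (k * t))" by (intro mult_right_mono) auto
  also have "\<dots> = u t x" by (simp add: exp_minus)
  finally show ?thesis by (simp only: k_def mult_minus_left)
qed

text \<open>The function \<open>H\<close> below is the integral of \<open>\<integral>\<^sub>f\<^sup>u (s - f) s powr (- p) ds \<ge> 0\<close> with \<open>f = u 0\<close>,
  so that \<open>H' = \<integral> (u - f) R\<close>. Were \<open>E\<close> nonnegative for positive times, \<open>H\<close> would decrease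
  from \<open>H 0 = 0\<close>.\<close>

lemma energy_initial:
  assumes neg: "energy a (u 0) < 0"
  shows "\<exists>t\<in>I1. E t < 0"
proof (rule ccontr)
  assume "\<not> (\<exists>t\<in>I1. E t < 0)"
  then have E0: "0 \<le> E t" if "t \<in> I1" for t using that by force
  define f where "f = u 0"
  have z0: "0 \<in> I0" using T by (simp add: zero_ereal_def)
  have fc: "continuous_on {0..a} f" unfolding f_def by (rule u_slice[OF z0])
  have fp: "0 < f x" if "x \<in> {0..a}" for x unfolding f_def using pos[of 0 x] T that by (simp add: zero_ereal_def)
  have "energy a f < \<infinity>" using neg unfolding f_def by (rule less_trans) simp
  then obtain G where G: "energy a f = ereal (G - integral {0..a} (\<lambda>x. (f x - mean a f)\<^sup>2))"
    and Gt: "\<And>\<psi> \<psi>'. \<lbrakk>\<And>x. x \<in> {0..a} \<Longrightarrow> (\<psi> has_real_derivative \<psi>' x) (at x within {0..a}); continuous_on {0..a} \<psi>'; \<psi> 0 = 0; \<psi> a = 0\<rbrakk>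
      \<Longrightarrow> - 2 * integral {0..a} (\<lambda>x. f x * \<psi>' x) \<le> G + integral {0..a} (\<lambda>x. (\<psi> x)\<^sup>2)"
    using energy_finite[OF a fc] by blast
  define \<mu> where "\<mu> t = mean a (u t)" for t
  define Vf where "Vf = integral {0..a} (\<lambda>x. (f x - \<mu> 0)\<^sup>2)"
  define e0 where "e0 = G - Vf"
  have e0: "e0 < 0" using neg G by (simp add: f_def[symmetric] e0_def Vf_def \<mu>_def)
  define V where "V t = integral {0..a} (\<lambda>x. ((u t x - \<mu> t) - (f x - \<mu> 0))\<^sup>2)" for t
  have fcz: "continuous_on (S \<times> {0..a}) (\<lambda>z. f (snd z))" for S :: "real set"
    by (rule continuous_on_compose2[OF fc]) (auto intro!: continuous_intros)
  have Vc: "continuous_on I0 V"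
  proof -
    have "continuous_on (I0 \<times> {0..a}) (\<lambda>z. \<mu> (fst z))"
      unfolding \<mu>_def by (rule continuous_on_compose2[OF mean_cont]) (auto intro!: continuous_intros)
    then have "continuous_on (I0 \<times> cbox 0 a) (\<lambda>(t, x). ((u t x - \<mu> t) - (f x - \<mu> 0))\<^sup>2)"
      unfolding cbox_interval case_prod_unfold by (intro continuous_intros u_cont[unfolded case_prod_unfold] fcz)
    then have "continuous_on I0 (\<lambda>t. integral (cbox 0 a) (\<lambda>x. ((u t x - \<mu> t) - (f x - \<mu> 0))\<^sup>2))"
      by (rule integral_continuous_on_param[where f="\<lambda>t x. ((u t x - \<mu> t) - (f x - \<mu> 0))\<^sup>2"])
    then show ?thesis by (simp add: V_def[abs_def])
  qed
  have V0: "V 0 = 0" by (simp add: V_def f_def)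
  \<comment> \<open>Continuity of V at 0 with V 0 = 0: for short times V stays below the gap - e0,
    so that (e0 + V t) / 2 is negative.\<close>
  obtain d where d: "d > 0" "\<forall>t\<in>I0. dist t 0 < d \<longrightarrow> dist (V t) (V 0) < - e0"
    using Vc[unfolded continuous_on_iff, rule_format, OF z0, of "- e0"] e0 by auto
  obtain r where r: "0 < ereal r" "ereal r < T" using ereal_dense2[OF T] by (elim exE conjE)
  define \<delta> where "\<delta> = min (d / 2) r"
  have \<delta>: "0 < \<delta>" "\<delta> < d" "\<delta> \<le> r" using d(1) r(1) by (auto simp: \<delta>_def zero_ereal_def)
  have dI: "t \<in> I1" if "0 < t" "t \<le> \<delta>" for t
    using that \<delta> le_less_trans[of "ereal t" "ereal r" T] r(2) by simp
  have dI0: "t \<in> I0" if "0 \<le> t" "t \<le> \<delta>" for t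
    using that \<delta> le_less_trans[of "ereal t" "ereal r" T] r(2) by simp
  have Vs: "V t < - e0" if "0 \<le> t" "t \<le> \<delta>" for t
    using bspec[OF d(2) dI0[OF that]] that \<delta>(2) V0 by (simp add: dist_real_def abs_less_iff)
  \<comment> \<open>Closed form of the inner integral from c to s: \<Phi> is a primitive of s powr
    (1 - p), and s powr (1 - p) / (1 - p) one of s powr (- p). The subtracted constant makes h c c =
    0.\<close>
  define h where "h s c = \<Phi> s - c * (s powr (1 - p) / (1 - p)) - (\<Phi> c - c * (c powr (1 - p) / (1 - p)))" for s c
  have hd: "((\<lambda>s. h s c) has_real_derivative (s - c) * s powr (- p)) (at s)" if "0 < s" for s c
  proof -
    have 1: "((\<lambda>s. s powr (1 - p) / (1 - p)) has_real_derivative s powr (- p)) (at s)"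
      using that p by (auto intro!: derivative_eq_intros)
    have "s powr (1 - p) = s * s powr (- p)" using that by (simp add: powr_mult_base)
    then have "s powr (1 - p) - c * s powr (- p) - 0 = (s - c) * s powr (- p)" by (simp add: algebra_simps)
    moreover have "((\<lambda>s. h s c) has_real_derivative s powr (1 - p) - c * s powr (- p) - 0) (at s)"
      unfolding h_def by (rule DERIV_diff[OF DERIV_diff[OF Phi_deriv[OF that] DERIV_cmult[OF 1]] DERIV_const])
    ultimately show ?thesis by simp
  qed
  have hc: "h c c = 0" for c by (simp add: h_def)
  have h0: "0 \<le> h s c" if "0 < s" "0 < c" for s c
  proof (cases "c \<le> s")
    case True
    have "h c c \<le> h s c"
    proof (rule DERIV_nonneg_imp_nondecreasing[OF True])
      fix x assume "c \<le> x" "x \<le> s"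
      then show "\<exists>y. ((\<lambda>s. h s c) has_real_derivative y) (at x) \<and> 0 \<le> y"
        using hd[of x c] that by (intro exI[of _ "(x - c) * x powr (- p)"]) auto
    qed
    then show ?thesis by (simp add: hc)
  next
    case False
    have "h c c \<le> h s c"
    proof (rule DERIV_nonpos_imp_nonincreasing[where f="\<lambda>s. h s c"])
      show "s \<le> c" using False by simp
      fix x assume "s \<le> x" "x \<le> c"
      then show "\<exists>y. ((\<lambda>s. h s c) has_real_derivative y) (at x) \<and> y \<le> 0"
        using hd[of x c] that by (intro exI[of _ "(x - c) * x powr (- p)"]) (auto simp: mult_nonpos_nonneg)
    qed
    then show ?thesis by (simp add: hc)
  qed
  define H where "H t = integral {0..a} (\<lambda>x. h (u t x) (f x))" for t
  have upz: "0 < u (fst z) (snd z)" if "z \<in> I0 \<times> {0..a}" for z using pos that by auto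
  have hcz: "continuous_on (I0 \<times> {0..a}) (\<lambda>z. h (u (fst z) (snd z)) (f (snd z)))"
  proof -
    have "continuous_on {0..a} (\<lambda>x. \<Phi> (f x) - f x * (f x powr (1 - p) / (1 - p)))"
      by (intro continuous_intros fc continuous_on_compose2[OF Phi_cont fc]) (use fp p in \<open>auto simp: less_imp_neq[symmetric]\<close>)
    then have 1: "continuous_on (I0 \<times> {0..a}) (\<lambda>z. \<Phi> (f (snd z)) - f (snd z) * (f (snd z) powr (1 - p) / (1 - p)))"
      by (rule continuous_on_compose2[where f=snd]) (auto intro!: continuous_intros)
    have 2: "continuous_on (I0 \<times> {0..a}) (\<lambda>z. \<Phi> (u (fst z) (snd z)))"
      by (rule continuous_on_compose2[OF Phi_cont u_cont[unfolded case_prod_unfold]]) (use upz in auto)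
    have 3: "u (fst z) (snd z) \<noteq> 0" if "z \<in> I0 \<times> {0..a}" for z using upz[OF that] by simp
    show ?thesis unfolding h_def
      by (intro continuous_on_diff[OF _ 1] continuous_on_diff[OF 2] continuous_on_mult continuous_on_divide continuous_on_powr fcz u_cont[unfolded case_prod_unfold] continuous_on_const)
        (use 3 p in auto)
  qed
  have Hc: "continuous_on I0 H"
  proof -
    have "continuous_on (I0 \<times> cbox 0 a) (\<lambda>(t, x). h (u t x) (f x))" using hcz by (simp add: case_prod_unfold)
    then have "continuous_on I0 (\<lambda>t. integral (cbox 0 a) (\<lambda>x. h (u t x) (f x)))"
      by (rule integral_continuous_on_param[where f="\<lambda>t x. h (u t x) (f x)"])
    then show ?thesis by (simp add: H_def[abs_def])
  qed
  have hslice: "continuous_on {0..a} (\<lambda>x. h (u t x) (f x))" if "t \<in> I0" for t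
    using continuous_on_slice[of I0 "{0..a}" "\<lambda>t x. h (u t x) (f x)"] hcz that by (simp add: case_prod_unfold)
  have Hd: "(H has_real_derivative integral {0..a} (\<lambda>x. (u t x - f x) * R t x)) (at t)" if t: "t \<in> I1" for t
  proof -
    have "((\<lambda>t. integral (cbox 0 a) (\<lambda>x. h (u t x) (f x))) has_real_derivative integral (cbox 0 a) (\<lambda>x. (u t x - f x) * R t x)) (at t within I1)"
    proof (rule leibniz_rule_field_derivative[where fx="\<lambda>s x. (u s x - f x) * R s x"])
      fix s x assume s: "s \<in> I1" and x: "x \<in> cbox 0 a"
      have us: "0 < u s x" using pos s x by auto
      have "((\<lambda>s. h (u s x) (f x)) has_real_derivative (u s x - f x) * u s x powr (- p) * ut s x) (at s)"
        by (rule DERIV_chain2[OF hd[OF us] ut]) (use s x in auto)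
      then have "((\<lambda>s. h (u s x) (f x)) has_real_derivative (u s x - f x) * R s x) (at s)"
        using R_eq[OF s, of x] x by (simp add: mult.assoc)
      then show "((\<lambda>s. h (u s x) (f x)) has_real_derivative (u s x - f x) * R s x) (at s within I1)"
        by (rule has_field_derivative_at_within)
    next
      show "(\<lambda>x. h (u s x) (f x)) integrable_on cbox 0 a" if "s \<in> I1" for s
        unfolding cbox_interval by (intro integrable_continuous_interval hslice) (use that in auto)
      show "continuous_on (I1 \<times> cbox 0 a) (\<lambda>(s, x). (u s x - f x) * R s x)"
        using R_cont unfolding cbox_interval case_prod_unfold by (intro continuous_intros u_cont1 fcz)
    qed (use t convex_I1 in auto)
    then show ?thesis using at_within_open[OF t open_I1] by (simp add: H_def[abs_def])
  qed
  \<comment> \<open>The left side is - E t - A - P. Here A is bounded through G and the gradient of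
    u, and P is expressed by V t and the two variances; the terms in u recombine to E t / 2, which
    leaves (e0 + V t) / 2 - E t / 2.\<close>
  have key: "integral {0..a} (\<lambda>x. (u t x - f x) * R t x) \<le> (e0 + V t) / 2" if t: "t \<in> I1" for t
  proof -
    have t0: "t \<in> I0" using t by auto
    note c = u_slice[OF t0] R_slice[OF t] uxx_slice[OF t] fc
    define P where "P = integral {0..a} (\<lambda>x. (u t x - \<mu> t) * (f x - \<mu> 0))"
    define A where "A = integral {0..a} (\<lambda>x. f x * uxx t x)"
    have um: "integral {0..a} (\<lambda>x. u t x - \<mu> t) = 0"
      using mean_integral[OF t0] a by (subst integral_diff) (auto intro!: integrable_continuous_interval c simp: \<mu>_def)
    have 1: "integral {0..a} (\<lambda>x. (u t x - f x) * R t x) = - E t - integral {0..a} (\<lambda>x. f x * R t x)"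
      unfolding left_diff_distrib integral_uR[OF t, symmetric]
      by (rule integral_diff) (intro integrable_continuous_interval continuous_intros c)+
    have 2: "integral {0..a} (\<lambda>x. f x * R t x) = A + P"
    proof -
      have "integral {0..a} (\<lambda>x. f x * R t x) = integral {0..a} (\<lambda>x. f x * uxx t x + ((u t x - \<mu> t) * (f x - \<mu> 0) + \<mu> 0 * (u t x - \<mu> t)))"
        by (rule integral_cong) (simp add: R_def \<mu>_def algebra_simps)
      also have "\<dots> = integral {0..a} (\<lambda>x. f x * uxx t x) + (integral {0..a} (\<lambda>x. (u t x - \<mu> t) * (f x - \<mu> 0)) + integral {0..a} (\<lambda>x. \<mu> 0 * (u t x - \<mu> t)))"
        by (subst integral_add, (intro integrable_continuous_interval continuous_intros c)+,
            subst integral_add, (intro integrable_continuous_interval continuous_intros c)+) simp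
      finally show ?thesis unfolding integral_mult_right um by (simp add: A_def P_def)
    qed
    have 3: "V t = integral {0..a} (\<lambda>x. (u t x - \<mu> t)\<^sup>2) + Vf - 2 * P"
    proof -
      have "V t = integral {0..a} (\<lambda>x. ((u t x - \<mu> t)\<^sup>2 + (f x - \<mu> 0)\<^sup>2) - 2 * ((u t x - \<mu> t) * (f x - \<mu> 0)))"
        unfolding V_def by (rule integral_cong) (simp add: power2_diff[of "u t _ - \<mu> t"] mult.assoc)
      also have "\<dots> = (integral {0..a} (\<lambda>x. (u t x - \<mu> t)\<^sup>2) + Vf) - integral {0..a} (\<lambda>x. 2 * ((u t x - \<mu> t) * (f x - \<mu> 0)))"
        unfolding Vf_def
        by (subst integral_diff, (intro integrable_continuous_interval continuous_intros c)+,
            subst integral_add, (intro integrable_continuous_interval continuous_intros c)+) simp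
      finally show ?thesis unfolding integral_mult_right by (simp add: P_def)
    qed
    \<comment> \<open>The test function is the spatial derivative of u at time t, admissible by the
      Neumann condition.\<close>
    have 4: "- 2 * A \<le> G + integral {0..a} (\<lambda>x. (ux t x)\<^sup>2)"
      unfolding A_def by (rule Gt[OF uxx uxx_slice[OF t] bc]) (use t in auto)
    have 5: "E t = integral {0..a} (\<lambda>x. (ux t x)\<^sup>2) - integral {0..a} (\<lambda>x. (u t x - \<mu> t)\<^sup>2)"
      by (simp add: E_def \<mu>_def)
    have lin: "X \<le> (G - F' + V') / 2"
      if "X = - E' - Y'" "Y' = A' + P'" "V' = U + F' - 2 * P'" "- 2 * A' \<le> G + W'" "E' = W' - U" "0 \<le> E'"
      for X E' Y' A' P' V' U F' W' :: real
      using that by (simp add: field_simps)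
    show ?thesis unfolding e0_def by (rule lin[OF 1 2 3 4 5 E0[OF t]])
  qed
  have "H \<delta> < H 0"
  proof (rule DERIV_neg_imp_decreasing_open[OF \<delta>(1)])
    fix t assume t: "0 < t" "t < \<delta>"
    then have tI: "t \<in> I1" using dI by auto
    have "V t < - e0" using Vs[of t] t by simp
    then have "(e0 + V t) / 2 < 0" by simp
    with key[OF tI] have "integral {0..a} (\<lambda>x. (u t x - f x) * R t x) < 0" by (rule le_less_trans)
    then show "\<exists>y. (H has_real_derivative y) (at t) \<and> y < 0" using Hd[OF tI] by blast
  next
    show "continuous_on {0..\<delta>} H" by (rule continuous_on_subset[OF Hc]) (use dI0 in auto)
  qed
  moreover have "H 0 = 0" by (simp add: H_def f_def hc)
  moreover have "0 \<le> H \<delta>" unfolding H_def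
    by (intro integral_nonneg integrable_continuous_interval hslice h0) (use pos[of \<delta>] dI0[of \<delta>] \<delta> fp in auto)
  ultimately show False by linarith
qed

text \<open>Otherwise \<open>D t > \<epsilon> / (r - t)\<close> near \<open>r\<close>, and \<open>E\<close> would tend to \<open>- \<infinity>\<close>.\<close>

lemma dissipation_near_end:
  assumes Tr: "T = ereal r" and E0: "\<And>t. t \<in> I1 \<Longrightarrow> 0 \<le> E t" and \<epsilon>: "0 < \<epsilon>" and s: "s < r"
  shows "\<exists>t. 0 < t \<and> s < t \<and> t < r \<and> (r - t) * D t \<le> \<epsilon>"
proof (rule ccontr)
  assume "\<not> ?thesis"
  then have neg: "\<epsilon> < (r - t) * D t" if "0 < t" "s < t" "t < r" for t using that by force
  have r0: "0 < r" using T Tr by (simp add: zero_ereal_def)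
  define s0 where "s0 = (max 0 s + r) / 2"
  have s0: "0 < s0" "s < s0" "s0 < r" using s r0 by (auto simp: s0_def)
  have s0I: "s0 \<in> I1" using s0 Tr by simp
  \<comment> \<open>With r - t = (r - s0) exp (- c) the logarithm drops by c, and 2 \<epsilon> c = E
    s0 + 1 pushes E t down to - 1 at most.\<close>
  define c where "c = (E s0 + 1) / (2 * \<epsilon>)"
  have c: "0 < c" using E0[OF s0I] \<epsilon> by (simp add: c_def)
  define e where "e = (r - s0) * exp (- c)"
  have e: "e < (r - s0) * 1" unfolding e_def using s0 c by (intro mult_strict_left_mono) auto
  have e0: "0 < e" using s0 by (simp add: e_def)
  define t where "t = r - e"
  have t: "s0 < t" "t < r" using e e0 by (simp_all add: t_def)
  have tI: "t \<in> I1" using t s0 Tr by simp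
  have "(E t - 2 * \<epsilon> * ln (r - t)) - (E s0 - 2 * \<epsilon> * ln (r - s0)) \<le> 0 * (t - s0)"
  proof (rule increment_le[where S=UNIV])
    fix x assume "x \<in> {s0..t}"
    then have x: "0 < x" "s < x" "x < r" using s0 t by auto
    then have xI: "x \<in> I1" using Tr by simp
    show "((\<lambda>t. E t - 2 * \<epsilon> * ln (r - t)) has_real_derivative - 2 * D x + 2 * \<epsilon> / (r - x)) (at x)"
      using x by (auto intro!: derivative_eq_intros E_deriv[OF xI])
    have "\<epsilon> / (r - x) < D x" using neg[OF x] x by (simp add: pos_divide_less_eq mult.commute)
    then show "- 2 * D x + 2 * \<epsilon> / (r - x) \<le> 0" by simp
  qed (use t in auto)
  moreover have "ln (r - t) = ln (r - s0) - c" using s0 by (simp add: t_def e_def ln_mult)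
  ultimately have "E t \<le> E s0 - 2 * \<epsilon> * c" by (simp add: algebra_simps)
  also have "\<dots> = - 1" using \<epsilon> by (simp add: c_def)
  finally show False using E0[OF tI] by simp
qed

lemma shift:
  assumes Tr: "T = ereal r" and t1: "0 < t1" "t1 < r"
  shows "neumann_flow p a (ereal (r - t1)) (\<lambda>t. u (t1 + t)) (\<lambda>t. ut (t1 + t)) (\<lambda>t. ux (t1 + t)) (\<lambda>t. uxx (t1 + t))"
proof
  have sh: "continuous_on (S' \<times> {0..a}) (\<lambda>(t, x). g (t1 + t) x)"
    if "continuous_on (S \<times> {0..a}) (\<lambda>(t, x). g t x)" "\<And>t. t \<in> S' \<Longrightarrow> t1 + t \<in> S" for g :: "real \<Rightarrow> real \<Rightarrow> real" and S S'
  proof -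
    have "continuous_on (S' \<times> {0..a}) (\<lambda>z. (\<lambda>(t, x). g t x) (t1 + fst z, snd z))"
      by (rule continuous_on_compose2[OF that(1)]) (use that(2) in \<open>auto intro!: continuous_intros\<close>)
    then show ?thesis by (simp add: case_prod_unfold)
  qed
  show "continuous_on ({t. 0 \<le> t \<and> ereal t < ereal (r - t1)} \<times> {0..a}) (\<lambda>(t, x). u (t1 + t) x)"
    by (rule sh[OF u_cont]) (use Tr t1 in auto)
  show "continuous_on ({t. 0 < t \<and> ereal t < ereal (r - t1)} \<times> {0..a}) (\<lambda>(t, x). ut (t1 + t) x)"
    by (rule sh[OF ut_cont]) (use Tr t1 in auto)
  show "continuous_on ({t. 0 < t \<and> ereal t < ereal (r - t1)} \<times> {0..a}) (\<lambda>(t, x). ux (t1 + t) x)"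
    by (rule sh[OF ux_cont]) (use Tr t1 in auto)
  show "continuous_on ({t. 0 < t \<and> ereal t < ereal (r - t1)} \<times> {0..a}) (\<lambda>(t, x). uxx (t1 + t) x)"
    by (rule sh[OF uxx_cont]) (use Tr t1 in auto)
  fix t x assume t: "0 < t" "ereal t < ereal (r - t1)"
  have tt: "0 < t1 + t" "ereal (t1 + t) < T" using t t1 Tr by auto
  show "((\<lambda>s. u (t1 + s) x) has_real_derivative ut (t1 + t) x) (at t)" if "x \<in> {0..a}"
    using DERIV_shift[of "\<lambda>s. u s x" "ut (t1 + t) x" t t1] ut[OF tt that] by (simp add: add.commute)
  show "(u (t1 + t) has_real_derivative ux (t1 + t) x) (at x within {0..a})" if "x \<in> {0..a}" by (rule ux[OF tt that])
  show "(ux (t1 + t) has_real_derivative uxx (t1 + t) x) (at x within {0..a})" if "x \<in> {0..a}" by (rule uxx[OF tt that])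
  show "ut (t1 + t) x = u (t1 + t) x powr p * (uxx (t1 + t) x + u (t1 + t) x - mean a (u (t1 + t)))" if "x \<in> {0<..<a}" by (rule pde_interior[OF tt that])
  show "ux (t1 + t) 0 = 0" "ux (t1 + t) a = 0" by (rule bc[OF tt])+
qed (use p a t1 pos Tr in \<open>auto simp: zero_ereal_def\<close>)

end

section \<open>Uniqueness and continuation\<close>

text \<open>Maximum principle for |u - v| exp (- k t). The difference of the equations is written as
  (u powr p - v powr p) * RU + v powr p * (RU - RV), so a bound on R is needed for u alone; for a
  solution from \<open>local_existence\<close> none is available near time 0. The nonlocal mean
  contributes at most the maximum of |u - v|.\<close>

lemma neumann_flow_unique:
  assumes fU: "neumann_flow p a T u ut ux uxx" and fV: "neumann_flow p a T' v vt vx vxx"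
    and init: "\<And>x. x \<in> {0..a} \<Longrightarrow> u 0 x = v 0 x"
    and \<tau>: "0 \<le> \<tau>" "ereal \<tau> < T" "ereal \<tau> < T'"
    and K: "\<And>t x. \<lbrakk>t \<in> {0<..\<tau>}; x \<in> {0..a}\<rbrakk> \<Longrightarrow> \<bar>uxx t x + u t x - mean a (u t)\<bar> \<le> K"
    and x: "x \<in> {0..a}"
  shows "u \<tau> x = v \<tau> x"
proof (rule ccontr)
  assume neq: "u \<tau> x \<noteq> v \<tau> x"
  interpret U: neumann_flow p a T u ut ux uxx by (rule fU)
  interpret V: neumann_flow p a T' v vt vx vxx by (rule fV)
  have IU: "0 < t \<and> ereal t < T" and IV: "0 < t \<and> ereal t < T'" if "t \<in> {0<..\<tau>}" for t
    using that \<tau> le_less_trans[of "ereal t" "ereal \<tau>"] by auto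
  have IU0: "0 \<le> t \<and> ereal t < T" and IV0: "0 \<le> t \<and> ereal t < T'" if "t \<in> {0..\<tau>}" for t
    using that \<tau> le_less_trans[of "ereal t" "ereal \<tau>"] by auto
  obtain m1 B1 where B1: "0 < m1" "\<forall>t\<in>{0..\<tau>}. \<forall>x\<in>{0..a}. m1 \<le> u t x \<and> u t x \<le> B1"
  proof -
    have "\<exists>m>0. \<exists>B. \<forall>t\<in>{0..\<tau>}. \<forall>x\<in>{0..a}. m \<le> u t x \<and> u t x \<le> B" by (rule U.compact_bounds) (use \<tau> in simp)
    then show thesis using that by (elim exE conjE)
  qed
  obtain m2 B2 where B2: "0 < m2" "\<forall>t\<in>{0..\<tau>}. \<forall>x\<in>{0..a}. m2 \<le> v t x \<and> v t x \<le> B2"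
  proof -
    have "\<exists>m>0. \<exists>B. \<forall>t\<in>{0..\<tau>}. \<forall>x\<in>{0..a}. m \<le> v t x \<and> v t x \<le> B" by (rule V.compact_bounds) (use \<tau> in simp)
    then show thesis using that by (elim exE conjE)
  qed
  define m B where "m = min m1 m2" and "B = max B1 B2"
  have m: "0 < m" using B1 B2 by (simp add: m_def)
  have ub: "u t x \<in> {m..B}" and vb: "v t x \<in> {m..B}" if "t \<in> {0..\<tau>}" "x \<in> {0..a}" for t x
    using bspec[OF bspec[OF B1(2) that(1)] that(2)] bspec[OF bspec[OF B2(2) that(1)] that(2)]
    by (auto simp: m_def B_def)
  have B: "0 < B" using ub[of 0 x] m \<tau> x by auto
  define d where "d t x = u t x - v t x" for t x
  \<comment> \<open>The first summand is the Lipschitz constant of the power times K; in the second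
    the factor 2 counts u - v and the difference of the means. The 1 makes the final derivative
    strictly negative.\<close>
  define k where "k = p * B powr (p - 1) * K + 2 * B powr p + 1"
  define w where "w t x = \<bar>d t x\<bar> * exp (- k * t)" for t x
  have wc: "continuous_on ({0..\<tau>} \<times> {0..a}) (\<lambda>(t, x). w t x)"
  proof -
    have "continuous_on ({0..\<tau>} \<times> {0..a}) (\<lambda>z. u (fst z) (snd z))"
      by (rule continuous_on_subset[OF U.u_cont[unfolded case_prod_unfold] Sigma_mono[OF subsetI subset_refl]]) (use IU0 in blast)
    moreover have "continuous_on ({0..\<tau>} \<times> {0..a}) (\<lambda>z. v (fst z) (snd z))"
      by (rule continuous_on_subset[OF V.u_cont[unfolded case_prod_unfold] Sigma_mono[OF subsetI subset_refl]]) (use IV0 in blast)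
    ultimately show ?thesis unfolding w_def d_def case_prod_unfold by (intro continuous_intros)
  qed
  have "{0..\<tau>} \<times> {0..a} \<noteq> {}" using \<tau> x by auto
  then obtain z where z: "z \<in> {0..\<tau>} \<times> {0..a}" "\<And>y. y \<in> {0..\<tau>} \<times> {0..a} \<Longrightarrow> (\<lambda>(t, x). w t x) y \<le> (\<lambda>(t, x). w t x) z"
    using continuous_attains_sup[OF compact_Times[OF compact_Icc compact_Icc] _ wc] by blast
  define s y where "s = fst z" and "y = snd z"
  have s: "s \<in> {0..\<tau>}" and y: "y \<in> {0..a}" using z(1) by (auto simp: s_def y_def)
  have wmax: "w s' y' \<le> w s y" if "s' \<in> {0..\<tau>}" "y' \<in> {0..a}" for s' y'
    using z(2)[of "(s', y')"] that by (simp add: s_def y_def case_prod_unfold)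
  have "0 < w \<tau> x" using neq by (simp add: w_def d_def)
  also have "\<dots> \<le> w s y" by (rule wmax) (use \<tau> x in auto)
  finally have wpos: "0 < w s y" .
  then have "s \<noteq> 0" using init[OF y] by (auto simp: w_def d_def)
  then have s1: "s \<in> {0<..\<tau>}" using s by auto
  define \<sigma> where "\<sigma> = sgn (d s y)"
  have dpos: "d s y \<noteq> 0" using wpos by (auto simp: w_def)
  have \<sigma>: "\<sigma> = 1 \<or> \<sigma> = - 1" "\<sigma> * d s y = \<bar>d s y\<bar>" using dpos by (auto simp: \<sigma>_def sgn_if)
  have \<sigma>le: "\<sigma> * b \<le> \<bar>b\<bar>" for b using \<sigma>(1) by auto
  define M where "M = \<sigma> * d s y"
  have M: "0 < M" using dpos \<sigma>(2) by (simp add: M_def)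
  have dmax: "\<bar>d s y'\<bar> \<le> M" if "y' \<in> {0..a}" for y'
    using wmax[OF s that] by (simp add: w_def M_def \<sigma>(2))
  note sU = IU[OF s1, THEN conjunct1] IU[OF s1, THEN conjunct2]
  note sV = IV[OF s1, THEN conjunct1] IV[OF s1, THEN conjunct2]
  \<comment> \<open>With the sign \<sigma> fixed, - \<sigma> * d s is minimal at y and satisfies the
    Neumann condition, so the second-derivative test applies even if y is an end point.\<close>
  have xx: "\<sigma> * (uxx s y - vxx s y) \<le> 0"
  proof -
    have "0 \<le> - \<sigma> * (uxx s y - vxx s y)"
    proof (rule neumann_min_second_deriv[of a "\<lambda>y. - \<sigma> * d s y" "\<lambda>y. - \<sigma> * (ux s y - vx s y)" "\<lambda>y. - \<sigma> * (uxx s y - vxx s y)" y, OF U.a])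
      show "((\<lambda>y. - \<sigma> * d s y) has_real_derivative - \<sigma> * (ux s y - vx s y)) (at y within {0..a})" if "y \<in> {0..a}" for y
        unfolding d_def by (intro DERIV_cmult DERIV_diff U.ux V.ux sU sV that)
      show "((\<lambda>y. - \<sigma> * (ux s y - vx s y)) has_real_derivative - \<sigma> * (uxx s y - vxx s y)) (at y within {0..a})" if "y \<in> {0..a}" for y
        by (intro DERIV_cmult DERIV_diff U.uxx V.uxx sU sV that)
      show "- \<sigma> * d s y \<le> - \<sigma> * d s y'" if "y' \<in> {0..a}" for y'
        using dmax[OF that] \<sigma>le[of "d s y'"] by (simp add: M_def)
    qed (use U.bc[OF sU] V.bc[OF sV] y in auto)
    then show ?thesis by simp
  qed
  have mean: "- \<sigma> * (mean a (u s) - mean a (v s)) \<le> M"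
  proof -
    have ci: "u s integrable_on {0..a}" "v s integrable_on {0..a}"
      using U.u_slice[of s] V.u_slice[of s] IU0[OF s] IV0[OF s] by (auto intro!: integrable_continuous_interval)
    have "integral {0..a} (\<lambda>y. - \<sigma> * (u s y - v s y)) \<le> integral {0..a} (\<lambda>_. M)"
    proof (rule integral_le)
      show "(\<lambda>y. - \<sigma> * (u s y - v s y)) integrable_on {0..a}" by (intro integrable_on_mult_right integrable_diff ci)
      fix y' assume "y' \<in> {0..a}"
      from dmax[OF this] show "- \<sigma> * (u s y' - v s y') \<le> M" using \<sigma>(1) by (auto simp: d_def)
    qed (intro integrable_continuous_interval continuous_intros)
    also have "integral {0..a} (\<lambda>y. - \<sigma> * (u s y - v s y)) = - \<sigma> * (a * mean a (u s) - a * mean a (v s))"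
      using U.mean_integral[of s] V.mean_integral[of s] IU0[OF s] IV0[OF s]
      unfolding integral_mult_right integral_diff[OF ci] by simp
    finally have "a * (- \<sigma> * (mean a (u s) - mean a (v s))) \<le> a * M" using U.a by (simp add: algebra_simps)
    then show ?thesis using U.a by (simp only: mult_le_cancel_left_pos)
  qed
  have usy: "u s y \<in> {m..B}" and vsy: "v s y \<in> {m..B}" using ub[OF s y] vb[OF s y] by auto
  define RU RV where "RU = U.R s y" and "RV = V.R s y"
  have "\<sigma> * (ut s y - vt s y) \<le> p * B powr (p - 1) * K * M + 2 * B powr p * M"
  proof -
    have R: "\<sigma> * (RU - RV) \<le> 2 * M"
    proof -
      have "RU - RV = (uxx s y - vxx s y) + d s y - (mean a (u s) - mean a (v s))"
        by (simp add: RU_def RV_def U.R_def V.R_def d_def)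
      then have "\<sigma> * (RU - RV) = \<sigma> * ((uxx s y - vxx s y) + d s y - (mean a (u s) - mean a (v s)))"
        by (simp only:)
      also have "\<dots> = \<sigma> * (uxx s y - vxx s y) + M + - \<sigma> * (mean a (u s) - mean a (v s))"
        by (simp add: M_def algebra_simps)
      finally have "\<sigma> * (RU - RV) = \<sigma> * (uxx s y - vxx s y) + M + - \<sigma> * (mean a (u s) - mean a (v s))" .
      then show ?thesis using xx mean by linarith
    qed
    have "\<bar>u s y powr p - v s y powr p\<bar> \<le> p * B powr (p - 1) * \<bar>u s y - v s y\<bar>"
      by (rule powr_lipschitz[OF m less_imp_le[OF U.p(1)] usy vsy])
    also have "\<bar>u s y - v s y\<bar> = M" using \<sigma>(2) by (simp add: M_def d_def)
    finally have 1: "\<bar>u s y powr p - v s y powr p\<bar> * \<bar>RU\<bar> \<le> p * B powr (p - 1) * M * K"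
      using K[OF s1 y] M U.p by (intro mult_mono) (auto simp: RU_def U.R_def)
    have "\<sigma> * ((u s y powr p - v s y powr p) * RU) \<le> \<bar>(u s y powr p - v s y powr p) * RU\<bar>" by (rule \<sigma>le)
    then have 2: "\<sigma> * ((u s y powr p - v s y powr p) * RU) \<le> p * B powr (p - 1) * M * K"
      using 1 unfolding abs_mult by linarith
    have "v s y powr p * (\<sigma> * (RU - RV)) \<le> v s y powr p * (2 * M)" by (rule mult_left_mono[OF R]) simp
    also have "\<dots> \<le> B powr p * (2 * M)"
      using vsy m U.p M by (intro mult_right_mono powr_mono2) auto
    finally have 3: "v s y powr p * (\<sigma> * (RU - RV)) \<le> B powr p * (2 * M)" .
    have "ut s y = u s y powr p * RU" "vt s y = v s y powr p * RV"
      using U.pde[of s y] V.pde[of s y] sU sV y by (auto simp: RU_def RV_def)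
    then have "\<sigma> * (ut s y - vt s y) = \<sigma> * ((u s y powr p - v s y powr p) * RU) + v s y powr p * (\<sigma> * (RU - RV))"
      by (simp add: algebra_simps)
    then show ?thesis using 2 3 by (simp add: algebra_simps)
  qed
  then have dn: "\<sigma> * (ut s y - vt s y) - k * M < 0" using M by (simp add: k_def algebra_simps)
  define g where "g t = \<sigma> * d t y * exp (- k * t)" for t
  have "(g has_real_derivative (\<sigma> * (ut s y - vt s y)) * exp (- k * s) + \<sigma> * d s y * (exp (- k * s) * (- k))) (at s)"
  proof -
    have 1: "((\<lambda>t. \<sigma> * d t y) has_real_derivative \<sigma> * (ut s y - vt s y)) (at s)"
      unfolding d_def by (intro DERIV_cmult DERIV_diff U.ut V.ut sU sV y)
    have 2: "((\<lambda>t. exp (- k * t)) has_real_derivative exp (- k * s) * (- k)) (at s)"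
      by (auto intro!: derivative_eq_intros)
    show ?thesis unfolding g_def[abs_def] by (rule DERIV_cong[OF DERIV_mult[OF 1 2]]) (simp add: algebra_simps)
  qed
  moreover have "(\<sigma> * (ut s y - vt s y)) * exp (- k * s) + \<sigma> * d s y * (exp (- k * s) * (- k)) = (\<sigma> * (ut s y - vt s y) - k * M) * exp (- k * s)"
    by (simp add: M_def algebra_simps)
  ultimately have gd: "(g has_real_derivative (\<sigma> * (ut s y - vt s y) - k * M) * exp (- k * s)) (at s)" by simp
  have "(\<sigma> * (ut s y - vt s y) - k * M) * exp (- k * s) < 0" by (rule mult_neg_pos[OF dn]) simp
  from DERIV_neg_dec_left[OF gd this] obtain h0 where h0: "h0 > 0" "\<forall>h>0. h < h0 \<longrightarrow> g s < g (s - h)" by (elim exE conjE)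
  define h where "h = min (h0 / 2) s"
  have h: "0 < h" "h < h0" "s - h \<in> {0..\<tau>}" using h0(1) s1 by (auto simp: h_def min_def)
  have "g s < g (s - h)" using h0(2) h by blast
  moreover have "g (s - h) \<le> w (s - h) y" unfolding g_def w_def by (intro mult_right_mono \<sigma>le) simp
  moreover have "w (s - h) y \<le> w s y" by (rule wmax[OF h(3) y])
  moreover have "w s y = g s" by (simp add: g_def w_def \<sigma>(2))
  ultimately show False by linarith
qed

lemma deriv_unique_within_Icc:
  fixes f g :: "real \<Rightarrow> real"
  assumes "0 < a" and x: "x \<in> {0..a}"
    and f: "(f has_real_derivative l) (at x within {0..a})" and g: "(g has_real_derivative l') (at x within {0..a})"
    and eq: "\<And>y. y \<in> {0..a} \<Longrightarrow> f y = g y"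
  shows "l = l'"
proof -
  have "(f has_real_derivative l') (at x within {0..a})"
    by (rule has_field_derivative_transform_within[OF g zero_less_one x]) (simp add: eq)
  then show ?thesis
    using vector_derivative_unique_within_closed_interval[OF assms(1), of x f l l'] f x
    by (simp add: has_real_derivative_iff_has_vector_derivative)
qed

text \<open>The two pieces agree on the window between s and r, and both domains are open relative
  to J \<times> X, so continuity is a local matter. J is left general to serve time intervals with
  and without the time 0.\<close>

lemma glue_continuous:
  fixes f g :: "real \<Rightarrow> real \<Rightarrow> real"
  assumes f: "continuous_on ((J \<inter> {..<r}) \<times> X) (\<lambda>(t, x). f t x)"
    and g: "continuous_on ({s<..<r'} \<times> X) (\<lambda>(t, x). g t x)"
    and s: "s < r" and J: "{s<..<r'} \<subseteq> J" "J \<subseteq> {..<r'}"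
    and eq: "\<And>t x. \<lbrakk>s < t; t < r; x \<in> X\<rbrakk> \<Longrightarrow> f t x = g t x"
  shows "continuous_on (J \<times> X) (\<lambda>(t, x). if t < r then f t x else g t x)"
proof -
  let ?S = "(J \<inter> {..<r}) \<times> X" and ?T = "{s<..<r'} \<times> X"
  have U: "?S \<union> ?T = J \<times> X" using s J by force
  have "?S = (J \<times> X) \<inter> ({..<r} \<times> UNIV)" by auto
  then have "openin (top_of_set (J \<times> X)) ?S"
    by (metis openin_open_Int open_Times open_lessThan open_UNIV)
  moreover have "?T = (J \<times> X) \<inter> ({s<..} \<times> UNIV)" using J by force
  then have "openin (top_of_set (J \<times> X)) ?T"
    by (metis openin_open_Int open_Times open_greaterThan open_UNIV)
  ultimately have "continuous_on (?S \<union> ?T) (\<lambda>z. if fst z < r then (\<lambda>(t, x). f t x) z else (\<lambda>(t, x). g t x) z)"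
    by (intro continuous_on_cases_local_open f g) (auto simp: U eq)
  then show ?thesis unfolding U case_prod_unfold .
qed

context neumann_flow
begin

lemma extension:
  assumes Tr: "T = ereal r" and E0: "\<And>t. t \<in> I1 \<Longrightarrow> 0 \<le> E t"
  shows "\<exists>r' w wt wx wxx. r < r' \<and> neumann_flow p a (ereal r') w wt wx wxx \<and>
    (\<forall>t x. 0 \<le> t \<and> t < r \<and> x \<in> {0..a} \<longrightarrow> w t x = u t x)"
proof -
  have r0: "0 < r" using T Tr by (simp add: zero_ereal_def)
  have "\<exists>B. \<forall>t\<in>I0. \<forall>x\<in>{0..a}. u t x \<le> B" by (rule bounded_all[OF E0])
  then obtain B where "\<forall>t\<in>I0. \<forall>x\<in>{0..a}. u t x \<le> B" by (elim exE)
  then have B: "u t x \<le> B" if "t \<in> I0" "x \<in> {0..a}" for t x using that by blast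
  have z0: "0 \<in> I0" using r0 Tr by simp
  obtain m0 B' where m0: "0 < m0" "\<forall>t\<in>{0..0}. \<forall>x\<in>{0..a}. m0 \<le> u t x \<and> u t x \<le> B'"
    using compact_bounds[OF z0] by (elim exE conjE)
  \<comment> \<open>The exponential is taken at the final time r, which gives one lower bound for
    all times.\<close>
  define c where "c = m0 * exp (- (B powr p + 1) * r)"
  have c: "0 < c" using m0 by (simp add: c_def)
  have low: "c \<le> u t x" if t: "t \<in> I0" and x: "x \<in> {0..a}" for t x
  proof -
    have "(B powr p + 1) * t \<le> (B powr p + 1) * r" using t Tr by (intro mult_left_mono add_nonneg_nonneg) auto
    then have "c \<le> m0 * exp (- (B powr p + 1) * t)"
      unfolding c_def using m0 by (intro mult_left_mono) (simp_all add: algebra_simps)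
    also have "\<dots> \<le> u t x" by (rule lower_bound[OF B t x]) (use m0 in auto)
    finally show ?thesis .
  qed
  have cB: "c \<le> B" using low[OF z0, of 0] B[OF z0, of 0] a by auto
  define M where "M = 2 * B"
  define A where "A = M powr p"
  have M: "0 < M" "0 < A" using c cB by (auto simp: M_def A_def)
  define K where "K = \<bar>grid_flow.K p a (c / 2) M\<bar>"
  have K: "0 \<le> K" by (simp add: K_def)
  \<comment> \<open>Chosen so that Y \<le> Y0 + Y1 * D t1: the factor 32 collects 2 * 2 from Y, 4
    from J and 2 from the bound on the integral of uxx^2.\<close>
  define Y1 where "Y1 = 32 * A / c powr p"
  define Y0 where "Y0 = 2 * (1 + A * (2 * (4 * (2 * a * B\<^sup>2 + a)) + 2 * (a * M\<^sup>2)))"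
  have Y1: "0 \<le> Y1" and Y0: "0 \<le> Y0" using M c a by (auto simp: Y1_def Y0_def intro!: mult_nonneg_nonneg add_nonneg_nonneg)
  \<comment> \<open>K * T' * Y is bounded by a part with Y0, made at most 1 / 2 by \<eta>, and a
    part with Y1 * D t1, made at most 1 / 2 by \<epsilon>. The other entry of \<eta> is the
    condition under which the truncation of the grid equation stays inactive.\<close>
  define \<epsilon> where "\<epsilon> = 1 / (4 * ((K + 1) * (Y1 + 1)))"
  define \<eta> where "\<eta> = min (c / (4 * (A * M))) (1 / (4 * ((K + 1) * (Y0 + 1))))"
  have \<epsilon>: "0 < \<epsilon>" using K Y1 by (simp add: \<epsilon>_def)
  have \<eta>: "0 < \<eta>" using K Y0 M c by (simp add: \<eta>_def)
  obtain t1 where t1: "0 < t1" "r - \<eta> < t1" "t1 < r" and Dt1: "(r - t1) * D t1 \<le> \<epsilon>"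
    using dissipation_near_end[OF Tr E0 \<epsilon>, of "r - \<eta>"] \<eta> by auto
  have t1I: "t1 \<in> I1" and t1I0: "t1 \<in> I0" using t1 Tr by auto
  have t1T: "0 < t1" "ereal t1 < T" using t1I by auto
  define \<tau> where "\<tau> = r - t1"
  have \<tau>: "0 < \<tau>" "\<tau> \<le> \<eta>" using t1 by (auto simp: \<tau>_def)
  \<comment> \<open>Twice the remaining time, so that the restarted solution reaches \<tau> beyond
    r.\<close>
  define T' where "T' = 2 * \<tau>"
  define J where "J = 4 * (integral {0..a} (\<lambda>x. (uxx t1 x)\<^sup>2) + a)"
  define Y where "Y = 2 * (1 + A * (2 * J + 2 * (a * M\<^sup>2)))"
  \<comment> \<open>The definition of R gives uxx = R - (u - mean), and R^2 \<le> ut * R / c powr p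
    by the lower bound on u; this is how D t1 enters the lifespan.\<close>
  have usq: "integral {0..a} (\<lambda>x. (uxx t1 x)\<^sup>2) \<le> 2 * D t1 / c powr p + 2 * a * B\<^sup>2"
  proof -
    have "integral {0..a} (\<lambda>x. (uxx t1 x)\<^sup>2) \<le> integral {0..a} (\<lambda>x. 2 / c powr p * (ut t1 x * R t1 x) + 2 * B\<^sup>2)"
    proof (rule integral_le)
      fix x assume x: "x \<in> {0..a}"
      have cp: "0 < c powr p" "c powr p \<le> u t1 x powr p"
        using c low[OF t1I0 x] p by (auto intro!: powr_mono2)
      define b where "b = u t1 x - mean a (u t1)"
      have b: "\<bar>b\<bar> \<le> B"
        using low[OF t1I0 x] B[OF t1I0 x] mean_le[OF t1I0 B[OF t1I0]] mean_nonneg[OF t1I0] c unfolding b_def by simp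
      have "(uxx t1 x)\<^sup>2 = (R t1 x - b)\<^sup>2" by (simp add: R_def b_def)
      also have "\<dots> \<le> 2 * (R t1 x)\<^sup>2 + 2 * b\<^sup>2" by (rule power2_diff_le)
      also have "\<dots> \<le> 2 * (R t1 x)\<^sup>2 + 2 * B\<^sup>2" using b abs_le_square_iff[of b B] c cB by simp
      finally have 1: "(uxx t1 x)\<^sup>2 \<le> 2 * (R t1 x)\<^sup>2 + 2 * B\<^sup>2" .
      have "c powr p * (R t1 x)\<^sup>2 \<le> u t1 x powr p * (R t1 x)\<^sup>2" using cp by (intro mult_right_mono) auto
      also have "\<dots> = ut t1 x * R t1 x" by (simp add: pde[OF t1I x] power2_eq_square)
      finally have "(R t1 x)\<^sup>2 \<le> ut t1 x * R t1 x / c powr p" using cp by (simp add: pos_le_divide_eq mult.commute)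
      then show "(uxx t1 x)\<^sup>2 \<le> 2 / c powr p * (ut t1 x * R t1 x) + 2 * B\<^sup>2" using 1 by simp
    qed (intro integrable_continuous_interval continuous_intros ut_slice R_slice uxx_slice t1I)+
    also have "\<dots> = 2 / c powr p * D t1 + integral {0..a} (\<lambda>_. 2 * B\<^sup>2)"
      unfolding D_def integral_mult_right[symmetric]
      by (rule integral_add) (intro integrable_continuous_interval continuous_intros ut_slice R_slice t1I)+
    finally show ?thesis using a by simp
  qed
  have YY: "Y \<le> Y0 + Y1 * D t1"
  proof -
    have "J \<le> 4 * (2 * D t1 / c powr p + 2 * a * B\<^sup>2 + a)" using usq by (simp add: J_def)
    then have "A * (2 * J + 2 * (a * M\<^sup>2)) \<le> A * (2 * (4 * (2 * D t1 / c powr p + 2 * a * B\<^sup>2 + a)) + 2 * (a * M\<^sup>2))"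
      using M by (intro mult_left_mono) auto
    then have "Y \<le> 2 * (1 + A * (2 * (4 * (2 * D t1 / c powr p + 2 * a * B\<^sup>2 + a)) + 2 * (a * M\<^sup>2)))"
      by (simp add: Y_def)
    also have "\<dots> = Y0 + Y1 * D t1" by (simp add: Y0_def Y1_def algebra_simps)
    finally show ?thesis .
  qed
  have KT: "K * T' * Y \<le> 1"
  proof -
    have half: "2 * K * z \<le> 1 / 2" if z: "z \<le> q / (4 * ((K + 1) * (q + 1)))" and q: "0 \<le> q" for z q
    proof -
      have "2 * K * z \<le> 2 * K * (q / (4 * ((K + 1) * (q + 1))))" using K z by (intro mult_left_mono) auto
      also have "\<dots> = 1 / 2 * ((K / (K + 1)) * (q / (q + 1)))"
      proof -
        have "2 * x * (y / (4 * (k * l))) = 1 / 2 * ((x / k) * (y / l))" for x y k l :: real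
          by (cases "k = 0 \<or> l = 0") (auto simp: field_simps)
        then show ?thesis .
      qed
      also have "\<dots> \<le> 1 / 2 * (1 * 1)" using K q by (intro mult_left_mono mult_mono) auto
      finally show ?thesis by simp
    qed
    have "\<tau> * Y0 \<le> 1 / (4 * ((K + 1) * (Y0 + 1))) * Y0"
      using \<tau> Y0 by (intro mult_right_mono) (auto simp: \<eta>_def)
    then have 1: "2 * K * (\<tau> * Y0) \<le> 1 / 2" by (intro half[OF _ Y0]) simp
    have "\<tau> * D t1 * Y1 \<le> \<epsilon> * Y1" using Dt1 Y1 by (intro mult_right_mono) (auto simp: \<tau>_def)
    then have 2: "2 * K * (\<tau> * D t1 * Y1) \<le> 1 / 2" by (intro half[OF _ Y1]) (simp add: \<epsilon>_def)
    have "K * T' * Y \<le> K * T' * (Y0 + Y1 * D t1)" using K \<tau> YY by (intro mult_left_mono) (auto simp: T'_def)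
    also have "\<dots> = 2 * K * (\<tau> * Y0) + 2 * K * (\<tau> * D t1 * Y1)" by (simp add: T'_def algebra_simps)
    also have "\<dots> \<le> 1 / 2 + 1 / 2" by (rule add_mono[OF 1 2])
    finally show ?thesis by simp
  qed
  have Tp: "0 < T'" using \<tau> by (simp add: T'_def)
  have cT: "2 * ((2 * B) powr p * (2 * B)) * T' \<le> c"
  proof -
    have "\<tau> \<le> c / (4 * (A * M))" using \<tau> by (simp add: \<eta>_def)
    then have "\<tau> * (4 * (A * M)) \<le> c" using M by (simp add: pos_le_divide_eq)
    then show ?thesis by (simp add: T'_def A_def M_def algebra_simps)
  qed
  have KT': "grid_flow.K p a (c / 2) (2 * B) * T' * (2 * (1 + (2 * B) powr p * (2 * (4 * (integral {0..a} (\<lambda>x. (uxx t1 x)\<^sup>2) + a)) + 2 * (a * (2 * B)\<^sup>2)))) \<le> 1"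
  proof -
    have Yn: "0 \<le> Y"
    proof -
      have "0 \<le> integral {0..a} (\<lambda>x. (uxx t1 x)\<^sup>2)"
        by (intro integral_nonneg integrable_continuous_interval continuous_intros uxx_slice t1I) auto
      then show ?thesis using M a by (auto simp: Y_def J_def intro!: mult_nonneg_nonneg add_nonneg_nonneg)
    qed
    have "grid_flow.K p a (c / 2) M * T' * Y \<le> K * T' * Y"
      unfolding K_def using Tp Yn by (intro mult_right_mono) auto
    then have "grid_flow.K p a (c / 2) M * T' * Y \<le> 1" using KT by (rule order_trans)
    then show ?thesis unfolding Y_def J_def A_def M_def .
  qed
  have data: "c \<le> u t1 x \<and> u t1 x \<le> B" if "x \<in> {0..a}" for x using low[OF t1I0 that] B[OF t1I0 that] by simp
  show ?thesis
  proof (rule local_existence[OF p(1) a c cB Tp cT KT' data ux[OF t1T] uxx[OF t1T] uxx_slice[OF t1I] bc(1)[OF t1T] bc(2)[OF t1T]])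
    fix V Vt Vx Vxx :: "real \<Rightarrow> real \<Rightarrow> real"
    assume V_cont: "continuous_on ({0..T'} \<times> {0..a}) (\<lambda>(t, x). V t x)"
      and V_pos: "\<And>t x. \<lbrakk>t \<in> {0..T'}; x \<in> {0..a}\<rbrakk> \<Longrightarrow> 0 < V t x"
      and V_init: "\<And>x. x \<in> {0..a} \<Longrightarrow> V 0 x = u t1 x"
      and Vt_cont: "continuous_on ({0<..T'} \<times> {0..a}) (\<lambda>(t, x). Vt t x)"
      and Vx_cont: "continuous_on ({0<..T'} \<times> {0..a}) (\<lambda>(t, x). Vx t x)"
      and Vxx_cont: "continuous_on ({0<..T'} \<times> {0..a}) (\<lambda>(t, x). Vxx t x)"
      and Vt: "\<And>t x. \<lbrakk>t \<in> {0<..<T'}; x \<in> {0..a}\<rbrakk> \<Longrightarrow> ((\<lambda>s. V s x) has_real_derivative Vt t x) (at t)"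
      and Vx: "\<And>t x. \<lbrakk>t \<in> {0<..T'}; x \<in> {0..a}\<rbrakk> \<Longrightarrow> ((\<lambda>y. V t y) has_real_derivative Vx t x) (at x within {0..a})"
      and Vxx: "\<And>t x. \<lbrakk>t \<in> {0<..T'}; x \<in> {0..a}\<rbrakk> \<Longrightarrow> ((\<lambda>y. Vx t y) has_real_derivative Vxx t x) (at x within {0..a})"
      and V_pde: "\<And>t x. \<lbrakk>t \<in> {0<..T'}; x \<in> {0..a}\<rbrakk> \<Longrightarrow> Vt t x = V t x powr p * (Vxx t x + V t x - mean a (V t))"
      and V_bc: "\<And>t. t \<in> {0<..T'} \<Longrightarrow> Vx t 0 = 0" "\<And>t. t \<in> {0<..T'} \<Longrightarrow> Vx t a = 0"
    have fV: "neumann_flow p a (ereal T') V Vt Vx Vxx"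
    proof
      show "continuous_on ({t. 0 \<le> t \<and> ereal t < ereal T'} \<times> {0..a}) (\<lambda>(t, x). V t x)"
        by (rule continuous_on_subset[OF V_cont]) auto
      show "continuous_on ({t. 0 < t \<and> ereal t < ereal T'} \<times> {0..a}) (\<lambda>(t, x). Vt t x)"
        by (rule continuous_on_subset[OF Vt_cont]) auto
      show "continuous_on ({t. 0 < t \<and> ereal t < ereal T'} \<times> {0..a}) (\<lambda>(t, x). Vx t x)"
        by (rule continuous_on_subset[OF Vx_cont]) auto
      show "continuous_on ({t. 0 < t \<and> ereal t < ereal T'} \<times> {0..a}) (\<lambda>(t, x). Vxx t x)"
        by (rule continuous_on_subset[OF Vxx_cont]) auto
    qed (use p a Tp V_pos Vt Vx Vxx V_pde V_bc in \<open>auto simp: zero_ereal_def\<close>)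
    have fU: "neumann_flow p a (ereal \<tau>) (\<lambda>t. u (t1 + t)) (\<lambda>t. ut (t1 + t)) (\<lambda>t. ux (t1 + t)) (\<lambda>t. uxx (t1 + t))"
      unfolding \<tau>_def by (rule shift[OF Tr t1(1,3)])
    \<comment> \<open>The restart happens at t1 > 0, where u is already classical, so R is bounded
      on the compact set of times from t1 to t1 + s. This is the bound that uniqueness asks of one
      of the two solutions.\<close>
    have agree: "u (t1 + s) x = V s x" if s: "0 \<le> s" "s < \<tau>" and x: "x \<in> {0..a}" for s x
    proof -
      have sub: "{t1..t1 + s} \<subseteq> I1" by (rule I1_sub'[OF t1I]) (use s t1 Tr in \<open>simp add: \<tau>_def\<close>)
      have "continuous_on ({t1..t1 + s} \<times> {0..a}) (\<lambda>(t, x). R t x)"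
        by (rule continuous_on_subset[OF R_cont Sigma_mono[OF sub subset_refl]])
      then have "bounded ((\<lambda>(t, x). R t x) ` ({t1..t1 + s} \<times> {0..a}))"
        by (intro compact_imp_bounded compact_continuous_image compact_Times compact_Icc)
      then obtain Q where Q: "\<forall>y\<in>(\<lambda>(t, x). R t x) ` ({t1..t1 + s} \<times> {0..a}). norm y \<le> Q" unfolding bounded_iff by (elim exE)
      show ?thesis
      proof (rule neumann_flow_unique[OF fU fV _ s(1) _ _ _ x, where K=Q])
        show "u (t1 + 0) y = V 0 y" if "y \<in> {0..a}" for y using V_init[OF that] by simp
        show "ereal s < ereal \<tau>" "ereal s < ereal T'" using s \<tau> by (auto simp: T'_def)
        fix t y assume t: "t \<in> {0<..s}" and y: "y \<in> {0..a}"
        have "norm (R (t1 + t) y) \<le> Q" using bspec[OF Q imageI[of "(t1 + t, y)"]] t y by simp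
        then show "\<bar>uxx (t1 + t) y + u (t1 + t) y - mean a (u (t1 + t))\<bar> \<le> Q" by (simp add: R_def)
      qed
    qed
    define v where "v s = V (s - t1)" for s
    define vt where "vt s = Vt (s - t1)" for s
    define vx where "vx s = Vx (s - t1)" for s
    define vxx where "vxx s = Vxx (s - t1)" for s
    define r' where "r' = t1 + T'"
    have r': "r < r'" using \<tau> by (simp add: r'_def T'_def \<tau>_def)
    have inV: "s - t1 \<in> {0<..<T'}" if "t1 < s" "s < r'" for s using that by (auto simp: r'_def)
    have inV2: "s - t1 \<in> {0<..T'}" "s - t1 \<in> {0..T'}" if "t1 < s" "s < r'" for s using inV[OF that] by auto
    have eq: "u s x = v s x" if "t1 < s" "s < r" "x \<in> {0..a}" for s x
      using agree[of "s - t1" x] that by (simp add: v_def \<tau>_def)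
    have inI: "0 < s" "ereal s < T" "s < r'" if "t1 < s" "s < r" for s using that t1 Tr r' by auto
    \<comment> \<open>Derivatives within [0, a] are unique, so the derivative functions agree on the
      overlap and can be glued by the same case distinction in time.\<close>
    have eqx: "ux s x = vx s x" if s: "t1 < s" "s < r" and x: "x \<in> {0..a}" for s x
      unfolding vx_def
      by (rule deriv_unique_within_Icc[OF a x ux[OF inI(1,2)[OF s] x] Vx[OF inV2(1)[OF s(1) inI(3)[OF s]] x]])
        (use eq[OF s] in \<open>simp add: v_def\<close>)
    have eqxx: "uxx s x = vxx s x" if s: "t1 < s" "s < r" and x: "x \<in> {0..a}" for s x
      unfolding vxx_def
      by (rule deriv_unique_within_Icc[OF a x uxx[OF inI(1,2)[OF s] x] Vxx[OF inV2(1)[OF s(1) inI(3)[OF s]] x]])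
        (use eqx[OF s] in \<open>simp add: vx_def\<close>)
    have eqt: "ut s x = vt s x" if s: "t1 < s" "s < r" and x: "x \<in> {0..a}" for s x
    proof -
      have "((\<lambda>s. V (s - t1) x) has_real_derivative Vt (s - t1) x) (at s)"
        using DERIV_shift[where f = "\<lambda>s. V s x" and x = s and z = "- t1"] Vt[OF inV[OF s(1) inI(3)[OF s]] x] by simp
      moreover have "\<forall>\<^sub>F s' in nhds s. V (s' - t1) x = u s' x"
      proof -
        have "\<forall>\<^sub>F s' in nhds s. s' \<in> {t1<..<r}" using s by (intro eventually_nhds_in_open) auto
        then show ?thesis by eventually_elim (use eq x in \<open>simp add: v_def\<close>)
      qed
      ultimately have "((\<lambda>s. u s x) has_real_derivative Vt (s - t1) x) (at s)"
        using DERIV_cong_ev[OF refl _ refl, where x = s and f = "\<lambda>s'. V (s' - t1) x" and g = "\<lambda>s'. u s' x"] by simp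
      then show ?thesis unfolding vt_def by (rule DERIV_unique[OF ut[OF inI(1,2)[OF s] x]])
    qed
    have shc: "continuous_on ({t1<..<r'} \<times> {0..a}) (\<lambda>(t, x). g (t - t1) x)"
      if "continuous_on ({0<..T'} \<times> {0..a}) (\<lambda>(t, x). g t x)" for g :: "real \<Rightarrow> real \<Rightarrow> real"
    proof -
      have "continuous_on ({t1<..<r'} \<times> {0..a}) (\<lambda>z. (\<lambda>(t, x). g t x) (fst z - t1, snd z))"
        by (rule continuous_on_compose2[OF that]) (auto intro!: continuous_intros simp: r'_def)
      then show ?thesis by (simp add: case_prod_unfold)
    qed
    have V_cont': "continuous_on ({0<..T'} \<times> {0..a}) (\<lambda>(t, x). V t x)"
      by (rule continuous_on_subset[OF V_cont]) auto
    have J0: "{t. 0 \<le> t \<and> ereal t < ereal r'} \<inter> {..<r} = {t. 0 \<le> t \<and> ereal t < T}"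
      and J1: "{t. 0 < t \<and> ereal t < ereal r'} \<inter> {..<r} = {t. 0 < t \<and> ereal t < T}" using r' Tr by auto
    have sub0: "{t1<..<r'} \<subseteq> {t. 0 \<le> t \<and> ereal t < ereal r'}" "{t. 0 \<le> t \<and> ereal t < ereal r'} \<subseteq> {..<r'}"
      and sub1: "{t1<..<r'} \<subseteq> {t. 0 < t \<and> ereal t < ereal r'}" "{t. 0 < t \<and> ereal t < ereal r'} \<subseteq> {..<r'}"
      using t1 by auto
    define w where "w t x = (if t < r then u t x else v t x)" for t x
    define wt where "wt t x = (if t < r then ut t x else vt t x)" for t x
    define wx where "wx t x = (if t < r then ux t x else vx t x)" for t x
    define wxx where "wxx t x = (if t < r then uxx t x else vxx t x)" for t x
    have w1: "w t = u t" "wt t = ut t" "wx t = ux t" "wxx t = uxx t" if "t < r" for t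
      using that by (auto simp: w_def wt_def wx_def wxx_def)
    have w2: "w t = v t" "wt t = vt t" "wx t = vx t" "wxx t = vxx t" if "\<not> t < r" for t
      using that by (auto simp: w_def wt_def wx_def wxx_def)
    have "neumann_flow p a (ereal r') w wt wx wxx"
    proof
      show "continuous_on ({t. 0 \<le> t \<and> ereal t < ereal r'} \<times> {0..a}) (\<lambda>(t, x). w t x)"
        unfolding w_def
        by (rule glue_continuous[OF _ _ t1(3) sub0 eq, unfolded J0]) (auto simp: v_def intro: u_cont shc[OF V_cont'])
      show "continuous_on ({t. 0 < t \<and> ereal t < ereal r'} \<times> {0..a}) (\<lambda>(t, x). wt t x)"
        unfolding wt_def
        by (rule glue_continuous[OF _ _ t1(3) sub1 eqt, unfolded J1]) (auto simp: vt_def intro: ut_cont shc[OF Vt_cont])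
      show "continuous_on ({t. 0 < t \<and> ereal t < ereal r'} \<times> {0..a}) (\<lambda>(t, x). wx t x)"
        unfolding wx_def
        by (rule glue_continuous[OF _ _ t1(3) sub1 eqx, unfolded J1]) (auto simp: vx_def intro: ux_cont shc[OF Vx_cont])
      show "continuous_on ({t. 0 < t \<and> ereal t < ereal r'} \<times> {0..a}) (\<lambda>(t, x). wxx t x)"
        unfolding wxx_def
        by (rule glue_continuous[OF _ _ t1(3) sub1 eqxx, unfolded J1]) (auto simp: vxx_def intro: uxx_cont shc[OF Vxx_cont])
      show "1 < p" "p \<le> 2" "0 < a" by (rule p a)+
      show "0 < ereal r'" using r0 r' by (simp add: zero_ereal_def)
      show "0 < w t x" if "0 \<le> t" "ereal t < ereal r'" "x \<in> {0..a}" for t x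
      proof (cases "t < r")
        case True
        then show ?thesis using pos[of t x] that Tr by (simp add: w1)
      next
        case False
        then have "t1 < t" "t < r'" using t1 that by auto
        from V_pos[OF inV2(2)[OF this] that(3)] show ?thesis using False by (simp add: w2 v_def)
      qed
      fix t assume t: "0 < t" "ereal t < ereal r'"
      have late: "t1 < t" "t < r'" if "\<not> t < r" using that t1 t by auto
      have early: "ereal t < T" if "t < r" using that Tr by simp
      show "((\<lambda>s. w s x) has_real_derivative wt t x) (at t)" if x: "x \<in> {0..a}" for x
      proof (cases "t < r")
        case True
        have "\<forall>\<^sub>F s in nhds t. s \<in> {..<r}" using True by (intro eventually_nhds_in_open) auto
        then have "\<forall>\<^sub>F s in nhds t. u s x = w s x" by eventually_elim (simp add: w1)
        then show ?thesis unfolding w1[OF True]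
          using ut[OF t(1) early[OF True] x] DERIV_cong_ev[OF refl _ refl, where x = t and f = "\<lambda>s. u s x" and g = "\<lambda>s. w s x"] by simp
      next
        case False
        have "\<forall>\<^sub>F s in nhds t. s \<in> {t1<..<r'}" using late[OF False] by (intro eventually_nhds_in_open) auto
        then have "\<forall>\<^sub>F s in nhds t. V (s - t1) x = w s x"
          by eventually_elim (use eq x in \<open>auto simp: w_def v_def\<close>)
        moreover have "((\<lambda>s. V (s - t1) x) has_real_derivative Vt (t - t1) x) (at t)"
          using DERIV_shift[where f = "\<lambda>s. V s x" and x = t and z = "- t1"] Vt[OF inV[OF late[OF False]] x] by simp
        ultimately show ?thesis unfolding w2[OF False] vt_def
          using DERIV_cong_ev[OF refl _ refl, where x = t and f = "\<lambda>s. V (s - t1) x" and g = "\<lambda>s. w s x"] by simp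
      qed
      show "(w t has_real_derivative wx t x) (at x within {0..a})" if x: "x \<in> {0..a}" for x
        using ux[OF t(1) early x] Vx[OF inV2(1)[OF late] x] by (cases "t < r") (simp_all add: w1 w2 v_def vx_def)
      show "(wx t has_real_derivative wxx t x) (at x within {0..a})" if x: "x \<in> {0..a}" for x
        using uxx[OF t(1) early x] Vxx[OF inV2(1)[OF late] x] by (cases "t < r") (simp_all add: w1 w2 vx_def vxx_def)
      show "wt t x = w t x powr p * (wxx t x + w t x - mean a (w t))" if x: "x \<in> {0<..<a}" for x
        using pde_interior[OF t(1) early x] V_pde[OF inV2(1)[OF late], of x] x
        by (cases "t < r") (simp_all add: w1 w2 v_def vt_def vxx_def)
      show "wx t 0 = 0" "wx t a = 0"
        using bc[OF t(1) early] V_bc[OF inV2(1)[OF late]] by (cases "t < r", simp_all add: w1 w2 vx_def)+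
    qed
    moreover have "\<forall>t x. 0 \<le> t \<and> t < r \<and> x \<in> {0..a} \<longrightarrow> w t x = u t x" by (simp add: w1)
    ultimately show ?thesis using r' by blast
  qed
qed

end

section \<open>From flows back to maximal solutions\<close>

lemma classical_solution_iff:
  assumes "1 < p" "p \<le> 2" "0 < a"
  shows "classical_solution p a u0 T u \<longleftrightarrow>
    (\<forall>x\<in>{0<..<a}. u 0 x = u0 x) \<and> (\<exists>ut ux uxx. neumann_flow p a T u ut ux uxx)"
proof (intro iffI conjI)
  assume *: "classical_solution p a u0 T u"
  then show "\<forall>x\<in>{0<..<a}. u 0 x = u0 x" unfolding classical_solution_def by (elim conjE)
  have 1: "0 < T" "\<forall>t x. 0 \<le> t \<and> ereal t < T \<and> x \<in> {0..a} \<longrightarrow> u t x > 0"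
    "continuous_on ({t. 0 \<le> t \<and> ereal t < T} \<times> {0..a}) (\<lambda>(t, x). u t x)"
    using * unfolding classical_solution_def by simp_all
  obtain ut ux uxx where 2:
    "continuous_on ({t. 0 < t \<and> ereal t < T} \<times> {0..a}) (\<lambda>(t, x). ut t x)"
    "continuous_on ({t. 0 < t \<and> ereal t < T} \<times> {0..a}) (\<lambda>(t, x). ux t x)"
    "continuous_on ({t. 0 < t \<and> ereal t < T} \<times> {0..a}) (\<lambda>(t, x). uxx t x)"
    and 3: "\<forall>t. 0 < t \<and> ereal t < T \<longrightarrow>
       (\<forall>x\<in>{0..a}.
          ((\<lambda>s. u s x) has_real_derivative ut t x) (at t) \<and>
          ((\<lambda>y. u t y) has_real_derivative ux t x) (at x within {0..a}) \<and>
          ((\<lambda>y. ux t y) has_real_derivative uxx t x) (at x within {0..a})) \<and>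
       (\<forall>x\<in>{0<..<a}.
          ut t x = u t x powr p * (uxx t x + u t x - mean a (u t))) \<and>
       ux t 0 = 0 \<and> ux t a = 0"
    using * unfolding classical_solution_def by (elim conjE exE)
  have "neumann_flow p a T u ut ux uxx"
    by (unfold_locales; (fact assms 1 2)?) (use 1(2) 3 in blast)+
  then show "\<exists>ut ux uxx. neumann_flow p a T u ut ux uxx" by (intro exI)
next
  assume "(\<forall>x\<in>{0<..<a}. u 0 x = u0 x) \<and> (\<exists>ut ux uxx. neumann_flow p a T u ut ux uxx)"
  then obtain ut ux uxx where init: "\<forall>x\<in>{0<..<a}. u 0 x = u0 x" and "neumann_flow p a T u ut ux uxx"
    by (elim conjE exE)
  then interpret neumann_flow p a T u ut ux uxx by simp
  show "classical_solution p a u0 T u"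
    unfolding classical_solution_def
    by (intro conjI exI[of _ ut] exI[of _ ux] exI[of _ uxx] T u_cont ut_cont ux_cont uxx_cont init allI impI ballI;
        (elim conjE)?; rule pos ut ux uxx pde_interior bc)
qed

theorem theorem1p2:
  fixes p a :: real
    and u0 :: "real \<Rightarrow> real"
    and u :: "real \<Rightarrow> real \<Rightarrow> real"
    and Tmax :: ereal
  assumes "1 < p" and "p \<le> 2"
    and "a > 0"
    and "continuous_on {0..a} u0"
    and "\<And>x. x \<in> {0..a} \<Longrightarrow> u0 x > 0"
    and "maximal_solution p a u0 Tmax u"
  shows "((\<exists>t0. 0 \<le> t0 \<and> ereal t0 < Tmax \<and> energy a (u t0) < 0) \<longrightarrow> Tmax < \<infinity>) \<and>
         ((\<forall>t. 0 \<le> t \<and> ereal t < Tmax \<longrightarrow> energy a (u t) \<ge> 0) \<longrightarrow>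
            Tmax = \<infinity> \<and> bounded_solution a Tmax u)"
proof -
  have sol: "classical_solution p a u0 Tmax u"
    and max: "\<nexists>T' v. Tmax < T' \<and> classical_solution p a u0 T' v \<and>
        (\<forall>t x. 0 \<le> t \<and> ereal t < Tmax \<and> x \<in> {0..a} \<longrightarrow> v t x = u t x)"
    using assms(6) by (auto simp: maximal_solution_def)
  have init: "\<forall>x\<in>{0<..<a}. u 0 x = u0 x" and "\<exists>ut ux uxx. neumann_flow p a Tmax u ut ux uxx"
    using sol classical_solution_iff[OF assms(1-3)] by auto
  then obtain ut ux uxx where flow: "neumann_flow p a Tmax u ut ux uxx" by (elim exE)
  interpret neumann_flow p a Tmax u ut ux uxx by (rule flow)
  have "Tmax < \<infinity>" if t0: "0 \<le> t0" "ereal t0 < Tmax" "energy a (u t0) < 0" for t0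
  \<comment> \<open>At t0 = 0 the slice may fail to be smooth and its energy is taken in the weak
    sense; at positive times the energy equals E.\<close>
  proof (cases "t0 = 0")
    case True
    obtain t where "t \<in> I1" "E t < 0" using energy_initial t0(3) unfolding True by blast
    then show ?thesis by (rule blow_up)
  next
    case False
    then have t: "t0 \<in> I1" using t0 by auto
    then have "E t0 < 0" using t0(3) energy_E[OF t] by (simp add: zero_ereal_def)
    with t show ?thesis by (rule blow_up)
  qed
  moreover have "Tmax = \<infinity> \<and> bounded_solution a Tmax u"
    if nonneg: "\<forall>t. 0 \<le> t \<and> ereal t < Tmax \<longrightarrow> energy a (u t) \<ge> 0"
  proof
    have E0: "0 \<le> E t" if t: "t \<in> I1" for t
      using nonneg[rule_format, of t] t energy_E[OF t] by (simp add: zero_ereal_def)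
    show "Tmax = \<infinity>"
    proof (rule ccontr)
      assume "Tmax \<noteq> \<infinity>"
      then obtain r where r: "Tmax = ereal r" using T by (cases Tmax) auto
      have "\<exists>r' w wt wx wxx. r < r' \<and> neumann_flow p a (ereal r') w wt wx wxx \<and>
          (\<forall>t x. 0 \<le> t \<and> t < r \<and> x \<in> {0..a} \<longrightarrow> w t x = u t x)"
        by (rule extension[OF r E0])
      then obtain r' w wt wx wxx where w: "r < r'" "neumann_flow p a (ereal r') w wt wx wxx"
        "\<forall>t x. 0 \<le> t \<and> t < r \<and> x \<in> {0..a} \<longrightarrow> w t x = u t x"
        by (elim exE conjE)
      have "0 < r" using T r by (simp add: zero_ereal_def)
      then have "\<forall>x\<in>{0<..<a}. w 0 x = u0 x" using w(3) init by simp
      then have "classical_solution p a u0 (ereal r') w"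
        using classical_solution_iff[OF assms(1-3)] w(2) by blast
      moreover have "Tmax < ereal r'" using w(1) r by simp
      moreover have "\<forall>t x. 0 \<le> t \<and> ereal t < Tmax \<and> x \<in> {0..a} \<longrightarrow> w t x = u t x" using w(3) r by simp
      ultimately show False using max by blast
    qed
    have "\<exists>B. \<forall>t\<in>I0. \<forall>x\<in>{0..a}. u t x \<le> B" by (rule bounded_all[OF E0])
    then obtain B where B: "\<forall>t\<in>I0. \<forall>x\<in>{0..a}. u t x \<le> B" by (elim exE)
    have "(SUP t\<in>I0. SUP x\<in>{0..a}. ereal \<bar>u t x\<bar>) \<le> ereal B"
      by (intro SUP_least) (use B pos in \<open>auto simp: less_imp_le\<close>)
    then show "bounded_solution a Tmax u" unfolding bounded_solution_def by (rule le_less_trans) simp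
  qed
  ultimately show ?thesis by blast
qed

end
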